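(* Let $T>0$, let $a_-,a_+,b_-,b_+>0$ and put $\overline{a}(x)=a_-$, $\overline{b}(x)=b_-$ for $x<0$ and $\overline{a}(x)=a_+$, $\overline{b}(x)=b_+$ for $x>0$. Let $(\varphi_\varepsilon)_\varepsilon$ be a compactly supported net of nonnegative smooth functions on $\mathbb{R}$ which is logarithmic slow scale regular and converges to the Dirac measure, and let $a,b$ be the generalised functions on $\mathbb{R}$ with representatives $a_\varepsilon=\overline{a}\ast\varphi_\varepsilon$, $b_\varepsilon=\overline{b}\ast\varphi_\varepsilon$. Let $\overline{w}_0$ be a continuously differentiable and $\overline{w}_1$ a continuous function on $\mathbb{R}$, both with compact support, and let $w_0,w_1\in\mathcal{G}_{2,2}(\mathbb{R})$ have representatives $w_{0\varepsilon}=\overline{w}_0\ast\psi_\varepsilon$, $w_{1\varepsilon}=\overline{w}_1\ast\psi_\varepsilon$, where $(\psi_\varepsilon)_\varepsilon$ is a moderate mollifier converging to the Dirac measure. Let $w\in\mathcal{G}_{2,2}((-T,T)\times\mathbb{R})$ be the unique generalised solution of $$a\,\frac{\partial^2}{\partial t^2}w-\frac{\partial}{\partial x}\Big(b\,\frac{\partial}{\partial x}w\Big)=0,\qquad w|_{t=0}=w_0,\quad \frac{\partial}{\partial t}w\Big|_{t=0}=w_1.$$ Then $w$ is associated with the classical connected solution $\overline{w}$ of the transmission problem with coefficients $\overline{a},\overline{b}$ and data $\overline{w}_0,\overline{w}_1$; that is, for a representative $(w_\varepsilon)_\varepsilon$ of $w$, $w_\varepsilon\to\overline{w}$ in the sense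 of distributions (on $\mathbb{R}\times(0,T)$) as $\varepsilon\to0$.
   Context: The classical connected solution $\overline{w}$ of the transmission problem is the unique distribution with the following properties: (1) $\overline{w}$ is a distributional solution of $\overline{a}\,\partial_t^2\overline{w}-\partial_x(\overline{b}\,\partial_x\overline{w})=0$ on the open half planes $\{x<0\}$ and $\{x>0\}$ of the $(x,t)$-plane; (2) $\overline{w}\in\mathcal{C}(\mathbb{R}\times[0,\infty))$ and $\overline{w}(\cdot,0)=\overline{w}_0$; (3) $\frac{\partial}{\partial t}\overline{w}\in\mathcal{C}(\mathbb{R}\times[0,\infty))$ and $\frac{\partial}{\partial t}\overline{w}(\cdot,0)=\overline{w}_1$; (4) the function $x\mapsto\overline{b}(x)\frac{\partial}{\partial x}\overline{w}(x,t)$ is continuous for almost all $t\ge0$. Nets are indexed by $\varepsilon\in(0,1]$; $O$-estimates are as $\varepsilon\to0$. For a locally convex space $E$ with seminorms $(p_i)$, $\mathcal{G}_E=\mathcal{M}_E/\mathcal{N}_E$, where $\mathcal{M}_E$ (moderate nets): for each $i$ there is $N\in\mathbb{N}$ with $p_i(u_\varepsilon)=O(\varepsilon^{-N})$, and $\mathcal{N}_E$ (negligible nets): $p_i(u_\varepsilon)=O(\varepsilon^q)$ for all $i$ and $q\in\mathbb{N}$. $\mathcal{G}_{2,2}(\mathbb{R})=\mathcal{G}_{H^\infty(\mathbb{R})}$, $\mathcal{G}_{2,2}((-T,T)\times\mathbb{R})=\mathcal{G}_{H^\infty((-T,T)\times\mathbb{R})}$. A logarithmic slow scale net of numbers is one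 with $|\omega_\varepsilon|=O(\log^p(1/\varepsilon))$ for all $p>0$. A net of smooth functions is logarithmic slow scale regular if the supremum of each derivative is $O$ of some logarithmic slow scale net. "Compactly supported net" means that all $\varphi_\varepsilon$ are supported in a common compact set. A moderate mollifier converging to the Dirac measure is a net $(\psi_\varepsilon)$ of compactly supported smooth functions with moderate derivatives, supports shrinking to $\{0\}$, $\int\psi_\varepsilon\to1$ and bounded $L^1$-norms. A generalised function is associated with a distribution if its representing nets converge weakly to that distribution. *)

theory Defs
  imports "HOL-Analysis.Analysis" "HOL-Library.Landau_Symbols"
begin

section \<open>Smooth functions and distributions\<close>

fun iter_deriv ::
  "'a list \<Rightarrow> ('a::real_normed_vector \<Rightarrow> 'b::real_normed_vector) \<Rightarrow> 'a \<Rightarrow> 'b" where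
  "iter_deriv [] f = f"
| "iter_deriv (v # vs) f = (\<lambda>x. frechet_derivative (iter_deriv vs f) (at x) v)"

text \<open>Differentiability of all iterated partial derivatives already gives their continuity, so this
  is \<open>C\<^sup>\<infinity>(U)\<close> for open \<open>U\<close>; values of \<open>f\<close> outside \<open>U\<close> do not matter. On the real line the only
  basis vector is \<open>1\<close>.\<close>

definition smooth_on :: "'a set \<Rightarrow> ('a::euclidean_space \<Rightarrow> 'b::real_normed_vector) \<Rightarrow> bool" where
  "smooth_on U f \<longleftrightarrow> (\<forall>vs\<in>lists Basis. \<forall>x\<in>U. iter_deriv vs f differentiable (at x))"

definition supp :: "('a::topological_space \<Rightarrow> 'b::zero) \<Rightarrow> 'a set" where
  "supp f = closure {x. f x \<noteq> 0}"

definition sup_norm :: "('a \<Rightarrow> 'b::real_normed_vector) \<Rightarrow> real" where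
  "sup_norm f = (SUP x. norm (f x))"

definition test_functions :: "'a::euclidean_space set \<Rightarrow> ('a \<Rightarrow> complex) set" where
  "test_functions U = {\<theta>. smooth_on UNIV \<theta> \<and> compact (supp \<theta>) \<and> supp \<theta> \<subseteq> U}"

text \<open>Distributions act on test functions bilinearly (no complex conjugation).\<close>

definition distribution_on ::
  "'a::euclidean_space set \<Rightarrow> (('a \<Rightarrow> complex) \<Rightarrow> complex) \<Rightarrow> bool" where
  "distribution_on U u \<longleftrightarrow>
     (\<forall>\<theta>\<in>test_functions U. \<forall>\<eta>\<in>test_functions U. u (\<lambda>z. \<theta> z + \<eta> z) = u \<theta> + u \<eta>) \<and>
     (\<forall>\<theta>\<in>test_functions U. \<forall>c. u (\<lambda>z. c * \<theta> z) = c * u \<theta>) \<and>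
     (\<forall>K. compact K \<and> K \<subseteq> U \<longrightarrow>
       (\<exists>(N::nat) C. \<forall>\<theta>\<in>test_functions U. supp \<theta> \<subseteq> K \<longrightarrow>
          norm (u \<theta>) \<le> C * (\<Sum>vs | vs \<in> lists Basis \<and> length vs \<le> N. sup_norm (iter_deriv vs \<theta>))))"

definition function_distribution ::
  "('a::euclidean_space \<Rightarrow> complex) \<Rightarrow> ('a \<Rightarrow> complex) \<Rightarrow> complex" where
  "function_distribution f \<theta> = (LINT z|lborel. f z * \<theta> z)"

definition dirac :: "('a::euclidean_space \<Rightarrow> complex) \<Rightarrow> complex" where
  "dirac \<theta> = \<theta> 0"

definition distributions_equal_on ::
  "'a::euclidean_space set \<Rightarrow> (('a \<Rightarrow> complex) \<Rightarrow> complex) \<Rightarrow> (('a \<Rightarrow> complex) \<Rightarrow> complex) \<Rightarrow> bool"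
  where
  "distributions_equal_on U u v \<longleftrightarrow> (\<forall>\<theta>\<in>test_functions U. u \<theta> = v \<theta>)"

definition converges_weakly_on ::
  "'a::euclidean_space set \<Rightarrow> (real \<Rightarrow> 'a \<Rightarrow> complex) \<Rightarrow> (('a \<Rightarrow> complex) \<Rightarrow> complex) \<Rightarrow> bool" where
  "converges_weakly_on U f u \<longleftrightarrow>
     (\<forall>\<theta>\<in>test_functions U. ((\<lambda>\<epsilon>. function_distribution (f \<epsilon>) \<theta>) \<longlongrightarrow> u \<theta>) (at_right 0))"

section \<open>Generalised functions\<close>

text \<open>A locally convex space is given by its carrier \<open>E\<close> and a generating family \<open>P\<close> of seminorms.
  A net is a function on the reals of which only the values at \<open>\<epsilon> \<in> (0,1]\<close> matter.\<close>

definition moderate_nets ::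
  "'v::minus set \<Rightarrow> ('v \<Rightarrow> real) set \<Rightarrow> (real \<Rightarrow> 'v) set" where
  "moderate_nets E P = {u. (\<forall>\<epsilon>\<in>{0<..1}. u \<epsilon> \<in> E) \<and>
     (\<forall>p\<in>P. \<exists>N::nat. (\<lambda>\<epsilon>. p (u \<epsilon>)) \<in> O[at_right 0](\<lambda>\<epsilon>. 1 / \<epsilon> ^ N))}"

definition negligible_nets ::
  "'v::minus set \<Rightarrow> ('v \<Rightarrow> real) set \<Rightarrow> (real \<Rightarrow> 'v) set" where
  "negligible_nets E P = {u. (\<forall>\<epsilon>\<in>{0<..1}. u \<epsilon> \<in> E) \<and>
     (\<forall>p\<in>P. \<forall>q::nat. (\<lambda>\<epsilon>. p (u \<epsilon>)) \<in> O[at_right 0](\<lambda>\<epsilon>. \<epsilon> ^ q))}"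

definition generalised_rel ::
  "'v::minus set \<Rightarrow> ('v \<Rightarrow> real) set \<Rightarrow> ((real \<Rightarrow> 'v) \<times> (real \<Rightarrow> 'v)) set" where
  "generalised_rel E P = {(u, v). u \<in> moderate_nets E P \<and> v \<in> moderate_nets E P \<and>
     (\<lambda>\<epsilon>. u \<epsilon> - v \<epsilon>) \<in> negligible_nets E P}"

definition generalised_functions ::
  "'v::minus set \<Rightarrow> ('v \<Rightarrow> real) set \<Rightarrow> (real \<Rightarrow> 'v) set set" where
  "generalised_functions E P = moderate_nets E P // generalised_rel E P"

definition generalised_class ::
  "'v::minus set \<Rightarrow> ('v \<Rightarrow> real) set \<Rightarrow> (real \<Rightarrow> 'v) \<Rightarrow> (real \<Rightarrow> 'v) set" where
  "generalised_class E P u = generalised_rel E P `` {u}"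

text \<open>Every element of \<open>H\<^sup>\<infinity>(U) = \<Inter>\<^sub>k H\<^sup>k(U)\<close>, \<open>U\<close> open, has a unique smooth representative
  by Sobolev's lemma.\<close>

definition H_infty :: "'a::euclidean_space set \<Rightarrow> ('a \<Rightarrow> complex) set" where
  "H_infty U = {f. smooth_on U f \<and>
     (\<forall>vs\<in>lists Basis. set_integrable lborel U (\<lambda>z. (norm (iter_deriv vs f z))\<^sup>2))}"

definition sobolev_seminorms :: "'a::euclidean_space set \<Rightarrow> (('a \<Rightarrow> complex) \<Rightarrow> real) set" where
  "sobolev_seminorms U =
     (\<lambda>vs f. sqrt (LINT z:U|lborel. (norm (iter_deriv vs f z))\<^sup>2)) ` lists Basis"

abbreviation G22 :: "'a::euclidean_space set \<Rightarrow> (real \<Rightarrow> 'a \<Rightarrow> complex) set set" where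
  "G22 U \<equiv> generalised_functions (H_infty U) (sobolev_seminorms U)"

abbreviation G22_class ::
  "'a::euclidean_space set \<Rightarrow> (real \<Rightarrow> 'a \<Rightarrow> complex) \<Rightarrow> (real \<Rightarrow> 'a \<Rightarrow> complex) set" where
  "G22_class U \<equiv> generalised_class (H_infty U) (sobolev_seminorms U)"

text \<open>The space \<open>W\<^bsup>\<infinity>,\<infinity>\<^esup>\<close> of smooth functions with bounded derivatives of all orders; the
  coefficients belong to the algebra built on it, which acts on \<open>G22\<close> by multiplication.\<close>

definition W_infty :: "('a::euclidean_space \<Rightarrow> 'b::real_normed_vector) set" where
  "W_infty = {f. smooth_on UNIV f \<and> (\<forall>vs\<in>lists Basis. bounded (range (iter_deriv vs f)))}"

definition sup_seminorms :: "(('a::euclidean_space \<Rightarrow> 'b::real_normed_vector) \<Rightarrow> real) set" where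
  "sup_seminorms = (\<lambda>vs f. sup_norm (iter_deriv vs f)) ` lists Basis"

section \<open>Regularisation\<close>

definition log_slow_scale :: "(real \<Rightarrow> real) \<Rightarrow> bool" where
  "log_slow_scale \<omega> \<longleftrightarrow> (\<forall>p>0. \<omega> \<in> O[at_right 0](\<lambda>\<epsilon>. (ln (1 / \<epsilon>)) powr p))"

definition log_slow_scale_regular ::
  "(real \<Rightarrow> 'a::euclidean_space \<Rightarrow> 'b::real_normed_vector) \<Rightarrow> bool" where
  "log_slow_scale_regular f \<longleftrightarrow> (\<forall>vs\<in>lists Basis. \<exists>\<omega>. log_slow_scale \<omega> \<and>
     (\<lambda>\<epsilon>. sup_norm (iter_deriv vs (f \<epsilon>))) \<in> O[at_right 0](\<omega>))"

definition compactly_supported_net ::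
  "(real \<Rightarrow> 'a::topological_space \<Rightarrow> 'b::zero) \<Rightarrow> bool" where
  "compactly_supported_net f \<longleftrightarrow> (\<exists>K. compact K \<and> (\<forall>\<epsilon>\<in>{0<..1}. supp (f \<epsilon>) \<subseteq> K))"

definition moderate_mollifier :: "(real \<Rightarrow> real \<Rightarrow> complex) \<Rightarrow> bool" where
  "moderate_mollifier \<psi> \<longleftrightarrow>
     \<psi> \<in> moderate_nets W_infty sup_seminorms \<and>
     (\<forall>\<epsilon>\<in>{0<..1}. compact (supp (\<psi> \<epsilon>))) \<and>
     (\<forall>\<delta>>0. \<forall>\<^sub>F \<epsilon> in at_right 0. supp (\<psi> \<epsilon>) \<subseteq> ball 0 \<delta>) \<and>
     ((\<lambda>\<epsilon>. LINT x|lborel. \<psi> \<epsilon> x) \<longlongrightarrow> 1) (at_right 0) \<and>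
     (\<exists>C. \<forall>\<epsilon>\<in>{0<..1}. (LINT x|lborel. norm (\<psi> \<epsilon> x)) \<le> C)"

definition convolution ::
  "(real \<Rightarrow> 'b) \<Rightarrow> (real \<Rightarrow> 'b) \<Rightarrow> real \<Rightarrow> 'b::{real_normed_field,banach,second_countable_topology}"
  where
  "convolution f g x = (LINT y|lborel. f (x - y) * g y)"

section \<open>The transmission problem\<close>

text \<open>The \<open>(x,t)\<close>-plane is \<open>real \<times> real\<close>, the first component being the space variable.\<close>

abbreviation D_x :: "(real \<times> real \<Rightarrow> 'b::real_normed_vector) \<Rightarrow> real \<times> real \<Rightarrow> 'b" where
  "D_x \<equiv> iter_deriv [(1, 0)]"

abbreviation D_t :: "(real \<times> real \<Rightarrow> 'b::real_normed_vector) \<Rightarrow> real \<times> real \<Rightarrow> 'b" where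
  "D_t \<equiv> iter_deriv [(0, 1)]"

definition wave_operator ::
  "(real \<Rightarrow> real) \<Rightarrow> (real \<Rightarrow> real) \<Rightarrow> (real \<times> real \<Rightarrow> complex) \<Rightarrow> real \<times> real \<Rightarrow> complex" where
  "wave_operator a b f =
     (\<lambda>z. a (fst z) *\<^sub>R D_t (D_t f) z - D_x (\<lambda>y. b (fst y) *\<^sub>R D_x f y) z)"

text \<open>The coefficients are not defined at the interface; the value chosen at \<open>0\<close> is irrelevant.\<close>

definition two_phase :: "real \<Rightarrow> real \<Rightarrow> real \<Rightarrow> real" where
  "two_phase c_minus c_plus x = (if x < 0 then c_minus else c_plus)"

text \<open>Equations in the generalised function algebras hold for one choice of representatives iff they
  hold for all.\<close>

definition generalised_wave_solution ::
  "real \<Rightarrow> (real \<Rightarrow> real \<Rightarrow> real) set \<Rightarrow> (real \<Rightarrow> real \<Rightarrow> real) set \<Rightarrow>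
   (real \<Rightarrow> real \<Rightarrow> complex) set \<Rightarrow> (real \<Rightarrow> real \<Rightarrow> complex) set \<Rightarrow>
   (real \<Rightarrow> real \<times> real \<Rightarrow> complex) set \<Rightarrow> bool" where
  "generalised_wave_solution T a b w0 w1 w \<longleftrightarrow>
     w \<in> G22 (UNIV \<times> {-T<..<T}) \<and>
     (\<exists>ar\<in>a. \<exists>br\<in>b. \<exists>wr\<in>w.
       (\<lambda>\<epsilon>. wave_operator (ar \<epsilon>) (br \<epsilon>) (wr \<epsilon>))
          \<in> negligible_nets (H_infty (UNIV \<times> {-T<..<T})) (sobolev_seminorms (UNIV \<times> {-T<..<T})) \<and>
       G22_class UNIV (\<lambda>\<epsilon> x. wr \<epsilon> (x, 0)) = w0 \<and>
       G22_class UNIV (\<lambda>\<epsilon> x. D_t (wr \<epsilon>) (x, 0)) = w1)"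

text \<open>The formal adjoint of the wave operator is the wave operator itself, and the coefficients are
  constant on each half plane; hence the first condition on \<open>u\<close> is the distributional equation
  there. \<open>W\<close> and \<open>V\<close> are the continuous functions which \<open>u\<close> and its \<open>t\<close>-derivative coincide with
  for \<open>t \<ge> 0\<close>. In the last condition \<open>h\<close> is the continuous extension of
  \<open>b(x) \<partial>\<^sub>x W(x,t)\<close> across the interface \<open>x = 0\<close>, where \<open>b\<close> jumps.\<close>

definition connected_solution ::
  "(real \<Rightarrow> real) \<Rightarrow> (real \<Rightarrow> real) \<Rightarrow> (real \<Rightarrow> complex) \<Rightarrow> (real \<Rightarrow> complex) \<Rightarrow>
   ((real \<times> real \<Rightarrow> complex) \<Rightarrow> complex) \<Rightarrow> bool" where
  "connected_solution a b w0 w1 u \<longleftrightarrow>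
     distribution_on UNIV u \<and>
     (\<forall>\<theta>\<in>test_functions ({..<0} \<times> UNIV) \<union> test_functions ({0<..} \<times> UNIV).
        u (wave_operator a b \<theta>) = 0) \<and>
     (\<exists>W V.
        continuous_on (UNIV \<times> {0..}) W \<and>
        distributions_equal_on (UNIV \<times> {0<..}) u (function_distribution W) \<and>
        (\<forall>x. W (x, 0) = w0 x) \<and>
        continuous_on (UNIV \<times> {0..}) V \<and>
        distributions_equal_on (UNIV \<times> {0<..}) (\<lambda>\<theta>. - u (D_t \<theta>)) (function_distribution V) \<and>
        (\<forall>x. V (x, 0) = w1 x) \<and>
        (AE t in lborel. t \<ge> 0 \<longrightarrow>
          (\<exists>h. continuous_on UNIV h \<and>
            (\<forall>x. x \<noteq> 0 \<longrightarrow>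
              (\<exists>d. ((\<lambda>y. W (y, t)) has_vector_derivative d) (at x) \<and> h x = b x *\<^sub>R d)))))"

definition associated_on ::
  "'a::euclidean_space set \<Rightarrow> (real \<Rightarrow> 'a \<Rightarrow> complex) set \<Rightarrow> (('a \<Rightarrow> complex) \<Rightarrow> complex) \<Rightarrow> bool" where
  "associated_on U w u \<longleftrightarrow> (\<forall>wr\<in>w. converges_weakly_on U wr u)"

end

theory Submission
  imports Defs
begin

text \<open>Reduction to a duality argument. Given a time \<open>s\<close> and a \<open>C\<^sup>1\<close> function \<open>G\<close> supported away from the
  interface, the dual transmission problem with terminal data \<open>0\<close> and \<open>G / a\<close> has an explicit
  \<open>C\<^sup>2\<close> solution \<open>\<zeta>\<close> on each closed half line, obtained from d'Alembert's formula with the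
  reflection and transmission coefficients of the interface. Pairing \<open>\<zeta>\<close> with the regularised
  solutions \<open>w\<^sub>\<epsilon>\<close> expresses \<open>\<integral> G w\<^sub>\<epsilon>(\<cdot>, s)\<close> by the initial data up to remainders containing
  \<open>a - a\<^sub>\<epsilon>\<close> and \<open>b - b\<^sub>\<epsilon>\<close> as factors. These factors tend to \<open>0\<close> in \<open>L\<^sup>2\<close> locally, and the local
  energy estimate bounds the first derivatives of \<open>w\<^sub>\<epsilon>\<close> in \<open>L\<^sup>2\<close> uniformly in \<open>\<epsilon>\<close>, because it
  involves the coefficients only through their bounds (they do not depend on \<open>t\<close>). Hence
  \<open>\<integral> G w\<^sub>\<epsilon>(\<cdot>, s)\<close> converges to an expression in the initial data. The connected solution satisfies the
  same identity: on each quadrant it is mollified into a classical solution, its time integral is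
  computed along characteristics, and the flux condition makes the boundary terms at the interface
  cancel.\<close>

section \<open>Smooth tensor products and cutoffs\<close>

text \<open>Because the coefficients jump, their regularisations cannot converge uniformly near the
  interface, only in L2. In the pairing a coefficient error multiplies a first derivative of the
  regularised solution, bounded in L2, and a first derivative of the dual solution, which must
  therefore be bounded pointwise, uniformly in \<epsilon>. So the dual problem carries the limit
  coefficients: its solution is explicit and independent of \<epsilon>. The price is that the dual
  datum has to vanish at the interface; general test functions are reached by a cutoff whose error
  is small in L2. The connected solution is only C1 on each side, too little for integrating by
  parts twice. Its primitive in t gains one derivative and turns the flux condition, known for
  almost every t, into an identity for every t; differentiating in the terminal time returns to the
  solution itself. Both half lines are reflected to x >= 0 and labelled by
  \<open>e \<in> {1, - 1}\<close>, so one-sided statements are proved once, and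
  \<open>two_phase c d e\<close> is the coefficient on side \<open>e\<close>.\<close>

lemma smooth_on_coinduct:
  assumes "P f"
    and step: "\<And>g. P g \<Longrightarrow> (\<forall>x. g differentiable (at x)) \<and>
                 (\<forall>v\<in>Basis. P (\<lambda>x. frechet_derivative g (at x) v))"
  shows "smooth_on UNIV f"
proof -
  have "P (iter_deriv vs f)" if "vs \<in> lists Basis" for vs
    using that by (induction vs) (use assms in auto)
  then show ?thesis
    using step unfolding smooth_on_def by blast
qed

text \<open>A smooth function carried together with all its derivatives: a class closed under
  differentiation, as \<open>smooth_on_coinduct\<close> wants it, in which no iterated
  \<open>frechet_derivative\<close> has to be computed.\<close>

definition deriv_seq :: "(nat \<Rightarrow> real \<Rightarrow> real) \<Rightarrow> bool" where
  "deriv_seq F \<longleftrightarrow> (\<forall>n x. (F n has_real_derivative F (Suc n) x) (at x))"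

lemma deriv_seqD: "deriv_seq F \<Longrightarrow> (F n has_real_derivative F (Suc n) x) (at x)"
  by (simp add: deriv_seq_def)

lemma deriv_seq_continuous: "deriv_seq F \<Longrightarrow> continuous_on S (F n)"
  by (intro continuous_at_imp_continuous_on ballI DERIV_isCont[OF deriv_seqD])

lemma frechet_derivative_real:
  fixes f :: "real \<Rightarrow> 'b::real_normed_vector"
  assumes "(f has_vector_derivative d) (at x)"
  shows "frechet_derivative f (at x) v = v *\<^sub>R d"
  using assms frechet_derivative_at[of f "\<lambda>h. h *\<^sub>R d" x]
  unfolding has_vector_derivative_def by metis

lemma has_vector_derivative_of_real_complex:
  assumes "(f has_real_derivative d) (at x)"
  shows "((\<lambda>x. complex_of_real (f x)) has_vector_derivative of_real d) (at x)"
  using assms by (simp add: has_vector_derivative_complex_iff has_real_derivative_iff_has_vector_derivative)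

lemma smooth_on_of_real_deriv_seq:
  assumes F: "deriv_seq F"
  shows "smooth_on UNIV (\<lambda>x. complex_of_real (F n x))"
proof (rule smooth_on_coinduct[where P = "\<lambda>g. \<exists>n. g = (\<lambda>x. complex_of_real (F n x))"])
  fix g assume "\<exists>n. g = (\<lambda>x. complex_of_real (F n x))"
  then obtain n where g: "g = (\<lambda>x. complex_of_real (F n x))" by blast
  have d: "(g has_vector_derivative of_real (F (Suc n) x)) (at x)" for x
    unfolding g by (intro has_vector_derivative_of_real_complex deriv_seqD F)
  have "(\<lambda>x. frechet_derivative g (at x) 1) = (\<lambda>x. complex_of_real (F (Suc n) x))"
    by (rule ext) (simp add: frechet_derivative_real[OF d])
  then show "(\<forall>x. g differentiable at x) \<and> (\<forall>v\<in>Basis. \<exists>n. (\<lambda>x. frechet_derivative g (at x) v) = (\<lambda>x. complex_of_real (F n x)))"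
    using d by (auto simp: differentiable_def has_vector_derivative_def)
qed auto

lemma Basis_real_prod: "(Basis :: (real \<times> real) set) = {(1, 0), (0, 1)}"
  by (auto simp: Basis_prod_def)

text \<open>The factor \<open>e ^ i\<close> is what i differentiations of \<open>A 0 (e * x)\<close>
  in x leave behind, so the family is closed under both partial derivatives. With
  \<open>e = - 1\<close> the space variable is reflected, which moves a test function from the right
  half plane to the left one.\<close>

definition tensor :: "real \<Rightarrow> (nat \<Rightarrow> real \<Rightarrow> real) \<Rightarrow> (nat \<Rightarrow> real \<Rightarrow> real) \<Rightarrow> nat \<Rightarrow> nat \<Rightarrow> real \<times> real \<Rightarrow> complex"
  where "tensor e A B i j = (\<lambda>z. complex_of_real (e ^ i * A i (e * fst z) * B j (snd z)))"

lemma tensor_has_derivative: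
  assumes "deriv_seq A" "deriv_seq B"
  shows "(tensor e A B i j has_derivative
     (\<lambda>h. fst h *\<^sub>R tensor e A B (Suc i) j z + snd h *\<^sub>R tensor e A B i (Suc j) z)) (at z)"
proof -
  have A: "((\<lambda>z. A i (e * fst z)) has_derivative (\<lambda>h. A (Suc i) (e * fst z) * (e * fst h))) (at z)"
    by (rule has_derivative_eq_rhs[OF DERIV_compose_FDERIV[OF deriv_seqD[OF assms(1)]
          has_derivative_mult_right[OF has_derivative_fst[OF has_derivative_ident]]]]) (simp add: mult_ac)
  have B: "((\<lambda>z. B j (snd z)) has_derivative (\<lambda>h. B (Suc j) (snd z) * snd h)) (at z)"
    by (rule has_derivative_eq_rhs[OF DERIV_compose_FDERIV[OF deriv_seqD[OF assms(2)]
          has_derivative_snd[OF has_derivative_ident]]]) (simp add: mult_ac)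
  have "((\<lambda>z. e ^ i * A i (e * fst z) * B j (snd z)) has_derivative
      (\<lambda>h. e ^ i * A i (e * fst z) * (B (Suc j) (snd z) * snd h)
         + e ^ i * (A (Suc i) (e * fst z) * (e * fst h)) * B j (snd z))) (at z)"
    by (rule has_derivative_mult[OF has_derivative_mult_right[OF A] B])
  from has_derivative_of_real[OF this, where ?'a = complex] show ?thesis
    unfolding tensor_def
    by (rule has_derivative_eq_rhs) (simp add: scaleR_conv_of_real algebra_simps)
qed

lemma tensor_deriv:
  assumes "deriv_seq A" "deriv_seq B"
  shows "D_x (tensor e A B i j) = tensor e A B (Suc i) j"
    and "D_t (tensor e A B i j) = tensor e A B i (Suc j)"
  by (simp_all add: fun_eq_iff frechet_derivative_at[OF tensor_has_derivative[OF assms], symmetric])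

lemma smooth_on_tensor:
  assumes "deriv_seq A" "deriv_seq B"
  shows "smooth_on UNIV (tensor e A B i j)"
proof (rule smooth_on_coinduct[where P = "\<lambda>g. \<exists>i j. g = tensor e A B i j"])
  fix g assume "\<exists>i j. g = tensor e A B i j"
  then obtain i j where g: "g = tensor e A B i j" by blast
  have "g differentiable (at z)" for z
    unfolding g using tensor_has_derivative[OF assms] differentiable_def by blast
  then show "(\<forall>x. g differentiable at x) \<and>
        (\<forall>v\<in>Basis. \<exists>i j. (\<lambda>x. frechet_derivative g (at x) v) = tensor e A B i j)"
    using tensor_deriv[OF assms, of e i j] g by (auto simp: Basis_real_prod)
qed auto

text \<open>Existence of n derivatives without naming them: products are then handled by induction
  on n, with no formula for higher derivatives. \<open>times_diff_imp_deriv_seq\<close> names the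
  derivatives again at the end.\<close>

fun times_diff :: "nat \<Rightarrow> (real \<Rightarrow> real) \<Rightarrow> bool" where
  "times_diff 0 f = True"
| "times_diff (Suc n) f = (\<exists>f'. (\<forall>x. (f has_real_derivative f' x) (at x)) \<and> times_diff n f')"

lemma times_diff_SucI:
  "(\<And>x. (f has_real_derivative f' x) (at x)) \<Longrightarrow> times_diff n f' \<Longrightarrow> times_diff (Suc n) f"
  unfolding times_diff.simps by (intro exI[of _ f'] conjI allI)

lemma times_diff_SucE:
  assumes "times_diff (Suc n) f"
  obtains f' where "\<forall>x. (f has_real_derivative f' x) (at x)" "times_diff n f'"
  using assms that unfolding times_diff.simps by (elim exE conjE)

declare times_diff.simps(2)[simp del]

lemma times_diff_SucD: "times_diff (Suc n) f \<Longrightarrow> times_diff n f"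
proof (induction n arbitrary: f)
  case (Suc n)
  obtain f' where f': "\<forall>x. (f has_real_derivative f' x) (at x)" "times_diff (Suc n) f'"
    using Suc.prems by (rule times_diff_SucE)
  show ?case by (rule times_diff_SucI[OF f'(1)[rule_format] Suc.IH[OF f'(2)]])
qed simp

lemma times_diff_add:
  "times_diff n f \<Longrightarrow> times_diff n g \<Longrightarrow> times_diff n (\<lambda>x. f x + g x)"
proof (induction n arbitrary: f g)
  case (Suc n)
  obtain f' where f': "\<forall>x. (f has_real_derivative f' x) (at x)" "times_diff n f'"
    using Suc.prems(1) by (rule times_diff_SucE)
  obtain g' where g': "\<forall>x. (g has_real_derivative g' x) (at x)" "times_diff n g'"
    using Suc.prems(2) by (rule times_diff_SucE)
  show ?case
    by (rule times_diff_SucI[OF DERIV_add[OF f'(1)[rule_format] g'(1)[rule_format]] Suc.IH[OF f'(2) g'(2)]])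
qed simp

lemma times_diff_mult:
  "times_diff n f \<Longrightarrow> times_diff n g \<Longrightarrow> times_diff n (\<lambda>x. f x * g x)"
proof (induction n arbitrary: f g)
  case (Suc n)
  obtain f' where f': "\<forall>x. (f has_real_derivative f' x) (at x)" "times_diff n f'"
    using Suc.prems(1) by (rule times_diff_SucE)
  obtain g' where g': "\<forall>x. (g has_real_derivative g' x) (at x)" "times_diff n g'"
    using Suc.prems(2) by (rule times_diff_SucE)
  have "times_diff n (\<lambda>x. f' x * g x + g' x * f x)"
    by (rule times_diff_add[OF Suc.IH[OF f'(2) times_diff_SucD[OF Suc.prems(2)]]
          Suc.IH[OF g'(2) times_diff_SucD[OF Suc.prems(1)]]])
  then show ?case
    by (rule times_diff_SucI[OF DERIV_mult[OF f'(1)[rule_format] g'(1)[rule_format]]])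
qed simp

text \<open>The free factor \<open>k\<close> absorbs the power of \<open>c\<close> that every
  application of the chain rule produces, so that the induction hypothesis applies to the
  derivative.\<close>

lemma times_diff_affine:
  "times_diff n f \<Longrightarrow> times_diff n (\<lambda>x. k * f (c * x + d))"
proof (induction n arbitrary: f k)
  case (Suc n)
  obtain f' where f': "\<forall>x. (f has_real_derivative f' x) (at x)" "times_diff n f'"
    using Suc.prems by (rule times_diff_SucE)
  have "((\<lambda>x. c * x + d) has_real_derivative c) (at x)" for x
    by (auto intro!: derivative_eq_intros)
  note D = DERIV_cmult[OF DERIV_chain2[OF f'(1)[rule_format] this], of k]
  have eq: "k * (u * c) = k * c * u" for u :: real
    by simp
  have d: "((\<lambda>x. k * f (c * x + d)) has_real_derivative k * c * f' (c * x + d)) (at x)" for x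
    using D[of x] unfolding eq .
  show ?case
    by (rule times_diff_SucI[OF d Suc.IH[OF f'(2), of "k * c"]])
qed simp

lemma times_diff_imp_deriv_seq:
  assumes "\<And>n. times_diff n f"
  obtains F where "deriv_seq F" "F 0 = f"
proof
  have t: "times_diff m ((deriv ^^ n) f)" for n m
  proof (induction n arbitrary: m)
    case (Suc n)
    obtain f' where f': "\<forall>x. ((deriv ^^ n) f has_real_derivative f' x) (at x)" "times_diff m f'"
      using Suc[of "Suc m"] by (rule times_diff_SucE)
    have "deriv ((deriv ^^ n) f) = f'"
      by (rule ext) (rule DERIV_imp_deriv[OF f'(1)[rule_format]])
    with f' show ?case by simp
  qed (use assms in auto)
  show "deriv_seq (\<lambda>n. (deriv ^^ n) f)"
    unfolding deriv_seq_def
  proof safe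
    fix n x
    obtain f' where f': "\<forall>x. ((deriv ^^ n) f has_real_derivative f' x) (at x)" "times_diff 0 f'"
      using t[of "Suc 0" n] by (rule times_diff_SucE)
    then show "((deriv ^^ n) f has_real_derivative (deriv ^^ Suc n) f x) (at x)"
      using DERIV_imp_deriv[OF f'(1)[rule_format]] by simp
  qed
qed auto

section \<open>Flat functions, a bump and a smooth step\<close>

definition flat_exp :: "real poly \<Rightarrow> real \<Rightarrow> real" where
  "flat_exp p x = (if x > 0 then poly p (1 / x) * exp (- 1 / x) else 0)"

lemma poly_exp_tendsto_0: "((\<lambda>u::real. poly p u * exp (- u)) \<longlongrightarrow> 0) at_top"
proof -
  have "((\<lambda>u::real. \<Sum>i\<le>degree p. coeff p i * (u ^ i / exp u)) \<longlongrightarrow> (\<Sum>i\<le>degree p. coeff p i * 0)) at_top"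
    by (intro tendsto_sum tendsto_mult tendsto_const tendsto_power_div_exp_0)
  then show ?thesis
    by (simp add: poly_altdef sum_distrib_left exp_minus divide_inverse mult_ac)
qed

text \<open>Polynomials in 1/x times exp(-1/x) are closed under differentiation: the derivative of
  p(1/x) exp(-1/x) is (1/x^2) (p - p')(1/x) exp(-1/x), and 1/x^2 is the value of
  \<open>monom 1 2\<close> at 1/x. Only the point 0 needs a limit.\<close>

lemma flat_exp_deriv:
  "(flat_exp p has_real_derivative flat_exp (monom 1 2 * (p - pderiv p)) x) (at x)"
proof -
  consider "x > 0" | "x < 0" | "x = 0" by linarith
  then show ?thesis
  proof cases
    case 1
    have i: "(inverse has_real_derivative - (inverse x)\<^sup>2) (at x)"
      using DERIV_inverse[of x] 1 by (simp add: power2_eq_square numeral_2_eq_2)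
    have "((\<lambda>x. poly p (inverse x) * exp (- inverse x)) has_real_derivative
        (poly (pderiv p) (inverse x) * - (inverse x)\<^sup>2) * exp (- inverse x)
        + (exp (- inverse x) * - (- (inverse x)\<^sup>2)) * poly p (inverse x)) (at x)"
      by (intro DERIV_mult DERIV_chain2[OF poly_DERIV i] DERIV_chain2[OF DERIV_exp DERIV_minus[OF i]])
    also have "(poly (pderiv p) (inverse x) * - (inverse x)\<^sup>2) * exp (- inverse x)
        + (exp (- inverse x) * - (- (inverse x)\<^sup>2)) * poly p (inverse x)
        = flat_exp (monom 1 2 * (p - pderiv p)) x"
      using 1 by (simp add: flat_exp_def poly_monom divide_inverse algebra_simps)
    finally have "((\<lambda>x. poly p (1 / x) * exp (- 1 / x)) has_real_derivative
        flat_exp (monom 1 2 * (p - pderiv p)) x) (at x)"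
      by (simp add: divide_inverse)
    then show ?thesis
      by (rule has_field_derivative_transform_within_open[of _ _ _ "{0<..}"])
        (use 1 in \<open>auto simp: flat_exp_def\<close>)
  next
    case 2
    have "((\<lambda>x. 0) has_real_derivative flat_exp (monom 1 2 * (p - pderiv p)) x) (at x)"
      using 2 by (auto intro!: derivative_eq_intros simp: flat_exp_def)
    then show ?thesis
      by (rule has_field_derivative_transform_within_open[of _ _ _ "{..<0}"])
        (use 2 in \<open>auto simp: flat_exp_def\<close>)
  next
    case 3
    \<comment> \<open>In u = 1/h the right difference quotient is u p(u) exp(-u), which decays as u
      grows; the left difference quotient is identically 0.\<close>
    have "((\<lambda>h. poly (monom 1 1 * p) (inverse h) * exp (- inverse h)) \<longlongrightarrow> 0) (at_right (0::real))"
      by (rule filterlim_compose[OF poly_exp_tendsto_0 filterlim_inverse_at_top_right])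
    moreover have "\<forall>\<^sub>F h in at_right 0. poly (monom 1 1 * p) (inverse h) * exp (- inverse h)
        = (flat_exp p (0 + h) - flat_exp p 0) / h"
      using eventually_at_right_less[of "0::real"]
      by eventually_elim (simp add: flat_exp_def poly_monom divide_inverse mult_ac)
    ultimately have R: "((\<lambda>h. (flat_exp p (0 + h) - flat_exp p 0) / h) \<longlongrightarrow> 0) (at_right 0)"
      by (rule Lim_transform_eventually)
    have "\<forall>\<^sub>F h in at_left (0::real). h < 0"
      by (auto simp: eventually_at_filter)
    then have "\<forall>\<^sub>F h in at_left 0. 0 = (flat_exp p (0 + h) - flat_exp p 0) / h"
      by eventually_elim (simp add: flat_exp_def)
    then have L: "((\<lambda>h. (flat_exp p (0 + h) - flat_exp p 0) / h) \<longlongrightarrow> 0) (at_left 0)"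
      by (rule Lim_transform_eventually[OF tendsto_const])
    have "((\<lambda>h. (flat_exp p (0 + h) - flat_exp p 0) / h) \<longlongrightarrow> 0) (at 0)"
      by (rule filterlim_split_at[OF L R])
    then show ?thesis
      by (simp add: 3 DERIV_def flat_exp_def)
  qed
qed

lemma times_diff_flat_exp: "times_diff n (flat_exp p)"
proof (induction n arbitrary: p)
  case (Suc n)
  show ?case
    by (rule times_diff_SucI[OF flat_exp_deriv Suc])
qed simp

text \<open>The function exp(-1/x) exp(-1/(1 - x)) on (0,1), continued by 0. The trivial factors are
  written out to make the second factor syntactically an instance of
  \<open>times_diff_affine\<close>.\<close>

definition flat_step :: "real \<Rightarrow> real" where
  "flat_step = (\<lambda>x. flat_exp 1 x * (1 * flat_exp 1 (-1 * x + 1)))"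

lemma times_diff_bump: "times_diff n flat_step"
  unfolding flat_step_def by (rule times_diff_mult[OF times_diff_flat_exp times_diff_affine[OF times_diff_flat_exp, where k = 1 and c = "-1" and d = 1]])

lemma bump_deriv_seq:
  "\<exists>F. deriv_seq F \<and> (\<forall>x. F 0 x \<ge> 0) \<and> (\<forall>n x. x \<notin> {0<..<1} \<longrightarrow> F n x = 0) \<and>
     (F 0 has_integral 1) {0..1}"
proof -
  obtain F where F: "deriv_seq F" "F 0 = flat_step"
    using times_diff_imp_deriv_seq[OF times_diff_bump] by blast
  define I where "I = integral {0..1} flat_step"
  have cont: "continuous_on S flat_step" for S
    using deriv_seq_continuous[OF F(1), of S 0] F(2) by simp
  have nn: "flat_step x \<ge> 0" for x
    by (simp add: flat_step_def flat_exp_def)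
  have i: "(flat_step has_integral I) {0..1}"
    unfolding I_def using cont by (intro integrable_integral integrable_continuous_real)
  have "I \<noteq> 0"
  proof
    assume "I = 0"
    then have "flat_step (1/2) = 0"
      using has_integral_0_cbox_imp_0[of 0 1 flat_step "1/2"] i cont nn by auto
    then show False by (simp add: flat_step_def flat_exp_def)
  qed
  moreover have "I \<ge> 0"
    unfolding I_def using nn i by (intro integral_nonneg) auto
  ultimately have I: "I > 0" by simp
  \<comment> \<open>Outside [0,1] each derivative is taken of a function that vanishes locally; at
    the two endpoints this argument fails and continuity takes over in \<open>z'\<close>.\<close>
  have z: "F n x = 0" if "x < 0 \<or> x > 1" for n x
    using that
  proof (induction n arbitrary: x)
    case 0
    then show ?case by (auto simp: F(2) flat_step_def flat_exp_def)
  next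
    case (Suc n)
    define S :: "real set" where "S = {..<0} \<union> {1<..}"
    have S: "open S" "x \<in> S" "\<And>y. y \<in> S \<Longrightarrow> 0 = F n y"
      using Suc.prems Suc.IH unfolding S_def by force+
    have "(F n has_real_derivative 0) (at x)"
      by (rule has_field_derivative_transform_within_open[OF DERIV_const S])
    with deriv_seqD[OF F(1)] show ?case
      by (rule DERIV_unique)
  qed
  have z': "F n x = 0" if "x = 0 \<or> x = 1" for n x
  proof -
    have "x \<in> closure ({..<0} \<union> {1<..})"
      using that by (auto simp: closure_Un)
    then show ?thesis
      by (rule continuous_constant_on_closure[OF deriv_seq_continuous[OF F(1)], rotated])
        (use z in blast)
  qed
  show ?thesis
  proof (rule exI[of _ "\<lambda>n x. F n x / I"], intro conjI allI impI)
    show "deriv_seq (\<lambda>n x. F n x / I)"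
      using F(1) unfolding deriv_seq_def by (auto intro: DERIV_cdivide)
    show "F n x / I = 0" if "x \<notin> {0<..<1}" for n x
      using that z[of x n] z'[of x n] by fastforce
    show "((\<lambda>x. F 0 x / I) has_integral 1) {0..1}"
      using has_integral_divide[OF i, of I] I by (simp add: F(2))
  qed (use nn I F(2) in auto)
qed

definition bump :: "nat \<Rightarrow> real \<Rightarrow> real" where
  "bump = (SOME F. deriv_seq F \<and> (\<forall>x. F 0 x \<ge> 0) \<and> (\<forall>n x. x \<notin> {0<..<1} \<longrightarrow> F n x = 0) \<and>
     (F 0 has_integral 1) {0..1})"

lemma bump: "deriv_seq bump" "bump 0 x \<ge> 0" "x \<notin> {0<..<1} \<Longrightarrow> bump n x = 0"
  "(bump 0 has_integral 1) {0..1}"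
proof -
  from someI_ex[OF bump_deriv_seq, folded bump_def]
  show "deriv_seq bump" "bump 0 x \<ge> 0" "x \<notin> {0<..<1} \<Longrightarrow> bump n x = 0"
    "(bump 0 has_integral 1) {0..1}" by blast+
qed

lemma bump_continuous: "continuous_on S (bump n)"
  by (rule deriv_seq_continuous[OF bump(1)])

text \<open>The primitive of the bump, continued by the bump and its derivatives. The lower limit -1
  lies to the left of the support, so that 0 is an interior point of the interval of integration and
  the fundamental theorem gives a two-sided derivative there.\<close>

definition smooth_step :: "nat \<Rightarrow> real \<Rightarrow> real" where
  "smooth_step n x = (case n of 0 \<Rightarrow> integral {-1..x} (bump 0) | Suc m \<Rightarrow> bump m x)"

lemma smooth_step_0: "x \<le> 0 \<Longrightarrow> smooth_step 0 x = 0" "x \<ge> 1 \<Longrightarrow> smooth_step 0 x = 1"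
    "0 \<le> smooth_step 0 x" "smooth_step 0 x \<le> 1"
proof -
  have I: "bump 0 integrable_on {a..b}" for a b
    by (intro integrable_continuous_real bump_continuous)
  have z: "integral {a..b} (bump 0) = 0" if "b \<le> 0 \<or> a \<ge> 1" for a b
  proof -
    have "integral {a..b} (bump 0) = integral {a..b} (\<lambda>_. 0)"
      by (rule integral_cong) (use that bump(3) in auto)
    then show ?thesis by simp
  qed
  show le0: "x \<le> 0 \<Longrightarrow> smooth_step 0 x = 0" for x
    using z by (simp add: smooth_step_def)
  show ge1: "x \<ge> 1 \<Longrightarrow> smooth_step 0 x = 1" for x
  proof -
    assume x: "x \<ge> 1"
    have "integral {-1..x} (bump 0) = integral {-1..0} (bump 0) + (integral {0..1} (bump 0) + integral {1..x} (bump 0))"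
      using x by (simp add: Henstock_Kurzweil_Integration.integral_combine I)
    then show ?thesis
      using z[where a = "-1" and b = 0] z[where a = 1 and b = x] bump(4) by (simp add: smooth_step_def integral_unique)
  qed
  show "0 \<le> smooth_step 0 x"
    by (simp add: smooth_step_def integral_nonneg I bump(2))
  show "smooth_step 0 x \<le> 1"
  proof (cases "x \<ge> 1")
    case False
    have "integral {-1..x} (bump 0) \<le> integral {-1..1} (bump 0)"
      using False by (intro integral_subset_le I) (auto simp: bump(2))
    also have "\<dots> = 1" using ge1[of 1] by (simp add: smooth_step_def)
    finally show ?thesis by (simp add: smooth_step_def)
  qed (use ge1 in simp)
qed

lemma smooth_step_deriv_seq: "deriv_seq smooth_step"
  unfolding deriv_seq_def
proof safe
  fix n x
  show "(smooth_step n has_real_derivative smooth_step (Suc n) x) (at x)"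
  proof (cases n)
    case (Suc m)
    then have "smooth_step n = bump m" "smooth_step (Suc n) = bump (Suc m)"
      by (auto simp: smooth_step_def fun_eq_iff)
    then show ?thesis by (simp add: deriv_seqD[OF bump(1)])
  next
    case 0
    have "(smooth_step 0 has_real_derivative bump 0 x) (at x)" if "x < 0"
    proof -
      have "bump 0 x = 0" using that by (simp add: bump(3))
      then have "((\<lambda>_. 0) has_real_derivative bump 0 x) (at x)" by simp
      then show ?thesis
        by (rule has_field_derivative_transform_within_open[where S = "{..<0}"])
          (simp_all only: open_lessThan lessThan_iff that smooth_step_0(1)[OF less_imp_le])
    qed
    moreover have "(smooth_step 0 has_real_derivative bump 0 x) (at x)" if "x \<ge> 0"
    proof -
      have x: "x \<in> {-1..x+1}" using that by simp
      have e: "smooth_step 0 = (\<lambda>u. integral {-1..u} (bump 0))"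
        by (simp add: fun_eq_iff smooth_step_def)
      have "((\<lambda>u. integral {-1..u} (bump 0)) has_real_derivative bump 0 x) (at x within {-1..x+1})"
        by (rule integral_has_real_derivative[OF bump_continuous x])
      moreover have "at x within {-1..x+1} = at x"
        by (rule at_within_Icc_at) (use that in auto)
      ultimately show ?thesis
        by (simp add: e)
    qed
    moreover have "smooth_step (Suc n) x = bump 0 x"
      unfolding 0 smooth_step_def by simp
    ultimately show ?thesis
      unfolding 0 by (metis linorder_not_le)
  qed
qed

section \<open>Regularised coefficients\<close>

lemma deriv_seq_imp_times_diff: "deriv_seq F \<Longrightarrow> times_diff n (F m)"
proof (induction n arbitrary: m)
  case (Suc n)
  show ?case
    by (rule times_diff_SucI[OF deriv_seqD[OF Suc.prems] Suc.IH[OF Suc.prems]])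
qed simp

text \<open>The two steps have the arguments 2 + x/r and 2 - x/r: both are at least 1 for |x| <= r,
  and one of them is at most 0 for |x| >= 2r. The form with factors \<open>1 *\<close> fits
  \<open>times_diff_affine\<close>.\<close>

definition plateau :: "real \<Rightarrow> real \<Rightarrow> real" where
  "plateau r x = (1 * smooth_step 0 ((1 / r) * x + 2)) * (1 * smooth_step 0 ((- 1 / r) * x + 2))"

lemma plateau_smooth: "smooth_on UNIV (\<lambda>x. complex_of_real (plateau r x))"
proof -
  have t: "times_diff n (smooth_step 0)" for n
    by (rule deriv_seq_imp_times_diff[OF smooth_step_deriv_seq])
  have "times_diff n (plateau r)" for n
    unfolding plateau_def[abs_def]
    by (rule times_diff_mult[OF times_diff_affine[OF t, where k = 1 and c = "1 / r" and d = 2]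
          times_diff_affine[OF t, where k = 1 and c = "- 1 / r" and d = 2]])
  then obtain F where F: "deriv_seq F" "F 0 = plateau r"
    by (rule times_diff_imp_deriv_seq)
  show ?thesis
    using smooth_on_of_real_deriv_seq[OF F(1), of 0] by (simp add: F(2))
qed

lemma plateau_bounds: "0 \<le> plateau r x" "plateau r x \<le> 1"
  unfolding plateau_def by (simp_all add: smooth_step_0 mult_le_one)

lemma plateau_eq_1: "r > 0 \<Longrightarrow> \<bar>x\<bar> \<le> r \<Longrightarrow> plateau r x = 1"
proof -
  assume "r > 0" "\<bar>x\<bar> \<le> r"
  then have "(1 / r) * x + 2 \<ge> 1" "(- 1 / r) * x + 2 \<ge> 1"
    by (auto simp: field_simps)
  then show ?thesis unfolding plateau_def by (simp only: smooth_step_0)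
qed

lemma plateau_eq_0: "r > 0 \<Longrightarrow> \<bar>x\<bar> \<ge> 2 * r \<Longrightarrow> plateau r x = 0"
proof -
  assume "r > 0" "\<bar>x\<bar> \<ge> 2 * r"
  then have "(1 / r) * x + 2 \<le> 0 \<or> (- 1 / r) * x + 2 \<le> 0"
    by (auto simp: field_simps)
  then show ?thesis unfolding plateau_def by (auto simp only: smooth_step_0)
qed

lemma supp_subset_closed:
  assumes "closed K" "\<And>x. x \<notin> K \<Longrightarrow> f x = 0"
  shows "supp f \<subseteq> K"
  unfolding supp_def by (rule closure_minimal) (use assms in auto)

lemma not_in_supp: "x \<notin> supp f \<Longrightarrow> f x = 0"
  using closure_subset[of "{x. f x \<noteq> 0}"] unfolding supp_def by (meson mem_Collect_eq subsetD)

lemma plateau_test_function: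
  assumes "r > 0"
  shows "(\<lambda>x. complex_of_real (plateau r x)) \<in> test_functions UNIV"
proof -
  have s: "supp (\<lambda>x. complex_of_real (plateau r x)) \<subseteq> {-(2 * r)..2 * r}"
    by (rule supp_subset_closed) (use assms plateau_eq_0[of r] in \<open>auto simp: abs_if\<close>)
  have "compact (supp (\<lambda>x. complex_of_real (plateau r x)))"
    unfolding compact_eq_bounded_closed
    using bounded_subset[OF _ s] by (auto simp: supp_def)
  then show ?thesis
    by (simp add: test_functions_def plateau_smooth)
qed

lemma smooth_on_imp_continuous_on: "smooth_on U f \<Longrightarrow> continuous_on U f"
proof (intro continuous_at_imp_continuous_on ballI)
  fix x assume f: "smooth_on U f" and x: "x \<in> U"
  have "([] :: 'a list) \<in> lists Basis" by simp
  from bspec[OF bspec[OF f[unfolded smooth_on_def] this] x]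
  show "isCont f x"
    by (simp add: differentiable_imp_continuous_within)
qed

lemma bigo_eventually_bound:
  assumes "(f :: real \<Rightarrow> real) \<in> O[at_right 0](g)"
  obtains C where "C > 0" "\<forall>\<^sub>F \<epsilon> in at_right 0. \<bar>f \<epsilon>\<bar> \<le> C * \<bar>g \<epsilon>\<bar>"
  using assms by (elim landau_o.bigE) auto

lemma eventually_in_unit: "\<forall>\<^sub>F \<epsilon> in at_right (0::real). \<epsilon> \<in> {0<..1}"
  using eventually_at_right_real[of 0 1] by (auto elim: eventually_mono)

lemma norm_le_sup_norm:
  assumes "bounded (range f)"
  shows "norm (f x) \<le> sup_norm f"
proof -
  have "bdd_above (range (\<lambda>x. norm (f x)))"
    using assms by (auto simp: bounded_iff bdd_above_def)
  then show ?thesis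
    unfolding sup_norm_def by (intro cSUP_upper) auto
qed

lemma generalised_class_iff:
  "v \<in> generalised_class E P u \<longleftrightarrow>
     u \<in> moderate_nets E P \<and> v \<in> moderate_nets E P \<and> (\<lambda>\<epsilon>. u \<epsilon> - v \<epsilon>) \<in> negligible_nets E P"
  by (simp add: generalised_class_def generalised_rel_def)

lemma moderate_netsD:
  assumes "u \<in> moderate_nets E P"
  shows "\<epsilon> \<in> {0<..1} \<Longrightarrow> u \<epsilon> \<in> E" "p \<in> P \<Longrightarrow> \<exists>N::nat. (\<lambda>\<epsilon>. p (u \<epsilon>)) \<in> O[at_right 0](\<lambda>\<epsilon>. 1 / \<epsilon> ^ N)"
  using assms unfolding moderate_nets_def mem_Collect_eq by (blast dest: bspec)+

lemma negligible_netsD: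
  assumes "u \<in> negligible_nets E P"
  shows "\<epsilon> \<in> {0<..1} \<Longrightarrow> u \<epsilon> \<in> E" "p \<in> P \<Longrightarrow> (\<lambda>\<epsilon>. p (u \<epsilon>)) \<in> O[at_right 0](\<lambda>\<epsilon>. \<epsilon> ^ q)"
proof -
  show "\<epsilon> \<in> {0<..1} \<Longrightarrow> u \<epsilon> \<in> E"
    using assms unfolding negligible_nets_def mem_Collect_eq by (blast dest: bspec)
  show "p \<in> P \<Longrightarrow> (\<lambda>\<epsilon>. p (u \<epsilon>)) \<in> O[at_right 0](\<lambda>\<epsilon>. \<epsilon> ^ q)"
    by (rule spec[OF bspec[OF conjunct2[OF assms[unfolded negligible_nets_def mem_Collect_eq]]]])
qed

lemma W_inftyD: "f \<in> W_infty \<Longrightarrow> smooth_on UNIV f"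
    "f \<in> W_infty \<Longrightarrow> vs \<in> lists Basis \<Longrightarrow> bounded (range (iter_deriv vs f))"
  by (simp_all add: W_infty_def)

section \<open>Nonnegative nets converging to the Dirac measure\<close>

locale delta_net =
  fixes \<phi> :: "real \<Rightarrow> real \<Rightarrow> real"
  assumes smooth: "\<forall>\<epsilon>\<in>{0<..1}. smooth_on UNIV (\<phi> \<epsilon>) \<and> (\<forall>x. \<phi> \<epsilon> x \<ge> 0)"
    and compactly_supported: "compactly_supported_net \<phi>"
    and to_dirac: "converges_weakly_on UNIV (\<lambda>\<epsilon> x. complex_of_real (\<phi> \<epsilon> x)) dirac"
begin

lemma radius: "\<exists>R>0. \<forall>\<epsilon>\<in>{0<..1}. \<forall>x. \<bar>x\<bar> > R \<longrightarrow> \<phi> \<epsilon> x = 0"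
proof -
  obtain K where K: "compact K" "\<forall>\<epsilon>\<in>{0<..1}. supp (\<phi> \<epsilon>) \<subseteq> K"
    using compactly_supported unfolding compactly_supported_net_def by auto
  obtain R where R: "R > 0" "\<forall>x\<in>K. norm x \<le> R"
    using compact_imp_bounded[OF K(1)] unfolding bounded_pos by blast
  have "\<phi> \<epsilon> x = 0" if e: "\<epsilon> \<in> {0<..1}" and x: "\<bar>x\<bar> > R" for \<epsilon> x
  proof -
    have "x \<notin> supp (\<phi> \<epsilon>)"
      using K(2) e x R(2) by fastforce
    then show ?thesis by (rule not_in_supp[of x "\<phi> \<epsilon>"])
  qed
  with R(1) show ?thesis by auto
qed

lemma integrable: "\<epsilon> \<in> {0<..1} \<Longrightarrow> integrable lborel (\<phi> \<epsilon>)"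
proof -
  assume e: "\<epsilon> \<in> {0<..1}"
  obtain R where R: "R > 0" "\<forall>\<epsilon>\<in>{0<..1}. \<forall>x. \<bar>x\<bar> > R \<longrightarrow> \<phi> \<epsilon> x = 0"
    using radius by blast
  have "continuous_on UNIV (\<phi> \<epsilon>)"
    using smooth e smooth_on_imp_continuous_on by blast
  then have "integrable lborel (\<lambda>x. indicator {-R..R} x *\<^sub>R \<phi> \<epsilon> x)"
    by (intro borel_integrable_compact) (auto intro: continuous_on_subset)
  moreover have "(\<lambda>x. indicator {-R..R} x *\<^sub>R \<phi> \<epsilon> x) = \<phi> \<epsilon>"
  proof
    fix x
    show "indicator {-R..R} x *\<^sub>R \<phi> \<epsilon> x = \<phi> \<epsilon> x"
      using R(2)[rule_format, OF e, of x] by (cases "\<bar>x\<bar> \<le> R") (auto simp: indicator_def abs_le_iff)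
  qed
  ultimately show ?thesis by simp
qed

lemma integrable_mult:
  assumes "\<epsilon> \<in> {0<..1}" "f \<in> borel_measurable lborel" "\<And>x. \<bar>f x\<bar> \<le> B"
  shows "integrable lborel (\<lambda>x. f x * \<phi> \<epsilon> x)"
proof (rule Bochner_Integration.integrable_bound[of _ "\<lambda>x. B * \<phi> \<epsilon> x"])
  show "integrable lborel (\<lambda>x. B * \<phi> \<epsilon> x)"
    using integrable[OF assms(1)] by simp
  show "(\<lambda>x. f x * \<phi> \<epsilon> x) \<in> borel_measurable lborel"
    using assms(2) integrable[OF assms(1)] by simp
  show "AE x in lborel. norm (f x * \<phi> \<epsilon> x) \<le> norm (B * \<phi> \<epsilon> x)"
    using assms(3) by (auto simp: abs_mult intro!: mult_right_mono order_trans[OF assms(3) abs_ge_self])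
qed

lemma plateau_measurable: "plateau r \<in> borel_measurable lborel"
proof -
  have "continuous_on UNIV (\<lambda>x. Re (complex_of_real (plateau r x)))"
    by (intro continuous_intros smooth_on_imp_continuous_on plateau_smooth)
  then show ?thesis by (simp add: borel_measurable_continuous_onI)
qed

lemma plateau_limit:
  assumes "r > 0"
  shows "((\<lambda>\<epsilon>. LINT x|lborel. plateau r x * \<phi> \<epsilon> x) \<longlongrightarrow> 1) (at_right 0)"
proof -
  have "((\<lambda>\<epsilon>. function_distribution (\<lambda>x. complex_of_real (\<phi> \<epsilon> x)) (\<lambda>x. of_real (plateau r x)))
      \<longlongrightarrow> complex_of_real (plateau r 0)) (at_right 0)"
    using to_dirac plateau_test_function[OF assms]
    unfolding converges_weakly_on_def by (auto simp: dirac_def)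
  moreover have "function_distribution (\<lambda>x. complex_of_real (\<phi> \<epsilon> x)) (\<lambda>x. of_real (plateau r x))
      = of_real (LINT x|lborel. plateau r x * \<phi> \<epsilon> x)" for \<epsilon>
    unfolding function_distribution_def
    by (subst integral_complex_of_real[symmetric]) (simp add: mult.commute)
  ultimately show ?thesis
    using plateau_eq_1[OF assms, of 0] assms
    by (simp add: tendsto_of_real_iff[where c = "1::real", simplified])
qed

text \<open>All supports lie in one bounded interval. A plateau equal to 1 on that interval turns
  the mass into a pairing with a test function, to which weak convergence applies.\<close>

lemma mass_limit: "((\<lambda>\<epsilon>. LINT x|lborel. \<phi> \<epsilon> x) \<longlongrightarrow> 1) (at_right 0)"
proof -
  obtain R where R: "R > 0" "\<forall>\<epsilon>\<in>{0<..1}. \<forall>x. \<bar>x\<bar> > R \<longrightarrow> \<phi> \<epsilon> x = 0"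
    using radius by blast
  have "plateau R x * \<phi> \<epsilon> x = \<phi> \<epsilon> x" if "\<epsilon> \<in> {0<..1}" for \<epsilon> x
    using R(2)[rule_format, OF that, of x] plateau_eq_1[OF R(1), of x] by (cases "\<bar>x\<bar> > R") auto
  then have "\<forall>\<^sub>F \<epsilon> in at_right 0. (LINT x|lborel. plateau R x * \<phi> \<epsilon> x) = (LINT x|lborel. \<phi> \<epsilon> x)"
    by (intro eventually_mono[OF eventually_in_unit] Bochner_Integration.integral_cong) auto
  with plateau_limit[OF R(1)] show ?thesis
    by (rule Lim_transform_eventually)
qed

text \<open>The total mass and the mass weighted by a plateau at 0 both tend to 1. As
  \<open>\<phi> \<epsilon>\<close> is nonnegative and the plateau vanishes at distance \<delta> from
  0, the difference dominates the mass beyond that distance: the net concentrates at 0.\<close>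

lemma tail_limit:
  assumes "\<delta> > 0"
  shows "((\<lambda>\<epsilon>. LINT x|lborel. (1 - plateau (\<delta> / 2) x) * \<phi> \<epsilon> x) \<longlongrightarrow> 0) (at_right 0)"
proof -
  have "((\<lambda>\<epsilon>. (LINT x|lborel. \<phi> \<epsilon> x) - (LINT x|lborel. plateau (\<delta> / 2) x * \<phi> \<epsilon> x)) \<longlongrightarrow> 1 - 1) (at_right 0)"
    using assms by (intro tendsto_diff mass_limit plateau_limit) auto
  moreover have "\<forall>\<^sub>F \<epsilon> in at_right 0. (LINT x|lborel. \<phi> \<epsilon> x) - (LINT x|lborel. plateau (\<delta> / 2) x * \<phi> \<epsilon> x)
      = (LINT x|lborel. (1 - plateau (\<delta> / 2) x) * \<phi> \<epsilon> x)"
  proof (rule eventually_mono[OF eventually_in_unit])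
    fix \<epsilon> :: real assume e: "\<epsilon> \<in> {0<..1}"
    show "(LINT x|lborel. \<phi> \<epsilon> x) - (LINT x|lborel. plateau (\<delta> / 2) x * \<phi> \<epsilon> x)
      = (LINT x|lborel. (1 - plateau (\<delta> / 2) x) * \<phi> \<epsilon> x)"
    proof -
      have "integrable lborel (\<lambda>x. plateau (\<delta> / 2) x * \<phi> \<epsilon> x)"
        by (rule integrable_mult[OF e plateau_measurable, of _ 1]) (use plateau_bounds in auto)
      with integrable[OF e] show ?thesis
        by (simp add: left_diff_distrib)
    qed
  qed
  ultimately show ?thesis
    using Lim_transform_eventually by fastforce
qed

lemma two_phase_measurable: "(\<lambda>y. two_phase c d (x - y)) \<in> borel_measurable lborel"
  unfolding two_phase_def by measurable

lemma two_phase_bound: "\<bar>two_phase c d x\<bar> \<le> \<bar>c\<bar> + \<bar>d\<bar>"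
  unfolding two_phase_def by auto

text \<open>For a nonnegative kernel the convolution is, up to the total mass, a weighted mean of
  the two values of the coefficient.\<close>

lemma convolution_bounds:
  assumes e: "\<epsilon> \<in> {0<..1}" and "c > 0" "d > 0"
  shows "min c d * (LINT x|lborel. \<phi> \<epsilon> x) \<le> convolution (two_phase c d) (\<phi> \<epsilon>) x"
    and "convolution (two_phase c d) (\<phi> \<epsilon>) x \<le> max c d * (LINT x|lborel. \<phi> \<epsilon> x)"
proof -
  have i: "integrable lborel (\<lambda>y. two_phase c d (x - y) * \<phi> \<epsilon> y)"
    by (rule integrable_mult[OF e two_phase_measurable two_phase_bound])
  have nn: "\<phi> \<epsilon> y \<ge> 0" for y using smooth e by auto
  have "(LINT y|lborel. min c d * \<phi> \<epsilon> y) \<le> (LINT y|lborel. two_phase c d (x - y) * \<phi> \<epsilon> y)"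
    by (rule integral_mono) (use i integrable[OF e] nn in \<open>auto intro!: mult_right_mono simp: two_phase_def\<close>)
  then show "min c d * (LINT x|lborel. \<phi> \<epsilon> x) \<le> convolution (two_phase c d) (\<phi> \<epsilon>) x"
    unfolding convolution_def by simp
  have "(LINT y|lborel. two_phase c d (x - y) * \<phi> \<epsilon> y) \<le> (LINT y|lborel. max c d * \<phi> \<epsilon> y)"
    by (rule integral_mono) (use i integrable[OF e] nn in \<open>auto intro!: mult_right_mono simp: two_phase_def\<close>)
  then show "convolution (two_phase c d) (\<phi> \<epsilon>) x \<le> max c d * (LINT x|lborel. \<phi> \<epsilon> x)"
    unfolding convolution_def by simp
qed

text \<open>For |y| < \<delta> <= |x| the points x - y and x lie on the same side of the jump, so
  only the mass of \<open>\<phi> \<epsilon>\<close> far from 0 contributes.\<close>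

lemma convolution_tail:
  assumes e: "\<epsilon> \<in> {0<..1}" and "\<delta> > 0" "\<bar>x\<bar> \<ge> \<delta>"
  shows "\<bar>convolution (two_phase c d) (\<phi> \<epsilon>) x - two_phase c d x * (LINT x|lborel. \<phi> \<epsilon> x)\<bar>
     \<le> \<bar>c - d\<bar> * (LINT y|lborel. (1 - plateau (\<delta> / 2) y) * \<phi> \<epsilon> y)"
proof -
  have nn: "\<phi> \<epsilon> y \<ge> 0" for y using smooth e by auto
  have i: "integrable lborel (\<lambda>y. two_phase c d (x - y) * \<phi> \<epsilon> y)"
    by (rule integrable_mult[OF e two_phase_measurable two_phase_bound])
  have j: "integrable lborel (\<lambda>y. (1 - plateau (\<delta> / 2) y) * \<phi> \<epsilon> y)"
    by (rule integrable_mult[OF e, of _ 1]) (use plateau_measurable plateau_bounds in auto)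
  have eq: "convolution (two_phase c d) (\<phi> \<epsilon>) x - two_phase c d x * (LINT x|lborel. \<phi> \<epsilon> x)
      = (LINT y|lborel. (two_phase c d (x - y) - two_phase c d x) * \<phi> \<epsilon> y)"
    unfolding convolution_def using i integrable[OF e]
    by (simp add: left_diff_distrib)
  have "norm (LINT y|lborel. (two_phase c d (x - y) - two_phase c d x) * \<phi> \<epsilon> y)
      \<le> (LINT y|lborel. \<bar>c - d\<bar> * ((1 - plateau (\<delta> / 2) y) * \<phi> \<epsilon> y))"
  proof (rule Bochner_Integration.integral_norm_bound_integral)
    show "integrable lborel (\<lambda>y. (two_phase c d (x - y) - two_phase c d x) * \<phi> \<epsilon> y)"
      using i integrable[OF e] by (simp add: left_diff_distrib)
    show "integrable lborel (\<lambda>y. \<bar>c - d\<bar> * ((1 - plateau (\<delta> / 2) y) * \<phi> \<epsilon> y))"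
      using j by simp
    show "norm ((two_phase c d (x - y) - two_phase c d x) * \<phi> \<epsilon> y)
        \<le> \<bar>c - d\<bar> * ((1 - plateau (\<delta> / 2) y) * \<phi> \<epsilon> y)" for y
    proof (cases "\<bar>y\<bar> < \<delta>")
      case True
      then have "two_phase c d (x - y) = two_phase c d x"
        using assms by (auto simp: two_phase_def)
      then show ?thesis using nn[of y] plateau_bounds[of "\<delta> / 2" y] by simp
    next
      case False
      then have "plateau (\<delta> / 2) y = 0"
        using plateau_eq_0[of "\<delta> / 2" y] assms by simp
      moreover have "\<bar>two_phase c d (x - y) - two_phase c d x\<bar> \<le> \<bar>c - d\<bar>"
        by (auto simp: two_phase_def)
      ultimately show ?thesis
        using nn[of y] by (auto simp: abs_mult intro!: mult_right_mono)
    qed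
  qed
  then show ?thesis
    unfolding eq by simp
qed

context
  fixes c d :: real and ar :: "real \<Rightarrow> real \<Rightarrow> real"
  assumes c: "c > 0" and d: "d > 0"
    and ar: "ar \<in> generalised_class W_infty sup_seminorms (\<lambda>\<epsilon>. convolution (two_phase c d) (\<phi> \<epsilon>))"
begin

lemma representative_smooth: "\<epsilon> \<in> {0<..1} \<Longrightarrow> smooth_on UNIV (ar \<epsilon>)"
  by (rule W_inftyD(1)[OF moderate_netsD(1)[OF conjunct1[OF conjunct2[OF ar[unfolded generalised_class_iff]]]]])

text \<open>Negligibility in the zeroth seminorm, with \<open>q = 1\<close>: this transfers the
  estimates for the convolution to an arbitrary representative of the class.\<close>

lemma representative_close:
  obtains C where "C > 0"
    "\<forall>\<^sub>F \<epsilon> in at_right 0. \<forall>x. \<bar>ar \<epsilon> x - convolution (two_phase c d) (\<phi> \<epsilon>) x\<bar> \<le> C * \<epsilon>"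
proof -
  define D where "D = (\<lambda>\<epsilon>. convolution (two_phase c d) (\<phi> \<epsilon>) - ar \<epsilon>)"
  have D: "D \<in> negligible_nets W_infty sup_seminorms"
    unfolding D_def using ar unfolding generalised_class_iff by (elim conjE)
  have p: "(\<lambda>f. sup_norm (iter_deriv [] f)) \<in> (sup_seminorms :: ((real \<Rightarrow> real) \<Rightarrow> real) set)"
    unfolding sup_seminorms_def by (rule imageI[of "[]"]) simp
  have "(\<lambda>\<epsilon>. sup_norm (iter_deriv [] (D \<epsilon>))) \<in> O[at_right 0](\<lambda>\<epsilon>. \<epsilon> ^ 1)"
    by (rule negligible_netsD(2)[OF D p])
  then obtain C where C: "C > 0" "\<forall>\<^sub>F \<epsilon> in at_right 0. \<bar>sup_norm (iter_deriv [] (D \<epsilon>))\<bar> \<le> C * \<bar>\<epsilon> ^ 1\<bar>"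
    by (rule bigo_eventually_bound)
  have "\<forall>\<^sub>F \<epsilon> in at_right 0. \<forall>x. \<bar>ar \<epsilon> x - convolution (two_phase c d) (\<phi> \<epsilon>) x\<bar> \<le> C * \<epsilon>"
    using C(2) eventually_in_unit
  proof eventually_elim
    case (elim \<epsilon>)
    have b: "bounded (range (D \<epsilon>))"
      using W_inftyD(2)[OF negligible_netsD(1)[OF D elim(2)], of "[]"] by simp
    have "\<bar>D \<epsilon> x\<bar> \<le> C * \<epsilon>" for x
    proof -
      have "norm (D \<epsilon> x) \<le> sup_norm (D \<epsilon>)"
        by (rule norm_le_sup_norm[OF b])
      also have "\<dots> \<le> C * \<epsilon>" using elim by simp
      finally show ?thesis by simp
    qed
    then show ?case by (simp add: D_def abs_minus_commute)
  qed
  with C(1) show ?thesis by (rule that)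
qed

lemma representative_bounds:
  "\<forall>\<^sub>F \<epsilon> in at_right 0. \<forall>x. min c d / 2 \<le> ar \<epsilon> x \<and> ar \<epsilon> x \<le> 2 * max c d"
proof -
  obtain C where C: "C > 0"
    "\<forall>\<^sub>F \<epsilon> in at_right 0. \<forall>x. \<bar>ar \<epsilon> x - convolution (two_phase c d) (\<phi> \<epsilon>) x\<bar> \<le> C * \<epsilon>"
    by (rule representative_close)
  have m: "\<forall>\<^sub>F \<epsilon> in at_right 0. \<bar>(LINT x|lborel. \<phi> \<epsilon> x) - 1\<bar> < 1 / 4"
    using tendstoD[OF mass_limit, of "1/4"] by (simp add: dist_real_def)
  \<comment> \<open>The budget: the mass lies between 3/4 and 5/4, and the change of representative
    costs at most \<open>min c d / 4\<close>. This leaves \<open>min c d / 2\<close> below and less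
    than \<open>2 * max c d\<close> above.\<close>
  have "min c d / (4 * C) > 0" using c d C by auto
  then have s: "\<forall>\<^sub>F \<epsilon> in at_right 0. \<epsilon> < min c d / (4 * C)"
    using eventually_at_right_real[of 0 "min c d / (4 * C)"] by (auto elim: eventually_mono)
  from C(2) m s eventually_in_unit show ?thesis
  proof eventually_elim
    case (elim \<epsilon>)
    define m where "m = (LINT x|lborel. \<phi> \<epsilon> x)"
    have m: "3 / 4 \<le> m" "m \<le> 5 / 4" using elim(2) unfolding m_def by (auto simp: abs_if split: if_splits)
    have ce: "C * \<epsilon> \<le> min c d / 4" using elim(3) C(1) by (simp add: field_simps)
    have "min c d / 2 \<le> ar \<epsilon> x \<and> ar \<epsilon> x \<le> 2 * max c d" for x
    proof -
      have 1: "\<bar>ar \<epsilon> x - convolution (two_phase c d) (\<phi> \<epsilon>) x\<bar> \<le> min c d / 4"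
        using elim(1) ce order_trans by blast
      have 2: "min c d * m \<le> convolution (two_phase c d) (\<phi> \<epsilon>) x" "convolution (two_phase c d) (\<phi> \<epsilon>) x \<le> max c d * m"
        using convolution_bounds[OF elim(4) c d] unfolding m_def by auto
      have 3: "min c d * (3 / 4) \<le> min c d * m" "max c d * m \<le> max c d * (5 / 4)"
        using m c d by (intro mult_left_mono; simp add: less_imp_le max.coboundedI1)+
      have 4: "min c d \<le> max c d" "0 < min c d" using c d by auto
      have "\<bar>u - v\<bar> \<le> p / 4 \<Longrightarrow> p * m \<le> v \<Longrightarrow> v \<le> q * m \<Longrightarrow> p * (3 / 4) \<le> p * m \<Longrightarrow>
          q * m \<le> q * (5 / 4) \<Longrightarrow> p \<le> q \<Longrightarrow> 0 < p \<Longrightarrow> p / 2 \<le> u \<and> u \<le> 2 * q" for p q u v :: real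
        by linarith
      from this[OF 1 2 3 4] show ?thesis .
    qed
    then show ?case by blast
  qed
qed

text \<open>Away from the interface the convergence is uniform. The three summands of the bound are
  the change of representative, the mass of \<open>\<phi> \<epsilon>\<close> far from 0, and the
  deviation of its total mass from 1.\<close>

lemma representative_limit:
  assumes "\<delta> > 0" "\<eta> > 0"
  shows "\<forall>\<^sub>F \<epsilon> in at_right 0. \<forall>x. \<bar>x\<bar> \<ge> \<delta> \<longrightarrow> \<bar>ar \<epsilon> x - two_phase c d x\<bar> < \<eta>"
proof -
  obtain C where C: "C > 0"
    "\<forall>\<^sub>F \<epsilon> in at_right 0. \<forall>x. \<bar>ar \<epsilon> x - convolution (two_phase c d) (\<phi> \<epsilon>) x\<bar> \<le> C * \<epsilon>"
    by (rule representative_close)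
  have "((\<lambda>\<epsilon>. C * \<epsilon> + \<bar>c - d\<bar> * (LINT y|lborel. (1 - plateau (\<delta> / 2) y) * \<phi> \<epsilon> y)
      + (\<bar>c\<bar> + \<bar>d\<bar>) * \<bar>(LINT x|lborel. \<phi> \<epsilon> x) - 1\<bar>) \<longlongrightarrow> C * 0 + \<bar>c - d\<bar> * 0 + (\<bar>c\<bar> + \<bar>d\<bar>) * \<bar>1 - 1\<bar>) (at_right 0)"
    by (intro tendsto_intros tail_limit assms mass_limit)
  then have "\<forall>\<^sub>F \<epsilon> in at_right 0. C * \<epsilon> + \<bar>c - d\<bar> * (LINT y|lborel. (1 - plateau (\<delta> / 2) y) * \<phi> \<epsilon> y)
      + (\<bar>c\<bar> + \<bar>d\<bar>) * \<bar>(LINT x|lborel. \<phi> \<epsilon> x) - 1\<bar> < \<eta>"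
    by (rule order_tendstoD(2)) (simp add: assms)
  with C(2) eventually_in_unit show ?thesis
  proof eventually_elim
    case (elim \<epsilon>)
    have "\<bar>ar \<epsilon> x - two_phase c d x\<bar> < \<eta>" if x: "\<bar>x\<bar> \<ge> \<delta>" for x
    proof -
      define m where "m = (LINT x|lborel. \<phi> \<epsilon> x)"
      have "\<bar>two_phase c d x * m - two_phase c d x\<bar> = \<bar>two_phase c d x\<bar> * \<bar>m - 1\<bar>"
        by (simp flip: abs_mult add: algebra_simps)
      also have "\<dots> \<le> (\<bar>c\<bar> + \<bar>d\<bar>) * \<bar>m - 1\<bar>"
        by (intro mult_right_mono two_phase_bound) auto
      finally have 1: "\<bar>two_phase c d x * m - two_phase c d x\<bar> \<le> (\<bar>c\<bar> + \<bar>d\<bar>) * \<bar>m - 1\<bar>" .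
      have 2: "\<bar>ar \<epsilon> x - convolution (two_phase c d) (\<phi> \<epsilon>) x\<bar> \<le> C * \<epsilon>" using elim(1) by blast
      note 3 = convolution_tail[OF elim(2) assms(1) x, of c d, folded m_def]
      have "\<bar>u - r\<bar> \<le> p \<Longrightarrow> \<bar>r - v * m\<bar> \<le> q \<Longrightarrow> \<bar>v * m - v\<bar> \<le> w \<Longrightarrow> p + q + w < \<eta> \<Longrightarrow> \<bar>u - v\<bar> < \<eta>"
        for u r p q v w :: real by linarith
      from this[OF 2 3 1 elim(3)[folded m_def]] show ?thesis .
    qed
    then show ?case by blast
  qed
qed

end

end

section \<open>Integrals over rectangles\<close>

abbreviation continuous2 :: "(real \<times> real) set \<Rightarrow> (real \<Rightarrow> real \<Rightarrow> 'b::topological_space) \<Rightarrow> bool" where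
  "continuous2 S f \<equiv> continuous_on S (\<lambda>z. f (fst z) (snd z))"

text \<open>Integration in x is innermost, so that estimates at fixed t can be inserted directly;
  \<open>rect_integral_swap\<close> exchanges the order for continuous integrands.\<close>

definition rect_integral :: "real \<Rightarrow> real \<Rightarrow> (real \<Rightarrow> real \<Rightarrow> 'b::banach) \<Rightarrow> 'b" where
  "rect_integral L s f = integral {0..s} (\<lambda>t. integral {0..L} (\<lambda>x. f x t))"

lemma continuous2_slice_x:
  "continuous2 (A \<times> B) f \<Longrightarrow> t \<in> B \<Longrightarrow> continuous_on A (\<lambda>x. f x t)"
  by (rule continuous_on_compose2[of _ "\<lambda>z. f (fst z) (snd z)" _ "\<lambda>x. (x, t)", simplified])
    (auto intro!: continuous_intros)

lemma continuous2_slice_t: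
  "continuous2 (A \<times> B) f \<Longrightarrow> x \<in> A \<Longrightarrow> continuous_on B (\<lambda>t. f x t)"
  by (rule continuous_on_compose2[of _ "\<lambda>z. f (fst z) (snd z)" _ "\<lambda>t. (x, t)", simplified])
    (auto intro!: continuous_intros)

lemma continuous2_integral_x:
  fixes f :: "real \<Rightarrow> real \<Rightarrow> 'b::banach"
  assumes "continuous2 ({a..b} \<times> B) f"
  shows "continuous_on B (\<lambda>t. integral {a..b} (\<lambda>x. f x t))"
proof -
  have "continuous_on (B \<times> {a..b}) ((\<lambda>z. f (fst z) (snd z)) \<circ> (\<lambda>z. (snd z, fst z)))"
    by (rule continuous_on_compose) (auto intro!: continuous_intros continuous_on_subset[OF assms])
  then have "continuous_on (B \<times> cbox a b) (\<lambda>(t, x). f x t)"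
    by (simp add: o_def case_prod_beta)
  from integral_continuous_on_param[OF this] show ?thesis by simp
qed

lemma rect_integral_swap:
  fixes f :: "real \<Rightarrow> real \<Rightarrow> 'b::banach"
  assumes "continuous2 ({0..L} \<times> {0..s}) f"
  shows "rect_integral L s f = integral {0..L} (\<lambda>x. integral {0..s} (\<lambda>t. f x t))"
proof -
  have "cbox (0, 0) (L, s) = {0..L} \<times> {0..s}" by (auto simp: cbox_Pair_eq)
  then have "continuous_on (cbox (0, 0) (L, s)) (\<lambda>(x, t). f x t)"
    using assms by (simp add: case_prod_beta)
  from integral_swap_continuous[OF this] show ?thesis
    by (simp add: rect_integral_def)
qed

context
  fixes L s :: real
begin

lemma rect_integral_add:
  fixes f g :: "real \<Rightarrow> real \<Rightarrow> 'b::banach"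
  assumes f: "continuous2 ({0..L} \<times> {0..s}) f" and g: "continuous2 ({0..L} \<times> {0..s}) g"
  shows "rect_integral L s (\<lambda>x t. f x t + g x t) = rect_integral L s f + rect_integral L s g"
proof -
  have "rect_integral L s (\<lambda>x t. f x t + g x t)
      = integral {0..s} (\<lambda>t. integral {0..L} (\<lambda>x. f x t) + integral {0..L} (\<lambda>x. g x t))"
    unfolding rect_integral_def
    by (intro integral_cong Henstock_Kurzweil_Integration.integral_add integrable_continuous_real
        continuous2_slice_x[OF f] continuous2_slice_x[OF g])
  also have "\<dots> = rect_integral L s f + rect_integral L s g"
    unfolding rect_integral_def
    by (intro Henstock_Kurzweil_Integration.integral_add integrable_continuous_real
        continuous2_integral_x f g)
  finally show ?thesis .
qed

lemma rect_integral_diff: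
  fixes f g :: "real \<Rightarrow> real \<Rightarrow> 'b::banach"
  assumes f: "continuous2 ({0..L} \<times> {0..s}) f" and g: "continuous2 ({0..L} \<times> {0..s}) g"
  shows "rect_integral L s (\<lambda>x t. f x t - g x t) = rect_integral L s f - rect_integral L s g"
proof -
  have "rect_integral L s (\<lambda>x t. f x t - g x t)
      = integral {0..s} (\<lambda>t. integral {0..L} (\<lambda>x. f x t) - integral {0..L} (\<lambda>x. g x t))"
    unfolding rect_integral_def
    by (intro integral_cong Henstock_Kurzweil_Integration.integral_diff integrable_continuous_real
        continuous2_slice_x[OF f] continuous2_slice_x[OF g])
  also have "\<dots> = rect_integral L s f - rect_integral L s g"
    unfolding rect_integral_def
    by (intro Henstock_Kurzweil_Integration.integral_diff integrable_continuous_real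
        continuous2_integral_x f g)
  finally show ?thesis .
qed

lemma rect_integral_cong:
  assumes "\<And>x t. x \<in> {0..L} \<Longrightarrow> t \<in> {0..s} \<Longrightarrow> f x t = g x t"
  shows "rect_integral L s f = rect_integral L s g"
  unfolding rect_integral_def by (intro integral_cong assms)

lemma rect_integral_deriv_x:
  fixes F :: "real \<Rightarrow> real \<Rightarrow> 'b::banach"
  assumes L: "L \<ge> 0" and F: "continuous2 ({0..L} \<times> {0..s}) F"
    and D: "\<And>x t. x \<in> {0<..<L} \<Longrightarrow> t \<in> {0..s} \<Longrightarrow> ((\<lambda>x. F x t) has_vector_derivative Fx x t) (at x)"
  shows "rect_integral L s Fx = integral {0..s} (\<lambda>t. F L t - F 0 t)"
  unfolding rect_integral_def
proof (rule integral_cong)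
  fix t assume t: "t \<in> {0..s}"
  show "integral {0..L} (\<lambda>x. Fx x t) = F L t - F 0 t"
    by (rule integral_unique[OF fundamental_theorem_of_calculus_interior[OF L continuous2_slice_x[OF F t] D[OF _ t]]])
qed

lemma rect_integral_deriv_t:
  fixes F :: "real \<Rightarrow> real \<Rightarrow> 'b::banach"
  assumes s: "s \<ge> 0" and F: "continuous2 ({0..L} \<times> {0..s}) F" and Ft: "continuous2 ({0..L} \<times> {0..s}) Ft"
    and D: "\<And>x t. x \<in> {0..L} \<Longrightarrow> t \<in> {0<..<s} \<Longrightarrow> ((\<lambda>t. F x t) has_vector_derivative Ft x t) (at t)"
  shows "rect_integral L s Ft = integral {0..L} (\<lambda>x. F x s - F x 0)"
  unfolding rect_integral_swap[OF Ft]
proof (rule integral_cong)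
  fix x assume x: "x \<in> {0..L}"
  show "integral {0..s} (\<lambda>t. Ft x t) = F x s - F x 0"
    by (rule integral_unique[OF fundamental_theorem_of_calculus_interior[OF s continuous2_slice_t[OF F x] D[OF x]]])
qed

text \<open>Integration by parts of P u_x in x and of Q u_t in t. It is always used twice, with a
  wave and the dual solution exchanging the roles of \<open>u\<close> and of the pair (P, Q); the
  left-hand sides of the two instances agree, up to the coefficient errors if there are any.
  Derivatives in x are required only for interior x, because at the interface only one-sided
  information exists.\<close>

lemma green_identity:
  fixes u P Q :: "real \<Rightarrow> real \<Rightarrow> 'b::{real_normed_field, banach}"
  assumes L: "L \<ge> 0" and s: "s \<ge> 0"
    and cont: "continuous2 ({0..L} \<times> {0..s}) u" "continuous2 ({0..L} \<times> {0..s}) ux" "continuous2 ({0..L} \<times> {0..s}) ut"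
      "continuous2 ({0..L} \<times> {0..s}) P" "continuous2 ({0..L} \<times> {0..s}) Px"
      "continuous2 ({0..L} \<times> {0..s}) Q" "continuous2 ({0..L} \<times> {0..s}) Qt"
    and u: "\<And>x t. x \<in> {0<..<L} \<Longrightarrow> t \<in> {0..s} \<Longrightarrow> ((\<lambda>x. u x t) has_vector_derivative ux x t) (at x)"
      "\<And>x t. x \<in> {0..L} \<Longrightarrow> t \<in> {0<..<s} \<Longrightarrow> ((\<lambda>t. u x t) has_vector_derivative ut x t) (at t)"
    and P: "\<And>x t. x \<in> {0<..<L} \<Longrightarrow> t \<in> {0..s} \<Longrightarrow> ((\<lambda>x. P x t) has_vector_derivative Px x t) (at x)"
    and Q: "\<And>x t. x \<in> {0..L} \<Longrightarrow> t \<in> {0<..<s} \<Longrightarrow> ((\<lambda>t. Q x t) has_vector_derivative Qt x t) (at t)"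
  shows "rect_integral L s (\<lambda>x t. P x t * ux x t - Q x t * ut x t)
    = rect_integral L s (\<lambda>x t. (Qt x t - Px x t) * u x t)
      - integral {0..L} (\<lambda>x. Q x s * u x s - Q x 0 * u x 0)
      + integral {0..s} (\<lambda>t. P L t * u L t - P 0 t * u 0 t)"
proof -
  note c = cont
  have x: "rect_integral L s (\<lambda>x t. P x t * ux x t + Px x t * u x t)
      = integral {0..s} (\<lambda>t. P L t * u L t - P 0 t * u 0 t)"
    by (rule rect_integral_deriv_x[OF L]) (use P u in \<open>auto intro!: continuous_intros c has_vector_derivative_mult\<close>)
  have t: "rect_integral L s (\<lambda>x t. Q x t * ut x t + Qt x t * u x t)
      = integral {0..L} (\<lambda>x. Q x s * u x s - Q x 0 * u x 0)"
    by (rule rect_integral_deriv_t[OF s]) (use Q u in \<open>auto intro!: continuous_intros c has_vector_derivative_mult\<close>)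
  have "rect_integral L s (\<lambda>x t. P x t * ux x t - Q x t * ut x t)
      = rect_integral L s (\<lambda>x t. ((Qt x t - Px x t) * u x t - (Q x t * ut x t + Qt x t * u x t))
          + (P x t * ux x t + Px x t * u x t))"
    by (rule rect_integral_cong) (simp add: algebra_simps)
  also have "\<dots> = rect_integral L s (\<lambda>x t. (Qt x t - Px x t) * u x t)
      - rect_integral L s (\<lambda>x t. Q x t * ut x t + Qt x t * u x t)
      + rect_integral L s (\<lambda>x t. P x t * ux x t + Px x t * u x t)"
  proof -
    have 1: "continuous2 ({0..L} \<times> {0..s}) (\<lambda>x t. (Qt x t - Px x t) * u x t)"
      and 2: "continuous2 ({0..L} \<times> {0..s}) (\<lambda>x t. Q x t * ut x t + Qt x t * u x t)"
      and 3: "continuous2 ({0..L} \<times> {0..s}) (\<lambda>x t. P x t * ux x t + Px x t * u x t)"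
      by (intro continuous_intros c)+
    show ?thesis
      unfolding rect_integral_diff[OF 1 2, symmetric]
      by (rule rect_integral_add[OF continuous_on_diff[OF 1 2] 3])
  qed
  finally show ?thesis unfolding x t .
qed

end

text \<open>The integral of (|f| t + |g|)^2 is a quadratic in t that takes no negative
  value.\<close>

lemma integral_Cauchy_Schwarz:
  fixes f :: "real \<Rightarrow> 'b::real_normed_vector" and g :: "real \<Rightarrow> 'c::real_normed_vector"
  assumes f: "continuous_on {a..b} f" and g: "continuous_on {a..b} g"
  shows "integral {a..b} (\<lambda>x. norm (f x) * norm (g x))
    \<le> sqrt (integral {a..b} (\<lambda>x. (norm (f x))\<^sup>2)) * sqrt (integral {a..b} (\<lambda>x. (norm (g x))\<^sup>2))"
proof -
  define A where "A = integral {a..b} (\<lambda>x. (norm (f x))\<^sup>2)"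
  define B where "B = integral {a..b} (\<lambda>x. (norm (g x))\<^sup>2)"
  define N where "N = integral {a..b} (\<lambda>x. norm (f x) * norm (g x))"
  have A: "((\<lambda>x. (norm (f x))\<^sup>2) has_integral A) {a..b}"
    unfolding A_def by (intro integrable_integral integrable_continuous_real continuous_intros f)
  have B: "((\<lambda>x. (norm (g x))\<^sup>2) has_integral B) {a..b}"
    unfolding B_def by (intro integrable_integral integrable_continuous_real continuous_intros g)
  have N: "((\<lambda>x. norm (f x) * norm (g x)) has_integral N) {a..b}"
    unfolding N_def by (intro integrable_integral integrable_continuous_real continuous_intros f g)
  have q: "A * t\<^sup>2 + 2 * N * t + B \<ge> 0" for t
  proof -
    have "((\<lambda>x. (norm (f x))\<^sup>2 * t\<^sup>2 + (norm (f x) * norm (g x)) * (2 * t) + (norm (g x))\<^sup>2) has_integral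
        (A * t\<^sup>2 + N * (2 * t) + B)) {a..b}"
      by (intro has_integral_add has_integral_mult_left A B N)
    then have "A * t\<^sup>2 + N * (2 * t) + B \<ge> 0"
    proof (rule has_integral_nonneg)
      fix x
      have "(norm (f x))\<^sup>2 * t\<^sup>2 + (norm (f x) * norm (g x)) * (2 * t) + (norm (g x))\<^sup>2
          = (norm (f x) * t + norm (g x))\<^sup>2"
        by (simp add: power2_sum power_mult_distrib)
      then show "0 \<le> (norm (f x))\<^sup>2 * t\<^sup>2 + (norm (f x) * norm (g x)) * (2 * t) + (norm (g x))\<^sup>2"
        by simp
    qed
    then show ?thesis by (simp add: mult_ac)
  qed
  have nn: "A \<ge> 0" "B \<ge> 0" "N \<ge> 0"
    using A B N by (auto intro: has_integral_nonneg)
  \<comment> \<open>For A = 0 the quadratic is affine, and t = -(B + 1)/(2 N) would give it the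
    value -1 unless N = 0. Otherwise t = -N/A is its minimum.\<close>
  have "N\<^sup>2 \<le> A * B"
  proof (cases "A = 0")
    case True
    have "N = 0"
    proof (rule ccontr)
      assume "N \<noteq> 0"
      with q[of "- (B + 1) / (2 * N)"] True show False by (simp add: field_simps)
    qed
    with True show ?thesis by simp
  next
    case False
    with nn have "A > 0" by simp
    with q[of "- N / A"] show ?thesis
      by (simp add: power2_eq_square field_simps)
  qed
  then have "sqrt (N\<^sup>2) \<le> sqrt (A * B)" by (rule real_sqrt_le_mono)
  then show ?thesis
    using nn by (simp add: real_sqrt_mult A_def[symmetric] B_def[symmetric] N_def[symmetric])
qed

section \<open>The energy estimate\<close>

text \<open>Differentiating f(x,\<tau>) - f(x,t0), the integral of f_t, under the integral sign
  writes f_x as the integral of f_tx plus a term constant in \<tau>; its t-derivative can then be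
  read off.\<close>

lemma mixed_partials_eq:
  fixes f fx ft fxt ftx :: "real \<Rightarrow> real \<Rightarrow> 'b::euclidean_space"
  assumes cont: "continuous2 (UNIV \<times> {-T<..<T}) ft" "continuous2 (UNIV \<times> {-T<..<T}) ftx"
    and f_x: "\<And>x t. t \<in> {-T<..<T} \<Longrightarrow> ((\<lambda>x. f x t) has_vector_derivative fx x t) (at x)"
    and f_t: "\<And>x t. t \<in> {-T<..<T} \<Longrightarrow> ((\<lambda>t. f x t) has_vector_derivative ft x t) (at t)"
    and fx_t: "\<And>x t. t \<in> {-T<..<T} \<Longrightarrow> ((\<lambda>t. fx x t) has_vector_derivative fxt x t) (at t)"
    and ft_x: "\<And>x t. t \<in> {-T<..<T} \<Longrightarrow> ((\<lambda>x. ft x t) has_vector_derivative ftx x t) (at x)"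
    and t: "t \<in> {-T<..<T}"
  shows "fxt x t = ftx x t"
proof -
  \<comment> \<open>Midpoints between t and the ends of the strip, so that a compact interval around
    t stays inside.\<close>
  define t0 where "t0 = (t - T) / 2"
  define t1 where "t1 = (t + T) / 2"
  have t01: "t0 < t" "t < t1" and sub: "{t0..t1} \<subseteq> {-T<..<T}"
    using t by (auto simp: t0_def t1_def)
  have c_ft: "continuous_on {t0..\<tau>} (\<lambda>t. ft x t)" if "\<tau> \<le> t1" for x \<tau>
    by (rule continuous_on_subset[OF continuous2_slice_t[OF cont(1)]]) (use sub that in auto)
  have c_ftx: "continuous_on {t0..t1} (\<lambda>t. ftx x t)" for x
    by (rule continuous_on_subset[OF continuous2_slice_t[OF cont(2)]]) (use sub in auto)
  have eq: "fx x \<tau> = fx x t0 + integral {t0..\<tau>} (\<lambda>t. ftx x t)" if \<tau>: "\<tau> \<in> {t0..t1}" for x \<tau>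
  proof -
    have "((\<lambda>t. ft y t) has_integral f y \<tau> - f y t0) {t0..\<tau>}" for y
      by (rule fundamental_theorem_of_calculus)
        (use \<tau> sub in \<open>auto intro!: has_vector_derivative_at_within f_t\<close>)
    then have i: "integral {t0..\<tau>} (\<lambda>t. ft y t) = f y \<tau> - f y t0" for y
      by (rule integral_unique)
    have "((\<lambda>x. integral (cbox t0 \<tau>) (\<lambda>t. ft x t)) has_vector_derivative
        integral (cbox t0 \<tau>) (\<lambda>t. ftx x t)) (at x within UNIV)"
    proof (rule leibniz_rule_vector_derivative)
      show "((\<lambda>x. ft x t) has_vector_derivative ftx x t) (at x within UNIV)" if "t \<in> cbox t0 \<tau>" for x t
        using that \<tau> sub by (auto intro!: ft_x)
      show "(\<lambda>t. ft x t) integrable_on cbox t0 \<tau>" for x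
        using c_ft[of \<tau> x] \<tau> by (simp add: integrable_continuous_real)
      show "continuous_on (UNIV \<times> cbox t0 \<tau>) (\<lambda>(x, t). ftx x t)"
        unfolding case_prod_beta
        by (rule continuous_on_subset[OF cont(2)]) (use \<tau> sub in auto)
    qed auto
    then have 1: "((\<lambda>x. f x \<tau> - f x t0) has_vector_derivative integral {t0..\<tau>} (\<lambda>t. ftx x t)) (at x)"
      by (simp add: i)
    have 2: "((\<lambda>x. f x \<tau> - f x t0) has_vector_derivative fx x \<tau> - fx x t0) (at x)"
      by (intro has_vector_derivative_diff f_x) (use \<tau> sub t01 t in \<open>auto simp: t0_def t1_def\<close>)
    show ?thesis
      using vector_derivative_unique_at[OF 1 2] by simp
  qed
  have "((\<lambda>\<tau>. integral {t0..\<tau>} (\<lambda>t. ftx x t)) has_vector_derivative ftx x t) (at t within {t0..t1})"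
    by (rule integral_has_vector_derivative[OF c_ftx]) (use t01 in auto)
  then have D: "((\<lambda>\<tau>. fx x t0 + integral {t0..\<tau>} (\<lambda>t. ftx x t)) has_vector_derivative ftx x t) (at t within {t0..t1})"
    by (auto intro!: derivative_eq_intros)
  have tin: "t \<in> {t0..t1}" using t01 by simp
  have "((\<lambda>\<tau>. fx x \<tau>) has_vector_derivative ftx x t) (at t within {t0..t1})"
    by (rule has_vector_derivative_transform[where f = "\<lambda>\<tau>. fx x t0 + integral {t0..\<tau>} (\<lambda>t. ftx x t)", OF tin _ D])
      (rule eq)
  then have "((\<lambda>\<tau>. fx x \<tau>) has_vector_derivative ftx x t) (at t)"
    using t01 by (simp add: at_within_Icc_at)
  from vector_derivative_unique_at[OF fx_t[OF t] this] show ?thesis .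
qed

text \<open>The square makes the positive part C1; this is the profile of the compactly supported
  weight in the energy estimate.\<close>

lemma pos_part_square_deriv:
  "((\<lambda>u::real. (max 0 u)\<^sup>2) has_real_derivative 2 * max 0 u) (at u)"
proof -
  consider "u > 0" | "u < 0" | "u = 0" by linarith
  then show ?thesis
  proof cases
    case 1
    have "((\<lambda>u::real. u\<^sup>2) has_real_derivative 2 * max 0 u) (at u)"
      using 1 by (auto intro!: derivative_eq_intros)
    then show ?thesis
      by (rule has_field_derivative_transform_within_open[where S = "{0<..}"]) (use 1 in auto)
  next
    case 2
    have "((\<lambda>u::real. 0) has_real_derivative 2 * max 0 u) (at u)"
      using 2 by simp
    then show ?thesis
      by (rule has_field_derivative_transform_within_open[where S = "{..<0}"]) (use 2 in auto)
  next
    case 3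
    have "((\<lambda>h. ((max 0 (0 + h))\<^sup>2 - (max 0 0)\<^sup>2) / h) \<longlongrightarrow> 0) (at (0::real))"
    proof (rule Lim_null_comparison)
      show "((\<lambda>h::real. \<bar>h\<bar>) \<longlongrightarrow> 0) (at 0)"
        by (rule tendsto_rabs_zero) (rule tendsto_ident_at)
      show "\<forall>\<^sub>F h in at (0::real). norm (((max 0 (0 + h))\<^sup>2 - (max 0 0)\<^sup>2) / h) \<le> \<bar>h\<bar>"
        by (rule always_eventually) (auto simp: max_def power2_eq_square)
    qed
    then show ?thesis unfolding DERIV_def 3 by simp
  qed
qed

text \<open>\<open>F\<close> is the x-derivative of the flux b w_x, kept as a single function so
  that no derivative of \<open>b\<close> appears, and \<open>n\<close> is the residual of the
  equation. One function \<open>wxt\<close> serves as both mixed derivatives.\<close>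

locale smooth_wave =
  fixes T :: real and a b :: "real \<Rightarrow> real" and w wt wx wtt wxt F n :: "real \<Rightarrow> real \<Rightarrow> complex"
  assumes cont: "continuous2 (UNIV \<times> {-T<..<T}) w" "continuous2 (UNIV \<times> {-T<..<T}) wt"
      "continuous2 (UNIV \<times> {-T<..<T}) wx" "continuous2 (UNIV \<times> {-T<..<T}) wtt"
      "continuous2 (UNIV \<times> {-T<..<T}) wxt" "continuous2 (UNIV \<times> {-T<..<T}) F"
      "continuous2 (UNIV \<times> {-T<..<T}) n"
    and cont_a: "continuous_on UNIV a" and cont_b: "continuous_on UNIV b"
    and w_t: "\<And>x t. t \<in> {-T<..<T} \<Longrightarrow> ((\<lambda>t. w x t) has_vector_derivative wt x t) (at t)"
    and w_x: "\<And>x t. t \<in> {-T<..<T} \<Longrightarrow> ((\<lambda>x. w x t) has_vector_derivative wx x t) (at x)"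
    and wt_t: "\<And>x t. t \<in> {-T<..<T} \<Longrightarrow> ((\<lambda>t. wt x t) has_vector_derivative wtt x t) (at t)"
    and wx_t: "\<And>x t. t \<in> {-T<..<T} \<Longrightarrow> ((\<lambda>t. wx x t) has_vector_derivative wxt x t) (at t)"
    and wt_x: "\<And>x t. t \<in> {-T<..<T} \<Longrightarrow> ((\<lambda>x. wt x t) has_vector_derivative wxt x t) (at x)"
    and flux_x: "\<And>x t. t \<in> {-T<..<T} \<Longrightarrow> ((\<lambda>x. b x *\<^sub>R wx x t) has_vector_derivative F x t) (at x)"
    and equation: "\<And>x t. t \<in> {-T<..<T} \<Longrightarrow> a x *\<^sub>R wtt x t - F x t = n x t"
begin

definition density :: "real \<Rightarrow> real \<Rightarrow> real" where
  "density x t = (norm (w x t))\<^sup>2 + (norm (wt x t))\<^sup>2 + (norm (wx x t))\<^sup>2"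

lemma continuous2_coeff: "continuous2 S (\<lambda>x t. a x)" "continuous2 S (\<lambda>x t. b x)"
  by (intro continuous_on_compose2[OF cont_a] continuous_on_compose2[OF cont_b] continuous_intros; simp)+

lemma cont_density: "continuous2 (UNIV \<times> {-T<..<T}) density"
  unfolding density_def by (intro continuous_intros cont)

text \<open>An energy with weight \<rho>, supported in a region that narrows as t grows. Since 2 |b
  w_x w_t| <= b |w_x|^2 + b |w_t|^2 <= M (a |w_t|^2 + b |w_x|^2), the decrease of \<rho> in t
  absorbs what its variation in x produces. The coefficients are independent of t and the flux is
  never expanded, so no derivative of \<open>a\<close> or \<open>b\<close> enters the
  constant.\<close>

lemma energy_estimate:
  assumes a0: "a0 > 0" "\<And>x. a0 \<le> a x" "\<And>x. a x \<le> a1"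
    and b0: "b0 > 0" "\<And>x. b0 \<le> b x" "\<And>x. b x \<le> b1"
    and M: "M \<ge> 1" "\<And>x. b x \<le> M * a x"
    and s: "0 \<le> s" "s < T" and X: "X \<ge> 0"
    and K: "K = M * s + sqrt (1 + X\<^sup>2) + 1"
    and t: "t \<in> {0..s}"
  shows "integral {-X..X} (\<lambda>x. density x t) \<le>
    exp ((2 / a0 + 1) * s) * K\<^sup>2 * (max 1 (max a1 b1) / min 1 (min a0 b0)) *
    (integral {-K..K} (\<lambda>x. density x 0) + integral {0..s} (\<lambda>t. integral {-K..K} (\<lambda>x. (norm (n x t))\<^sup>2)))"
proof -
  \<comment> \<open>\<open>2 / a0\<close> pays for the two copies of |w_t|^2 that come from
    estimating n w_t and w w_t, and 1 pays for |w|^2.\<close>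
  define c1 where "c1 = 2 / a0 + 1"
  have c1: "c1 > 0" using a0 by (simp add: c1_def add_pos_pos)
  define sq :: "real \<Rightarrow> real" where "sq = (\<lambda>x. sqrt (1 + x\<^sup>2))"
  have sq: "sq x > 0" "\<bar>x\<bar> \<le> sq x" for x
  proof -
    have p: "1 + x\<^sup>2 > 0" by (rule add_pos_nonneg) auto
    then show "sq x > 0" by (simp add: sq_def)
    have "sqrt (x\<^sup>2) \<le> sqrt (1 + x\<^sup>2)" by (rule real_sqrt_le_mono) simp
    then show "\<bar>x\<bar> \<le> sq x" by (simp add: sq_def)
  qed
  have sq_deriv: "(sq has_real_derivative x / sq x) (at x)" for x
  proof -
    have p: "1 + x\<^sup>2 > 0" by (rule add_pos_nonneg) auto
    have "((\<lambda>x. 1 + x\<^sup>2) has_real_derivative 2 * x) (at x)"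
      by (auto intro!: derivative_eq_intros)
    from DERIV_chain2[OF DERIV_real_sqrt[OF p] this]
    show ?thesis by (simp add: sq_def field_simps)
  qed
  have sq_cont: "continuous_on S sq" for S
    unfolding sq_def by (intro continuous_intros)
  \<comment> \<open>\<open>sq\<close> is a smooth substitute for |x| with slope at most 1. The value
    of \<open>K\<close> makes the weight at least 1 on [-X,X] up to time \<open>s\<close>, while it
    vanishes at both ends of [-K,K].\<close>
  define r where "r = (\<lambda>x t. max 0 (K - M * t - sq x))"
  define \<rho> where "\<rho> = (\<lambda>x t. (r x t)\<^sup>2)"
  have K1: "K \<ge> 1" using s M X by (simp add: K)
  have r: "r x t \<ge> 0" for x t by (simp add: r_def)
  have r_le: "r x t \<le> K" if "t \<ge> 0" for x t
  proof -
    have "M * t \<ge> 0" using M that by simp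
    then show ?thesis using sq(1)[of x] K1 by (auto simp: r_def max_def)
  qed
  have \<rho>_le: "\<rho> x t \<le> K\<^sup>2" if "t \<ge> 0" for x t
    unfolding \<rho>_def by (intro power_mono r_le that r)
  have \<rho>_nn: "\<rho> x t \<ge> 0" for x t by (simp add: \<rho>_def)
  have \<rho>_ge: "\<rho> x t \<ge> 1" if "x \<in> {-X..X}" "t \<in> {0..s}" for x t
  proof -
    have "x\<^sup>2 \<le> X\<^sup>2" using that(1) by (intro abs_le_square_iff[THEN iffD1]) auto
    then have "sq x \<le> sqrt (1 + X\<^sup>2)" by (simp add: sq_def)
    moreover have "M * t \<le> M * s" using that M by (intro mult_left_mono) auto
    ultimately have "r x t \<ge> 1" by (simp add: r_def K)
    then show ?thesis by (simp add: \<rho>_def)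
  qed
  have \<rho>_0: "\<rho> x t = 0" if "\<bar>x\<bar> = K" "t \<ge> 0" for x t
  proof -
    have "M * t \<ge> 0" using M that by simp
    then have "K - M * t - sq x \<le> 0" using sq(2)[of x] that by simp
    then show ?thesis by (simp add: \<rho>_def r_def)
  qed
  have r_cont: "continuous2 S r" for S
    unfolding r_def by (intro continuous_intros continuous_on_compose2[OF sq_cont[of UNIV]]) auto
  have \<rho>_cont: "continuous2 S \<rho>" for S
    unfolding \<rho>_def by (intro continuous_intros r_cont)
  have \<rho>_t: "((\<lambda>t. \<rho> x t) has_vector_derivative 2 * r x t * (- M)) (at t)" for x t
  proof -
    have "((\<lambda>t. K - M * t - sq x) has_real_derivative - M) (at t)"
      by (auto intro!: derivative_eq_intros)
    from DERIV_chain2[OF pos_part_square_deriv this] show ?thesis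
      by (simp add: \<rho>_def r_def has_real_derivative_iff_has_vector_derivative)
  qed
  have \<rho>_x: "((\<lambda>x. \<rho> x t) has_vector_derivative 2 * r x t * (- (x / sq x))) (at x)" for x t
  proof -
    have "((\<lambda>x. K - M * t - sq x) has_real_derivative - (x / sq x)) (at x)"
      by (auto intro!: derivative_eq_intros sq_deriv)
    from DERIV_chain2[OF pos_part_square_deriv this] show ?thesis
      by (simp add: \<rho>_def r_def has_real_derivative_iff_has_vector_derivative)
  qed
  define e where "e = (\<lambda>x t. a x * (wt x t \<bullet> wt x t) + b x * (wx x t \<bullet> wx x t) + w x t \<bullet> w x t)"
  define et where "et = (\<lambda>x t. a x * (wt x t \<bullet> wtt x t + wtt x t \<bullet> wt x t)
      + b x * (wx x t \<bullet> wxt x t + wxt x t \<bullet> wx x t) + (w x t \<bullet> wt x t + wt x t \<bullet> w x t))"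
  define j where "j = (\<lambda>x t. (b x *\<^sub>R wx x t) \<bullet> wt x t)"
  define jx where "jx = (\<lambda>x t. (b x *\<^sub>R wx x t) \<bullet> wxt x t + F x t \<bullet> wt x t)"
  let ?U = "UNIV \<times> {-T<..<T}"
  have e_cont: "continuous2 ?U e" and et_cont: "continuous2 ?U et" and j_cont: "continuous2 ?U j"
    and jx_cont: "continuous2 ?U jx"
    unfolding e_def et_def j_def jx_def by (intro continuous_intros cont continuous2_coeff)+
  note inner_deriv = bounded_bilinear.has_vector_derivative[OF bounded_bilinear_inner]
  have e_t: "((\<lambda>t. e x t) has_vector_derivative et x t) (at t)" if "t \<in> {-T<..<T}" for x t
    unfolding e_def et_def using that
    by (intro has_vector_derivative_add has_vector_derivative_mult_right inner_deriv w_t wt_t wx_t)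
  have j_x: "((\<lambda>x. j x t) has_vector_derivative jx x t) (at x)" if "t \<in> {-T<..<T}" for x t
    unfolding j_def jx_def using that by (intro inner_deriv flux_x wt_x)
  have e_eq: "e x t = a x * (norm (wt x t))\<^sup>2 + b x * (norm (wx x t))\<^sup>2 + (norm (w x t))\<^sup>2" for x t
    by (simp add: e_def power2_norm_eq_inner)
  have ab: "a x > 0" "b x > 0" for x using a0(1) a0(2)[of x] b0(1) b0(2)[of x] by linarith+
  have e_nn: "e x t \<ge> 0" for x t
    unfolding e_eq using ab[of x] by (intro add_nonneg_nonneg mult_nonneg_nonneg) auto
  \<comment> \<open>\<open>D\<close> is the t-derivative of \<rho> e and \<open>G\<close> the
    x-derivative of \<rho> j. In \<open>D - 2 * G\<close> the mixed derivatives cancel, and the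
    other second-order terms survive only as a w_tt - F, which is the residual.\<close>
  define D where "D = (\<lambda>x t. \<rho> x t * et x t + 2 * r x t * (- M) * e x t)"
  define G where "G = (\<lambda>x t. \<rho> x t * jx x t + 2 * r x t * (- (x / sq x)) * j x t)"
  have D_cont: "continuous2 ?U D"
    unfolding D_def by (intro continuous_intros \<rho>_cont r_cont e_cont et_cont)
  have sqx_cont: "continuous2 S (\<lambda>x t. x / sq x)" for S
    by (intro continuous_intros continuous_on_compose2[OF sq_cont[of UNIV]])
      (use sq(1) in \<open>auto simp: less_imp_neq[symmetric]\<close>)
  have G_cont: "continuous2 ?U G"
    unfolding G_def by (intro continuous_intros \<rho>_cont r_cont j_cont jx_cont sqx_cont)
  define E where "E = (\<lambda>t. integral {-K..K} (\<lambda>x. \<rho> x t * e x t))"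
  have slice: "continuous_on {-K..K} (\<lambda>x. f x t)" if "continuous2 ?U f" "t \<in> {-T<..<T}" for f :: "real \<Rightarrow> real \<Rightarrow> real" and t
    by (rule continuous_on_subset[OF continuous2_slice_x[OF that]]) simp
  have re_cont: "continuous2 ?U (\<lambda>x t. \<rho> x t * e x t)"
    by (intro continuous_intros \<rho>_cont e_cont)
  have E_deriv: "(E has_vector_derivative integral {-K..K} (\<lambda>x. D x t)) (at t)" if t: "t \<in> {-T<..<T}" for t
  proof -
    have "((\<lambda>t. integral (cbox (-K) K) (\<lambda>x. \<rho> x t * e x t)) has_vector_derivative
        integral (cbox (-K) K) (\<lambda>x. D x t)) (at t within {-T<..<T})"
    proof (rule leibniz_rule_vector_derivative)
      show "((\<lambda>t. \<rho> x t * e x t) has_vector_derivative D x t) (at t within {-T<..<T})"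
        if "t \<in> {-T<..<T}" for x t
        unfolding D_def by (rule has_vector_derivative_at_within) (intro has_vector_derivative_mult \<rho>_t e_t that)
      show "(\<lambda>x. \<rho> x t * e x t) integrable_on cbox (- K) K" if "t \<in> {-T<..<T}" for t
        using slice[OF re_cont that] by (simp add: integrable_continuous_real)
      have "continuous_on ({-T<..<T} \<times> cbox (-K) K) ((\<lambda>z. D (fst z) (snd z)) \<circ> (\<lambda>z. (snd z, fst z)))"
        by (rule continuous_on_compose) (auto intro!: continuous_intros continuous_on_subset[OF D_cont])
      then show "continuous_on ({-T<..<T} \<times> cbox (-K) K) (\<lambda>(t, x). D x t)"
        by (simp add: o_def case_prod_beta)
    qed (use t in auto)
    then show ?thesis
      using t by (simp add: E_def at_within_open[of t "{-T<..<T}"])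
  qed
  define \<nu> where "\<nu> = (\<lambda>t. integral {-K..K} (\<lambda>x. (norm (n x t))\<^sup>2))"
  have n2_cont: "continuous2 ?U (\<lambda>x t. (norm (n x t))\<^sup>2)"
    by (intro continuous_intros cont)
  have pointwise: "D x t - 2 * G x t \<le> c1 * (\<rho> x t * e x t) + K\<^sup>2 * (norm (n x t))\<^sup>2"
    if t: "t \<in> {0..s}" for x t
  proof -
    have tT: "t \<in> {-T<..<T}" using t s by auto
    define p where "p = norm (wt x t)"
    define q where "q = norm (wx x t)"
    define v where "v = norm (w x t)"
    define N where "N = norm (n x t)"
    define R where "R = r x t"
    define k where "k = x / sq x"
    have k: "\<bar>k\<bar> \<le> 1" using sq[of x] by (simp add: k_def abs_divide)
    have eq: "e x t = a x * p\<^sup>2 + b x * q\<^sup>2 + v\<^sup>2" by (simp add: e_eq p_def q_def v_def)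
    have "D x t - 2 * G x t = - 2 * M * R * e x t + 4 * R * (k * j x t)
        + R\<^sup>2 * (2 * ((a x *\<^sub>R wtt x t - F x t) \<bullet> wt x t) + 2 * (w x t \<bullet> wt x t))"
      by (simp add: D_def G_def et_def j_def jx_def \<rho>_def R_def k_def inner_diff_left inner_diff_right inner_commute
          algebra_simps)
    also have "\<dots> = (- 2 * M * R * e x t + 4 * R * (k * j x t)) + R\<^sup>2 * (2 * (n x t \<bullet> wt x t) + 2 * (w x t \<bullet> wt x t))"
      by (simp add: equation[OF tT])
    also have "\<dots> \<le> 0 + R\<^sup>2 * (N\<^sup>2 + c1 * e x t)"
    proof (rule add_mono)
      have "\<bar>k * j x t\<bar> \<le> 1 * (b x * q * p)"
        unfolding abs_mult
      proof (rule mult_mono[OF k])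
        have "\<bar>j x t\<bar> \<le> norm (b x *\<^sub>R wx x t) * norm (wt x t)"
          unfolding j_def by (rule Cauchy_Schwarz_ineq2)
        then show "\<bar>j x t\<bar> \<le> b x * q * p" using ab[of x] by (simp add: p_def q_def)
      qed auto
      then have 1: "2 * (k * j x t) \<le> b x * (2 * (q * p))" by (simp add: abs_le_iff mult_ac)
      have "2 * (q * p) \<le> q\<^sup>2 + p\<^sup>2" using sum_squares_bound[of q p] by (simp add: mult_ac)
      then have 2: "b x * (2 * (q * p)) \<le> b x * q\<^sup>2 + b x * p\<^sup>2"
        using ab[of x] by (simp add: distrib_left[symmetric])
      have 3: "b x * p\<^sup>2 \<le> M * (a x * p\<^sup>2)"
        using mult_right_mono[OF M(2)[of x], of "p\<^sup>2"] by (simp add: mult_ac)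
      have 4: "b x * q\<^sup>2 \<le> M * (b x * q\<^sup>2)"
        using mult_right_mono[OF M(1), of "b x * q\<^sup>2"] ab[of x] by simp
      have 5: "0 \<le> M * v\<^sup>2" using M by simp
      \<comment> \<open>The point of the cone: the flux through its slanted boundary is at most
        \<open>M\<close> times the energy, exactly what the t-derivative of the weight
        removes.\<close>
      have "2 * (k * j x t) \<le> M * e x t"
        unfolding eq using 1 2 3 4 5 by (simp add: distrib_left)
      then have "R * (2 * (k * j x t)) \<le> R * (M * e x t)"
        by (rule mult_left_mono) (simp add: R_def r)
      then show "- 2 * M * R * e x t + 4 * R * (k * j x t) \<le> 0" by (simp add: mult_ac)
    next
      have "n x t \<bullet> wt x t \<le> N * p" "w x t \<bullet> wt x t \<le> v * p"
        unfolding N_def p_def v_def by (rule norm_cauchy_schwarz)+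
      moreover have "2 * (N * p) \<le> N\<^sup>2 + p\<^sup>2" "2 * (v * p) \<le> v\<^sup>2 + p\<^sup>2"
        using sum_squares_bound[of N p] sum_squares_bound[of v p] by (simp_all add: mult_ac)
      ultimately have 1: "2 * (n x t \<bullet> wt x t) + 2 * (w x t \<bullet> wt x t) \<le> N\<^sup>2 + (2 * p\<^sup>2 + v\<^sup>2)" by linarith
      have "2 * p\<^sup>2 = (2 / a0) * (a0 * p\<^sup>2)" using a0 by simp
      also have "\<dots> \<le> (2 / a0) * (a x * p\<^sup>2)"
        using a0 by (intro mult_left_mono mult_right_mono) auto
      also have "\<dots> \<le> (2 / a0) * e x t"
        unfolding eq using a0(1) ab[of x] by (intro mult_left_mono) auto
      finally have 2: "2 * p\<^sup>2 \<le> (2 / a0) * e x t" .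
      have 3: "v\<^sup>2 \<le> e x t" unfolding eq using ab[of x] by simp
      have "2 * (n x t \<bullet> wt x t) + 2 * (w x t \<bullet> wt x t) \<le> N\<^sup>2 + c1 * e x t"
        using 1 2 3 by (simp add: c1_def distrib_right)
      then show "R\<^sup>2 * (2 * (n x t \<bullet> wt x t) + 2 * (w x t \<bullet> wt x t)) \<le> R\<^sup>2 * (N\<^sup>2 + c1 * e x t)"
        by (rule mult_left_mono) simp
    qed
    also have "\<dots> = c1 * (\<rho> x t * e x t) + \<rho> x t * N\<^sup>2"
      by (simp add: \<rho>_def R_def algebra_simps)
    also have "\<dots> \<le> c1 * (\<rho> x t * e x t) + K\<^sup>2 * N\<^sup>2"
      using \<rho>_le[of t x] t by (intro add_left_mono mult_right_mono) auto
    finally show ?thesis by (simp add: N_def)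
  qed
  have E'_le: "integral {-K..K} (\<lambda>x. D x t) \<le> c1 * E t + K\<^sup>2 * \<nu> t" if t: "t \<in> {0..s}" for t
  proof -
    have tT: "t \<in> {-T<..<T}" using t s by auto
    \<comment> \<open>The weight vanishes at both ends of [-K,K], so the divergence term integrates
      to 0.\<close>
    have "((\<lambda>x. G x t) has_integral \<rho> K t * j K t - \<rho> (-K) t * j (-K) t) {-K..K}"
    proof (rule fundamental_theorem_of_calculus)
      show "((\<lambda>x. \<rho> x t * j x t) has_vector_derivative G x t) (at x within {-K..K})" for x
        unfolding G_def by (rule has_vector_derivative_at_within) (intro has_vector_derivative_mult \<rho>_x j_x tT)
    qed (use K1 in simp)
    then have G: "((\<lambda>x. G x t) has_integral 0) {-K..K}"
      using \<rho>_0[of K t] \<rho>_0[of "-K" t] t K1 by simp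
    have D: "((\<lambda>x. D x t) has_integral integral {-K..K} (\<lambda>x. D x t)) {-K..K}"
      by (intro integrable_integral integrable_continuous_real slice[OF D_cont tT])
    have rhs: "((\<lambda>x. c1 * (\<rho> x t * e x t) + K\<^sup>2 * (norm (n x t))\<^sup>2) has_integral c1 * E t + K\<^sup>2 * \<nu> t) {-K..K}"
      unfolding E_def \<nu>_def
      by (intro has_integral_add has_integral_mult_right integrable_integral integrable_continuous_real
          slice[OF re_cont tT] slice[OF n2_cont tT])
    have lhs: "((\<lambda>x. D x t - 2 * G x t) has_integral integral {-K..K} (\<lambda>x. D x t) - 2 * 0) {-K..K}"
      by (intro has_integral_diff has_integral_mult_right D G)
    from has_integral_le[OF lhs rhs pointwise[OF t]] show ?thesis
      by (simp only: mult_zero_right diff_zero)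
  qed
  have E_le: "E t \<le> exp (c1 * s) * (E 0 + K\<^sup>2 * integral {0..s} \<nu>)"
  proof -
    \<comment> \<open>Gronwall's argument: \<open>H\<close> is the derivative of exp(-c1 t) E(t),
      which \<open>E'_le\<close> bounds by the residual alone.\<close>
    define H where "H = (\<lambda>t. exp (- c1 * t) * integral {-K..K} (\<lambda>x. D x t) + (exp (- c1 * t) * - c1) * E t)"
    have \<nu>_cont: "continuous_on {0..s} \<nu>"
      unfolding \<nu>_def by (rule continuous2_integral_x[OF continuous_on_subset[OF n2_cont]]) (use s in force)
    have \<nu>_nn: "\<nu> t \<ge> 0" if "t \<in> {0..s}" for t
      unfolding \<nu>_def by (intro integral_nonneg integrable_continuous_real slice[OF n2_cont]) (use that s in auto)
    have 1: "(H has_integral exp (- c1 * t) * E t - exp (- c1 * 0) * E 0) {0..t}"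
    proof (rule fundamental_theorem_of_calculus)
      fix \<tau> assume "\<tau> \<in> {0..t}"
      then have \<tau>: "\<tau> \<in> {-T<..<T}" using t s by auto
      have "((\<lambda>\<tau>. exp (- c1 * \<tau>)) has_real_derivative exp (- c1 * \<tau>) * - c1) (at \<tau>)"
        by (auto intro!: derivative_eq_intros)
      then have "((\<lambda>\<tau>. exp (- c1 * \<tau>)) has_vector_derivative exp (- c1 * \<tau>) * - c1) (at \<tau>)"
        by (simp add: has_real_derivative_iff_has_vector_derivative)
      from has_vector_derivative_at_within[OF has_vector_derivative_mult[OF this E_deriv[OF \<tau>]]]
      show "((\<lambda>\<tau>. exp (- c1 * \<tau>) * E \<tau>) has_vector_derivative H \<tau>) (at \<tau> within {0..t})"
        unfolding H_def .
    qed (use t in simp)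
    have 2: "((\<lambda>\<tau>. K\<^sup>2 * \<nu> \<tau>) has_integral K\<^sup>2 * integral {0..t} \<nu>) {0..t}"
      using t by (intro has_integral_mult_right integrable_integral integrable_continuous_real continuous_on_subset[OF \<nu>_cont]) auto
    have "exp (- c1 * t) * E t - exp (- c1 * 0) * E 0 \<le> K\<^sup>2 * integral {0..t} \<nu>"
    proof (rule has_integral_le[OF 1 2])
      fix \<tau> assume "\<tau> \<in> {0..t}"
      then have \<tau>: "\<tau> \<in> {0..s}" using t by auto
      have "H \<tau> = exp (- c1 * \<tau>) * (integral {-K..K} (\<lambda>x. D x \<tau>) - c1 * E \<tau>)"
        unfolding H_def right_diff_distrib by simp
      also have "\<dots> \<le> exp (- c1 * \<tau>) * (K\<^sup>2 * \<nu> \<tau>)"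
        using E'_le[OF \<tau>] by (intro mult_left_mono) auto
      also have "\<dots> \<le> 1 * (K\<^sup>2 * \<nu> \<tau>)"
        using \<nu>_nn[OF \<tau>] c1 \<tau> by (intro mult_right_mono) auto
      finally show "H \<tau> \<le> K\<^sup>2 * \<nu> \<tau>" by simp
    qed
    also have "\<dots> \<le> K\<^sup>2 * integral {0..s} \<nu>"
      using t \<nu>_nn by (intro mult_left_mono integral_subset_le integrable_continuous_real continuous_on_subset[OF \<nu>_cont]) auto
    finally have le: "exp (- c1 * t) * E t \<le> E 0 + K\<^sup>2 * integral {0..s} \<nu>" by simp
    have E0: "E 0 \<ge> 0" unfolding E_def
      by (intro integral_nonneg integrable_continuous_real slice[OF re_cont] mult_nonneg_nonneg \<rho>_nn e_nn) (use s in auto)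
    have I0: "integral {0..s} \<nu> \<ge> 0"
      using \<nu>_nn by (intro integral_nonneg integrable_continuous_real \<nu>_cont)
    have "E t = exp (c1 * t) * (exp (- c1 * t) * E t)"
      by (simp add: exp_minus)
    also have "\<dots> \<le> exp (c1 * t) * (E 0 + K\<^sup>2 * integral {0..s} \<nu>)"
      by (intro mult_left_mono le) auto
    also have "\<dots> \<le> exp (c1 * s) * (E 0 + K\<^sup>2 * integral {0..s} \<nu>)"
      using t c1 E0 I0 by (intro mult_right_mono) auto
    finally show ?thesis .
  qed
  \<comment> \<open>Constants comparing the energy with \<open>density\<close>; the 1 in the minimum
    and in the maximum is the coefficient of |w|^2 in the energy.\<close>
  define m0 where "m0 = min 1 (min a0 b0)"
  define m1 where "m1 = max 1 (max a1 b1)"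
  have m0: "m0 > 0" using a0 b0 by (simp add: m0_def)
  have m1: "m1 \<ge> 1" by (simp add: m1_def)
  have e_ge: "m0 * density x t \<le> e x t" for x t
  proof -
    have "m0 \<le> a x" "m0 \<le> b x" "m0 \<le> 1"
      using a0(2)[of x] b0(2)[of x] by (auto simp: m0_def)
    then have "m0 * (norm (wt x t))\<^sup>2 \<le> a x * (norm (wt x t))\<^sup>2" "m0 * (norm (wx x t))\<^sup>2 \<le> b x * (norm (wx x t))\<^sup>2"
      "m0 * (norm (w x t))\<^sup>2 \<le> 1 * (norm (w x t))\<^sup>2"
      by (intro mult_right_mono; simp)+
    then show ?thesis by (simp add: density_def e_eq algebra_simps)
  qed
  have e_le: "e x t \<le> m1 * density x t" for x t
  proof -
    have "a x \<le> m1" "b x \<le> m1" "1 \<le> m1"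
      using a0(3)[of x] b0(3)[of x] by (auto simp: m1_def)
    then have "a x * (norm (wt x t))\<^sup>2 \<le> m1 * (norm (wt x t))\<^sup>2" "b x * (norm (wx x t))\<^sup>2 \<le> m1 * (norm (wx x t))\<^sup>2"
      "1 * (norm (w x t))\<^sup>2 \<le> m1 * (norm (w x t))\<^sup>2"
      by (intro mult_right_mono; simp)+
    then show ?thesis by (simp add: density_def e_eq algebra_simps)
  qed
  have XK: "X \<le> K"
  proof -
    have "X \<le> sq X" using sq(2)[of X] by simp
    moreover have "M * s \<ge> 0" using M s by simp
    ultimately show ?thesis by (simp add: K sq_def)
  qed
  have tT: "t \<in> {-T<..<T}" and 0: "0 \<in> {-T<..<T}" using t s by auto
  have d_nn: "density x t \<ge> 0" for x t by (simp add: density_def)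
  have "m0 * integral {-X..X} (\<lambda>x. density x t) = integral {-X..X} (\<lambda>x. m0 * density x t)"
    by simp
  also have "\<dots> \<le> integral {-X..X} (\<lambda>x. \<rho> x t * e x t)"
  proof (rule integral_le)
    show "(\<lambda>x. m0 * density x t) integrable_on {-X..X}"
      using XK by (intro integrable_continuous_real continuous_intros continuous_on_subset[OF slice[OF cont_density tT]]) auto
    show "(\<lambda>x. \<rho> x t * e x t) integrable_on {-X..X}"
      using XK by (intro integrable_continuous_real continuous_on_subset[OF slice[OF re_cont tT]]) auto
    show "m0 * density x t \<le> \<rho> x t * e x t" if "x \<in> {-X..X}" for x
      using e_ge[of x t] mult_right_mono[OF \<rho>_ge[OF that t] e_nn[of x t]] by simp
  qed
  also have "\<dots> \<le> E t"
    unfolding E_def using XK \<rho>_nn e_nn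
    by (intro integral_subset_le integrable_continuous_real continuous_on_subset[OF slice[OF re_cont tT]]) auto
  also note E_le
  also have "E 0 \<le> K\<^sup>2 * m1 * integral {-K..K} (\<lambda>x. density x 0)"
  proof -
    have "E 0 \<le> integral {-K..K} (\<lambda>x. (K\<^sup>2 * m1) * density x 0)"
      unfolding E_def
    proof (rule integral_le)
      show "(\<lambda>x. K\<^sup>2 * m1 * density x 0) integrable_on {-K..K}"
        by (intro integrable_continuous_real continuous_intros slice[OF cont_density 0])
      show "\<rho> x 0 * e x 0 \<le> K\<^sup>2 * m1 * density x 0" for x
        using mult_mono[OF \<rho>_le[of 0 x] e_le[of x 0]] e_nn[of x 0] by (simp add: mult.assoc)
    qed (intro integrable_continuous_real slice[OF re_cont 0])
    then show ?thesis by simp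
  qed
  finally have fin: "m0 * integral {-X..X} (\<lambda>x. density x t) \<le> exp (c1 * s) *
      (K\<^sup>2 * m1 * integral {-K..K} (\<lambda>x. density x 0) + K\<^sup>2 * integral {0..s} \<nu>)"
    by simp
  have I0: "integral {0..s} \<nu> \<ge> 0"
    unfolding \<nu>_def using s
    by (intro integral_nonneg integrable_continuous_real continuous2_integral_x continuous_on_subset[OF n2_cont] slice[OF n2_cont]) auto
  have "K\<^sup>2 * integral {0..s} \<nu> \<le> K\<^sup>2 * m1 * integral {0..s} \<nu>"
    using m1 I0 mult_left_mono[OF m1, of "K\<^sup>2"] by (intro mult_right_mono) auto
  then have "exp (c1 * s) * (K\<^sup>2 * m1 * integral {-K..K} (\<lambda>x. density x 0) + K\<^sup>2 * integral {0..s} \<nu>)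
      \<le> exp (c1 * s) * (K\<^sup>2 * m1 * (integral {-K..K} (\<lambda>x. density x 0) + integral {0..s} \<nu>))"
    by (intro mult_left_mono) (auto simp: algebra_simps)
  with fin have "m0 * integral {-X..X} (\<lambda>x. density x t) \<le>
      exp (c1 * s) * (K\<^sup>2 * m1 * (integral {-K..K} (\<lambda>x. density x 0) + integral {0..s} \<nu>))"
    by linarith
  then have "integral {-X..X} (\<lambda>x. density x t) \<le>
      exp (c1 * s) * (K\<^sup>2 * m1 * (integral {-K..K} (\<lambda>x. density x 0) + integral {0..s} \<nu>)) / m0"
    using m0 by (simp add: field_simps)
  then show ?thesis
    unfolding c1_def[symmetric] m0_def[symmetric] m1_def[symmetric] \<nu>_def[symmetric]
    by (simp add: mult_ac)
qed

end

section \<open>The dual transmission problem\<close>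

text \<open>For y < 0 the interval is empty and the integral is 0, which is the correct primitive
  because \<open>f\<close> vanishes there. A base point to the left of both 0 and y gives one
  formula on a neighbourhood of y.\<close>

lemma primitive_from_0_deriv:
  fixes f :: "real \<Rightarrow> 'b::banach"
  assumes f: "continuous_on UNIV f" and 0: "\<And>y. y \<le> 0 \<Longrightarrow> f y = 0"
  shows "((\<lambda>y. integral {0..y} f) has_vector_derivative f y) (at y)"
proof -
  define m where "m = min 0 y - 1"
  have int: "f integrable_on {p..q}" for p q
    by (intro integrable_continuous_real continuous_on_subset[OF f]) auto
  have z: "integral {p..q} f = 0" if "q \<le> 0" for p q
  proof -
    have "integral {p..q} f = integral {p..q} (\<lambda>_. 0)"
      by (rule integral_cong) (use that 0 in auto)
    then show ?thesis by simp
  qed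
  have eq: "integral {0..u} f = integral {m..u} f" for u
  proof (cases "u \<ge> 0")
    case True
    have "integral {m..0} f + integral {0..u} f = integral {m..u} f"
      by (rule Henstock_Kurzweil_Integration.integral_combine) (use True int in \<open>auto simp: m_def\<close>)
    then show ?thesis using z[of 0 m] by simp
  next
    case False
    then show ?thesis using z[of u 0] z[of u m] by simp
  qed
  have "((\<lambda>u. integral {m..u} f) has_vector_derivative f y) (at y within {m..y + 1})"
    by (rule integral_has_vector_derivative[OF continuous_on_subset[OF f]]) (auto simp: m_def)
  moreover have "at y within {m..y + 1} = at y"
    by (rule at_within_Icc_at) (auto simp: m_def)
  ultimately show ?thesis by (simp add: eq)
qed

lemma continuous_on_UNIV_compose:
  "continuous_on UNIV f \<Longrightarrow> continuous_on S g \<Longrightarrow> continuous_on S (\<lambda>x. f (g x))"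
  by (rule continuous_on_compose2[of UNIV f S g]) auto

lemma has_vector_derivative_scaleR_const:
  "(f has_vector_derivative d) F \<Longrightarrow> ((\<lambda>x. c *\<^sub>R f x) has_vector_derivative c *\<^sub>R d) F"
  by (rule bounded_linear.has_vector_derivative[OF bounded_linear_scaleR_right])

lemma has_vector_derivative_affine:
  fixes f :: "real \<Rightarrow> 'b::real_normed_vector"
  assumes "(f has_vector_derivative d) (at (k * x + q))"
  shows "((\<lambda>x. f (k * x + q)) has_vector_derivative k *\<^sub>R d) (at x)"
proof -
  have "((\<lambda>x. k * x + q) has_vector_derivative k) (at x)"
    by (auto intro!: derivative_eq_intros simp: has_real_derivative_iff_has_vector_derivative[symmetric])
  from vector_diff_chain_at[OF this assms] show ?thesis by (simp add: o_def)
qed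

text \<open>Each side is parametrised by the distance x >= 0 to the interface, and
  \<open>- e\<close> is the side opposite to \<open>e\<close>. \<open>G e\<close> is C1 on the whole
  line and 0 for x <= 0, so it joins 0 smoothly at the interface; this is what makes the reflected
  and transmitted waves C1 and the dual solution C2.\<close>

locale transmission_dual =
  fixes A B :: "real \<Rightarrow> real" and G G' :: "real \<Rightarrow> real \<Rightarrow> complex" and X :: real
  assumes pos: "\<And>e. A e > 0" "\<And>e. B e > 0"
    and G_deriv: "\<And>e x. (G e has_vector_derivative G' e x) (at x)"
    and G'_cont: "\<And>e. continuous_on UNIV (G' e)"
    and G_zero: "\<And>e x. x \<le> 0 \<or> x \<ge> X \<Longrightarrow> G e x = 0" and X: "X \<ge> 0"
begin

definition "speed e = sqrt (B e / A e)"
definition "impedance e = sqrt (A e * B e)"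
text \<open>The classical coefficients for a wave on side \<open>e\<close>. They are determined by 1
  + reflection e = transmission (- e), which gives continuity, and 1 - reflection e = transmission
  e, which gives balance of the fluxes.\<close>

definition "reflection e = (impedance e - impedance (- e)) / (impedance e + impedance (- e))"
definition "transmission e = 2 * impedance (- e) / (impedance e + impedance (- e))"
text \<open>The velocity datum G / A as a function of the travel time y = x / speed. In this
  variable waves move with speed 1 on both sides and reach the interface with the same
  argument.\<close>

definition "h e y = (1 / A e) *\<^sub>R G e (speed e * y)"
definition "h' e y = (speed e / A e) *\<^sub>R G' e (speed e * y)"
definition "H e y = integral {0..y} (h e)"
text \<open>Method of images: the values for negative y are chosen so that d'Alembert's formula on
  the line produces the wave reflected on side \<open>e\<close> and the wave arriving from the other
  side. \<open>P\<close> is a primitive of \<open>\<gamma>\<close>, and \<open>\<zeta>\<close> is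
  d'Alembert's formula with zero displacement and velocity \<open>\<gamma>\<close>.\<close>

definition "\<gamma> e y = h e y + reflection e *\<^sub>R h e (- y) + transmission e *\<^sub>R h (- e) (- y)"
definition "\<gamma>' e y = h' e y - reflection e *\<^sub>R h' e (- y) - transmission e *\<^sub>R h' (- e) (- y)"
definition "P e y = H e y - reflection e *\<^sub>R H e (- y) - transmission e *\<^sub>R H (- e) (- y)"
definition "\<zeta> e x \<tau> = (1 / 2) *\<^sub>R (P e (x / speed e + \<tau>) - P e (x / speed e - \<tau>))"
definition "\<zeta>x e x \<tau> = (1 / (2 * speed e)) *\<^sub>R (\<gamma> e (x / speed e + \<tau>) - \<gamma> e (x / speed e - \<tau>))"
definition "\<zeta>t e x \<tau> = (1 / 2) *\<^sub>R (\<gamma> e (x / speed e + \<tau>) + \<gamma> e (x / speed e - \<tau>))"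
definition "\<zeta>xx e x \<tau> = (1 / (2 * (speed e)\<^sup>2)) *\<^sub>R (\<gamma>' e (x / speed e + \<tau>) - \<gamma>' e (x / speed e - \<tau>))"
definition "\<zeta>tt e x \<tau> = (1 / 2) *\<^sub>R (\<gamma>' e (x / speed e + \<tau>) - \<gamma>' e (x / speed e - \<tau>))"
text \<open>The sum of the two speeds bounds each of them, so that one radius serves both
  sides.\<close>

definition "range_at S = X + (speed 1 + speed (- 1)) * S"

lemma speed_pos: "speed e > 0" and impedance_pos: "impedance e > 0"
  using pos by (simp_all add: speed_def impedance_def)

lemma speed_sq: "(speed e)\<^sup>2 = B e / A e"
  using pos[of e] by (simp add: speed_def less_imp_le)

lemma impedance_speed: "B e / speed e = impedance e"
proof -
  have "impedance e * speed e = sqrt ((A e * B e) * (B e / A e))"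
    by (simp add: impedance_def speed_def real_sqrt_mult[symmetric])
  also have "(A e * B e) * (B e / A e) = (B e)\<^sup>2"
    using pos(1)[of e] by (simp add: power2_eq_square)
  finally have "impedance e * speed e = B e" using pos(2)[of e] by simp
  then show ?thesis using speed_pos[of e] by (simp add: field_simps)
qed

lemma G_cont: "continuous_on UNIV (G e)"
  using G_deriv by (auto intro!: continuous_at_imp_continuous_on has_vector_derivative_continuous)

lemma h_zero: "y \<le> 0 \<Longrightarrow> h e y = 0" "speed e * y \<ge> X \<Longrightarrow> h e y = 0"
proof -
  show "y \<le> 0 \<Longrightarrow> h e y = 0"
    using speed_pos[of e] by (simp add: h_def G_zero mult_nonneg_nonpos)
  show "speed e * y \<ge> X \<Longrightarrow> h e y = 0"
    by (simp add: h_def G_zero)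
qed

lemma h_cont: "continuous_on UNIV (h e)" and h'_cont: "continuous_on UNIV (h' e)"
  unfolding h_def[abs_def] h'_def[abs_def]
  by (intro continuous_intros continuous_on_UNIV_compose[OF G_cont] continuous_on_UNIV_compose[OF G'_cont])+

lemma h_deriv: "(h e has_vector_derivative h' e y) (at y)"
proof -
  have "((\<lambda>y. G e (speed e * y + 0)) has_vector_derivative speed e *\<^sub>R G' e (speed e * y + 0)) (at y)"
    by (rule has_vector_derivative_affine[OF G_deriv])
  from has_vector_derivative_scaleR_const[OF this, of "1 / A e"] show ?thesis
    by (simp add: h_def[abs_def] h'_def)
qed

lemma H_zero: "y \<le> 0 \<Longrightarrow> H e y = 0"
  unfolding H_def by (cases "y = 0") auto

lemma H_deriv: "(H e has_vector_derivative h e y) (at y)"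
  unfolding H_def[abs_def] by (rule primitive_from_0_deriv[OF h_cont h_zero(1)])

lemma uminus_deriv:
  fixes f :: "real \<Rightarrow> 'b::real_normed_vector"
  assumes "(f has_vector_derivative d) (at (- y))"
  shows "((\<lambda>y. f (- y)) has_vector_derivative - d) (at y)"
  using has_vector_derivative_affine[of f d "-1" y 0] assms by simp

lemma \<gamma>_deriv: "(\<gamma> e has_vector_derivative \<gamma>' e y) (at y)"
proof -
  have "((\<lambda>y. h e y + reflection e *\<^sub>R h e (- y) + transmission e *\<^sub>R h (- e) (- y)) has_vector_derivative
      (h' e y + reflection e *\<^sub>R (- h' e (- y)) + transmission e *\<^sub>R (- h' (- e) (- y)))) (at y)"
    by (intro has_vector_derivative_add has_vector_derivative_scaleR_const uminus_deriv h_deriv)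
  then show ?thesis by (simp add: \<gamma>_def[abs_def] \<gamma>'_def)
qed

lemma P_deriv: "(P e has_vector_derivative \<gamma> e y) (at y)"
proof -
  have "((\<lambda>y. H e y - reflection e *\<^sub>R H e (- y) - transmission e *\<^sub>R H (- e) (- y)) has_vector_derivative
      (h e y - reflection e *\<^sub>R (- h e (- y)) - transmission e *\<^sub>R (- h (- e) (- y)))) (at y)"
    by (intro has_vector_derivative_diff has_vector_derivative_scaleR_const uminus_deriv h_deriv H_deriv)
  then show ?thesis by (simp add: P_def[abs_def] \<gamma>_def)
qed

lemma \<gamma>_cont: "continuous_on UNIV (\<gamma> e)" and P_cont: "continuous_on UNIV (P e)"
  using \<gamma>_deriv P_deriv by (auto intro!: continuous_at_imp_continuous_on has_vector_derivative_continuous)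

lemma \<gamma>'_cont: "continuous_on UNIV (\<gamma>' e)"
  unfolding \<gamma>'_def[abs_def]
  by (intro continuous_intros continuous_on_UNIV_compose[OF h'_cont])

lemma continuous2_dual:
  "continuous2 S (\<zeta> e)" "continuous2 S (\<zeta>x e)" "continuous2 S (\<zeta>t e)" "continuous2 S (\<zeta>xx e)" "continuous2 S (\<zeta>tt e)"
  using speed_pos[of e]
  unfolding \<zeta>_def \<zeta>x_def \<zeta>t_def \<zeta>xx_def \<zeta>tt_def
  by (intro continuous_intros continuous_on_UNIV_compose[OF \<gamma>_cont] continuous_on_UNIV_compose[OF P_cont]
      continuous_on_UNIV_compose[OF \<gamma>'_cont]; simp)+

lemma along_x:
  assumes "\<And>y. (f has_vector_derivative f' y) (at y)"
  shows "((\<lambda>x. f (x / speed e + \<tau>)) has_vector_derivative (1 / speed e) *\<^sub>R f' (x / speed e + \<tau>)) (at x)"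
  using has_vector_derivative_affine[of f "f' (x / speed e + \<tau>)" "1 / speed e" x \<tau>] assms by simp

lemma along_x':
  assumes "\<And>y. (f has_vector_derivative f' y) (at y)"
  shows "((\<lambda>x. f (x / speed e - \<tau>)) has_vector_derivative (1 / speed e) *\<^sub>R f' (x / speed e - \<tau>)) (at x)"
  using has_vector_derivative_affine[of f "f' (x / speed e - \<tau>)" "1 / speed e" x "- \<tau>"] assms by simp

lemma along_t:
  assumes "\<And>y. (f has_vector_derivative f' y) (at y)"
  shows "((\<lambda>t. f (q + t)) has_vector_derivative f' (q + t)) (at t)"
  using has_vector_derivative_affine[of f "f' (q + t)" 1 t q] assms by (simp add: add.commute)

lemma along_t':
  assumes "\<And>y. (f has_vector_derivative f' y) (at y)"
  shows "((\<lambda>t. f (q - t)) has_vector_derivative - f' (q - t)) (at t)"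
  using has_vector_derivative_affine[of f "f' (q - t)" "-1" t q] assms by simp

lemma dual_x: "((\<lambda>x. \<zeta> e x \<tau>) has_vector_derivative \<zeta>x e x \<tau>) (at x)"
proof -
  have "((\<lambda>x. \<zeta> e x \<tau>) has_vector_derivative (1 / 2) *\<^sub>R
      ((1 / speed e) *\<^sub>R \<gamma> e (x / speed e + \<tau>) - (1 / speed e) *\<^sub>R \<gamma> e (x / speed e - \<tau>))) (at x)"
    unfolding \<zeta>_def by (intro has_vector_derivative_scaleR_const has_vector_derivative_diff along_x along_x' P_deriv)
  then show ?thesis by (simp add: \<zeta>x_def scaleR_diff_right)
qed

lemma dual_t: "((\<lambda>\<tau>. \<zeta> e x \<tau>) has_vector_derivative \<zeta>t e x \<tau>) (at \<tau>)"
proof -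
  have "((\<lambda>\<tau>. \<zeta> e x \<tau>) has_vector_derivative (1 / 2) *\<^sub>R
      (\<gamma> e (x / speed e + \<tau>) - - \<gamma> e (x / speed e - \<tau>))) (at \<tau>)"
    unfolding \<zeta>_def by (intro has_vector_derivative_scaleR_const has_vector_derivative_diff along_t along_t' P_deriv)
  then show ?thesis by (simp add: \<zeta>t_def)
qed

lemma dual_xx: "((\<lambda>x. \<zeta>x e x \<tau>) has_vector_derivative \<zeta>xx e x \<tau>) (at x)"
proof -
  have "((\<lambda>x. \<zeta>x e x \<tau>) has_vector_derivative (1 / (2 * speed e)) *\<^sub>R
      ((1 / speed e) *\<^sub>R \<gamma>' e (x / speed e + \<tau>) - (1 / speed e) *\<^sub>R \<gamma>' e (x / speed e - \<tau>))) (at x)"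
    unfolding \<zeta>x_def by (intro has_vector_derivative_scaleR_const has_vector_derivative_diff along_x along_x' \<gamma>_deriv)
  then show ?thesis by (simp add: \<zeta>xx_def scaleR_diff_right power2_eq_square mult.assoc)
qed

lemma dual_tt: "((\<lambda>\<tau>. \<zeta>t e x \<tau>) has_vector_derivative \<zeta>tt e x \<tau>) (at \<tau>)"
proof -
  have "((\<lambda>\<tau>. \<zeta>t e x \<tau>) has_vector_derivative (1 / 2) *\<^sub>R
      (\<gamma>' e (x / speed e + \<tau>) + - \<gamma>' e (x / speed e - \<tau>))) (at \<tau>)"
    unfolding \<zeta>t_def by (intro has_vector_derivative_scaleR_const has_vector_derivative_add along_t along_t' \<gamma>_deriv)
  then show ?thesis by (simp add: \<zeta>tt_def)
qed

lemma dual_equation: "A e *\<^sub>R \<zeta>tt e x \<tau> = B e *\<^sub>R \<zeta>xx e x \<tau>"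
  using pos[of e] by (simp add: \<zeta>tt_def \<zeta>xx_def speed_sq)

text \<open>For x >= 0 the two image terms are evaluated at nonpositive arguments and vanish,
  leaving the given datum.\<close>

lemma dual_initial: "\<zeta> e x 0 = 0" "x \<ge> 0 \<Longrightarrow> A e *\<^sub>R \<zeta>t e x 0 = G e x"
proof -
  show "\<zeta> e x 0 = 0" by (simp add: \<zeta>_def)
  assume x: "x \<ge> 0"
  then have "x / speed e \<ge> 0" using speed_pos[of e] by simp
  then have "\<zeta>t e x 0 = h e (x / speed e)"
    by (simp add: \<zeta>t_def \<gamma>_def h_zero scaleR_add_left[symmetric])
  then show "A e *\<^sub>R \<zeta>t e x 0 = G e x"
    using pos(1)[of e] speed_pos[of e] by (simp add: h_def)
qed

text \<open>At x = 0 the terms with negative argument vanish. What remains on side \<open>f\<close>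
  has the coefficients 1 + reflection f on its own datum and transmission f on the opposite one, and
  these are interchanged when the sides are.\<close>

lemma dual_continuous_at_interface:
  assumes \<tau>: "\<tau> \<ge> 0"
  shows "\<zeta> e 0 \<tau> = \<zeta> (- e) 0 \<tau>"
proof -
  define s where "s = impedance e + impedance (- e)"
  have s: "s > 0" using impedance_pos[of e] impedance_pos[of "- e"] by (simp add: s_def)
  have "\<zeta> f 0 \<tau> = (1 / 2) *\<^sub>R ((1 + reflection f) *\<^sub>R H f \<tau> + transmission f *\<^sub>R H (- f) \<tau>)" for f
    using \<tau> by (simp add: \<zeta>_def P_def H_zero scaleR_add_left)
  moreover have "1 + reflection e = 2 * impedance e / s" "transmission e = 2 * impedance (- e) / s"
    "1 + reflection (- e) = 2 * impedance (- e) / s" "transmission (- e) = 2 * impedance e / s"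
    using s by (simp_all add: reflection_def transmission_def s_def field_simps)
  ultimately show ?thesis by (simp add: add.commute)
qed

text \<open>Both coordinates point away from the interface, so continuity of the flux is a vanishing
  sum. Here it comes from 1 - reflection e = transmission e, with impedance = B / speed converting
  derivatives into fluxes.\<close>

lemma dual_flux_at_interface:
  assumes \<tau>: "\<tau> \<ge> 0"
  shows "B e *\<^sub>R \<zeta>x e 0 \<tau> + B (- e) *\<^sub>R \<zeta>x (- e) 0 \<tau> = 0"
proof -
  define s where "s = impedance e + impedance (- e)"
  have s: "s > 0" using impedance_pos[of e] impedance_pos[of "- e"] by (simp add: s_def)
  have "B f *\<^sub>R \<zeta>x f 0 \<tau> = (impedance f / 2) *\<^sub>R ((1 - reflection f) *\<^sub>R h f \<tau> - transmission f *\<^sub>R h (- f) \<tau>)" for f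
    using \<tau> speed_pos[of f] by (simp add: \<zeta>x_def \<gamma>_def h_zero scaleR_diff_left impedance_speed[symmetric] diff_diff_eq mult.commute)
  moreover have "1 - reflection e = 2 * impedance (- e) / s" "transmission e = 2 * impedance (- e) / s"
    "1 - reflection (- e) = 2 * impedance e / s" "transmission (- e) = 2 * impedance e / s"
    using s by (simp_all add: reflection_def transmission_def s_def field_simps)
  ultimately show ?thesis by (simp add: scaleR_diff_right mult.commute)
qed

lemma speed_le: "S \<ge> 0 \<Longrightarrow> e \<in> {1, -1} \<Longrightarrow> speed e * S \<le> (speed 1 + speed (- 1)) * S"
  using speed_pos[of 1] speed_pos[of "-1"] by (auto simp: distrib_right)

text \<open>Finite speed of propagation: every y >= x / speed - \<tau> is nonnegative and beyond the
  support of the datum, so \<open>\<gamma>\<close> vanishes there.\<close>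

lemma dual_support:
  assumes "e \<in> {1, -1}" "\<tau> \<in> {0..S}" "x \<ge> range_at S"
  shows "\<zeta> e x \<tau> = 0" "\<zeta>x e x \<tau> = 0" "\<zeta>t e x \<tau> = 0"
proof -
  have "speed e * \<tau> \<le> speed e * S" using assms speed_pos[of e] by simp
  also have "\<dots> \<le> (speed 1 + speed (- 1)) * S" using assms by (intro speed_le) auto
  finally have x: "x \<ge> X + speed e * \<tau>" using assms by (simp add: range_at_def)
  have far: "speed e * y \<ge> X" "y \<ge> 0" if "y \<ge> x / speed e - \<tau>" for y
  proof -
    have "speed e * y \<ge> speed e * (x / speed e - \<tau>)" using that speed_pos[of e] by simp
    also have "speed e * (x / speed e - \<tau>) = x - speed e * \<tau>"
      using speed_pos[of e] by (simp add: right_diff_distrib)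
    finally show 1: "speed e * y \<ge> X" using x by linarith
    show "y \<ge> 0"
      using 1 X speed_pos[of e] by (metis order.trans zero_le_mult_iff not_less)
  qed
  have h0: "h e y = 0" if "y \<ge> x / speed e - \<tau>" for y
    by (rule h_zero(2)[OF far(1)[OF that]])
  have \<gamma>0: "\<gamma> e y = 0" if "y \<ge> x / speed e - \<tau>" for y
    using far(2)[OF that] by (simp add: \<gamma>_def h0[OF that] h_zero(1))
  have \<tau>: "x / speed e - \<tau> \<le> x / speed e + \<tau>" using assms by simp
  show "\<zeta>x e x \<tau> = 0" "\<zeta>t e x \<tau> = 0"
    using \<gamma>0[OF order_refl] \<gamma>0[OF \<tau>] by (simp_all add: \<zeta>x_def \<zeta>t_def)
  \<comment> \<open>On this interval \<open>P\<close> is constant but not necessarily 0, so its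
    increment is computed by integrating \<open>\<gamma>\<close>.\<close>
  have "(\<gamma> e has_integral P e (x / speed e + \<tau>) - P e (x / speed e - \<tau>)) {x / speed e - \<tau>..x / speed e + \<tau>}"
    by (rule fundamental_theorem_of_calculus[OF \<tau>]) (rule has_vector_derivative_at_within[OF P_deriv])
  moreover have "(\<gamma> e has_integral 0) {x / speed e - \<tau>..x / speed e + \<tau>}"
    by (rule has_integral_is_0) (simp add: \<gamma>0)
  ultimately have "P e (x / speed e + \<tau>) - P e (x / speed e - \<tau>) = 0"
    by (rule has_integral_unique)
  then show "\<zeta> e x \<tau> = 0" by (simp add: \<zeta>_def)
qed

lemma range_at_ge: "S \<ge> 0 \<Longrightarrow> range_at S \<ge> X"
  using speed_pos[of 1] speed_pos[of "-1"] by (simp add: range_at_def)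

end

section \<open>Continuous solutions on a quadrant\<close>

text \<open>The shift keeps the closed support away from \<open>0\<close>.\<close>

definition scaled_bump :: "real \<Rightarrow> nat \<Rightarrow> real \<Rightarrow> real" where
  "scaled_bump m i y = (2 * m) ^ Suc i * bump i (2 * m * y - 1)"

lemma scaled_bump_deriv_seq: "deriv_seq (scaled_bump m)"
  unfolding deriv_seq_def
proof safe
  fix i y
  have "((\<lambda>y. 2 * m * y - 1) has_real_derivative 2 * m) (at y)"
    by (auto intro!: derivative_eq_intros)
  from DERIV_cmult[OF DERIV_chain2[OF deriv_seqD[OF bump(1)] this], of "(2 * m) ^ Suc i" i]
  show "(scaled_bump m i has_real_derivative scaled_bump m (Suc i) y) (at y)"
    by (simp add: scaled_bump_def[abs_def] mult_ac)
qed

lemma scaled_bump_cont: "continuous_on UNIV (scaled_bump m i)"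
  by (rule deriv_seq_continuous[OF scaled_bump_deriv_seq])

lemma scaled_bump_nonneg: "m > 0 \<Longrightarrow> scaled_bump m 0 y \<ge> 0"
  by (simp add: scaled_bump_def bump(2))

lemma scaled_bump_zero':
  assumes "m > 0" "y \<le> 1 / (2 * m) \<or> y \<ge> 1 / m"
  shows "scaled_bump m i y = 0"
proof -
  have "2 * m * y - 1 \<notin> {0<..<1}"
    using assms by (auto simp: field_simps)
  then show ?thesis by (simp add: scaled_bump_def bump(3))
qed

lemma scaled_bump_zero:
  assumes "m > 0" "y \<le> 0 \<or> y \<ge> 1 / m"
  shows "scaled_bump m i y = 0"
proof (rule scaled_bump_zero'[OF assms(1)])
  have "1 / (2 * m) \<ge> 0" using assms(1) by simp
  then show "y \<le> 1 / (2 * m) \<or> y \<ge> 1 / m" using assms(2) by linarith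
qed

lemma scaled_bump_integral:
  assumes m: "m \<ge> 1" and x: "p \<le> x" "x + 1 \<le> q"
  shows "((\<lambda>y. scaled_bump m 0 (y - x)) has_integral 1) {p..q}"
proof -
  have "((\<lambda>y. scaled_bump m 0 (y - x)) has_integral
      smooth_step 0 (2 * m * (q - x) - 1) - smooth_step 0 (2 * m * (p - x) - 1)) {p..q}"
  proof (rule fundamental_theorem_of_calculus)
    fix y
    have "((\<lambda>y. 2 * m * (y - x) - 1) has_real_derivative 2 * m) (at y)"
      by (auto intro!: derivative_eq_intros)
    from DERIV_chain2[OF deriv_seqD[OF smooth_step_deriv_seq] this, of 0]
    have "((\<lambda>y. smooth_step 0 (2 * m * (y - x) - 1)) has_real_derivative scaled_bump m 0 (y - x)) (at y)"
      by (simp add: scaled_bump_def smooth_step_def mult_ac)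
    then show "((\<lambda>y. smooth_step 0 (2 * m * (y - x) - 1)) has_vector_derivative scaled_bump m 0 (y - x)) (at y within {p..q})"
      by (simp add: has_real_derivative_iff_has_vector_derivative has_vector_derivative_at_within)
  qed (use x in simp)
  moreover have "m * (q - x) \<ge> 1"
    using mult_mono[of 1 m 1 "q - x"] m x by simp
  moreover have "m * (p - x) \<le> 0" using m x by (simp add: mult_nonneg_nonpos)
  ultimately show ?thesis by (simp add: smooth_step_0)
qed

text \<open>\<open>i\<close> and \<open>j\<close> count derivatives falling on the kernel. The
  kernel at (x,t) lives at distances between 1/(2m) and 1/m to the right of x and after t; hence
  (x,t) may lie on the boundary of the quadrant although only interior values are averaged.
  \<open>D\<close> merely has to exceed x and t by 1.\<close>

definition mollified :: "real \<Rightarrow> (real \<Rightarrow> real \<Rightarrow> complex) \<Rightarrow> real \<Rightarrow> nat \<Rightarrow> nat \<Rightarrow> real \<Rightarrow> real \<Rightarrow> complex" where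
  "mollified D F m i j x t = integral (cbox (0, 0) (D, D))
     (\<lambda>z. (scaled_bump m i (fst z - x) * scaled_bump m j (snd z - t)) *\<^sub>R F (fst z) (snd z))"

lemma kernel_cont:
  assumes "continuous_on S f" "continuous_on S g" "continuous_on S h" "continuous_on S k"
  shows "continuous_on S (\<lambda>z. scaled_bump m i (f z - g z) * scaled_bump m j (h z - k z))"
  by (intro continuous_intros continuous_on_UNIV_compose[OF scaled_bump_cont] assms)

lemma kernel_integral:
  assumes m: "m \<ge> 1" and x: "0 \<le> x" "x + 1 \<le> D" and t: "0 \<le> t" "t + 1 \<le> D"
  shows "integral (cbox (0, 0) (D, D)) (\<lambda>z. scaled_bump m 0 (fst z - x) * scaled_bump m 0 (snd z - t)) = 1"
proof -
  have "integral (cbox (0, 0) (D, D)) (\<lambda>z. scaled_bump m 0 (fst z - x) * scaled_bump m 0 (snd z - t))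
    = integral (cbox 0 D) (\<lambda>y. integral (cbox 0 D) (\<lambda>u. scaled_bump m 0 (y - x) * scaled_bump m 0 (u - t)))"
    using integral_prod_continuous[OF kernel_cont[OF continuous_on_fst[OF continuous_on_id] continuous_on_const
          continuous_on_snd[OF continuous_on_id] continuous_on_const], where a = 0 and b = D and c = 0 and d = D]
    by simp
  also have "\<dots> = 1"
    using scaled_bump_integral[OF m x] scaled_bump_integral[OF m t] by (simp add: integral_unique)
  finally show ?thesis .
qed

lemma box_eq: "cbox (0::real, 0::real) (D, D) = {0..D} \<times> {0..D}"
  by (auto simp: cbox_Pair_eq)

text \<open>The mollification is a weighted mean of values of \<open>F\<close> at distance at most
  2/m from (x,t), and \<open>F\<close> is uniformly continuous on the closed square; m >= 2/d brings
  this distance below its modulus d.\<close>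

lemma mollified_limit:
  assumes F: "continuous2 ({0..D} \<times> {0..D}) F" and \<eta>: "\<eta> > 0"
  shows "\<exists>m0\<ge>1. \<forall>m\<ge>m0. \<forall>x t. 0 \<le> x \<and> x + 1 \<le> D \<and> 0 \<le> t \<and> t + 1 \<le> D \<longrightarrow>
    norm (mollified D F m 0 0 x t - F x t) \<le> \<eta>"
proof -
  have "uniformly_continuous_on ({0..D} \<times> {0..D}) (\<lambda>z. F (fst z) (snd z))"
    by (rule compact_uniformly_continuous[OF F]) (intro compact_Times compact_Icc)
  then obtain d where d: "d > 0" "\<And>z z'. z \<in> {0..D} \<times> {0..D} \<Longrightarrow> z' \<in> {0..D} \<times> {0..D} \<Longrightarrow> dist z' z < d \<Longrightarrow>
      dist (F (fst z') (snd z')) (F (fst z) (snd z)) < \<eta>"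
    unfolding uniformly_continuous_on_def using \<eta> by metis
  have "norm (mollified D F m 0 0 x t - F x t) \<le> \<eta>"
    if m': "m \<ge> max 1 (2 / d)" and x: "0 \<le> x" "x + 1 \<le> D" and t: "0 \<le> t" "t + 1 \<le> D" for m x t
  proof -
    have m: "m \<ge> 1" "m \<ge> 2 / d" using m' by simp_all
    have md: "1 / m + 1 / m \<le> d" using m d(1) by (simp add: field_simps)
    let ?k = "\<lambda>z. scaled_bump m 0 (fst z - x) * scaled_bump m 0 (snd z - t)"
    have k_cont: "continuous_on (cbox (0, 0) (D, D)) ?k"
      by (intro kernel_cont continuous_intros)
    have F': "continuous_on (cbox (0, 0) (D, D)) (\<lambda>z. F (fst z) (snd z))"
      using F by (simp add: box_eq)
    have k: "(?k has_integral 1) (cbox (0, 0) (D, D))"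
      using integrable_integral[OF integrable_continuous[OF k_cont]] kernel_integral[OF m(1) x t] by simp
    have a: "((\<lambda>z. ?k z *\<^sub>R F (fst z) (snd z)) has_integral mollified D F m 0 0 x t) (cbox (0, 0) (D, D))"
      unfolding mollified_def by (intro integrable_integral integrable_continuous continuous_intros k_cont F')
    have b: "((\<lambda>z. ?k z *\<^sub>R F x t) has_integral 1 *\<^sub>R F x t) (cbox (0, 0) (D, D))"
      by (rule has_integral_scaleR_left[OF k])
    have diff: "((\<lambda>z. ?k z *\<^sub>R F (fst z) (snd z) - ?k z *\<^sub>R F x t) has_integral mollified D F m 0 0 x t - 1 *\<^sub>R F x t) (cbox (0, 0) (D, D))"
      by (rule has_integral_diff[OF a b])
    have c: "((\<lambda>z. ?k z * \<eta>) has_integral 1 * \<eta>) (cbox (0, 0) (D, D))"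
      by (rule has_integral_mult_left[OF k])
    have "norm (mollified D F m 0 0 x t - 1 *\<^sub>R F x t) \<le> 1 * \<eta>"
      unfolding integral_unique[OF diff, symmetric] integral_unique[OF c, symmetric]
    proof (rule integral_norm_bound_integral)
      fix z :: "real \<times> real" assume z: "z \<in> cbox (0, 0) (D, D)"
      have nn: "?k z \<ge> 0" using m by (simp add: scaled_bump_nonneg)
      show "norm (?k z *\<^sub>R F (fst z) (snd z) - ?k z *\<^sub>R F x t) \<le> ?k z * \<eta>"
      proof (cases "?k z = 0")
        case False
        then have "0 < fst z - x" "fst z - x < 1 / m" "0 < snd z - t" "snd z - t < 1 / m"
          using scaled_bump_zero[of m "fst z - x" 0] scaled_bump_zero[of m "snd z - t" 0] m by (auto simp: not_le[symmetric])
        then have "dist z (x, t) < d"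
          using sqrt_sum_squares_le_sum_abs[of "fst z - x" "snd z - t"] md
          by (cases z) (simp add: dist_Pair_Pair dist_real_def)
        then have "dist (F (fst z) (snd z)) (F x t) < \<eta>"
          using d(2)[of "(x, t)" z] z x t by (simp add: box_eq)
        then have "norm (F (fst z) (snd z) - F x t) \<le> \<eta>" by (simp add: dist_norm)
        with nn show ?thesis
          by (simp only: scaleR_diff_right[symmetric] norm_scaleR abs_of_nonneg mult_left_mono)
      next
        case True
        then show ?thesis
          by (simp only: scaleR_zero_left diff_self norm_zero mult_zero_left order.refl)
      qed
    qed (use diff c in \<open>auto simp: integrable_on_def\<close>)
    then show ?thesis by simp
  qed
  then show ?thesis by (intro exI[of _ "max 1 (2 / d)"]) simp
qed

text \<open>The minus sign appears because the kernel depends on z - (x,t). Differentiating along an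
  arbitrary straight line covers the coordinate directions and the characteristics at once.\<close>

lemma mollified_deriv:
  assumes F: "continuous2 ({0..D} \<times> {0..D}) F"
  shows "((\<lambda>\<sigma>. mollified D F m i j (x + k * \<sigma>) (t + l * \<sigma>)) has_vector_derivative
     - (k *\<^sub>R mollified D F m (Suc i) j (x + k * \<sigma>) (t + l * \<sigma>) + l *\<^sub>R mollified D F m i (Suc j) (x + k * \<sigma>) (t + l * \<sigma>))) (at \<sigma>)"
proof -
  let ?C = "cbox (0::real, 0::real) (D, D)"
  have F': "continuous_on ?C (\<lambda>z. F (fst z) (snd z))"
    using F by (simp add: box_eq)
  define d where "d = (\<lambda>\<sigma> z. - ((k * (scaled_bump m (Suc i) (fst z - (x + k * \<sigma>)) * scaled_bump m j (snd z - (t + l * \<sigma>)))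
       + l * (scaled_bump m i (fst z - (x + k * \<sigma>)) * scaled_bump m (Suc j) (snd z - (t + l * \<sigma>)))) *\<^sub>R F (fst z) (snd z)))"
  have "((\<lambda>\<sigma>. integral ?C (\<lambda>z. (scaled_bump m i (fst z - (x + k * \<sigma>)) * scaled_bump m j (snd z - (t + l * \<sigma>))) *\<^sub>R F (fst z) (snd z)))
      has_vector_derivative integral ?C (d \<sigma>)) (at \<sigma> within UNIV)"
  proof (rule leibniz_rule_vector_derivative)
    fix \<sigma> :: real and z :: "real \<times> real"
    have A: "((\<lambda>\<sigma>. scaled_bump m i (fst z - (x + k * \<sigma>))) has_real_derivative scaled_bump m (Suc i) (fst z - (x + k * \<sigma>)) * (- k)) (at \<sigma>)"
      by (rule DERIV_chain2[OF deriv_seqD[OF scaled_bump_deriv_seq]]) (auto intro!: derivative_eq_intros)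
    have B: "((\<lambda>\<sigma>. scaled_bump m j (snd z - (t + l * \<sigma>))) has_real_derivative scaled_bump m (Suc j) (snd z - (t + l * \<sigma>)) * (- l)) (at \<sigma>)"
      by (rule DERIV_chain2[OF deriv_seqD[OF scaled_bump_deriv_seq]]) (auto intro!: derivative_eq_intros)
    have "((\<lambda>\<sigma>. scaled_bump m i (fst z - (x + k * \<sigma>)) * scaled_bump m j (snd z - (t + l * \<sigma>))) has_vector_derivative
       - (k * (scaled_bump m (Suc i) (fst z - (x + k * \<sigma>)) * scaled_bump m j (snd z - (t + l * \<sigma>)))
       + l * (scaled_bump m i (fst z - (x + k * \<sigma>)) * scaled_bump m (Suc j) (snd z - (t + l * \<sigma>))))) (at \<sigma>)"
      using DERIV_mult[OF A B] by (simp add: has_real_derivative_iff_has_vector_derivative algebra_simps)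
    from bounded_linear.has_vector_derivative[OF bounded_linear_scaleR_left this, of "F (fst z) (snd z)"]
    show "((\<lambda>\<sigma>. (scaled_bump m i (fst z - (x + k * \<sigma>)) * scaled_bump m j (snd z - (t + l * \<sigma>))) *\<^sub>R F (fst z) (snd z))
        has_vector_derivative d \<sigma> z) (at \<sigma> within UNIV)"
      by (simp only: d_def scaleR_minus_left)
  next
    fix \<sigma> :: real
    show "(\<lambda>z. (scaled_bump m i (fst z - (x + k * \<sigma>)) * scaled_bump m j (snd z - (t + l * \<sigma>))) *\<^sub>R F (fst z) (snd z)) integrable_on ?C"
      by (intro integrable_continuous continuous_intros kernel_cont F')
  next
    have "continuous_on (UNIV \<times> ?C) (\<lambda>q. F (fst (snd q)) (snd (snd q)))"
      by (rule continuous_on_compose2[OF F']) (auto intro!: continuous_intros)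
    then show "continuous_on (UNIV \<times> ?C) (\<lambda>(\<sigma>, z). d \<sigma> z)"
      unfolding d_def case_prod_beta by (intro continuous_intros kernel_cont)
  qed auto
  moreover have "integral ?C (d \<sigma>) = - (k *\<^sub>R mollified D F m (Suc i) j (x + k * \<sigma>) (t + l * \<sigma>) + l *\<^sub>R mollified D F m i (Suc j) (x + k * \<sigma>) (t + l * \<sigma>))"
  proof -
    have D: "d \<sigma> = (\<lambda>z. - (k *\<^sub>R ((scaled_bump m (Suc i) (fst z - (x + k * \<sigma>)) * scaled_bump m j (snd z - (t + l * \<sigma>))) *\<^sub>R F (fst z) (snd z))
       + l *\<^sub>R ((scaled_bump m i (fst z - (x + k * \<sigma>)) * scaled_bump m (Suc j) (snd z - (t + l * \<sigma>))) *\<^sub>R F (fst z) (snd z))))"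
      by (simp add: d_def fun_eq_iff scaleR_add_left)
    have I: "(d' has_integral - (k *\<^sub>R mollified D F m (Suc i) j (x + k * \<sigma>) (t + l * \<sigma>) + l *\<^sub>R mollified D F m i (Suc j) (x + k * \<sigma>) (t + l * \<sigma>))) ?C"
      if "d' = (\<lambda>z. - (k *\<^sub>R ((scaled_bump m (Suc i) (fst z - (x + k * \<sigma>)) * scaled_bump m j (snd z - (t + l * \<sigma>))) *\<^sub>R F (fst z) (snd z))
       + l *\<^sub>R ((scaled_bump m i (fst z - (x + k * \<sigma>)) * scaled_bump m (Suc j) (snd z - (t + l * \<sigma>))) *\<^sub>R F (fst z) (snd z))))" for d'
      unfolding that mollified_def
      by (intro has_integral_neg has_integral_add has_integral_cmul integrable_integral integrable_continuous
          continuous_intros kernel_cont F')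
    show ?thesis by (rule integral_unique[OF I[OF D]])
  qed
  ultimately show ?thesis unfolding mollified_def by simp
qed

lemma zero_if_small:
  fixes d :: "'b::real_normed_vector"
  assumes "\<And>\<eta>. \<eta> > 0 \<Longrightarrow> norm d \<le> C * \<eta>"
  shows "d = 0"
proof -
  have C: "C \<ge> 0" using assms[of 1] norm_ge_zero[of d] by linarith
  have "norm d \<le> 0 + e" if "e > 0" for e
  proof -
    have "norm d \<le> C * (e / (C + 1))" using that C by (intro assms) simp
    also have "\<dots> \<le> e" using that C by (simp add: field_simps)
    finally show ?thesis by simp
  qed
  then have "norm d \<le> 0" by (rule field_le_epsilon)
  then show ?thesis by simp
qed

text \<open>The wave equation and p_t = v are required only after mollification: this is what
  testing the distributional equations with translated kernels provides. Derivatives on the kernel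
  change sign once each, hence the minus sign in \<open>velocity\<close> and none in
  \<open>wave\<close>.\<close>

locale quadrant_solution =
  fixes p v :: "real \<Rightarrow> real \<Rightarrow> complex" and c :: real
  assumes c: "c > 0"
    and p_cont: "continuous2 ({0..} \<times> {0..}) p" and v_cont: "continuous2 ({0..} \<times> {0..}) v"
    and wave: "\<And>D m x t. m \<ge> 1 \<Longrightarrow> 0 \<le> x \<Longrightarrow> x + 1 \<le> D \<Longrightarrow> 0 \<le> t \<Longrightarrow> t + 1 \<le> D \<Longrightarrow>
        mollified D p m 0 2 x t = c\<^sup>2 *\<^sub>R mollified D p m 2 0 x t"
    and velocity: "\<And>D m x t. m \<ge> 1 \<Longrightarrow> 0 \<le> x \<Longrightarrow> x + 1 \<le> D \<Longrightarrow> 0 \<le> t \<Longrightarrow> t + 1 \<le> D \<Longrightarrow>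
        mollified D p m 0 1 x t = - mollified D v m 0 0 x t"
begin

lemma p_box: "continuous2 ({0..D} \<times> {0..D}) p" and v_box: "continuous2 ({0..D} \<times> {0..D}) v"
  by (rule continuous_on_subset[OF p_cont], force) (rule continuous_on_subset[OF v_cont], force)

lemma p_line: "continuous_on {0..} (\<lambda>t. p x t)" and v_line: "continuous_on {0..} (\<lambda>t. v x t)" if "x \<ge> 0"
  using continuous2_slice_t[OF p_cont] continuous2_slice_t[OF v_cont] that by auto

lemma mollified_close:
  assumes \<eta>: "\<eta> > 0"
  shows "\<exists>m\<ge>1. (\<forall>x t. 0 \<le> x \<and> x + 1 \<le> D \<and> 0 \<le> t \<and> t + 1 \<le> D \<longrightarrow> norm (mollified D p m 0 0 x t - p x t) \<le> \<eta>)
     \<and> (\<forall>x t. 0 \<le> x \<and> x + 1 \<le> D \<and> 0 \<le> t \<and> t + 1 \<le> D \<longrightarrow> norm (mollified D v m 0 0 x t - v x t) \<le> \<eta>)"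
proof -
  obtain m1 where m1: "m1 \<ge> 1" "\<forall>m\<ge>m1. \<forall>x t. 0 \<le> x \<and> x + 1 \<le> D \<and> 0 \<le> t \<and> t + 1 \<le> D \<longrightarrow>
      norm (mollified D p m 0 0 x t - p x t) \<le> \<eta>"
    using mollified_limit[OF p_box \<eta>] by blast
  obtain m2 where m2: "m2 \<ge> 1" "\<forall>m\<ge>m2. \<forall>x t. 0 \<le> x \<and> x + 1 \<le> D \<and> 0 \<le> t \<and> t + 1 \<le> D \<longrightarrow>
      norm (mollified D v m 0 0 x t - v x t) \<le> \<eta>"
    using mollified_limit[OF v_box \<eta>] by blast
  show ?thesis
    by (rule exI[of _ "max m1 m2"]) (use m1 m2 in simp)
qed

lemma mollified_cont:
  assumes F: "continuous2 ({0..D} \<times> {0..D}) F"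
  shows "continuous_on S (\<lambda>\<sigma>. mollified D F m i j (x + k * \<sigma>) (t + l * \<sigma>))"
  by (rule continuous_at_imp_continuous_on, rule ballI, rule has_vector_derivative_continuous[OF mollified_deriv[OF F]])

lemma integral_close:
  fixes f g :: "real \<Rightarrow> complex"
  assumes "continuous_on {0..s} f" "continuous_on {0..s} g" "s \<ge> 0"
    and "\<And>\<sigma>. \<sigma> \<in> {0..s} \<Longrightarrow> norm (g \<sigma> - f \<sigma>) \<le> \<eta>"
  shows "norm (integral {0..s} g - integral {0..s} f) \<le> s * \<eta>"
proof -
  have "norm (integral {0..s} (\<lambda>\<sigma>. g \<sigma> - f \<sigma>)) \<le> integral {0..s} (\<lambda>_. \<eta>)"
    by (rule integral_norm_bound_integral)
      (use assms in \<open>auto intro!: integrable_continuous_real continuous_intros\<close>)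
  moreover have "integral {0..s} (\<lambda>\<sigma>. g \<sigma> - f \<sigma>) = integral {0..s} g - integral {0..s} f"
    by (intro Henstock_Kurzweil_Integration.integral_diff integrable_continuous_real assms)
  ultimately show ?thesis using assms(3) by simp
qed

text \<open>The fundamental theorem holds for the mollifications, whose t-derivative is the
  mollified \<open>v\<close>, and every term of it passes to the limit.\<close>

lemma velocity_integral:
  assumes x: "x \<ge> 0" and t: "t \<ge> 0"
  shows "integral {0..t} (\<lambda>\<sigma>. v x \<sigma>) = p x t - p x 0"
proof -
  define D where "D = x + t + 1"
  have "integral {0..t} (\<lambda>\<sigma>. v x \<sigma>) - (p x t - p x 0) = 0"
  proof (rule zero_if_small[where C = "t + 2"])
    fix \<eta> :: real assume \<eta>: "\<eta> > 0"
    obtain m where m: "m \<ge> 1"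
      and lp: "\<forall>x t. 0 \<le> x \<and> x + 1 \<le> D \<and> 0 \<le> t \<and> t + 1 \<le> D \<longrightarrow> norm (mollified D p m 0 0 x t - p x t) \<le> \<eta>"
      and lv: "\<forall>x t. 0 \<le> x \<and> x + 1 \<le> D \<and> 0 \<le> t \<and> t + 1 \<le> D \<longrightarrow> norm (mollified D v m 0 0 x t - v x t) \<le> \<eta>"
      using mollified_close[OF \<eta>] by blast
    have I: "((\<lambda>\<sigma>. mollified D v m 0 0 x \<sigma>) has_integral mollified D p m 0 0 x t - mollified D p m 0 0 x 0) {0..t}"
    proof (rule fundamental_theorem_of_calculus[OF t])
      fix \<sigma> assume \<sigma>: "\<sigma> \<in> {0..t}"
      have "((\<lambda>\<sigma>. mollified D p m 0 0 x \<sigma>) has_vector_derivative - mollified D p m 0 1 x \<sigma>) (at \<sigma>)"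
        using mollified_deriv[OF p_box, of D m 0 0 x 0 0 1 \<sigma>] by simp
      moreover have "- mollified D p m 0 1 x \<sigma> = mollified D v m 0 0 x \<sigma>"
        using velocity[OF m, of x D \<sigma>] x \<sigma> by (simp add: D_def)
      ultimately show "((\<lambda>\<sigma>. mollified D p m 0 0 x \<sigma>) has_vector_derivative mollified D v m 0 0 x \<sigma>) (at \<sigma> within {0..t})"
        by (simp add: has_vector_derivative_at_within)
    qed
    have cv: "continuous_on {0..t} (\<lambda>\<sigma>. v x \<sigma>)"
      by (rule continuous_on_subset[OF v_line[OF x]]) auto
    have cm: "continuous_on {0..t} (\<lambda>\<sigma>. mollified D v m 0 0 x \<sigma>)"
      using mollified_cont[OF v_box, of "{0..t}" D m 0 0 x 0 0 1] by simp
    have 1: "norm (integral {0..t} (\<lambda>\<sigma>. mollified D v m 0 0 x \<sigma>) - integral {0..t} (\<lambda>\<sigma>. v x \<sigma>)) \<le> t * \<eta>"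
      by (rule integral_close[OF cv cm t]) (use lv x t in \<open>auto simp: D_def\<close>)
    have 2: "norm (mollified D p m 0 0 x t - p x t) \<le> \<eta>" "norm (mollified D p m 0 0 x 0 - p x 0) \<le> \<eta>"
      using lp x t by (auto simp: D_def)
    have "integral {0..t} (\<lambda>\<sigma>. v x \<sigma>) - (p x t - p x 0)
      = (mollified D p m 0 0 x t - p x t) - (mollified D p m 0 0 x 0 - p x 0)
        - (integral {0..t} (\<lambda>\<sigma>. mollified D v m 0 0 x \<sigma>) - integral {0..t} (\<lambda>\<sigma>. v x \<sigma>))"
      using integral_unique[OF I] by simp
    also have "norm \<dots> \<le> (\<eta> + \<eta>) + t * \<eta>"
      by (intro norm_triangle_le_diff add_mono 1 2)
    finally show "norm (integral {0..t} (\<lambda>\<sigma>. v x \<sigma>) - (p x t - p x 0)) \<le> (t + 2) * \<eta>"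
      by (simp add: algebra_simps)
  qed
  then show ?thesis by simp
qed

text \<open>Along incoming characteristics the quantity \<open>p\<^sub>t + c p\<^sub>x\<close> is constant, so it is determined by the
  initial data, and integrating it along outgoing characteristics involves no boundary values.\<close>

lemma outgoing_characteristic:
  assumes x: "x \<ge> 0" and t: "t \<ge> 0" and s: "s \<ge> 0"
  shows "integral {0..s} (\<lambda>\<sigma>. v (x + c * t + 2 * c * \<sigma>) 0)
    = p (x + c * s) (t + s) - p x t - (1 / 2) *\<^sub>R (p (x + c * t + 2 * c * s) 0 - p (x + c * t) 0)"
proof -
  define D where "D = x + c * t + 2 * c * s + t + s + 1"
  have nn: "c * t \<ge> 0" "c * s \<ge> 0" using c t s by simp_all
  have "integral {0..s} (\<lambda>\<sigma>. v (x + c * t + 2 * c * \<sigma>) 0)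
    - (p (x + c * s) (t + s) - p x t - (1 / 2) *\<^sub>R (p (x + c * t + 2 * c * s) 0 - p (x + c * t) 0)) = 0"
  proof (rule zero_if_small[where C = "s + 3"])
    fix \<eta> :: real assume \<eta>: "\<eta> > 0"
    obtain m where m: "m \<ge> 1"
      and lp: "\<forall>x t. 0 \<le> x \<and> x + 1 \<le> D \<and> 0 \<le> t \<and> t + 1 \<le> D \<longrightarrow> norm (mollified D p m 0 0 x t - p x t) \<le> \<eta>"
      and lv: "\<forall>x t. 0 \<le> x \<and> x + 1 \<le> D \<and> 0 \<le> t \<and> t + 1 \<le> D \<longrightarrow> norm (mollified D v m 0 0 x t - v x t) \<le> \<eta>"
      using mollified_close[OF \<eta>] by blast
    define M where "M = mollified D p m"
    define V where "V = mollified D v m 0 0"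
    \<comment> \<open>Since derivatives on the kernel carry a minus sign, \<open>J\<close> is minus
      the derivative of the mollified solution in the direction (c, 1).\<close>
    define J where "J = (\<lambda>x t. M 0 1 x t + c *\<^sub>R M 1 0 x t)"
    have J: "J (x + c * \<sigma>) (t + \<sigma>) = J (x + c * t + 2 * c * \<sigma>) 0" if \<sigma>: "\<sigma> \<in> {0..s}" for \<sigma>
    proof -
      \<comment> \<open>The foot at time 0 of the incoming characteristic through (x + c \<sigma>, t
        + \<sigma>).\<close>
      define y where "y = x + c * t + 2 * c * \<sigma>"
      have "((\<lambda>\<tau>. 0 :: complex) has_integral (J (y + (- c) * (t + \<sigma>)) (0 + 1 * (t + \<sigma>)) - J (y + (- c) * 0) (0 + 1 * 0))) {0..t + \<sigma>}"
      proof (rule fundamental_theorem_of_calculus)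
        fix \<tau> assume \<tau>: "\<tau> \<in> {0..t + \<sigma>}"
        define x' where "x' = y + (- c) * \<tau>"
        define t' where "t' = 0 + 1 * \<tau>"
        have "((\<lambda>\<tau>. J (y + (- c) * \<tau>) (0 + 1 * \<tau>)) has_vector_derivative
            - ((- c) *\<^sub>R M (Suc 0) 1 x' t' + 1 *\<^sub>R M 0 (Suc 1) x' t')
            + c *\<^sub>R - ((- c) *\<^sub>R M (Suc 1) 0 x' t' + 1 *\<^sub>R M 1 (Suc 0) x' t')) (at \<tau>)"
          unfolding J_def M_def x'_def t'_def
          by (intro has_vector_derivative_add has_vector_derivative_scaleR_const mollified_deriv p_box)
        moreover have "M 0 2 x' t' = c\<^sup>2 *\<^sub>R M 2 0 x' t'"
          unfolding M_def
        proof (rule wave[OF m])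
          have "c * \<tau> \<le> c * (t + \<sigma>)" using \<tau> c by (intro mult_left_mono) auto
          moreover have "c * \<sigma> \<ge> 0" using c \<sigma> by simp
          ultimately show "0 \<le> x'" using x by (simp add: x'_def y_def algebra_simps)
          have "c * \<sigma> \<le> c * s" using \<sigma> c by simp
          moreover have "c * \<tau> \<ge> 0" using c \<tau> by simp
          ultimately show "x' + 1 \<le> D" using t s by (simp add: x'_def y_def D_def)
          show "0 \<le> t'" using \<tau> by (simp add: t'_def)
          show "t' + 1 \<le> D" using \<tau> \<sigma> x nn by (simp add: t'_def D_def)
        qed
        ultimately show "((\<lambda>\<tau>. J (y + (- c) * \<tau>) (0 + 1 * \<tau>)) has_vector_derivative 0) (at \<tau> within {0..t + \<sigma>})"
          by (simp add: numeral_2_eq_2 power2_eq_square has_vector_derivative_at_within scaleR_diff_right)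
      qed (use t \<sigma> in simp)
      from has_integral_unique[OF this has_integral_0] show ?thesis
        by (simp add: y_def algebra_simps)
    qed
    \<comment> \<open>Along the outgoing characteristic the derivative is that of p_t + c p_x at the
      foot. The foot moves with speed 2c, so subtracting half of the initial value removes c p_x and
      leaves the initial velocity.\<close>
    have I: "((\<lambda>\<sigma>. V (x + c * t + 2 * c * \<sigma>) 0) has_integral
        (M 0 0 (x + c * s) (t + 1 * s) - (1 / 2) *\<^sub>R M 0 0 (x + c * t + 2 * c * s) (0 + 0 * s))
        - (M 0 0 (x + c * 0) (t + 1 * 0) - (1 / 2) *\<^sub>R M 0 0 (x + c * t + 2 * c * 0) (0 + 0 * 0))) {0..s}"
    proof (rule fundamental_theorem_of_calculus[OF s])
      fix \<sigma> assume \<sigma>: "\<sigma> \<in> {0..s}"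
      have "((\<lambda>\<sigma>. M 0 0 (x + c * \<sigma>) (t + 1 * \<sigma>) - (1 / 2) *\<^sub>R M 0 0 (x + c * t + 2 * c * \<sigma>) (0 + 0 * \<sigma>)) has_vector_derivative
          - (c *\<^sub>R M (Suc 0) 0 (x + c * \<sigma>) (t + 1 * \<sigma>) + 1 *\<^sub>R M 0 (Suc 0) (x + c * \<sigma>) (t + 1 * \<sigma>))
          - (1 / 2) *\<^sub>R - ((2 * c) *\<^sub>R M (Suc 0) 0 (x + c * t + 2 * c * \<sigma>) (0 + 0 * \<sigma>)
             + 0 *\<^sub>R M 0 (Suc 0) (x + c * t + 2 * c * \<sigma>) (0 + 0 * \<sigma>))) (at \<sigma>)"
        unfolding M_def
        by (intro has_vector_derivative_diff has_vector_derivative_scaleR_const mollified_deriv p_box)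
      moreover have "- (c *\<^sub>R M (Suc 0) 0 (x + c * \<sigma>) (t + 1 * \<sigma>) + 1 *\<^sub>R M 0 (Suc 0) (x + c * \<sigma>) (t + 1 * \<sigma>))
          - (1 / 2) *\<^sub>R - ((2 * c) *\<^sub>R M (Suc 0) 0 (x + c * t + 2 * c * \<sigma>) (0 + 0 * \<sigma>)
             + 0 *\<^sub>R M 0 (Suc 0) (x + c * t + 2 * c * \<sigma>) (0 + 0 * \<sigma>)) = V (x + c * t + 2 * c * \<sigma>) 0"
      proof -
        have "c * \<sigma> \<ge> 0" "c * \<sigma> \<le> c * s" using c \<sigma> by auto
        then have "M 0 1 (x + c * t + 2 * c * \<sigma>) 0 = - V (x + c * t + 2 * c * \<sigma>) 0"
          unfolding M_def V_def using x t s nn by (intro velocity[OF m]) (auto simp: D_def)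
        then show ?thesis
          using J[OF \<sigma>] by (simp add: J_def algebra_simps)
      qed
      ultimately show "((\<lambda>\<sigma>. M 0 0 (x + c * \<sigma>) (t + 1 * \<sigma>) - (1 / 2) *\<^sub>R M 0 0 (x + c * t + 2 * c * \<sigma>) (0 + 0 * \<sigma>))
          has_vector_derivative V (x + c * t + 2 * c * \<sigma>) 0) (at \<sigma> within {0..s})"
        using has_vector_derivative_at_within by simp
    qed
    have cv: "continuous_on {0..s} (\<lambda>\<sigma>. v (x + c * t + 2 * c * \<sigma>) 0)"
      by (rule continuous_on_compose2[OF continuous2_slice_x[OF v_cont, of 0]])
        (use x c nn in \<open>auto intro!: continuous_intros add_nonneg_nonneg\<close>)
    have cm: "continuous_on {0..s} (\<lambda>\<sigma>. V (x + c * t + 2 * c * \<sigma>) 0)"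
      unfolding V_def using mollified_cont[OF v_box, of "{0..s}" D m 0 0 "x + c * t" "2 * c" 0 0] by simp
    have dom: "0 \<le> x + c * t + 2 * c * \<sigma>" "x + c * t + 2 * c * \<sigma> + 1 \<le> D" if "\<sigma> \<in> {0..s}" for \<sigma>
    proof -
      have "c * \<sigma> \<ge> 0" "c * \<sigma> \<le> c * s" using c that by auto
      then show "0 \<le> x + c * t + 2 * c * \<sigma>" "x + c * t + 2 * c * \<sigma> + 1 \<le> D"
        using x t s nn by (auto simp: D_def)
    qed
    have 1: "norm (integral {0..s} (\<lambda>\<sigma>. V (x + c * t + 2 * c * \<sigma>) 0) - integral {0..s} (\<lambda>\<sigma>. v (x + c * t + 2 * c * \<sigma>) 0)) \<le> s * \<eta>"
      by (rule integral_close[OF cv cm s]) (use lv dom x t s nn in \<open>auto simp: V_def D_def\<close>)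
    have 2: "norm (M 0 0 (x + c * s) (t + s) - p (x + c * s) (t + s)) \<le> \<eta>" "norm (M 0 0 x t - p x t) \<le> \<eta>"
      "norm (M 0 0 (x + c * t + 2 * c * s) 0 - p (x + c * t + 2 * c * s) 0) \<le> \<eta>"
      "norm (M 0 0 (x + c * t) 0 - p (x + c * t) 0) \<le> \<eta>"
      unfolding M_def using lp x t s nn by (auto simp: D_def)
    have 3: "norm ((1 / 2) *\<^sub>R ((M 0 0 (x + c * t + 2 * c * s) 0 - p (x + c * t + 2 * c * s) 0) - (M 0 0 (x + c * t) 0 - p (x + c * t) 0))) \<le> \<eta>"
      using norm_triangle_le_diff[OF add_mono[OF 2(3) 2(4)]] by simp
    have "integral {0..s} (\<lambda>\<sigma>. v (x + c * t + 2 * c * \<sigma>) 0)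
      - (p (x + c * s) (t + s) - p x t - (1 / 2) *\<^sub>R (p (x + c * t + 2 * c * s) 0 - p (x + c * t) 0))
      = ((M 0 0 (x + c * s) (t + s) - p (x + c * s) (t + s)) - (M 0 0 x t - p x t))
        - (1 / 2) *\<^sub>R ((M 0 0 (x + c * t + 2 * c * s) 0 - p (x + c * t + 2 * c * s) 0) - (M 0 0 (x + c * t) 0 - p (x + c * t) 0))
        - (integral {0..s} (\<lambda>\<sigma>. V (x + c * t + 2 * c * \<sigma>) 0) - integral {0..s} (\<lambda>\<sigma>. v (x + c * t + 2 * c * \<sigma>) 0))"
      using integral_unique[OF I] by (simp add: scaleR_diff_right)
    also have "norm \<dots> \<le> ((\<eta> + \<eta>) + \<eta>) + s * \<eta>"
      by (intro norm_triangle_le_diff add_mono 1 2 3)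
    finally show "norm (integral {0..s} (\<lambda>\<sigma>. v (x + c * t + 2 * c * \<sigma>) 0)
      - (p (x + c * s) (t + s) - p x t - (1 / 2) *\<^sub>R (p (x + c * t + 2 * c * s) 0 - p (x + c * t) 0))) \<le> (s + 3) * \<eta>"
      by (simp add: algebra_simps)
  qed
  then show ?thesis by simp
qed

end

lemma antiderivative_exists:
  fixes f :: "real \<Rightarrow> 'b::banach"
  assumes f: "continuous_on UNIV f"
  shows "\<exists>N. \<forall>x. (N has_vector_derivative f x) (at x)"
proof -
  \<comment> \<open>For x of either sign one of the two integrals runs over an empty or one-point
    interval and is 0.\<close>
  define N where "N = (\<lambda>x. integral {0..x} f - integral {x..0} f)"
  have int: "f integrable_on {p..q}" for p q
    by (intro integrable_continuous_real continuous_on_subset[OF f]) auto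
  have "(N has_vector_derivative f x) (at x)" for x
  proof -
    define m where "m = min 0 x - 1"
    have eq: "integral {m..u} f - integral {m..0} f = N u" if "u \<in> {m<..}" for u
    proof (cases "u \<ge> 0")
      case True
      have "integral {m..0} f + integral {0..u} f = integral {m..u} f"
        by (rule Henstock_Kurzweil_Integration.integral_combine) (use True int in \<open>auto simp: m_def\<close>)
      moreover have "integral {u..0} f = 0" using True by (cases "u = 0") auto
      ultimately show ?thesis by (simp add: N_def algebra_simps)
    next
      case False
      have "integral {m..u} f + integral {u..0} f = integral {m..0} f"
        by (rule Henstock_Kurzweil_Integration.integral_combine) (use False that int in auto)
      moreover have "integral {0..u} f = 0" using False by simp
      ultimately show ?thesis by (simp add: N_def algebra_simps)
    qed
    have "((\<lambda>u. integral {m..u} f) has_vector_derivative f x) (at x within {m..x + 1})"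
      by (rule integral_has_vector_derivative[OF continuous_on_subset[OF f]]) (auto simp: m_def)
    moreover have "at x within {m..x + 1} = at x"
      by (rule at_within_Icc_at) (auto simp: m_def)
    ultimately have "((\<lambda>u. integral {m..u} f) has_vector_derivative f x) (at x)" by simp
    from has_vector_derivative_diff[OF this has_vector_derivative_const]
    have "((\<lambda>u. integral {m..u} f - integral {m..0} f) has_vector_derivative f x) (at x)" by simp
    then show ?thesis
      by (rule has_vector_derivative_transform_within_open[where S = "{m<..}"]) (use eq in \<open>auto simp: m_def\<close>)
  qed
  then show ?thesis by blast
qed

lemma has_vector_derivative_chain_real:
  fixes f :: "real \<Rightarrow> 'b::real_normed_vector"
  assumes "(f has_vector_derivative d) (at (g x))" "(g has_real_derivative k) (at x)"
  shows "((\<lambda>x. f (g x)) has_vector_derivative k *\<^sub>R d) (at x)"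
  using vector_diff_chain_at[of g k x f d] assms
  by (simp add: o_def has_real_derivative_iff_has_vector_derivative)

lemma has_vector_derivative_imp_continuous_on:
  "(\<And>x. x \<in> S \<Longrightarrow> (f has_vector_derivative f' x) (at x)) \<Longrightarrow> continuous_on S f"
  by (rule continuous_at_imp_continuous_on, rule ballI, rule has_vector_derivative_continuous)

text \<open>The problem is solved sideways: for 0 <= x <= L the solution is expressed by the initial
  data and its values on the distant line x = L. No boundary value at the interface enters, and the
  unknown values are taken at a fixed x, where the t-derivative is known.\<close>

locale cauchy_quadrant = quadrant_solution +
  fixes w0 w0' w1 :: "real \<Rightarrow> complex" and L :: real
  assumes w0_deriv: "\<And>x. (w0 has_vector_derivative w0' x) (at x)"
    and w0'_cont: "continuous_on UNIV w0'" and w1_cont: "continuous_on UNIV w1"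
    and p_init: "\<And>x. x \<ge> 0 \<Longrightarrow> p x 0 = w0 x" and v_init: "\<And>x. x \<ge> 0 \<Longrightarrow> v x 0 = w1 x"
    and L: "L > 0"
begin

definition "N = (SOME N. \<forall>x. (N has_vector_derivative w1 x) (at x))"
text \<open>The incoming profile in d'Alembert's formula, \<open>N\<close> being a primitive of the
  initial velocity.\<close>

definition "R \<xi> = (1 / 2) *\<^sub>R w0 \<xi> + (1 / (2 * c)) *\<^sub>R N \<xi>"
definition "R' \<xi> = (1 / 2) *\<^sub>R w0' \<xi> + (1 / (2 * c)) *\<^sub>R w1 \<xi>"
text \<open>The x-derivative of the solution, read off from \<open>p_identity\<close>; unlike a
  derivative taken at the interface it is defined and continuous up to x = 0. \<open>Yx\<close> is
  its time integral in closed form.\<close>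

definition "U x t = R' (2 * L - x + c * t) + R' (x + c * t) - (1 / c) *\<^sub>R v L (t + (L - x) / c)"
definition "Y x t = integral {0..t} (p x)"
definition "Yx x t = (1 / c) *\<^sub>R ((R (2 * L - x + c * t) - R (2 * L - x)) + (R (x + c * t) - R x)
   - (p L (t + (L - x) / c) - p L ((L - x) / c)))"

lemma N_deriv: "(N has_vector_derivative w1 x) (at x)"
  using someI_ex[OF antiderivative_exists[OF w1_cont]] unfolding N_def by blast

lemma R_deriv: "(R has_vector_derivative R' \<xi>) (at \<xi>)"
  unfolding R_def[abs_def] R'_def
  by (intro has_vector_derivative_add has_vector_derivative_scaleR_const w0_deriv N_deriv)

lemma R_cont: "continuous_on UNIV R"
  by (rule has_vector_derivative_imp_continuous_on[OF R_deriv])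

lemma R'_cont: "continuous_on UNIV R'"
  unfolding R'_def[abs_def] by (intro continuous_intros w0'_cont w1_cont)

text \<open>The outgoing characteristic through (x,t) meets x = L after the time (L - x)/c. The
  initial velocity between the two feet x + c t and 2 L - x + c t integrates to a difference of
  \<open>N\<close>, which combines with the initial values into \<open>R\<close>.\<close>

lemma p_identity:
  assumes x: "x \<in> {0..L}" and t: "t \<ge> 0"
  shows "p x t = p L (t + (L - x) / c) - (R (2 * L - x + c * t) - R (x + c * t))"
proof -
  define s where "s = (L - x) / c"
  have s: "s \<ge> 0" using x c by (simp add: s_def)
  have cs: "c * s = L - x" using c by (simp add: s_def)
  have nn: "c * t \<ge> 0" using c t by simp
  have T: "integral {0..s} (\<lambda>\<sigma>. v (x + c * t + 2 * c * \<sigma>) 0)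
    = p (x + c * s) (t + s) - p x t - (1 / 2) *\<^sub>R (p (x + c * t + 2 * c * s) 0 - p (x + c * t) 0)"
    by (rule outgoing_characteristic) (use x t s in auto)
  have "((\<lambda>\<sigma>. w1 (x + c * t + 2 * c * \<sigma>)) has_integral
      (1 / (2 * c)) *\<^sub>R N (x + c * t + 2 * c * s) - (1 / (2 * c)) *\<^sub>R N (x + c * t + 2 * c * 0)) {0..s}"
  proof (rule fundamental_theorem_of_calculus[OF s])
    fix \<sigma>
    have "((\<lambda>\<sigma>. x + c * t + 2 * c * \<sigma>) has_real_derivative 2 * c) (at \<sigma>)"
      by (auto intro!: derivative_eq_intros)
    from has_vector_derivative_scaleR_const[OF has_vector_derivative_chain_real[OF N_deriv this], of "1 / (2 * c)"]
    show "((\<lambda>\<sigma>. (1 / (2 * c)) *\<^sub>R N (x + c * t + 2 * c * \<sigma>)) has_vector_derivative w1 (x + c * t + 2 * c * \<sigma>)) (at \<sigma> within {0..s})"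
      using c by (simp add: has_vector_derivative_at_within)
  qed
  then have i: "integral {0..s} (\<lambda>\<sigma>. w1 (x + c * t + 2 * c * \<sigma>))
      = (1 / (2 * c)) *\<^sub>R N (x + c * t + 2 * c * s) - (1 / (2 * c)) *\<^sub>R N (x + c * t + 2 * c * 0)"
    by (rule integral_unique)
  have j: "integral {0..s} (\<lambda>\<sigma>. v (x + c * t + 2 * c * \<sigma>) 0) = integral {0..s} (\<lambda>\<sigma>. w1 (x + c * t + 2 * c * \<sigma>))"
  proof (rule integral_cong)
    fix \<sigma> assume "\<sigma> \<in> {0..s}"
    then have "0 \<le> x + c * t + 2 * c * \<sigma>" using x nn c by auto
    then show "v (x + c * t + 2 * c * \<sigma>) 0 = w1 (x + c * t + 2 * c * \<sigma>)" by (rule v_init)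
  qed
  have k: "p (x + c * t + 2 * c * s) 0 = w0 (x + c * t + 2 * c * s)" "p (x + c * t) 0 = w0 (x + c * t)"
    using x nn s c by (auto intro!: p_init)
  have l: "x + c * t + 2 * c * s = 2 * L - x + c * t" "x + c * s = L" "x + c * t + 2 * c * 0 = x + c * t"
    using cs by auto
  have gen: "a = n - n' \<Longrightarrow> a = P - u - (1 / 2) *\<^sub>R (h - h') \<Longrightarrow> u = P - (((1 / 2) *\<^sub>R h + n) - ((1 / 2) *\<^sub>R h' + n'))"
    for a n n' P u h h' :: complex by (simp add: scaleR_diff_right algebra_simps)
  from gen[OF j[unfolded i l(1) l(3)] T[unfolded k, unfolded l(1) l(2)]] show ?thesis
    unfolding R_def s_def[symmetric] .
qed

lemma p_t:
  assumes x: "x \<ge> 0" and t: "t > 0"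
  shows "(p x has_vector_derivative v x t) (at t)"
proof -
  have "((\<lambda>u. integral {0..u} (v x)) has_vector_derivative v x t) (at t within {0..t + 1})"
    by (rule integral_has_vector_derivative[OF continuous_on_subset[OF v_line[OF x]]]) (use t in auto)
  moreover have "at t within {0..t + 1} = at t" by (rule at_within_Icc_at) (use t in auto)
  ultimately have "((\<lambda>u. integral {0..u} (v x)) has_vector_derivative v x t) (at t)" by simp
  from has_vector_derivative_add[OF has_vector_derivative_const this, of "p x 0"]
  have D: "((\<lambda>u. p x 0 + integral {0..u} (v x)) has_vector_derivative v x t) (at t)" by simp
  show ?thesis
    by (rule has_vector_derivative_transform_within_open[OF D open_greaterThan[of 0]])
      (use t velocity_integral[OF x] in auto)
qed

lemma shift_deriv: "((\<lambda>t. t + q) has_real_derivative 1) (at t)" for q t :: real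
  by (auto intro!: derivative_eq_intros)

lemma line_deriv: "((\<lambda>t. q + c * t) has_real_derivative c) (at t)" for q t :: real
  by (auto intro!: derivative_eq_intros)

lemma slope_deriv: "((\<lambda>x. t + (L - x) / c) has_real_derivative - (1 / c)) (at x)"
    "((\<lambda>x. (L - x) / c) has_real_derivative - (1 / c)) (at x)"
    "((\<lambda>x. 2 * L - x + q) has_real_derivative - 1) (at x)"
    "((\<lambda>x. 2 * L - x) has_real_derivative - 1) (at x)"
    "((\<lambda>x. x + q) has_real_derivative 1) (at x)"
  using c by (auto intro!: derivative_eq_intros simp: field_simps)

lemma v_identity:
  assumes x: "x \<in> {0..L}" and t: "t \<ge> 0"
  shows "v x t = v L (t + (L - x) / c) - c *\<^sub>R (R' (2 * L - x + c * t) - R' (x + c * t))"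
proof -
  define q where "q = (L - x) / c"
  have q: "q \<ge> 0" using x c by (simp add: q_def)
  have L0: "L \<ge> 0" using L by simp
  define D where "D = (\<lambda>t. v x t - (v L (t + q) - c *\<^sub>R (R' (2 * L - x + c * t) - R' (x + c * t))))"
  have D0: "D t = 0" if t: "t \<in> {0<..}" for t
  proof -
    have "((\<lambda>t. p L (t + q) - (R (2 * L - x + c * t) - R (x + c * t))) has_vector_derivative
        1 *\<^sub>R v L (t + q) - (c *\<^sub>R R' (2 * L - x + c * t) - c *\<^sub>R R' (x + c * t))) (at t)"
      by (rule has_vector_derivative_diff[OF has_vector_derivative_chain_real[OF p_t[OF L0] shift_deriv]
            has_vector_derivative_diff[OF has_vector_derivative_chain_real[OF R_deriv line_deriv]
              has_vector_derivative_chain_real[OF R_deriv line_deriv]]]) (use t q in simp)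
    then have "(p x has_vector_derivative
        1 *\<^sub>R v L (t + q) - (c *\<^sub>R R' (2 * L - x + c * t) - c *\<^sub>R R' (x + c * t))) (at t)"
      by (rule has_vector_derivative_transform_within_open[OF _ open_greaterThan[of 0]])
        (use t p_identity[OF x] in \<open>auto simp: q_def\<close>)
    from vector_derivative_unique_at[OF p_t this] x t show ?thesis
      by (simp add: D_def scaleR_diff_right)
  qed
  \<comment> \<open>Differentiating \<open>p_identity\<close> is possible for t > 0 only; the case t
    = 0 follows by continuity.\<close>
  have "continuous_on {0..} D"
    unfolding D_def
    by (intro continuous_intros v_line continuous_on_UNIV_compose[OF R'_cont] continuous_on_compose2[OF v_line[OF L0]])
      (use x q in auto)
  then have "continuous_on (closure {0<..}) D" by simp
  then have "D t = 0"
    by (rule continuous_constant_on_closure[OF _ D0]) (use t in auto)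
  then show ?thesis by (simp add: D_def q_def)
qed

text \<open>On the right-hand side of \<open>p_identity\<close> the variable x enters the solution
  only through its time argument on the line x = L, so differentiability in t yields
  differentiability in x.\<close>

lemma p_x:
  assumes x: "x \<in> {0<..<L}" and t: "t \<ge> 0"
  shows "((\<lambda>x. p x t) has_vector_derivative U x t) (at x)"
proof -
  have pos: "t + (L - x) / c > 0" using x t c by (intro add_nonneg_pos) auto
  have L0: "L \<ge> 0" using L by simp
  have "((\<lambda>x. p L (t + (L - x) / c) - (R (2 * L - x + c * t) - R (x + c * t))) has_vector_derivative
      - (1 / c) *\<^sub>R v L (t + (L - x) / c) - (- 1 *\<^sub>R R' (2 * L - x + c * t) - 1 *\<^sub>R R' (x + c * t))) (at x)"
    by (rule has_vector_derivative_diff[OF has_vector_derivative_chain_real[OF p_t[OF L0 pos] slope_deriv(1)]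
          has_vector_derivative_diff[OF has_vector_derivative_chain_real[OF R_deriv slope_deriv(3)]
            has_vector_derivative_chain_real[OF R_deriv slope_deriv(5)]]])
  then have "((\<lambda>x. p x t) has_vector_derivative
      - (1 / c) *\<^sub>R v L (t + (L - x) / c) - (- 1 *\<^sub>R R' (2 * L - x + c * t) - 1 *\<^sub>R R' (x + c * t))) (at x)"
    by (rule has_vector_derivative_transform_within_open[OF _ open_greaterThanLessThan[of 0 L] x])
      (use t p_identity in auto)
  moreover have "- (1 / c) *\<^sub>R v L (t + (L - x) / c) - (- 1 *\<^sub>R R' (2 * L - x + c * t) - 1 *\<^sub>R R' (x + c * t)) = U x t"
    by (simp add: U_def)
  ultimately show ?thesis by simp
qed

lemma U_cont: "continuous2 ({0..L} \<times> {0..}) U"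
  unfolding U_def using L c
  by (intro continuous_intros continuous_on_UNIV_compose[OF R'_cont] continuous_on_compose2[OF v_line[of L]])
    (auto intro!: add_nonneg_nonneg)

lemma Yx_cont: "continuous2 ({0..L} \<times> {0..}) Yx"
  unfolding Yx_def using L c
  by (intro continuous_intros continuous_on_UNIV_compose[OF R_cont] continuous_on_compose2[OF p_line[of L]])
    (auto intro!: add_nonneg_nonneg)

lemma Yx_t:
  assumes x: "x \<in> {0..L}" and t: "t > 0"
  shows "(Yx x has_vector_derivative U x t) (at t)"
proof -
  have L0: "L \<ge> 0" using L by simp
  have pos: "t + (L - x) / c > 0" using x t c by (intro add_pos_nonneg) auto
  have "(Yx x has_vector_derivative (1 / c) *\<^sub>R ((c *\<^sub>R R' (2 * L - x + c * t) - 0) + (c *\<^sub>R R' (x + c * t) - 0)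
      - (1 *\<^sub>R v L (t + (L - x) / c) - 0))) (at t)"
    unfolding Yx_def[abs_def]
    by (rule has_vector_derivative_scaleR_const[OF has_vector_derivative_diff[OF
          has_vector_derivative_add[OF
            has_vector_derivative_diff[OF has_vector_derivative_chain_real[OF R_deriv line_deriv] has_vector_derivative_const]
            has_vector_derivative_diff[OF has_vector_derivative_chain_real[OF R_deriv line_deriv] has_vector_derivative_const]]
          has_vector_derivative_diff[OF has_vector_derivative_chain_real[OF p_t[OF L0 pos] shift_deriv] has_vector_derivative_const]]])
  then show ?thesis using c by (simp add: U_def scaleR_diff_right scaleR_add_right)
qed

lemma U_integral:
  assumes x: "x \<in> {0..L}" and t: "t \<ge> 0"
  shows "integral {0..t} (U x) = Yx x t"
proof -
  have "(U x has_integral Yx x t - Yx x 0) {0..t}"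
    by (rule fundamental_theorem_of_calculus_interior[OF t])
      (use x in \<open>auto intro!: Yx_t continuous_on_subset[OF continuous2_slice_t[OF Yx_cont]]\<close>)
  then have "integral {0..t} (U x) = Yx x t - Yx x 0" by (rule integral_unique)
  then show ?thesis by (simp add: Yx_def)
qed

lemma Y_x:
  assumes x: "x \<in> {0<..<L}" and t: "t \<ge> 0"
  shows "((\<lambda>x. Y x t) has_vector_derivative Yx x t) (at x)"
proof -
  have "((\<lambda>x. integral (cbox 0 t) (p x)) has_vector_derivative integral (cbox 0 t) (U x)) (at x within {0<..<L})"
  proof (rule leibniz_rule_vector_derivative)
    show "((\<lambda>x. p x u) has_vector_derivative U x u) (at x within {0<..<L})" if "x \<in> {0<..<L}" "u \<in> cbox 0 t" for x u
      by (rule has_vector_derivative_at_within[OF p_x]) (use that in auto)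
    show "p x integrable_on cbox 0 t" if "x \<in> {0<..<L}" for x
      using that by (auto intro!: integrable_continuous_real continuous_on_subset[OF p_line[of x]])
    show "continuous_on ({0<..<L} \<times> cbox 0 t) (\<lambda>(x, u). U x u)"
      unfolding case_prod_beta by (rule continuous_on_subset[OF U_cont]) auto
  qed (use x in auto)
  then have "((\<lambda>x. Y x t) has_vector_derivative integral {0..t} (U x)) (at x)"
    using x by (simp add: Y_def at_within_open[of x "{0<..<L}"])
  then show ?thesis using U_integral[of x t] x t by simp
qed

text \<open>The wave equation integrated once in time: c^2 Y_xx = p_t - w1. This is the second
  x-derivative that the solution itself lacks.\<close>

lemma Yx_x:
  assumes x: "x \<in> {0<..<L}" and t: "t \<ge> 0"
  shows "((\<lambda>x. Yx x t) has_vector_derivative (1 / c\<^sup>2) *\<^sub>R (v x t - w1 x)) (at x)"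
proof -
  have L0: "L \<ge> 0" using L by simp
  have pos: "t + (L - x) / c > 0" "(L - x) / c > 0" using x t c by (auto intro!: add_nonneg_pos)
  have xL: "x \<in> {0..L}" using x by auto
  have "((\<lambda>x. Yx x t) has_vector_derivative (1 / c) *\<^sub>R ((- 1 *\<^sub>R R' (2 * L - x + c * t) - - 1 *\<^sub>R R' (2 * L - x))
      + (1 *\<^sub>R R' (x + c * t) - R' x)
      - (- (1 / c) *\<^sub>R v L (t + (L - x) / c) - - (1 / c) *\<^sub>R v L ((L - x) / c)))) (at x)"
    unfolding Yx_def
    by (rule has_vector_derivative_scaleR_const[OF has_vector_derivative_diff[OF
          has_vector_derivative_add[OF
            has_vector_derivative_diff[OF has_vector_derivative_chain_real[OF R_deriv slope_deriv(3)]
              has_vector_derivative_chain_real[OF R_deriv slope_deriv(4)]]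
            has_vector_derivative_diff[OF has_vector_derivative_chain_real[OF R_deriv slope_deriv(5)] R_deriv]]
          has_vector_derivative_diff[OF has_vector_derivative_chain_real[OF p_t[OF L0 pos(1)] slope_deriv(1)]
            has_vector_derivative_chain_real[OF p_t[OF L0 pos(2)] slope_deriv(2)]]]])
  moreover have "(1 / c) *\<^sub>R ((- 1 *\<^sub>R R' (2 * L - x + c * t) - - 1 *\<^sub>R R' (2 * L - x))
      + (1 *\<^sub>R R' (x + c * t) - R' x)
      - (- (1 / c) *\<^sub>R v L (t + (L - x) / c) - - (1 / c) *\<^sub>R v L ((L - x) / c)))
      = (1 / c\<^sup>2) *\<^sub>R (v x t - v x 0)"
    using c unfolding v_identity[OF xL t] v_identity[OF xL order_refl]
    by (simp add: power2_eq_square scaleR_diff_right scaleR_add_right)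
  ultimately show ?thesis using v_init[of x] x by simp
qed

lemma Y_t:
  assumes x: "x \<ge> 0" and t: "t > 0"
  shows "(Y x has_vector_derivative p x t) (at t)"
proof -
  have "((\<lambda>u. integral {0..u} (p x)) has_vector_derivative p x t) (at t within {0..t + 1})"
    by (rule integral_has_vector_derivative[OF continuous_on_subset[OF p_line[OF x]]]) (use t in auto)
  moreover have "at t within {0..t + 1} = at t" by (rule at_within_Icc_at) (use t in auto)
  ultimately show ?thesis by (simp add: Y_def[abs_def])
qed

lemma Y_0: "Y x 0 = 0" by (simp add: Y_def)

lemma Y_line_cont: "x \<ge> 0 \<Longrightarrow> continuous_on {0..t} (Y x)"
  unfolding Y_def[abs_def]
  by (rule indefinite_integral_continuous_1)
    (auto intro!: integrable_continuous_real continuous_on_subset[OF p_line])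

lemma Y_cont: "continuous2 ({0..} \<times> {0..}) Y"
proof -
  \<comment> \<open>The substitution t \<sigma> moves t from the limit of integration into the
    integrand, where joint continuity is a statement about a parameter integral.\<close>
  have eq: "Y x t = t *\<^sub>R integral {0..1} (\<lambda>\<sigma>. p x (t * \<sigma>))" if x: "x \<ge> 0" and t: "t \<ge> 0" for x t
  proof (cases "t = 0")
    case False
    with t have t: "t > 0" by simp
    have "((\<lambda>\<sigma>. t *\<^sub>R p x (t * \<sigma>)) has_integral Y x (t * 1) - Y x (t * 0)) {0..1}"
    proof (rule fundamental_theorem_of_calculus_interior)
      show "continuous_on {0..1} (\<lambda>\<sigma>. Y x (t * \<sigma>))"
        by (rule continuous_on_compose2[OF Y_line_cont[OF x, of t]]) (use t in \<open>auto intro!: continuous_intros\<close>)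
      fix \<sigma> :: real assume "\<sigma> \<in> {0<..<1}"
      then have "t * \<sigma> > 0" using t by simp
      moreover have "((\<lambda>\<sigma>. t * \<sigma>) has_real_derivative t) (at \<sigma>)"
        by (auto intro!: derivative_eq_intros)
      ultimately show "((\<lambda>\<sigma>. Y x (t * \<sigma>)) has_vector_derivative t *\<^sub>R p x (t * \<sigma>)) (at \<sigma>)"
        by (intro has_vector_derivative_chain_real Y_t x)
    qed simp
    from integral_unique[OF this] show ?thesis by (simp add: Y_0)
  qed (simp add: Y_0)
  have "continuous_on (({0..} \<times> {0..}) \<times> cbox 0 1) (\<lambda>q. p (fst (fst q)) (snd (fst q) * snd q))"
    by (rule continuous_on_compose2[OF p_cont, of _ "\<lambda>q. (fst (fst q), snd (fst q) * snd q)", simplified])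
      (auto intro!: continuous_intros)
  then have "continuous_on (({0..} \<times> {0..}) \<times> cbox 0 1) (\<lambda>(z, \<sigma>). p (fst z) (snd z * \<sigma>))"
    by (simp add: case_prod_beta)
  from integral_continuous_on_param[OF this]
  have "continuous_on ({0..} \<times> {0..}) (\<lambda>z. snd z *\<^sub>R integral {0..1} (\<lambda>\<sigma>. p (fst z) (snd z * \<sigma>)))"
    by (intro continuous_intros) simp
  then show ?thesis
    by (rule continuous_on_eq) (use eq in auto)
qed

end

section \<open>Pairing the connected solution\<close>

text \<open>The two instances of Green's identity have the same left-hand side: first the dual
  solution is \<open>u\<close> and the fields belong to \<open>Y\<close>, then the roles are
  exchanged. As A Y_tt - B Y_xx = A w1, the initial velocity appears as a source, and the initial
  displacement is Y_t at time 0. The interface terms stay; they cancel only between the two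
  sides.\<close>

lemma (in cauchy_quadrant) green_pairing:
  fixes \<zeta> \<zeta>x \<zeta>t \<zeta>xx \<zeta>tt :: "real \<Rightarrow> real \<Rightarrow> complex"
  assumes A: "A > 0" "B = A * c\<^sup>2" and s: "s \<ge> 0"
    and cont: "continuous2 UNIV \<zeta>" "continuous2 UNIV \<zeta>x" "continuous2 UNIV \<zeta>t" "continuous2 UNIV \<zeta>xx" "continuous2 UNIV \<zeta>tt"
    and dx: "\<And>x \<tau>. ((\<lambda>x. \<zeta> x \<tau>) has_vector_derivative \<zeta>x x \<tau>) (at x)"
    and dt: "\<And>x \<tau>. ((\<lambda>\<tau>. \<zeta> x \<tau>) has_vector_derivative \<zeta>t x \<tau>) (at \<tau>)"
    and dxx: "\<And>x \<tau>. ((\<lambda>x. \<zeta>x x \<tau>) has_vector_derivative \<zeta>xx x \<tau>) (at x)"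
    and dtt: "\<And>x \<tau>. ((\<lambda>\<tau>. \<zeta>t x \<tau>) has_vector_derivative \<zeta>tt x \<tau>) (at \<tau>)"
    and eqn: "\<And>x \<tau>. A *\<^sub>R \<zeta>tt x \<tau> = B *\<^sub>R \<zeta>xx x \<tau>"
    and init: "\<And>x. \<zeta> x 0 = 0" "\<And>x. x \<ge> 0 \<Longrightarrow> A *\<^sub>R \<zeta>t x 0 = G x"
    and far: "\<And>\<tau>. \<tau> \<in> {0..s} \<Longrightarrow> \<zeta> L \<tau> = 0" "\<And>\<tau>. \<tau> \<in> {0..s} \<Longrightarrow> \<zeta>x L \<tau> = 0"
  shows "integral {0..L} (\<lambda>x. G x * Y x s) =
    rect_integral L s (\<lambda>x t. (A *\<^sub>R w1 x) * \<zeta> x (s - t)) + integral {0..L} (\<lambda>x. (A *\<^sub>R w0 x) * \<zeta> x s)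
    - integral {0..s} (\<lambda>t. (B *\<^sub>R Yx 0 t) * \<zeta> 0 (s - t)) + integral {0..s} (\<lambda>t. (B *\<^sub>R \<zeta>x 0 (s - t)) * Y 0 t)"
proof -
  let ?R = "{0..L} \<times> {0..s}"
  have L0: "L \<ge> 0" using L by simp
  have time: "continuous2 ?R (\<lambda>x t. f x (s - t))" if "continuous2 UNIV f" for f :: "real \<Rightarrow> real \<Rightarrow> complex"
    by (rule continuous_on_compose2[OF that, of ?R "\<lambda>z. (fst z, s - snd z)", simplified]) (intro continuous_intros)
  note ct = cont[THEN time]
  have cY: "continuous2 ?R Y" "continuous2 ?R Yx" "continuous2 ?R p" "continuous2 ?R v"
    by (rule continuous_on_subset[OF Y_cont], force, rule continuous_on_subset[OF Yx_cont], force,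
        rule continuous_on_subset[OF p_cont], force, rule continuous_on_subset[OF v_cont], force)
  have cw1: "continuous2 ?R (\<lambda>x t. w1 x)"
    by (intro continuous_on_UNIV_compose[OF w1_cont] continuous_intros)
  \<comment> \<open>The dual solution is run backwards from the terminal time \<open>s\<close>,
    where its displacement is 0 and A times its velocity is \<open>G\<close>, up to sign.\<close>
  have rt: "((\<lambda>t. s - t) has_real_derivative - 1) (at t)" for t
    by (auto intro!: derivative_eq_intros)
  have \<zeta>_t: "((\<lambda>t. \<zeta> x (s - t)) has_vector_derivative - \<zeta>t x (s - t)) (at t)" for x t
    using has_vector_derivative_chain_real[OF dt rt] by simp
  have \<zeta>t_t: "((\<lambda>t. - (A *\<^sub>R \<zeta>t x (s - t))) has_vector_derivative A *\<^sub>R \<zeta>tt x (s - t)) (at t)" for x t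
    using has_vector_derivative_minus[OF has_vector_derivative_scaleR_const[OF has_vector_derivative_chain_real[OF dtt rt], of A]] by simp
  have 1: "rect_integral L s (\<lambda>x t. (B *\<^sub>R Yx x t) * \<zeta>x x (s - t) - (A *\<^sub>R p x t) * - \<zeta>t x (s - t))
    = rect_integral L s (\<lambda>x t. (A *\<^sub>R v x t - A *\<^sub>R (v x t - w1 x)) * \<zeta> x (s - t))
      - integral {0..L} (\<lambda>x. (A *\<^sub>R p x s) * \<zeta> x (s - s) - (A *\<^sub>R p x 0) * \<zeta> x (s - 0))
      + integral {0..s} (\<lambda>t. (B *\<^sub>R Yx L t) * \<zeta> L (s - t) - (B *\<^sub>R Yx 0 t) * \<zeta> 0 (s - t))"
  proof (rule green_identity[OF L0 s])
    show "((\<lambda>x. B *\<^sub>R Yx x t) has_vector_derivative A *\<^sub>R (v x t - w1 x)) (at x)"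
      if "x \<in> {0<..<L}" "t \<in> {0..s}" for x t
      using has_vector_derivative_scaleR_const[OF Yx_x[of x t], of B] that A c by simp
    show "((\<lambda>t. A *\<^sub>R p x t) has_vector_derivative A *\<^sub>R v x t) (at t)"
      if "x \<in> {0..L}" "t \<in> {0<..<s}" for x t
      using has_vector_derivative_scaleR_const[OF p_t[of x t], of A] that by simp
  qed (intro continuous_intros ct cY cw1 dx \<zeta>_t)+
  have 2: "rect_integral L s (\<lambda>x t. (B *\<^sub>R \<zeta>x x (s - t)) * Yx x t - (- (A *\<^sub>R \<zeta>t x (s - t))) * p x t)
    = rect_integral L s (\<lambda>x t. (A *\<^sub>R \<zeta>tt x (s - t) - B *\<^sub>R \<zeta>xx x (s - t)) * Y x t)
      - integral {0..L} (\<lambda>x. (- (A *\<^sub>R \<zeta>t x (s - s))) * Y x s - (- (A *\<^sub>R \<zeta>t x (s - 0))) * Y x 0)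
      + integral {0..s} (\<lambda>t. (B *\<^sub>R \<zeta>x L (s - t)) * Y L t - (B *\<^sub>R \<zeta>x 0 (s - t)) * Y 0 t)"
  proof (rule green_identity[OF L0 s])
    show "((\<lambda>x. Y x t) has_vector_derivative Yx x t) (at x)" if "x \<in> {0<..<L}" "t \<in> {0..s}" for x t
      by (rule Y_x) (use that in auto)
    show "((\<lambda>t. Y x t) has_vector_derivative p x t) (at t)" if "x \<in> {0..L}" "t \<in> {0<..<s}" for x t
      by (rule Y_t) (use that in auto)
  qed (intro continuous_intros ct cY has_vector_derivative_scaleR_const dxx \<zeta>t_t)+
  have lhs: "rect_integral L s (\<lambda>x t. (B *\<^sub>R Yx x t) * \<zeta>x x (s - t) - (A *\<^sub>R p x t) * - \<zeta>t x (s - t))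
     = rect_integral L s (\<lambda>x t. (B *\<^sub>R \<zeta>x x (s - t)) * Yx x t - (- (A *\<^sub>R \<zeta>t x (s - t))) * p x t)"
    by (rule rect_integral_cong) (simp add: mult.commute)
  have a1: "integral {0..L} (\<lambda>x. (A *\<^sub>R p x s) * \<zeta> x (s - s) - (A *\<^sub>R p x 0) * \<zeta> x (s - 0))
      = integral {0..L} (\<lambda>x. - ((A *\<^sub>R w0 x) * \<zeta> x s))"
    by (rule integral_cong) (simp add: init p_init)
  have a2: "integral {0..s} (\<lambda>t. (B *\<^sub>R Yx L t) * \<zeta> L (s - t) - (B *\<^sub>R Yx 0 t) * \<zeta> 0 (s - t))
      = integral {0..s} (\<lambda>t. - ((B *\<^sub>R Yx 0 t) * \<zeta> 0 (s - t)))"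
    by (rule integral_cong) (simp add: far)
  have b0: "rect_integral L s (\<lambda>x t. (A *\<^sub>R \<zeta>tt x (s - t) - B *\<^sub>R \<zeta>xx x (s - t)) * Y x t) = 0"
    by (simp add: eqn rect_integral_def)
  have b1: "integral {0..L} (\<lambda>x. (- (A *\<^sub>R \<zeta>t x (s - s))) * Y x s - (- (A *\<^sub>R \<zeta>t x (s - 0))) * Y x 0)
      = integral {0..L} (\<lambda>x. - (G x * Y x s))"
    by (rule integral_cong) (simp add: init Y_0)
  have b2: "integral {0..s} (\<lambda>t. (B *\<^sub>R \<zeta>x L (s - t)) * Y L t - (B *\<^sub>R \<zeta>x 0 (s - t)) * Y 0 t)
      = integral {0..s} (\<lambda>t. - ((B *\<^sub>R \<zeta>x 0 (s - t)) * Y 0 t))"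
    by (rule integral_cong) (simp add: far)
  have c1: "rect_integral L s (\<lambda>x t. (A *\<^sub>R v x t - A *\<^sub>R (v x t - w1 x)) * \<zeta> x (s - t))
      = rect_integral L s (\<lambda>x t. (A *\<^sub>R w1 x) * \<zeta> x (s - t))"
    by (rule rect_integral_cong) (simp add: scaleR_diff_right)
  show ?thesis
    using 1 2 unfolding lhs a1 a2 b0 b1 b2 c1 by simp
qed

locale transmission_solution = transmission_dual +
  fixes p v :: "real \<Rightarrow> real \<Rightarrow> real \<Rightarrow> complex" and w0 w0' w1 :: "real \<Rightarrow> real \<Rightarrow> complex" and L S :: real
  assumes quadrant: "\<And>e. e \<in> {1, - 1} \<Longrightarrow> cauchy_quadrant (p e) (v e) (speed e) (w0 e) (w0' e) (w1 e) L"
    and S: "S \<ge> 0" and L_range: "L \<ge> range_at S"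
    and interface: "\<And>t. t \<ge> 0 \<Longrightarrow> p 1 0 t = p (- 1) 0 t"
    and flux: "\<And>t. t \<ge> 0 \<Longrightarrow> B 1 *\<^sub>R cauchy_quadrant.Yx (p 1) (speed 1) (w0 1) (w1 1) L 0 t
       + B (- 1) *\<^sub>R cauchy_quadrant.Yx (p (- 1)) (speed (- 1)) (w0 (- 1)) (w1 (- 1)) L 0 t = 0"
begin

text \<open>The interface terms cancel crosswise: the dual solution is continuous while the
  integrated fluxes of the solution add up to 0, and the solution is continuous while the dual
  fluxes add up to 0.\<close>

lemma integrated_pairing:
  assumes s: "s \<in> {0..S}"
  shows "(\<Sum>e\<in>{1, - 1}. integral {0..L} (\<lambda>x. G e x * integral {0..s} (p e x)))
    = (\<Sum>e\<in>{1, - 1}. rect_integral L s (\<lambda>x t. (A e *\<^sub>R w1 e x) * \<zeta> e x (s - t)) + integral {0..L} (\<lambda>x. (A e *\<^sub>R w0 e x) * \<zeta> e x s))"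
proof -
  define Yx where "Yx = (\<lambda>e. cauchy_quadrant.Yx (p e) (speed e) (w0 e) (w1 e) L)"
  define b1 where "b1 = (\<lambda>e. integral {0..s} (\<lambda>t. (B e *\<^sub>R Yx e 0 t) * \<zeta> e 0 (s - t)))"
  define b2 where "b2 = (\<lambda>e. integral {0..s} (\<lambda>t. (B e *\<^sub>R \<zeta>x e 0 (s - t)) * integral {0..t} (p e 0)))"
  have G: "integral {0..L} (\<lambda>x. G e x * integral {0..s} (p e x)) =
    rect_integral L s (\<lambda>x t. (A e *\<^sub>R w1 e x) * \<zeta> e x (s - t)) + integral {0..L} (\<lambda>x. (A e *\<^sub>R w0 e x) * \<zeta> e x s)
    - b1 e + b2 e" if e: "e \<in> {1, - 1}" for e
  proof -
    interpret q: cauchy_quadrant "p e" "v e" "speed e" "w0 e" "w0' e" "w1 e" L by (rule quadrant[OF e])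
    have "integral {0..L} (\<lambda>x. G e x * q.Y x s) =
      rect_integral L s (\<lambda>x t. (A e *\<^sub>R w1 e x) * \<zeta> e x (s - t)) + integral {0..L} (\<lambda>x. (A e *\<^sub>R w0 e x) * \<zeta> e x s)
      - integral {0..s} (\<lambda>t. (B e *\<^sub>R q.Yx 0 t) * \<zeta> e 0 (s - t)) + integral {0..s} (\<lambda>t. (B e *\<^sub>R \<zeta>x e 0 (s - t)) * q.Y 0 t)"
    proof (rule q.green_pairing[where \<zeta>t = "\<zeta>t e" and \<zeta>xx = "\<zeta>xx e" and \<zeta>tt = "\<zeta>tt e"])
      show "B e = A e * (speed e)\<^sup>2" using pos(1)[of e] by (simp add: speed_sq)
      show "\<zeta> e L \<tau> = 0" "\<zeta>x e L \<tau> = 0" if "\<tau> \<in> {0..s}" for \<tau>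
        using dual_support[OF e, of \<tau> S L] that s L_range by auto
      show "A e *\<^sub>R \<zeta>tt e x \<tau> = B e *\<^sub>R \<zeta>xx e x \<tau>" for x \<tau> by (rule dual_equation)
    qed (use s in \<open>auto intro: pos continuous2_dual dual_x dual_t dual_xx dual_tt dual_initial\<close>)
    then show ?thesis by (simp add: q.Y_def b1_def b2_def Yx_def)
  qed
  have "b1 1 + b1 (- 1) = 0"
  proof -
    have c: "continuous_on {0..s} (\<lambda>t. (B e *\<^sub>R Yx e 0 t) * \<zeta> e 0 (s - t))" if e: "e \<in> {1, - 1}" for e
    proof -
      interpret q: cauchy_quadrant "p e" "v e" "speed e" "w0 e" "w0' e" "w1 e" L by (rule quadrant[OF e])
      have "continuous_on {0..s} (Yx e 0)"
        unfolding Yx_def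
        by (rule continuous_on_subset[OF continuous2_slice_t[OF q.Yx_cont]]) (use q.L in auto)
      moreover have "continuous_on {0..s} (\<lambda>t. \<zeta> e 0 (s - t))"
        by (rule continuous_on_compose2[OF continuous2_slice_t[of UNIV UNIV]])
          (use continuous2_dual(1)[of UNIV e] in \<open>auto intro!: continuous_intros\<close>)
      ultimately show ?thesis by (intro continuous_intros)
    qed
    have "b1 1 + b1 (- 1) = integral {0..s} (\<lambda>t. (B 1 *\<^sub>R Yx 1 0 t) * \<zeta> 1 0 (s - t) + (B (- 1) *\<^sub>R Yx (- 1) 0 t) * \<zeta> (- 1) 0 (s - t))"
      unfolding b1_def
      by (rule Henstock_Kurzweil_Integration.integral_add[symmetric]) (intro integrable_continuous_real c; simp)+
    also have "\<dots> = integral {0..s} (\<lambda>t. 0)"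
    proof (rule integral_cong)
      fix t assume t: "t \<in> {0..s}"
      have "\<zeta> 1 0 (s - t) = \<zeta> (- 1) 0 (s - t)"
        using dual_continuous_at_interface[of "s - t" 1] t by simp
      then have "(B 1 *\<^sub>R Yx 1 0 t) * \<zeta> 1 0 (s - t) + (B (- 1) *\<^sub>R Yx (- 1) 0 t) * \<zeta> (- 1) 0 (s - t)
          = (B 1 *\<^sub>R Yx 1 0 t + B (- 1) *\<^sub>R Yx (- 1) 0 t) * \<zeta> (- 1) 0 (s - t)"
        by (simp only: distrib_right)
      also have "\<dots> = 0" using flux[of t] t by (simp add: Yx_def)
      finally show "(B 1 *\<^sub>R Yx 1 0 t) * \<zeta> 1 0 (s - t) + (B (- 1) *\<^sub>R Yx (- 1) 0 t) * \<zeta> (- 1) 0 (s - t) = 0" .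
    qed
    finally show ?thesis by simp
  qed
  moreover have "b2 1 + b2 (- 1) = 0"
  proof -
    have c: "continuous_on {0..s} (\<lambda>t. (B e *\<^sub>R \<zeta>x e 0 (s - t)) * integral {0..t} (p e 0))" if e: "e \<in> {1, - 1}" for e
    proof -
      interpret q: cauchy_quadrant "p e" "v e" "speed e" "w0 e" "w0' e" "w1 e" L by (rule quadrant[OF e])
      have "continuous_on {0..s} (\<lambda>t. integral {0..t} (p e 0))"
        using q.Y_line_cont[of 0 s] by (simp add: q.Y_def[abs_def])
      moreover have "continuous_on {0..s} (\<lambda>t. \<zeta>x e 0 (s - t))"
        by (rule continuous_on_compose2[OF continuous2_slice_t[of UNIV UNIV]])
          (use continuous2_dual(2)[of UNIV e] in \<open>auto intro!: continuous_intros\<close>)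
      ultimately show ?thesis by (intro continuous_intros)
    qed
    have "b2 1 + b2 (- 1) = integral {0..s} (\<lambda>t. (B 1 *\<^sub>R \<zeta>x 1 0 (s - t)) * integral {0..t} (p 1 0)
        + (B (- 1) *\<^sub>R \<zeta>x (- 1) 0 (s - t)) * integral {0..t} (p (- 1) 0))"
      unfolding b2_def
      by (rule Henstock_Kurzweil_Integration.integral_add[symmetric]) (intro integrable_continuous_real c; simp)+
    also have "\<dots> = integral {0..s} (\<lambda>t. 0)"
    proof (rule integral_cong)
      fix t assume t: "t \<in> {0..s}"
      have i: "integral {0..t} (p 1 0) = integral {0..t} (p (- 1) 0)"
        by (rule integral_cong) (simp add: interface)
      have "(B 1 *\<^sub>R \<zeta>x 1 0 (s - t)) * integral {0..t} (p 1 0) + (B (- 1) *\<^sub>R \<zeta>x (- 1) 0 (s - t)) * integral {0..t} (p (- 1) 0)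
          = (B 1 *\<^sub>R \<zeta>x 1 0 (s - t) + B (- 1) *\<^sub>R \<zeta>x (- 1) 0 (s - t)) * integral {0..t} (p (- 1) 0)"
        unfolding i by (simp only: distrib_right)
      also have "\<dots> = 0" using dual_flux_at_interface[of "s - t" 1] t by simp
      finally show "(B 1 *\<^sub>R \<zeta>x 1 0 (s - t)) * integral {0..t} (p 1 0) + (B (- 1) *\<^sub>R \<zeta>x (- 1) 0 (s - t)) * integral {0..t} (p (- 1) 0) = 0" .
    qed
    finally show ?thesis by simp
  qed
  ultimately have b: "b1 1 + b1 (- 1) = 0" "b2 1 + b2 (- 1) = 0" by auto
  have "x1 = r1 - y1 + z1 \<Longrightarrow> x2 = r2 - y2 + z2 \<Longrightarrow> y1 + y2 = 0 \<Longrightarrow> z1 + z2 = 0 \<Longrightarrow> x1 + x2 = r1 + r2"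
    for x1 x2 r1 r2 y1 y2 z1 z2 :: complex
  proof -
    assume x: "x1 = r1 - y1 + z1" "x2 = r2 - y2 + z2" and yz: "y1 + y2 = 0" "z1 + z2 = 0"
    have "x1 + x2 = (r1 + r2) - (y1 + y2) + (z1 + z2)" unfolding x by simp
    then show "x1 + x2 = r1 + r2" by (simp only: yz) simp
  qed
  from this[OF G[of 1] G[of "-1"] b] show ?thesis by simp
qed

text \<open>Differentiating the previous identity with respect to the terminal time.\<close>

lemma pairing:
  assumes s: "s \<in> {0<..<S}"
  shows "(\<Sum>e\<in>{1, - 1}. integral {0..L} (\<lambda>x. G e x * p e x s))
    = (\<Sum>e\<in>{1, - 1}. integral {0..L} (\<lambda>x. (A e *\<^sub>R w1 e x) * \<zeta> e x s) + integral {0..L} (\<lambda>x. (A e *\<^sub>R w0 e x) * \<zeta>t e x s))"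
proof -
  have lhs: "((\<lambda>s. integral {0..L} (\<lambda>x. G e x * integral {0..s} (p e x))) has_vector_derivative
      integral {0..L} (\<lambda>x. G e x * p e x s)) (at s)" if e: "e \<in> {1, - 1}" for e
  proof -
    interpret q: cauchy_quadrant "p e" "v e" "speed e" "w0 e" "w0' e" "w1 e" L by (rule quadrant[OF e])
    have "((\<lambda>s. integral (cbox 0 L) (\<lambda>x. G e x * q.Y x s)) has_vector_derivative
        integral (cbox 0 L) (\<lambda>x. G e x * p e x s)) (at s within {0<..<S})"
    proof (rule leibniz_rule_vector_derivative)
      show "((\<lambda>s. G e x * q.Y x s) has_vector_derivative G e x * p e x u) (at u within {0<..<S})"
        if "u \<in> {0<..<S}" "x \<in> cbox 0 L" for u x
        by (rule has_vector_derivative_at_within[OF has_vector_derivative_mult_right[OF q.Y_t]]) (use that in auto)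
      show "(\<lambda>x. G e x * q.Y x u) integrable_on cbox 0 L" if "u \<in> {0<..<S}" for u
        using that by (auto intro!: integrable_continuous_real continuous_intros continuous_on_subset[OF G_cont]
            continuous_on_subset[OF continuous2_slice_x[OF q.Y_cont]])
      have "continuous_on ({0<..<S} \<times> cbox 0 L) (\<lambda>z. p e (snd z) (fst z))"
        by (rule continuous_on_compose2[OF q.p_cont, of _ "\<lambda>z. (snd z, fst z)", simplified]) (auto intro!: continuous_intros)
      then show "continuous_on ({0<..<S} \<times> cbox 0 L) (\<lambda>(u, x). G e x * p e x u)"
        unfolding case_prod_beta by (intro continuous_intros continuous_on_UNIV_compose[OF G_cont]) auto
    qed (use s in auto)
    then show ?thesis
      using s by (simp add: q.Y_def at_within_open[of s "{0<..<S}"])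
  qed
  have rhs: "((\<lambda>s. rect_integral L s (\<lambda>x t. (A e *\<^sub>R w1 e x) * \<zeta> e x (s - t)) + integral {0..L} (\<lambda>x. (A e *\<^sub>R w0 e x) * \<zeta> e x s))
      has_vector_derivative integral {0..L} (\<lambda>x. (A e *\<^sub>R w1 e x) * \<zeta> e x s) + integral {0..L} (\<lambda>x. (A e *\<^sub>R w0 e x) * \<zeta>t e x s)) (at s within {0<..<S})"
    if e: "e \<in> {1, - 1}" for e
  proof -
    interpret q: cauchy_quadrant "p e" "v e" "speed e" "w0 e" "w0' e" "w1 e" L by (rule quadrant[OF e])
    define k where "k = (\<lambda>\<tau>. integral {0..L} (\<lambda>x. (A e *\<^sub>R w1 e x) * \<zeta> e x \<tau>))"
    have c1: "continuous2 ({0..L} \<times> UNIV) (\<lambda>x \<tau>. (A e *\<^sub>R w1 e x) * \<zeta> e x \<tau>)"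
      by (intro continuous_intros continuous_on_UNIV_compose[OF q.w1_cont] continuous2_dual)
    have w0_cont: "continuous_on UNIV (w0 e)"
      by (rule has_vector_derivative_imp_continuous_on[OF q.w0_deriv])
    have "continuous_on UNIV k"
      unfolding k_def by (rule continuous2_integral_x[OF c1])
    then obtain N where N: "\<forall>x. (N has_vector_derivative k x) (at x)"
      using antiderivative_exists by blast
    \<comment> \<open>The Duhamel term is the integral of k(u - t) over 0 <= t <= u, hence an
      increment of a primitive of \<open>k\<close>; its derivative in the terminal time is
      \<open>k\<close> itself.\<close>
    have r: "rect_integral L u (\<lambda>x t. (A e *\<^sub>R w1 e x) * \<zeta> e x (u - t)) = N u - N 0" if u: "u \<ge> 0" for u
    proof -
      have "((\<lambda>t. k (u - t)) has_integral - N (u - u) - - N (u - 0)) {0..u}"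
      proof (rule fundamental_theorem_of_calculus[OF u])
        fix t
        have "((\<lambda>t. u - t) has_real_derivative - 1) (at t)"
          by (auto intro!: derivative_eq_intros)
        from has_vector_derivative_minus[OF has_vector_derivative_chain_real[OF spec[OF N] this]]
        show "((\<lambda>t. - N (u - t)) has_vector_derivative k (u - t)) (at t within {0..u})"
          by (simp add: has_vector_derivative_at_within)
      qed
      from integral_unique[OF this] show ?thesis
        by (simp add: rect_integral_def k_def)
    qed
    have "((\<lambda>s. integral (cbox 0 L) (\<lambda>x. (A e *\<^sub>R w0 e x) * \<zeta> e x s)) has_vector_derivative
        integral (cbox 0 L) (\<lambda>x. (A e *\<^sub>R w0 e x) * \<zeta>t e x s)) (at s within {0<..<S})"
    proof (rule leibniz_rule_vector_derivative)
      show "((\<lambda>s. (A e *\<^sub>R w0 e x) * \<zeta> e x s) has_vector_derivative (A e *\<^sub>R w0 e x) * \<zeta>t e x u) (at u within {0<..<S})" for u x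
        by (rule has_vector_derivative_at_within[OF has_vector_derivative_mult_right[OF dual_t]])
      show "(\<lambda>x. (A e *\<^sub>R w0 e x) * \<zeta> e x u) integrable_on cbox 0 L" for u
        using continuous2_slice_x[of "{0..L}" UNIV "\<zeta> e" u] continuous2_dual(1)
        by (auto intro!: integrable_continuous_real continuous_intros continuous_on_subset[OF w0_cont])
      have "continuous_on ({0<..<S} \<times> cbox 0 L) (\<lambda>z. \<zeta>t e (snd z) (fst z))"
        by (rule continuous_on_compose2[OF continuous2_dual(3)[of UNIV e], of _ "\<lambda>z. (snd z, fst z)", simplified]) (auto intro!: continuous_intros)
      then show "continuous_on ({0<..<S} \<times> cbox 0 L) (\<lambda>(u, x). (A e *\<^sub>R w0 e x) * \<zeta>t e x u)"
        unfolding case_prod_beta by (intro continuous_intros continuous_on_UNIV_compose[OF w0_cont]) auto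
    qed (use s in auto)
    moreover have "((\<lambda>s. N s - N 0) has_vector_derivative k s) (at s within {0<..<S})"
      using has_vector_derivative_at_within[OF has_vector_derivative_diff[OF spec[OF N] has_vector_derivative_const]] by simp
    ultimately have D: "((\<lambda>s. N s - N 0 + integral {0..L} (\<lambda>x. (A e *\<^sub>R w0 e x) * \<zeta> e x s)) has_vector_derivative
        k s + integral {0..L} (\<lambda>x. (A e *\<^sub>R w0 e x) * \<zeta>t e x s)) (at s within {0<..<S})"
      using has_vector_derivative_add by fastforce
    show ?thesis
      by (rule has_vector_derivative_transform[OF s _ D[unfolded k_def]])
        (rule arg_cong2[where f = "(+)", OF r refl], simp)
  qed
  have l2: "((\<lambda>s. \<Sum>e\<in>{1, - 1}. integral {0..L} (\<lambda>x. G e x * integral {0..s} (p e x))) has_vector_derivative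
      (\<Sum>e\<in>{1, - 1}. integral {0..L} (\<lambda>x. G e x * p e x s))) (at s within {0<..<S})"
    by (rule has_vector_derivative_sum) (use lhs in \<open>auto intro: has_vector_derivative_at_within\<close>)
  have r2: "((\<lambda>s. \<Sum>e\<in>{1, - 1}. rect_integral L s (\<lambda>x t. (A e *\<^sub>R w1 e x) * \<zeta> e x (s - t)) + integral {0..L} (\<lambda>x. (A e *\<^sub>R w0 e x) * \<zeta> e x s))
      has_vector_derivative (\<Sum>e\<in>{1, - 1}. integral {0..L} (\<lambda>x. (A e *\<^sub>R w1 e x) * \<zeta> e x s) + integral {0..L} (\<lambda>x. (A e *\<^sub>R w0 e x) * \<zeta>t e x s)))
      (at s within {0<..<S})"
    by (rule has_vector_derivative_sum) (use rhs in auto)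
  have "((\<lambda>s. \<Sum>e\<in>{1, - 1}. integral {0..L} (\<lambda>x. G e x * integral {0..s} (p e x))) has_vector_derivative
      (\<Sum>e\<in>{1, - 1}. integral {0..L} (\<lambda>x. (A e *\<^sub>R w1 e x) * \<zeta> e x s) + integral {0..L} (\<lambda>x. (A e *\<^sub>R w0 e x) * \<zeta>t e x s)))
      (at s within {0<..<S})"
    by (rule has_vector_derivative_transform[OF _ integrated_pairing r2]) (use s in auto)
  with l2 show ?thesis
    using s by (simp only: at_within_open[OF s open_greaterThanLessThan] vector_derivative_unique_at)
qed

end

section \<open>Regularised initial data\<close>

lemma smooth_on_iter_deriv:
  assumes "smooth_on U f" "vs \<in> lists Basis" "x \<in> U"
  shows "iter_deriv vs f differentiable (at x)"
  by (rule bspec[OF bspec[OF assms(1)[unfolded smooth_on_def] assms(2)] assms(3)])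

lemma smooth_real_iter_deriv:
  fixes f :: "real \<Rightarrow> 'b::real_normed_vector"
  assumes "smooth_on UNIV f" "vs \<in> lists Basis"
  shows "(iter_deriv vs f has_vector_derivative iter_deriv (1 # vs) f x) (at x)"
proof -
  define D where "D = frechet_derivative (iter_deriv vs f) (at x)"
  have "iter_deriv vs f differentiable (at x)"
    by (rule smooth_on_iter_deriv[OF assms]) simp
  then have D: "(iter_deriv vs f has_derivative D) (at x)"
    unfolding D_def by (simp add: frechet_derivative_works)
  have "D h = h *\<^sub>R D 1" for h
    using linear_scale[OF has_derivative_linear[OF D], of h 1] by (simp only: real_scaleR_def mult_1_right)
  then have eq: "D = (\<lambda>h. h *\<^sub>R D 1)"
    by (rule ext)
  have "(iter_deriv vs f has_derivative (\<lambda>h. h *\<^sub>R D 1)) (at x)"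
    by (rule has_derivative_eq_rhs[OF D eq])
  then show ?thesis
    unfolding has_vector_derivative_def D_def iter_deriv.simps .
qed

text \<open>The bridge from the Lebesgue integrals in the Sobolev seminorms to the gauge integrals
  over boxes in which the energies are written.\<close>

lemma integral_le_set_integral:
  fixes f :: "'a::euclidean_space \<Rightarrow> real"
  assumes int: "set_integrable lborel U f" and sub: "cbox a b \<subseteq> U" and nn: "\<And>z. z \<in> U \<Longrightarrow> f z \<ge> 0"
  shows "integral (cbox a b) f \<le> (LINT z:U|lborel. f z)"
proof -
  have i: "set_integrable lborel (cbox a b) f"
    by (rule set_integrable_subset[OF int]) (use sub in auto)
  have "integral (cbox a b) f = (LINT z:cbox a b|lborel. f z)"
    by (rule set_borel_integral_eq_integral(2)[OF i, symmetric])
  also have "\<dots> \<le> (LINT z:U|lborel. f z)"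
    unfolding set_lebesgue_integral_def
    by (rule integral_mono) (use i int sub nn in \<open>auto simp: set_integrable_def indicator_def split: if_splits\<close>)
  finally show ?thesis .
qed

lemma compact_supp_radius:
  fixes f :: "real \<Rightarrow> 'b::zero"
  assumes "compact (supp f)"
  shows "\<exists>R>0. \<forall>x. \<bar>x\<bar> > R \<longrightarrow> f x = 0"
proof -
  obtain R where R: "R > 0" "\<forall>x\<in>supp f. norm x \<le> R"
    using compact_imp_bounded[OF assms] unfolding bounded_pos by blast
  have "f x = 0" if "\<bar>x\<bar> > R" for x
  proof -
    have "x \<notin> supp f" using R(2) that by force
    then show ?thesis by (rule not_in_supp)
  qed
  with R(1) show ?thesis by blast
qed

lemma iter_deriv_zero_outside:
  fixes f :: "real \<Rightarrow> 'b::real_normed_vector"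
  assumes "\<And>x. \<bar>x\<bar> > r \<Longrightarrow> f x = 0" "\<bar>x\<bar> > r"
  shows "iter_deriv vs f x = 0"
  using assms(2)
proof (induction vs arbitrary: x)
  case (Cons v vs)
  have "open {x::real. \<bar>x\<bar> > r}"
    by (intro open_Collect_less continuous_intros)
  then have "(iter_deriv vs f has_derivative (\<lambda>_. 0)) (at x)"
    by (rule has_derivative_transform_within_open[OF has_derivative_const]) (use Cons in auto)
  then have "(\<lambda>_. 0) = frechet_derivative (iter_deriv vs f) (at x)"
    by (rule frechet_derivative_at)
  from fun_cong[OF this, of v] show ?case by simp
qed (use assms in simp)

lemma integrable_zero_outside:
  fixes f :: "real \<Rightarrow> 'b::{banach, second_countable_topology}"
  assumes "continuous_on UNIV f" "\<And>x. \<bar>x\<bar> > R \<Longrightarrow> f x = 0"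
  shows "integrable lborel f" "(LINT x|lborel. f x) = (LINT x:{-R..R}|lborel. f x)"
proof -
  have eq: "(\<lambda>x. indicator {-R..R} x *\<^sub>R f x) = f"
  proof
    fix x
    show "indicator {-R..R} x *\<^sub>R f x = f x"
      using assms(2)[of x] by (cases "\<bar>x\<bar> \<le> R") (auto simp: indicator_def abs_le_iff)
  qed
  have "integrable lborel (\<lambda>x. indicator {-R..R} x *\<^sub>R f x)"
    by (rule borel_integrable_compact) (auto intro: continuous_on_subset[OF assms(1)])
  then show "integrable lborel f" by (simp add: eq)
  show "(LINT x|lborel. f x) = (LINT x:{-R..R}|lborel. f x)"
    by (simp add: set_lebesgue_integral_def eq)
qed

lemma integral_zero_outside:
  fixes f :: "real \<Rightarrow> 'b::euclidean_space"
  assumes "continuous_on UNIV f" "\<And>x. \<bar>x\<bar> > R \<Longrightarrow> f x = 0"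
  shows "(LINT x|lborel. f x) = integral {-R..R} f"
proof -
  have i: "set_integrable lborel {-R..R} f"
    unfolding set_integrable_def
    by (rule borel_integrable_compact) (auto intro: continuous_on_subset[OF assms(1)])
  have "(LINT x|lborel. f x) = (LINT x:{-R..R}|lborel. f x)"
    by (rule integrable_zero_outside(2)) (use assms in auto)
  also have "\<dots> = integral {-R..R} f"
    by (rule set_borel_integral_eq_integral(2)[OF i])
  finally show ?thesis .
qed

section \<open>Convolution of the initial data with the mollifier\<close>

locale convolution_data =
  fixes f :: "real \<Rightarrow> complex" and R F :: real
  assumes f_cont: "continuous_on UNIV f" and f_zero: "\<And>x. \<bar>x\<bar> > R \<Longrightarrow> f x = 0" and R: "R > 0"
    and f_bound: "\<And>x. norm (f x) \<le> F"
begin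

text \<open>After the substitution the integration runs over the support of \<open>f\<close>, which
  does not depend on the mollifier, and x-derivatives fall on the smooth factor
  \<open>g\<close>.\<close>

lemma convolution_eq:
  assumes g: "continuous_on UNIV g"
  shows "convolution f g x = integral {-R..R} (\<lambda>y. f y * g (x - y))"
proof -
  have "convolution f g x = \<bar>-1\<bar> *\<^sub>R (LINT y|lborel. f (x - (x + (-1) * y)) * g (x + (-1) * y))"
    unfolding convolution_def by (rule lborel_integral_real_affine) simp
  also have "\<dots> = (LINT y|lborel. f y * g (x - y))" by simp
  also have "\<dots> = integral {-R..R} (\<lambda>y. f y * g (x - y))"
    by (rule integral_zero_outside) (auto intro!: continuous_intros f_cont continuous_on_UNIV_compose[OF g] simp: f_zero)
  finally show ?thesis .
qed

lemma convolution_has_vector_derivative: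
  assumes g: "\<And>x. (g has_vector_derivative g' x) (at x)" and g': "continuous_on UNIV g'"
  shows "(convolution f g has_vector_derivative convolution f g' x) (at x)"
proof -
  have gc: "continuous_on UNIV g"
    by (rule has_vector_derivative_imp_continuous_on[OF g])
  have "((\<lambda>x. integral (cbox (-R) R) (\<lambda>y. f y * g (x - y))) has_vector_derivative
      integral (cbox (-R) R) (\<lambda>y. f y * g' (x - y))) (at x within UNIV)"
  proof (rule leibniz_rule_vector_derivative)
    fix x y :: real
    have "((\<lambda>x. x - y) has_real_derivative 1) (at x)" by (auto intro!: derivative_eq_intros)
    from has_vector_derivative_mult_right[OF has_vector_derivative_chain_real[OF g this]]
    show "((\<lambda>x. f y * g (x - y)) has_vector_derivative f y * g' (x - y)) (at x within UNIV)" by simp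
    show "(\<lambda>y. f y * g (x - y)) integrable_on cbox (-R) R"
      by (intro integrable_continuous continuous_intros continuous_on_subset[OF f_cont] continuous_on_UNIV_compose[OF gc]) auto
    show "continuous_on (UNIV \<times> cbox (-R) R) (\<lambda>(x, y). f y * g' (x - y))"
      unfolding case_prod_beta
      by (intro continuous_intros continuous_on_UNIV_compose[OF f_cont] continuous_on_UNIV_compose[OF g'])
  qed auto
  then show ?thesis
    by (simp add: convolution_eq[OF gc, abs_def] convolution_eq[OF g'])
qed

lemma convolution_norm_le:
  assumes g: "continuous_on UNIV g" and b: "\<And>x. norm (g x) \<le> C"
  shows "norm (convolution f g x) \<le> 2 * R * F * C"
proof -
  have C: "C \<ge> 0" using b[of 0] norm_ge_zero order_trans by blast
  have "norm (integral {-R..R} (\<lambda>y. f y * g (x - y))) \<le> integral {-R..R} (\<lambda>_. F * C)"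
  proof (rule integral_norm_bound_integral)
    show "(\<lambda>y. f y * g (x - y)) integrable_on {-R..R}"
      by (intro integrable_continuous_real continuous_intros continuous_on_subset[OF f_cont] continuous_on_UNIV_compose[OF g]) auto
    show "norm (f y * g (x - y)) \<le> F * C" for y
      unfolding norm_mult using f_bound b C by (intro mult_mono) (auto intro: order_trans[OF norm_ge_zero f_bound])
  qed (simp add: integrable_continuous_real)
  then show ?thesis using R by (simp add: convolution_eq[OF g] algebra_simps)
qed

lemma convolution_zero:
  assumes g: "continuous_on UNIV g" and z: "\<And>x. \<bar>x\<bar> > r \<Longrightarrow> g x = 0" and x: "\<bar>x\<bar> > R + r"
  shows "convolution f g x = 0"
proof -
  have "integral {-R..R} (\<lambda>y. f y * g (x - y)) = integral {-R..R} (\<lambda>_. 0)"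
  proof (rule integral_cong)
    fix y assume "y \<in> {-R..R}"
    then have "\<bar>x - y\<bar> > r" using x by (auto simp: abs_if split: if_splits)
    then show "f y * g (x - y) = 0" by (simp add: z)
  qed
  then show ?thesis by (simp add: convolution_eq[OF g])
qed

lemma iter_deriv_continuous:
  fixes g :: "real \<Rightarrow> complex"
  assumes "smooth_on UNIV g" "vs \<in> lists Basis"
  shows "continuous_on UNIV (iter_deriv vs g)"
  by (rule has_vector_derivative_imp_continuous_on[OF smooth_real_iter_deriv[OF assms]])

lemma iter_deriv_convolution:
  assumes g: "smooth_on UNIV g" and vs: "vs \<in> lists Basis"
  shows "iter_deriv vs (convolution f g) = convolution f (iter_deriv vs g)"
  using vs
proof (induction vs)
  case (Cons v vs)
  then have v: "v = 1" and vs: "vs \<in> lists Basis" by auto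
  have "(1::real) # vs \<in> lists Basis" using vs by simp
  note c = iter_deriv_continuous[OF g this]
  have d: "(convolution f (iter_deriv vs g) has_vector_derivative convolution f (iter_deriv (1 # vs) g) x) (at x)" for x
    by (rule convolution_has_vector_derivative[OF smooth_real_iter_deriv[OF g vs] c])
  show ?case
    by (rule ext) (simp only: iter_deriv.simps Cons.IH v frechet_derivative_real[OF d[unfolded iter_deriv.simps]] scaleR_one)
qed simp

lemma smooth_convolution:
  assumes g: "smooth_on UNIV g"
  shows "smooth_on UNIV (convolution f g)"
  unfolding smooth_on_def
proof (intro ballI)
  fix vs :: "real list" and x :: real assume vs: "vs \<in> lists Basis"
  have vs1: "(1::real) # vs \<in> lists Basis" using vs by simp
  have "(convolution f (iter_deriv vs g) has_vector_derivative convolution f (iter_deriv (1 # vs) g) x) (at x)"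
    by (rule convolution_has_vector_derivative[OF smooth_real_iter_deriv[OF g vs] iter_deriv_continuous[OF g vs1]])
  then show "iter_deriv vs (convolution f g) differentiable at x"
    unfolding iter_deriv_convolution[OF g vs] has_vector_derivative_def differentiable_def by blast
qed

context
  fixes \<psi> :: "real \<Rightarrow> real \<Rightarrow> complex"
  assumes \<psi>: "moderate_mollifier \<psi>"
begin

lemma mollifier_W: "\<epsilon> \<in> {0<..1} \<Longrightarrow> \<psi> \<epsilon> \<in> W_infty"
  using \<psi> unfolding moderate_mollifier_def by (elim conjE) (rule moderate_netsD(1))

lemma mollifier_smooth: "\<epsilon> \<in> {0<..1} \<Longrightarrow> smooth_on UNIV (\<psi> \<epsilon>)"
  by (rule W_inftyD(1)[OF mollifier_W])

lemma mollifier_radius: "\<epsilon> \<in> {0<..1} \<Longrightarrow> \<exists>r>0. \<forall>x. \<bar>x\<bar> > r \<longrightarrow> \<psi> \<epsilon> x = 0"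
  using \<psi> unfolding moderate_mollifier_def by (elim conjE) (rule compact_supp_radius, erule (1) bspec)

lemma mollifier_small_support:
  assumes "\<delta> > 0"
  shows "\<forall>\<^sub>F \<epsilon> in at_right 0. \<forall>x. \<bar>x\<bar> \<ge> \<delta> \<longrightarrow> \<psi> \<epsilon> x = 0"
proof -
  have "\<forall>\<delta>>0. \<forall>\<^sub>F \<epsilon> in at_right 0. supp (\<psi> \<epsilon>) \<subseteq> ball 0 \<delta>"
    using \<psi> unfolding moderate_mollifier_def by (elim conjE)
  from this[rule_format, OF assms] show ?thesis
  proof eventually_elim
    case (elim \<epsilon>)
    have "\<psi> \<epsilon> x = 0" if "\<bar>x\<bar> \<ge> \<delta>" for x
    proof -
      have "x \<notin> supp (\<psi> \<epsilon>)" using elim that by force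
      then show ?thesis by (rule not_in_supp)
    qed
    then show ?case by blast
  qed
qed

lemma mollifier_continuous: "\<epsilon> \<in> {0<..1} \<Longrightarrow> continuous_on UNIV (\<psi> \<epsilon>)"
  by (rule smooth_on_imp_continuous_on[OF mollifier_smooth])

lemma mollifier_integrable:
  assumes e: "\<epsilon> \<in> {0<..1}"
  shows "integrable lborel (\<psi> \<epsilon>)"
proof -
  obtain r where "r > 0" and r: "\<forall>x. \<bar>x\<bar> > r \<longrightarrow> \<psi> \<epsilon> x = 0" using mollifier_radius[OF e] by blast
  show ?thesis
    by (rule integrable_zero_outside(1)[OF mollifier_continuous[OF e]]) (rule r[rule_format])
qed

lemma mollifier_L1: "\<exists>C\<ge>0. \<forall>\<epsilon>\<in>{0<..1}. (LINT x|lborel. norm (\<psi> \<epsilon> x)) \<le> C"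
proof -
  obtain C where C: "\<forall>\<epsilon>\<in>{0<..1}. (LINT x|lborel. norm (\<psi> \<epsilon> x)) \<le> C"
    using \<psi> unfolding moderate_mollifier_def by blast
  then have "\<forall>\<epsilon>\<in>{0<..1}. (LINT x|lborel. norm (\<psi> \<epsilon> x)) \<le> \<bar>C\<bar>"
    using abs_ge_self order_trans by blast
  then show ?thesis by (intro exI[of _ "\<bar>C\<bar>"]) simp
qed

lemma square_integrable_convolution:
  assumes e: "\<epsilon> \<in> {0<..1}" and vs: "vs \<in> lists Basis"
  shows "set_integrable lborel UNIV (\<lambda>x. (norm (iter_deriv vs (convolution f (\<psi> \<epsilon>)) x))\<^sup>2)"
proof -
  obtain r where r: "r > 0" "\<forall>x. \<bar>x\<bar> > r \<longrightarrow> \<psi> \<epsilon> x = 0" using mollifier_radius[OF e] by blast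
  note s = mollifier_smooth[OF e]
  have "integrable lborel (\<lambda>x. (norm (iter_deriv vs (convolution f (\<psi> \<epsilon>)) x))\<^sup>2)"
  proof (rule integrable_zero_outside(1))
    show "continuous_on UNIV (\<lambda>x. (norm (iter_deriv vs (convolution f (\<psi> \<epsilon>)) x))\<^sup>2)"
      by (intro continuous_intros iter_deriv_continuous smooth_convolution s vs)
    fix x :: real assume x: "\<bar>x\<bar> > R + r"
    have "convolution f (iter_deriv vs (\<psi> \<epsilon>)) x = 0"
      by (rule convolution_zero[OF iter_deriv_continuous[OF s vs] _ x]) (rule iter_deriv_zero_outside, use r in auto)
    then show "(norm (iter_deriv vs (convolution f (\<psi> \<epsilon>)) x))\<^sup>2 = 0"
      by (simp add: iter_deriv_convolution[OF s vs])
  qed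
  then show ?thesis by (simp add: set_integrable_def)
qed

text \<open>All derivatives fall on the mollifier, so the growth of its sup norms carries over with
  the same exponent.\<close>

lemma convolution_moderate:
  "(\<lambda>\<epsilon>. convolution f (\<psi> \<epsilon>)) \<in> moderate_nets (H_infty UNIV) (sobolev_seminorms UNIV)"
  unfolding moderate_nets_def mem_Collect_eq
proof (intro conjI ballI)
  fix \<epsilon> :: real assume e: "\<epsilon> \<in> {0<..1}"
  show "convolution f (\<psi> \<epsilon>) \<in> H_infty UNIV"
    unfolding H_infty_def using smooth_convolution[OF mollifier_smooth[OF e]] square_integrable_convolution[OF e] by simp
next
  fix q :: "(real \<Rightarrow> complex) \<Rightarrow> real" assume "q \<in> sobolev_seminorms UNIV"
  then obtain vs where vs: "vs \<in> lists Basis"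
    and q: "q = (\<lambda>f. sqrt (LINT z:UNIV|lborel. (norm (iter_deriv vs f z))\<^sup>2))"
    unfolding sobolev_seminorms_def by blast
  \<comment> \<open>Eventually the mollifier is supported in the unit ball, and the convolution
    vanishes outside [-Q,Q].\<close>
  define Q where "Q = R + 1"
  have F: "F \<ge> 0" using f_bound[of 0] norm_ge_zero order_trans by blast
  have m1: "\<psi> \<in> moderate_nets W_infty sup_seminorms"
    using \<psi> unfolding moderate_mollifier_def by (elim conjE)
  have m2: "(\<lambda>f. sup_norm (iter_deriv vs f)) \<in> sup_seminorms"
    unfolding sup_seminorms_def using vs by (rule imageI)
  obtain N :: nat where N: "(\<lambda>\<epsilon>. sup_norm (iter_deriv vs (\<psi> \<epsilon>))) \<in> O[at_right 0](\<lambda>\<epsilon>. 1 / \<epsilon> ^ N)"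
    using moderate_netsD(2)[OF m1 m2] by (rule exE)
  have "\<forall>\<^sub>F \<epsilon> in at_right 0. norm (q (convolution f (\<psi> \<epsilon>))) \<le> (sqrt (2 * Q) * (2 * R * F)) * norm (sup_norm (iter_deriv vs (\<psi> \<epsilon>)))"
    using mollifier_small_support[OF zero_less_one] eventually_in_unit
  proof eventually_elim
    case (elim \<epsilon>)
    note s = mollifier_smooth[OF elim(2)]
    define C where "C = sup_norm (iter_deriv vs (\<psi> \<epsilon>))"
    have C: "norm (iter_deriv vs (\<psi> \<epsilon>) x) \<le> C" for x
      unfolding C_def by (rule norm_le_sup_norm[OF W_inftyD(2)[OF mollifier_W[OF elim(2)] vs]])
    have C0: "C \<ge> 0" using C[of 0] norm_ge_zero order_trans by blast
    have b: "norm (iter_deriv vs (convolution f (\<psi> \<epsilon>)) x) \<le> 2 * R * F * C" for x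
      unfolding iter_deriv_convolution[OF s vs] by (rule convolution_norm_le[OF iter_deriv_continuous[OF s vs] C])
    have z: "iter_deriv vs (convolution f (\<psi> \<epsilon>)) x = 0" if x: "\<bar>x\<bar> > Q" for x
      unfolding iter_deriv_convolution[OF s vs]
      by (rule convolution_zero[OF iter_deriv_continuous[OF s vs] _ x[unfolded Q_def]]) (rule iter_deriv_zero_outside, use elim in auto)
    have c: "continuous_on UNIV (\<lambda>x. (norm (iter_deriv vs (convolution f (\<psi> \<epsilon>)) x))\<^sup>2)"
      by (intro continuous_intros iter_deriv_continuous smooth_convolution s vs)
    have "(LINT x:UNIV|lborel. (norm (iter_deriv vs (convolution f (\<psi> \<epsilon>)) x))\<^sup>2)
        = (LINT x|lborel. (norm (iter_deriv vs (convolution f (\<psi> \<epsilon>)) x))\<^sup>2)"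
      by (simp add: set_lebesgue_integral_def)
    also have "\<dots> = integral {-Q..Q} (\<lambda>x. (norm (iter_deriv vs (convolution f (\<psi> \<epsilon>)) x))\<^sup>2)"
      by (rule integral_zero_outside[OF c]) (simp add: z)
    also have "\<dots> \<le> integral {-Q..Q} (\<lambda>_. (2 * R * F * C)\<^sup>2)"
      by (rule integral_le) (auto intro!: integrable_continuous_real continuous_on_subset[OF c] power_mono b)
    also have "\<dots> = (2 * Q) * (2 * R * F * C)\<^sup>2" using R by (simp add: Q_def)
    finally have "q (convolution f (\<psi> \<epsilon>)) \<le> sqrt ((2 * Q) * (2 * R * F * C)\<^sup>2)"
      unfolding q by (rule real_sqrt_le_mono)
    also have "\<dots> = sqrt (2 * Q) * (2 * R * F) * C"
    proof -
      have "2 * R * F * C \<ge> 0" using C0 F R by simp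
      then have "sqrt ((2 * R * F * C)\<^sup>2) = 2 * R * F * C" by (simp only: real_sqrt_abs abs_of_nonneg)
      moreover have "sqrt ((2 * Q) * (2 * R * F * C)\<^sup>2) = sqrt (2 * Q) * sqrt ((2 * R * F * C)\<^sup>2)"
        by (rule real_sqrt_mult)
      ultimately show ?thesis by (simp only: mult.assoc)
    qed
    finally have "q (convolution f (\<psi> \<epsilon>)) \<le> sqrt (2 * Q) * (2 * R * F) * C" .
    moreover have "q (convolution f (\<psi> \<epsilon>)) \<ge> 0"
      unfolding q by (simp add: set_lebesgue_integral_def)
    ultimately show ?case using C0 by (simp add: C_def)
  qed
  then have "(\<lambda>\<epsilon>. q (convolution f (\<psi> \<epsilon>))) \<in> O[at_right 0](\<lambda>\<epsilon>. sup_norm (iter_deriv vs (\<psi> \<epsilon>)))"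
    by (rule bigoI)
  then show "\<exists>N::nat. (\<lambda>\<epsilon>. q (convolution f (\<psi> \<epsilon>))) \<in> O[at_right 0](\<lambda>\<epsilon>. 1 / \<epsilon> ^ N)"
    by (intro exI[of _ N]) (rule landau_o.big_trans[OF _ N])
qed

text \<open>The mollifier is complex-valued and its mass only tends to 1. The error splits into the
  oscillation of \<open>f\<close>, controlled by the bounded L1 norm, and \<open>f\<close> times the
  deviation of the mass from 1.\<close>

lemma convolution_uniform_limit:
  assumes \<eta>: "\<eta> > 0"
  shows "\<forall>\<^sub>F \<epsilon> in at_right 0. \<forall>x\<in>{-L..L}. norm (convolution f (\<psi> \<epsilon>) x - f x) \<le> \<eta>"
proof -
  obtain C where C: "C \<ge> 0" "\<forall>\<epsilon>\<in>{0<..1}. (LINT x|lborel. norm (\<psi> \<epsilon> x)) \<le> C"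
    using mollifier_L1 by blast
  have F: "F \<ge> 0" using f_bound[of 0] norm_ge_zero order_trans by blast
  define \<eta>' where "\<eta>' = \<eta> / (2 * (C + 1))"
  have \<eta>': "\<eta>' > 0" "\<eta>' * C \<le> \<eta> / 2" using \<eta> C by (auto simp: \<eta>'_def field_simps)
  have "uniformly_continuous_on {-L - 1..L + 1} f"
    by (rule compact_uniformly_continuous) (auto intro: continuous_on_subset[OF f_cont])
  then obtain d where d: "d > 0" "\<And>x y. x \<in> {-L - 1..L + 1} \<Longrightarrow> y \<in> {-L - 1..L + 1} \<Longrightarrow> dist y x < d \<Longrightarrow> dist (f y) (f x) < \<eta>'"
    unfolding uniformly_continuous_on_def using \<eta>'(1) by metis
  define \<delta> where "\<delta> = min d 1"
  have \<delta>: "\<delta> > 0" using d by (simp add: \<delta>_def)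
  have "((\<lambda>\<epsilon>. LINT x|lborel. \<psi> \<epsilon> x) \<longlongrightarrow> 1) (at_right 0)"
    using \<psi> unfolding moderate_mollifier_def by (elim conjE)
  then have m: "\<forall>\<^sub>F \<epsilon> in at_right 0. dist (LINT x|lborel. \<psi> \<epsilon> x) 1 < \<eta> / (2 * (F + 1))"
    by (rule tendstoD) (use \<eta> F in simp)
  from m mollifier_small_support[OF \<delta>] eventually_in_unit show ?thesis
  proof eventually_elim
    case (elim \<epsilon>)
    note int = mollifier_integrable[OF elim(3)]
    have "norm (convolution f (\<psi> \<epsilon>) x - f x) \<le> \<eta>" if x: "x \<in> {-L..L}" for x
    proof -
      have int1: "integrable lborel (\<lambda>y. f (x - y) * \<psi> \<epsilon> y)"
        by (rule integrable_zero_outside(1)[of _ \<delta>])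
          (use elim(2) in \<open>auto intro!: continuous_intros continuous_on_UNIV_compose[OF f_cont] mollifier_continuous[OF elim(3)]\<close>)
      have "norm (LINT y|lborel. f (x - y) * \<psi> \<epsilon> y - f x * \<psi> \<epsilon> y) \<le> (LINT y|lborel. \<eta>' * norm (\<psi> \<epsilon> y))"
      proof (rule Bochner_Integration.integral_norm_bound_integral)
        show "integrable lborel (\<lambda>y. f (x - y) * \<psi> \<epsilon> y - f x * \<psi> \<epsilon> y)"
          using int1 int by simp
        show "integrable lborel (\<lambda>y. \<eta>' * norm (\<psi> \<epsilon> y))" using int by simp
        show "norm (f (x - y) * \<psi> \<epsilon> y - f x * \<psi> \<epsilon> y) \<le> \<eta>' * norm (\<psi> \<epsilon> y)" for y
        proof (cases "\<bar>y\<bar> \<ge> \<delta>")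
          case False
          then have "dist (f (x - y)) (f x) < \<eta>'"
            by (intro d(2)) (use x in \<open>auto simp: \<delta>_def dist_real_def abs_if split: if_splits\<close>)
          then have "norm (f (x - y) - f x) \<le> \<eta>'" by (simp add: dist_norm)
          then show ?thesis
            by (simp only: left_diff_distrib[symmetric] norm_mult mult_right_mono norm_ge_zero)
        qed (use elim(2) in simp)
      qed
      also have "\<dots> \<le> \<eta>' * C" using C(2) elim(3) \<eta>'(1) by simp
      also have "\<dots> \<le> \<eta> / 2" by (rule \<eta>'(2))
      finally have 1: "norm (LINT y|lborel. f (x - y) * \<psi> \<epsilon> y - f x * \<psi> \<epsilon> y) \<le> \<eta> / 2" .
      have "norm (f x * ((LINT y|lborel. \<psi> \<epsilon> y) - 1)) \<le> (F + 1) * (\<eta> / (2 * (F + 1)))"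
        unfolding norm_mult using elim(1) f_bound[of x] F
        by (intro mult_mono) (auto simp: dist_norm)
      also have "\<dots> = \<eta> / 2" using F by (simp add: field_simps)
      finally have 2: "norm (f x * ((LINT y|lborel. \<psi> \<epsilon> y) - 1)) \<le> \<eta> / 2" .
      have "convolution f (\<psi> \<epsilon>) x - f x = (LINT y|lborel. f (x - y) * \<psi> \<epsilon> y - f x * \<psi> \<epsilon> y) + f x * ((LINT y|lborel. \<psi> \<epsilon> y) - 1)"
        using int1 int by (simp add: convolution_def right_diff_distrib)
      also have "norm \<dots> \<le> \<eta> / 2 + \<eta> / 2" by (rule norm_triangle_mono[OF 1 2])
      finally show ?thesis by simp
    qed
    then show ?case by blast
  qed
qed

text \<open>Here the derivative falls on \<open>f\<close> and the mollifier enters through its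
  bounded L1 norm; differentiating the mollifier would only give a moderate bound.\<close>

lemma convolution_deriv_bound:
  assumes f': "\<And>x. (f has_vector_derivative f' x) (at x)" and b: "\<And>x. norm (f' x) \<le> B"
    and f'_cont: "continuous_on UNIV f'"
  shows "\<exists>C. \<forall>\<epsilon>\<in>{0<..1}. \<forall>x. norm (iter_deriv [1] (convolution f (\<psi> \<epsilon>)) x) \<le> C"
proof -
  obtain C where C: "C \<ge> 0" "\<forall>\<epsilon>\<in>{0<..1}. (LINT x|lborel. norm (\<psi> \<epsilon> x)) \<le> C"
    using mollifier_L1 by blast
  have B: "B \<ge> 0" using b[of 0] norm_ge_zero order_trans by blast
  have "norm (iter_deriv [1] (convolution f (\<psi> \<epsilon>)) x) \<le> B * C" if e: "\<epsilon> \<in> {0<..1}" for \<epsilon> x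
  proof -
    note c = mollifier_continuous[OF e]
    obtain r where r: "r > 0" "\<forall>x. \<bar>x\<bar> > r \<longrightarrow> \<psi> \<epsilon> x = 0" using mollifier_radius[OF e] by blast
    have eq: "convolution f (\<psi> \<epsilon>) = (\<lambda>x. integral (cbox (-r) r) (\<lambda>y. f (x - y) * \<psi> \<epsilon> y))"
    proof
      fix x
      show "convolution f (\<psi> \<epsilon>) x = integral (cbox (-r) r) (\<lambda>y. f (x - y) * \<psi> \<epsilon> y)"
        unfolding convolution_def box_real
        by (rule integral_zero_outside) (use r in \<open>auto intro!: continuous_intros continuous_on_UNIV_compose[OF f_cont] c\<close>)
    qed
    have d1: "(convolution f (\<psi> \<epsilon>) has_vector_derivative integral (cbox (-r) r) (\<lambda>y. f' (x - y) * \<psi> \<epsilon> y)) (at x within UNIV)"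
      unfolding eq
    proof (rule leibniz_rule_vector_derivative)
      fix x y :: real
      have "((\<lambda>x. x - y) has_real_derivative 1) (at x)" by (auto intro!: derivative_eq_intros)
      from has_vector_derivative_mult_left[OF has_vector_derivative_chain_real[OF f' this]]
      show "((\<lambda>x. f (x - y) * \<psi> \<epsilon> y) has_vector_derivative f' (x - y) * \<psi> \<epsilon> y) (at x within UNIV)" by simp
      show "(\<lambda>y. f (x - y) * \<psi> \<epsilon> y) integrable_on cbox (-r) r"
        by (intro integrable_continuous continuous_intros continuous_on_subset[OF c] continuous_on_UNIV_compose[OF f_cont]) auto
      show "continuous_on (UNIV \<times> cbox (-r) r) (\<lambda>(x, y). f' (x - y) * \<psi> \<epsilon> y)"
        unfolding case_prod_beta
        by (intro continuous_intros continuous_on_UNIV_compose[OF f'_cont] continuous_on_UNIV_compose[OF c])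
    qed auto
    have d2: "(convolution f (\<psi> \<epsilon>) has_vector_derivative iter_deriv [1] (convolution f (\<psi> \<epsilon>)) x) (at x)"
      using smooth_real_iter_deriv[OF smooth_convolution[OF mollifier_smooth[OF e]], of "[]" x] by simp
    have "iter_deriv [1] (convolution f (\<psi> \<epsilon>)) x = integral {-r..r} (\<lambda>y. f' (x - y) * \<psi> \<epsilon> y)"
      using vector_derivative_unique_at[OF d2 d1] by (simp only: box_real)
    also have "norm \<dots> \<le> integral {-r..r} (\<lambda>y. B * norm (\<psi> \<epsilon> y))"
    proof (rule integral_norm_bound_integral)
      show "(\<lambda>y. f' (x - y) * \<psi> \<epsilon> y) integrable_on {-r..r}"
        by (intro integrable_continuous_real continuous_intros continuous_on_subset[OF c] continuous_on_UNIV_compose[OF f'_cont]) auto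
      show "(\<lambda>y. B * norm (\<psi> \<epsilon> y)) integrable_on {-r..r}"
        by (intro integrable_continuous_real continuous_intros continuous_on_subset[OF c]) auto
      show "norm (f' (x - y) * \<psi> \<epsilon> y) \<le> B * norm (\<psi> \<epsilon> y)" for y
        unfolding norm_mult by (intro mult_right_mono b) simp
    qed
    also have "\<dots> = B * (LINT y|lborel. norm (\<psi> \<epsilon> y))"
    proof -
      have "(LINT y|lborel. norm (\<psi> \<epsilon> y)) = integral {-r..r} (\<lambda>y. norm (\<psi> \<epsilon> y))"
        by (rule integral_zero_outside) (use r c in \<open>auto intro!: continuous_intros\<close>)
      then show ?thesis by simp
    qed
    also have "\<dots> \<le> B * C" using C(2) e B by (intro mult_left_mono) auto
    finally show ?thesis .
  qed
  then show ?thesis by blast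
qed

end

end

lemma norm_add_square_le: "(norm (x + y))\<^sup>2 \<le> 2 * (norm x)\<^sup>2 + 2 * (norm y)\<^sup>2"
proof -
  have "(norm (x + y))\<^sup>2 \<le> (norm x + norm y)\<^sup>2"
    by (intro power_mono norm_triangle_ineq) simp
  also have "\<dots> \<le> 2 * (norm x)\<^sup>2 + 2 * (norm y)\<^sup>2"
    using sum_squares_bound[of "norm x" "norm y"] by (simp add: power2_sum)
  finally show ?thesis .
qed

lemma negligible_seminorm:
  assumes "D \<in> negligible_nets (H_infty U) (sobolev_seminorms U)" "vs \<in> lists Basis"
  shows "\<exists>C>0. \<forall>\<^sub>F \<epsilon> in at_right 0. (LINT z:U|lborel. (norm (iter_deriv vs (D \<epsilon>) z))\<^sup>2) \<le> C * \<epsilon>\<^sup>2"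
proof -
  have "(\<lambda>f. sqrt (LINT z:U|lborel. (norm (iter_deriv vs f z))\<^sup>2)) \<in> sobolev_seminorms U"
    unfolding sobolev_seminorms_def using assms(2) by (rule imageI)
  from negligible_netsD(2)[OF assms(1) this, of 1]
  obtain C where C: "C > 0" "\<forall>\<^sub>F \<epsilon> in at_right 0. \<bar>sqrt (LINT z:U|lborel. (norm (iter_deriv vs (D \<epsilon>) z))\<^sup>2)\<bar> \<le> C * \<bar>\<epsilon> ^ 1\<bar>"
    by (rule bigo_eventually_bound)
  from C(2) have "\<forall>\<^sub>F \<epsilon> in at_right 0. (LINT z:U|lborel. (norm (iter_deriv vs (D \<epsilon>) z))\<^sup>2) \<le> C\<^sup>2 * \<epsilon>\<^sup>2"
  proof eventually_elim
    case (elim \<epsilon>)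
    define I where "I = (LINT z:U|lborel. (norm (iter_deriv vs (D \<epsilon>) z))\<^sup>2)"
    have I: "I \<ge> 0" unfolding I_def set_lebesgue_integral_def by simp
    have "(sqrt I)\<^sup>2 \<le> (C * \<bar>\<epsilon>\<bar>)\<^sup>2"
      using elim by (intro power_mono) (auto simp: I_def[symmetric] I)
    then show ?case using I by (simp add: I_def[symmetric] power_mult_distrib)
  qed
  then show ?thesis using C(1) by (intro exI[of _ "C\<^sup>2"]) simp
qed

lemma H_inftyD:
  assumes "f \<in> H_infty U"
  shows "smooth_on U f" "vs \<in> lists Basis \<Longrightarrow> set_integrable lborel U (\<lambda>z. (norm (iter_deriv vs f z))\<^sup>2)"
  using assms by (simp_all add: H_infty_def)

lemma iter_deriv_1_diff:
  fixes f g :: "real \<Rightarrow> complex"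
  assumes "smooth_on UNIV f" "smooth_on UNIV g"
  shows "iter_deriv [1] (f - g) x = iter_deriv [1] f x - iter_deriv [1] g x"
proof -
  have "((\<lambda>x. f x - g x) has_vector_derivative iter_deriv [1] f x - iter_deriv [1] g x) (at x)"
    using has_vector_derivative_diff[OF smooth_real_iter_deriv[OF assms(1), of "[]" x] smooth_real_iter_deriv[OF assms(2), of "[]" x]]
    by simp
  from frechet_derivative_real[OF this, of 1] show ?thesis
    by (simp add: fun_diff_def)
qed

lemma iter_deriv_zero: "iter_deriv vs (\<lambda>x. 0) = (\<lambda>x. 0)"
  by (induction vs) simp_all

text \<open>The initial slice differs from the convolution by a negligible net, which is small in
  L2, and the convolution converges uniformly on bounded sets. For the derivative a uniform bound is
  enough, because it enters only through the initial energy.\<close>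

lemma initial_data:
  fixes f :: "real \<Rightarrow> complex"
  assumes f_cont: "continuous_on UNIV f" and f_supp: "compact (supp f)" and \<psi>: "moderate_mollifier \<psi>"
    and eq: "G22_class UNIV v = G22_class UNIV (\<lambda>\<epsilon>. convolution f (\<psi> \<epsilon>))"
  shows "\<forall>\<epsilon>\<in>{0<..1}. smooth_on UNIV (v \<epsilon>)"
    and "((\<lambda>\<epsilon>. integral {-L..L} (\<lambda>x. (norm (v \<epsilon> x - f x))\<^sup>2)) \<longlongrightarrow> 0) (at_right 0)"
    and "f C1_differentiable_on UNIV \<Longrightarrow>
      \<exists>C. \<forall>\<^sub>F \<epsilon> in at_right 0. integral {-L..L} (\<lambda>x. (norm (iter_deriv [1] (v \<epsilon>) x))\<^sup>2) \<le> C"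
proof -
  obtain R where R: "R > 0" "\<forall>x. \<bar>x\<bar> > R \<longrightarrow> f x = 0"
    using compact_supp_radius[OF f_supp] by blast
  have bdd: "\<exists>F. \<forall>x. norm (g x) \<le> F" if g: "continuous_on UNIV g" "\<forall>x. \<bar>x\<bar> > R \<longrightarrow> g x = 0" for g :: "real \<Rightarrow> complex"
  proof -
    have "compact (g ` {-R..R})"
      by (intro compact_continuous_image continuous_on_subset[OF g(1)]) auto
    from compact_imp_bounded[OF this] obtain F where F: "\<forall>y\<in>g ` {-R..R}. norm y \<le> F"
      unfolding bounded_iff by blast
    have "norm (g x) \<le> \<bar>F\<bar>" for x
    proof (cases "\<bar>x\<bar> > R")
      case False
      then have "x \<in> {-R..R}" by auto
      then show ?thesis using F by force
    qed (use g in simp)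
    then show ?thesis by blast
  qed
  obtain F where F: "\<forall>x. norm (f x) \<le> F" using bdd[OF f_cont R(2)] by (rule exE)
  interpret convolution_data f R F
    by standard (use R F f_cont in auto)
  define u where "u = (\<lambda>\<epsilon>. convolution f (\<psi> \<epsilon>))"
  have u: "u \<in> moderate_nets (H_infty UNIV) (sobolev_seminorms UNIV)"
    unfolding u_def by (rule convolution_moderate[OF \<psi>])
  note zero' = iter_deriv_zero
  have zero: "(\<lambda>x. 0 :: complex) \<in> H_infty (UNIV :: real set)"
    by (simp add: H_infty_def smooth_on_def iter_deriv_zero set_integrable_def)
  \<comment> \<open>Only an equality of classes is given. Reflexivity puts the convolution into its
    own class, hence into the class of \<open>v\<close>, and this yields both moderateness of
    \<open>v\<close> and the negligible difference.\<close>
  have "(\<lambda>\<epsilon>. u \<epsilon> - u \<epsilon>) \<in> negligible_nets (H_infty UNIV) (sobolev_seminorms UNIV)"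
    unfolding negligible_nets_def mem_Collect_eq
  proof (intro conjI ballI allI)
    fix \<epsilon> :: real show "u \<epsilon> - u \<epsilon> \<in> H_infty UNIV"
      using zero by (simp add: fun_diff_def)
  next
    fix q :: "(real \<Rightarrow> complex) \<Rightarrow> real" and k :: nat assume "q \<in> sobolev_seminorms UNIV"
    then obtain vs where q: "q = (\<lambda>f. sqrt (LINT z:UNIV|lborel. (norm (iter_deriv vs f z))\<^sup>2))"
      unfolding sobolev_seminorms_def by (rule imageE)
    have "q (u \<epsilon> - u \<epsilon>) = 0" for \<epsilon>
      unfolding q fun_diff_def diff_self zero' by (simp add: set_lebesgue_integral_def)
    then show "(\<lambda>\<epsilon>. q (u \<epsilon> - u \<epsilon>)) \<in> O[at_right 0](\<lambda>\<epsilon>. \<epsilon> ^ k)" by simp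
  qed
  then have "u \<in> G22_class UNIV u"
    using u by (simp add: generalised_class_iff)
  then have "u \<in> G22_class UNIV v" using eq by (simp add: u_def)
  then have v: "v \<in> moderate_nets (H_infty UNIV) (sobolev_seminorms UNIV)"
    and D: "(\<lambda>\<epsilon>. v \<epsilon> - u \<epsilon>) \<in> negligible_nets (H_infty UNIV) (sobolev_seminorms UNIV)"
    by (simp_all add: generalised_class_iff)
  show smooth: "\<forall>\<epsilon>\<in>{0<..1}. smooth_on UNIV (v \<epsilon>)"
    by (rule ballI) (rule H_inftyD(1)[OF moderate_netsD(1)[OF v]])
  have us: "smooth_on UNIV (u \<epsilon>)" if "\<epsilon> \<in> {0<..1}" for \<epsilon>
    by (rule H_inftyD(1)[OF moderate_netsD(1)[OF u that]])
  have local: "\<exists>C>0. \<forall>\<^sub>F \<epsilon> in at_right 0. integral {-L..L} (\<lambda>x. (norm (iter_deriv vs (v \<epsilon> - u \<epsilon>) x))\<^sup>2) \<le> C * \<epsilon>\<^sup>2"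
    if vs: "vs \<in> lists Basis" for vs
  proof -
    obtain C where C: "C > 0" "\<forall>\<^sub>F \<epsilon> in at_right 0. (LINT z:UNIV|lborel. (norm (iter_deriv vs (v \<epsilon> - u \<epsilon>) z))\<^sup>2) \<le> C * \<epsilon>\<^sup>2"
      using negligible_seminorm[OF D vs] by blast
    from C(2) eventually_in_unit have "\<forall>\<^sub>F \<epsilon> in at_right 0. integral {-L..L} (\<lambda>x. (norm (iter_deriv vs (v \<epsilon> - u \<epsilon>) x))\<^sup>2) \<le> C * \<epsilon>\<^sup>2"
    proof eventually_elim
      case (elim \<epsilon>)
      have "set_integrable lborel UNIV (\<lambda>x. (norm (iter_deriv vs (v \<epsilon> - u \<epsilon>) x))\<^sup>2)"
        by (rule H_inftyD(2)[OF negligible_netsD(1)[OF D elim(2)] vs])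
      from integral_le_set_integral[OF this, of "-L" L] elim(1) show ?case by simp
    qed
    with C(1) show ?thesis by blast
  qed
  have sq_cont: "continuous_on S (\<lambda>x. (norm (g x))\<^sup>2)" if "continuous_on UNIV g" for g :: "real \<Rightarrow> complex" and S
    by (intro continuous_intros continuous_on_subset[OF that]) simp
  show "((\<lambda>\<epsilon>. integral {-L..L} (\<lambda>x. (norm (v \<epsilon> x - f x))\<^sup>2)) \<longlongrightarrow> 0) (at_right 0)"
  proof (rule tendstoI)
    fix \<eta> :: real assume \<eta>: "\<eta> > 0"
    obtain C where C: "C > 0" "\<forall>\<^sub>F \<epsilon> in at_right 0. integral {-L..L} (\<lambda>x. (norm (iter_deriv [] (v \<epsilon> - u \<epsilon>) x))\<^sup>2) \<le> C * \<epsilon>\<^sup>2"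
      using local[of "[]"] by auto
    have "((\<lambda>\<epsilon>. 2 * (C * \<epsilon>\<^sup>2)) \<longlongrightarrow> 2 * (C * 0\<^sup>2)) (at_right 0)"
      by (intro tendsto_intros)
    then have t: "\<forall>\<^sub>F \<epsilon> in at_right 0. 2 * (C * \<epsilon>\<^sup>2) < \<eta> / 2"
      by (rule order_tendstoD(2)) (use \<eta> in simp)
    \<comment> \<open>Chosen so that the uniform error k contributes at most 4 k^2 |L| < \<eta>/2 to
      the integral; the denominator |L| + 1 covers every sign of L.\<close>
    define k where "k = sqrt (\<eta> / (8 * (\<bar>L\<bar> + 1)))"
    have k: "k > 0" "2 * (k\<^sup>2 * (2 * \<bar>L\<bar>)) < \<eta> / 2 + 0" using \<eta> by (auto simp: k_def field_simps)
    from C(2) t convolution_uniform_limit[OF \<psi> k(1), of L] eventually_in_unit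
    show "\<forall>\<^sub>F \<epsilon> in at_right 0. dist (integral {-L..L} (\<lambda>x. (norm (v \<epsilon> x - f x))\<^sup>2)) 0 < \<eta>"
    proof eventually_elim
      case (elim \<epsilon>)
      have vc: "continuous_on UNIV (v \<epsilon>)" and uc: "continuous_on UNIV (u \<epsilon>)"
        by (rule smooth_on_imp_continuous_on, rule bspec[OF smooth elim(4)],
            rule smooth_on_imp_continuous_on, rule us[OF elim(4)])
      have i1: "(\<lambda>x. (norm (v \<epsilon> x - f x))\<^sup>2) integrable_on {-L..L}"
        by (intro integrable_continuous_real sq_cont continuous_intros vc f_cont)
      have i2: "(\<lambda>x. 2 * (norm (v \<epsilon> x - u \<epsilon> x))\<^sup>2 + 2 * k\<^sup>2) integrable_on {-L..L}"
        by (intro integrable_continuous_real continuous_intros sq_cont vc uc continuous_on_subset[OF vc] continuous_on_subset[OF uc]) auto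
      have i3: "(\<lambda>x. 2 * (norm (v \<epsilon> x - u \<epsilon> x))\<^sup>2) integrable_on {-L..L}"
        by (intro integrable_continuous_real continuous_intros continuous_on_subset[OF vc] continuous_on_subset[OF uc]) auto
      have "integral {-L..L} (\<lambda>x. (norm (v \<epsilon> x - f x))\<^sup>2) \<le> integral {-L..L} (\<lambda>x. 2 * (norm (v \<epsilon> x - u \<epsilon> x))\<^sup>2 + 2 * k\<^sup>2)"
      proof (rule integral_le[OF i1 i2])
        fix x assume x: "x \<in> {-L..L}"
        have "(norm (v \<epsilon> x - f x))\<^sup>2 \<le> 2 * (norm (v \<epsilon> x - u \<epsilon> x))\<^sup>2 + 2 * (norm (u \<epsilon> x - f x))\<^sup>2"
          using norm_add_square_le[of "v \<epsilon> x - u \<epsilon> x" "u \<epsilon> x - f x"] by simp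
        also have "(norm (u \<epsilon> x - f x))\<^sup>2 \<le> k\<^sup>2"
          using elim(3) x by (intro power_mono) (auto simp: u_def)
        finally show "(norm (v \<epsilon> x - f x))\<^sup>2 \<le> 2 * (norm (v \<epsilon> x - u \<epsilon> x))\<^sup>2 + 2 * k\<^sup>2" by simp
      qed
      also have "\<dots> = integral {-L..L} (\<lambda>x. 2 * (norm (v \<epsilon> x - u \<epsilon> x))\<^sup>2) + integral {-L..L} (\<lambda>x. 2 * k\<^sup>2)"
        by (rule Henstock_Kurzweil_Integration.integral_add[OF i3]) (simp add: integrable_continuous_real)
      also have "integral {-L..L} (\<lambda>x. 2 * k\<^sup>2) \<le> 2 * (k\<^sup>2 * (2 * \<bar>L\<bar>))"
      proof (cases "L \<ge> 0")
        case False
        then show ?thesis by (simp add: mult_nonpos_nonneg)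
      qed simp
      finally have "integral {-L..L} (\<lambda>x. (norm (v \<epsilon> x - f x))\<^sup>2) \<le> 2 * (C * \<epsilon>\<^sup>2) + 2 * (k\<^sup>2 * (2 * \<bar>L\<bar>))"
        using elim(1) by simp
      then have "integral {-L..L} (\<lambda>x. (norm (v \<epsilon> x - f x))\<^sup>2) < \<eta>" using elim(2) k(2) by linarith
      moreover have "integral {-L..L} (\<lambda>x. (norm (v \<epsilon> x - f x))\<^sup>2) \<ge> 0"
        by (rule integral_nonneg[OF i1]) simp
      ultimately show ?case by simp
    qed
  qed
  assume "f C1_differentiable_on UNIV"
  then obtain f' where "(\<forall>x\<in>UNIV. (f has_vector_derivative f' x) (at x)) \<and> continuous_on UNIV f'"
    unfolding C1_differentiable_on_def by (rule exE)
  then have f': "\<forall>x. (f has_vector_derivative f' x) (at x)" "continuous_on UNIV f'"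
    by simp_all
  have f'0: "f' x = 0" if x: "\<bar>x\<bar> > R" for x
  proof -
    have o: "open {x::real. \<bar>x\<bar> > R}"
      by (intro open_Collect_less continuous_intros)
    have xo: "x \<in> {x. \<bar>x\<bar> > R}" using x by simp
    have "((\<lambda>_. 0 :: complex) has_vector_derivative 0) (at x)" by simp
    then have "(f has_vector_derivative 0) (at x)"
      by (rule has_vector_derivative_transform_within_open[OF _ o xo]) (simp add: f_zero)
    from vector_derivative_unique_at[OF f'(1)[rule_format] this] show ?thesis .
  qed
  have f'1: "\<forall>x. \<bar>x\<bar> > R \<longrightarrow> f' x = 0" by (intro allI impI) (rule f'0)
  obtain B where B: "\<forall>x. norm (f' x) \<le> B" using bdd[OF f'(2) f'1] by (rule exE)
  obtain C1 where C1: "\<forall>\<epsilon>\<in>{0<..1}. \<forall>x. norm (iter_deriv [1] (u \<epsilon>) x) \<le> C1"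
    using convolution_deriv_bound[OF \<psi> f'(1)[rule_format] B[rule_format] f'(2)] unfolding u_def by (rule exE)
  have one: "([1] :: real list) \<in> lists Basis" by simp
  obtain C where "C > 0 \<and> (\<forall>\<^sub>F \<epsilon> in at_right 0. integral {-L..L} (\<lambda>x. (norm (iter_deriv [1] (v \<epsilon> - u \<epsilon>) x))\<^sup>2) \<le> C * \<epsilon>\<^sup>2)"
    using local[OF one] by (rule exE)
  note C = conjunct1[OF this] conjunct2[OF this]
  have "\<forall>\<^sub>F \<epsilon> in at_right 0. integral {-L..L} (\<lambda>x. (norm (iter_deriv [1] (v \<epsilon>) x))\<^sup>2) \<le> 2 * C + 2 * C1\<^sup>2 * (2 * \<bar>L\<bar>)"
    using C(2) eventually_in_unit
  proof eventually_elim
    case (elim \<epsilon>)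
    have vs: "smooth_on UNIV (v \<epsilon>)" using smooth elim(2) by blast
    note vc = iter_deriv_continuous[OF vs one] and uc = iter_deriv_continuous[OF us[OF elim(2)] one]
    note dd = iter_deriv_1_diff[OF vs us[OF elim(2)]]
    have i2: "(\<lambda>x. 2 * (norm (iter_deriv [1] (v \<epsilon> - u \<epsilon>) x))\<^sup>2) integrable_on {-L..L}"
      unfolding dd
      by (intro integrable_continuous_real continuous_intros continuous_on_subset[OF vc] continuous_on_subset[OF uc]) auto
    have "integral {-L..L} (\<lambda>x. (norm (iter_deriv [1] (v \<epsilon>) x))\<^sup>2)
        \<le> integral {-L..L} (\<lambda>x. 2 * (norm (iter_deriv [1] (v \<epsilon> - u \<epsilon>) x))\<^sup>2 + 2 * C1\<^sup>2)"
    proof (rule integral_le)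
      show "(\<lambda>x. (norm (iter_deriv [1] (v \<epsilon>) x))\<^sup>2) integrable_on {-L..L}"
        by (intro integrable_continuous_real sq_cont vc)
      show "(\<lambda>x. 2 * (norm (iter_deriv [1] (v \<epsilon> - u \<epsilon>) x))\<^sup>2 + 2 * C1\<^sup>2) integrable_on {-L..L}"
        by (intro Henstock_Kurzweil_Integration.integrable_add i2) (simp add: integrable_continuous_real)
      fix x
      have "(norm (iter_deriv [1] (v \<epsilon>) x))\<^sup>2 \<le> 2 * (norm (iter_deriv [1] (v \<epsilon> - u \<epsilon>) x))\<^sup>2 + 2 * (norm (iter_deriv [1] (u \<epsilon>) x))\<^sup>2"
        using norm_add_square_le[of "iter_deriv [1] (v \<epsilon> - u \<epsilon>) x" "iter_deriv [1] (u \<epsilon>) x"]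
        unfolding dd diff_add_cancel .
      also have "(norm (iter_deriv [1] (u \<epsilon>) x))\<^sup>2 \<le> C1\<^sup>2"
        by (rule power_mono[OF C1[rule_format, OF elim(2)] norm_ge_zero])
      finally show "(norm (iter_deriv [1] (v \<epsilon>) x))\<^sup>2 \<le> 2 * (norm (iter_deriv [1] (v \<epsilon> - u \<epsilon>) x))\<^sup>2 + 2 * C1\<^sup>2"
        by (simp only: mult_left_mono add_left_mono)
    qed
    also have "\<dots> = integral {-L..L} (\<lambda>x. 2 * (norm (iter_deriv [1] (v \<epsilon> - u \<epsilon>) x))\<^sup>2) + integral {-L..L} (\<lambda>x. 2 * C1\<^sup>2)"
      by (rule Henstock_Kurzweil_Integration.integral_add[OF i2]) (simp add: integrable_continuous_real)
    also have "integral {-L..L} (\<lambda>x. 2 * (norm (iter_deriv [1] (v \<epsilon> - u \<epsilon>) x))\<^sup>2) \<le> 2 * C"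
    proof -
      have "C * \<epsilon>\<^sup>2 \<le> C * 1" using elim(2) C(1) by (intro mult_left_mono) (auto simp: power_le_one)
      with elim(1) have "integral {-L..L} (\<lambda>x. (norm (iter_deriv [1] (v \<epsilon> - u \<epsilon>) x))\<^sup>2) \<le> C" by linarith
      then show ?thesis by (simp only: integral_mult_right mult_le_cancel_left_pos zero_less_numeral)
    qed
    also have "integral {-L..L} (\<lambda>x. 2 * C1\<^sup>2) \<le> 2 * C1\<^sup>2 * (2 * \<bar>L\<bar>)"
      by (cases "L \<ge> 0") (simp_all add: mult_nonneg_nonpos)
    finally show ?case by (simp only: add_left_mono add_right_mono)
  qed
  then show "\<exists>C. \<forall>\<^sub>F \<epsilon> in at_right 0. integral {-L..L} (\<lambda>x. (norm (iter_deriv [1] (v \<epsilon>) x))\<^sup>2) \<le> C" by blast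
qed

section \<open>The connected solution on the two quadrants\<close>

lemma deriv_seq_shift_scale:
  assumes "deriv_seq F"
  shows "deriv_seq (\<lambda>i y. k * F i (y - x))"
  unfolding deriv_seq_def
proof (intro allI)
  fix i y
  have "((\<lambda>y. y - x) has_real_derivative 1) (at y)"
    by (auto intro!: derivative_eq_intros)
  from DERIV_cmult[OF DERIV_chain2[OF deriv_seqD[OF assms] this], of k i]
  show "((\<lambda>y. k * F i (y - x)) has_real_derivative k * F (Suc i) (y - x)) (at y)" by simp
qed

text \<open>The mollifying kernel at (x,t), placed on side \<open>e\<close>. The factor
  \<open>k\<close> absorbs a coefficient, so that the wave operator maps such a kernel to a sum of
  two of them.\<close>

abbreviation bump_tensor :: "real \<Rightarrow> real \<Rightarrow> real \<Rightarrow> real \<Rightarrow> real \<Rightarrow> nat \<Rightarrow> nat \<Rightarrow> real \<times> real \<Rightarrow> complex" where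
  "bump_tensor k e m x t \<equiv> tensor e (\<lambda>i y. k * scaled_bump m i (y - x)) (\<lambda>i y. 1 * scaled_bump m i (y - t))"

lemmas bump_tensor_smooth = smooth_on_tensor[OF deriv_seq_shift_scale[OF scaled_bump_deriv_seq] deriv_seq_shift_scale[OF scaled_bump_deriv_seq]]
lemmas bump_tensor_deriv = tensor_deriv[OF deriv_seq_shift_scale[OF scaled_bump_deriv_seq] deriv_seq_shift_scale[OF scaled_bump_deriv_seq]]

lemma bump_tensor_nonzero:
  assumes m: "m \<ge> 1" and nz: "bump_tensor k e m x t i j z \<noteq> 0"
  shows "x + 1 / (2 * m) \<le> e * fst z" "e * fst z \<le> x + 1 / m" "t + 1 / (2 * m) \<le> snd z" "snd z \<le> t + 1 / m"
proof -
  have "scaled_bump m i (e * fst z - x) \<noteq> 0" "scaled_bump m j (snd z - t) \<noteq> 0"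
    using nz by (auto simp: tensor_def)
  then have "\<not> (e * fst z - x \<le> 1 / (2 * m) \<or> e * fst z - x \<ge> 1 / m)" "\<not> (snd z - t \<le> 1 / (2 * m) \<or> snd z - t \<ge> 1 / m)"
    using scaled_bump_zero'[of m] m by fastforce+
  then show "x + 1 / (2 * m) \<le> e * fst z" "e * fst z \<le> x + 1 / m" "t + 1 / (2 * m) \<le> snd z" "snd z \<le> t + 1 / m"
    by linarith+
qed

lemma bump_tensor_test_function:
  assumes m: "m \<ge> 1" and e: "e \<in> {1, - 1}"
    and U: "\<And>z. x + 1 / (2 * m) \<le> e * fst z \<Longrightarrow> t + 1 / (2 * m) \<le> snd z \<Longrightarrow> z \<in> U"
  shows "bump_tensor k e m x t i j \<in> test_functions U"
proof -
  define K where "K = {z :: real \<times> real. x + 1 / (2 * m) \<le> e * fst z \<and> e * fst z \<le> x + 1 / m \<and> t + 1 / (2 * m) \<le> snd z \<and> snd z \<le> t + 1 / m}"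
  have "closed K"
    unfolding K_def by (intro closed_Collect_conj closed_Collect_le continuous_intros)
  then have s: "supp (bump_tensor k e m x t i j) \<subseteq> K"
    by (rule supp_subset_closed) (use bump_tensor_nonzero[OF m] in \<open>fastforce simp: K_def\<close>)
  have "K \<subseteq> cbox (- (\<bar>x\<bar> + 1 / m), t) (\<bar>x\<bar> + 1 / m, t + 1 / m)"
  proof
    fix z assume "z \<in> K"
    moreover have "1 / (2 * m) \<ge> 0" using m by simp
    ultimately show "z \<in> cbox (- (\<bar>x\<bar> + 1 / m), t) (\<bar>x\<bar> + 1 / m, t + 1 / m)"
      using e by (cases z) (auto simp: K_def cbox_Pair_eq)
  qed
  then have "bounded K" using bounded_cbox bounded_subset by blast
  then have "compact (supp (bump_tensor k e m x t i j))"
    unfolding compact_eq_bounded_closed using bounded_subset[OF _ s] by (auto simp: supp_def)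
  moreover have "supp (bump_tensor k e m x t i j) \<subseteq> U"
    using s U by (fastforce simp: K_def)
  ultimately show ?thesis
    unfolding test_functions_def using bump_tensor_smooth by blast
qed

lemma integral_reflect:
  fixes f :: "real \<Rightarrow> complex"
  assumes "e \<in> {1, - 1}"
  shows "integral {-D..D} (\<lambda>y. f (e * y)) = integral {-D..D} f"
  using assms Henstock_Kurzweil_Integration.integral_reflect_real[of D "-D" f] by auto

text \<open>The support of the kernel lies in 0 <= e x <= D, 0 <= t <= D, so that only values of
  \<open>F\<close> for t >= 0 matter and the pairing becomes an integral over the square after
  reflection. Each x-derivative contributes one factor \<open>e\<close>.\<close>

lemma function_distribution_bump_tensor:
  assumes F: "continuous_on (UNIV \<times> {0..}) F" and m: "m \<ge> 1" and e: "e \<in> {1, - 1}"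
    and x: "x \<ge> 0" "x + 1 \<le> D" and t: "t \<ge> 0" "t + 1 \<le> D"
  shows "function_distribution F (bump_tensor k e m x t i j) = (k * e ^ i) *\<^sub>R mollified D (\<lambda>x t. F (e * x, t)) m i j x t"
proof -
  define g where "g = (\<lambda>z. F z * bump_tensor k e m x t i j z)"
  let ?C = "cbox (-D, 0) (D, D)"
  have mm: "1 / m \<le> 1" "1 / (2 * m) > 0" using m by auto
  have ee: "e * (e * y) = y" for y using e by auto
  have g0: "g z = 0" if "z \<notin> ?C" for z
  proof (rule ccontr)
    assume "g z \<noteq> 0"
    then have "bump_tensor k e m x t i j z \<noteq> 0" by (simp add: g_def)
    note nz = bump_tensor_nonzero[OF m this]
    have "0 \<le> e * fst z" "e * fst z \<le> D" "0 \<le> snd z" "snd z \<le> D"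
      using nz mm x t by linarith+
    then show False using that e by (cases z) (auto simp: cbox_Pair_eq)
  qed
  have cont_t: "continuous_on S (bump_tensor k e m x t i j)" for S
    by (rule continuous_on_subset[OF smooth_on_imp_continuous_on[OF bump_tensor_smooth]]) simp
  have cont: "continuous_on ?C g"
    unfolding g_def by (intro continuous_intros cont_t continuous_on_subset[OF F]) (auto simp: cbox_Pair_eq)
  have gi: "indicator ?C z *\<^sub>R g z = g z" for z using g0[of z] by (auto simp: indicator_def)
  have si: "set_integrable lborel ?C g"
    unfolding set_integrable_def by (rule borel_integrable_compact[OF compact_cbox cont])
  define f where "f = (\<lambda>y. integral {0..D} (\<lambda>\<tau>. g (y, \<tau>)))"
  have "function_distribution F (bump_tensor k e m x t i j) = (LINT z:?C|lborel. g z)"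
    unfolding function_distribution_def set_lebesgue_integral_def gi by (simp add: g_def)
  also have "\<dots> = integral ?C g"
    by (rule set_borel_integral_eq_integral(2)[OF si])
  also have "\<dots> = integral {-D..D} f"
    using integral_prod_continuous[OF cont] by (simp add: f_def)
  also have "\<dots> = integral {-D..D} (\<lambda>y. f (e * y))"
    by (rule integral_reflect[OF e, symmetric])
  also have "\<dots> = integral {0..D} (\<lambda>y. f (e * y))"
  proof -
    have "f (e * y) = 0" if "y < 0" for y
    proof -
      have "g (e * y, \<tau>) = 0" for \<tau>
      proof (rule ccontr)
        assume "g (e * y, \<tau>) \<noteq> 0"
        then have "bump_tensor k e m x t i j (e * y, \<tau>) \<noteq> 0" by (simp add: g_def)
        from bump_tensor_nonzero(1)[OF m this] have "x + 1 / (2 * m) \<le> y" by (simp add: ee)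
        then show False using that mm(2) x(1) by linarith
      qed
      then show ?thesis by (simp add: f_def)
    qed
    then have "integral {-D..D} (\<lambda>y. if y \<in> {0..D} then f (e * y) else 0) = integral {-D..D} (\<lambda>y. f (e * y))"
      by (intro integral_cong) auto
    moreover have "integral {-D..D} (\<lambda>y. if y \<in> {0..D} then f (e * y) else 0) = integral {0..D} (\<lambda>y. f (e * y))"
      unfolding Henstock_Kurzweil_Integration.integral_restrict_Int
      by (rule arg_cong2[where f = integral]) (use x in auto)
    ultimately show ?thesis by simp
  qed
  also have "\<dots> = (k * e ^ i) *\<^sub>R mollified D (\<lambda>x t. F (e * x, t)) m i j x t"
  proof -
    have Fe: "continuous_on (cbox (0, 0) (D, D)) (\<lambda>z. F (e * fst z, snd z))"
      by (rule continuous_on_compose2[OF F]) (auto intro!: continuous_intros simp: cbox_Pair_eq)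
    have c2: "continuous_on (cbox (0, 0) (D, D)) (\<lambda>z. (k * e ^ i) *\<^sub>R ((scaled_bump m i (fst z - x) * scaled_bump m j (snd z - t)) *\<^sub>R F (e * fst z, snd z)))"
      by (intro continuous_intros kernel_cont Fe)
    have "(k * e ^ i) *\<^sub>R mollified D (\<lambda>x t. F (e * x, t)) m i j x t
        = integral (cbox (0, 0) (D, D)) (\<lambda>z. (k * e ^ i) *\<^sub>R ((scaled_bump m i (fst z - x) * scaled_bump m j (snd z - t)) *\<^sub>R F (e * fst z, snd z)))"
      unfolding mollified_def by (rule Henstock_Kurzweil_Integration.integral_cmul[symmetric])
    also have "\<dots> = integral {0..D} (\<lambda>y. integral {0..D} (\<lambda>\<tau>. (k * e ^ i) *\<^sub>R ((scaled_bump m i (y - x) * scaled_bump m j (\<tau> - t)) *\<^sub>R F (e * y, \<tau>))))"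
      using integral_prod_continuous[OF c2] by simp
    also have "\<dots> = integral {0..D} (\<lambda>y. f (e * y))"
      unfolding f_def g_def tensor_def fst_conv snd_conv ee
      by (intro integral_cong) (simp add: scaleR_conv_of_real mult_ac)
    finally show ?thesis by simp
  qed
  finally show ?thesis .
qed

section \<open>The connected solution on either side of the interface\<close>

locale connected_wave =
  fixes a_minus a_plus b_minus b_plus :: real and w0 w0' w1 :: "real \<Rightarrow> complex"
    and u :: "(real \<times> real \<Rightarrow> complex) \<Rightarrow> complex" and W V :: "real \<times> real \<Rightarrow> complex"
  assumes pos: "a_minus > 0" "a_plus > 0" "b_minus > 0" "b_plus > 0"
    and dist: "distribution_on UNIV u"
    and equation: "\<And>\<theta>. \<theta> \<in> test_functions ({..<0} \<times> UNIV) \<union> test_functions ({0<..} \<times> UNIV) \<Longrightarrow>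
        u (wave_operator (two_phase a_minus a_plus) (two_phase b_minus b_plus) \<theta>) = 0"
    and W_cont: "continuous_on (UNIV \<times> {0..}) W"
    and u_W: "distributions_equal_on (UNIV \<times> {0<..}) u (function_distribution W)"
    and W_init: "\<And>x. W (x, 0) = w0 x"
    and V_cont: "continuous_on (UNIV \<times> {0..}) V"
    and u_V: "distributions_equal_on (UNIV \<times> {0<..}) (\<lambda>\<theta>. - u (D_t \<theta>)) (function_distribution V)"
    and V_init: "\<And>x. V (x, 0) = w1 x"
    and flux: "AE t in lborel. t \<ge> 0 \<longrightarrow> (\<exists>h. continuous_on UNIV h \<and> (\<forall>x. x \<noteq> 0 \<longrightarrow>
          (\<exists>d. ((\<lambda>y. W (y, t)) has_vector_derivative d) (at x) \<and> h x = two_phase b_minus b_plus x *\<^sub>R d)))"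
    and w0_deriv: "\<And>x. (w0 has_vector_derivative w0' x) (at x)" and w0'_cont: "continuous_on UNIV w0'"
    and w1_cont: "continuous_on UNIV w1"
begin

abbreviation "A \<equiv> two_phase a_minus a_plus"
abbreviation "B \<equiv> two_phase b_minus b_plus"
definition "c e = sqrt (B e / A e)"
definition "p e x t = W (e * x, t)"
definition "v e x t = V (e * x, t)"

lemma AB_pos: "A e > 0" "B e > 0"
  using pos by (auto simp: two_phase_def)

lemma c_pos: "c e > 0" and c_sq: "(c e)\<^sup>2 = B e / A e"
  using AB_pos[of e] by (auto simp: c_def less_imp_le)

lemma on_side: "e \<in> {1, - 1} \<Longrightarrow> e * y > 0 \<Longrightarrow> A y = A e \<and> B y = B e"
  by (auto simp: two_phase_def)

text \<open>On the support of the kernel the coefficients equal their constants on side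
  \<open>e\<close>; elsewhere both sides vanish. The coefficients may therefore be treated as
  constant although they jump.\<close>

lemma wave_operator_bump_tensor:
  assumes m: "m \<ge> 1" and e: "e \<in> {1, - 1}" and x: "x \<ge> 0" and t: "t \<ge> 0"
  shows "wave_operator A B (bump_tensor 1 e m x t 0 0) = (\<lambda>z. bump_tensor (A e) e m x t 0 2 z + bump_tensor (- B e) e m x t 2 0 z)"
proof -
  have mm: "1 / (2 * m) > 0" using m by simp
  have side: "A (fst z) = A e \<and> B (fst z) = B e" if "bump_tensor 1 e m x t i j z \<noteq> 0" for i j z
    using bump_tensor_nonzero(1)[OF m that] mm x by (intro on_side e) linarith
  have scale: "k *\<^sub>R bump_tensor 1 e m x t i j z = bump_tensor k e m x t i j z" for k i j z
    by (simp add: tensor_def scaleR_conv_of_real mult_ac)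
  have 1: "A (fst z) *\<^sub>R bump_tensor 1 e m x t i j z = bump_tensor (A e) e m x t i j z" for i j z
    using side[of i j z] scale[of "A e" i j z] by (cases "bump_tensor 1 e m x t i j z = 0") auto
  have 2: "B (fst z) *\<^sub>R bump_tensor 1 e m x t i j z = bump_tensor (B e) e m x t i j z" for i j z
    using side[of i j z] scale[of "B e" i j z] by (cases "bump_tensor 1 e m x t i j z = 0") auto
  have 3: "- bump_tensor (B e) e m x t i j z = bump_tensor (- B e) e m x t i j z" for i j z
    by (simp add: tensor_def)
  have Dt: "D_t (D_t (bump_tensor 1 e m x t 0 0)) = bump_tensor 1 e m x t 0 2"
    by (simp only: bump_tensor_deriv numeral_2_eq_2)
  have Dx: "D_x (\<lambda>y. B (fst y) *\<^sub>R D_x (bump_tensor 1 e m x t 0 0) y) = bump_tensor (B e) e m x t 2 0"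
    by (simp only: bump_tensor_deriv 2 numeral_2_eq_2)
  show ?thesis
    unfolding wave_operator_def Dt Dx 1 3[symmetric] by (rule ext, rule diff_conv_add_uminus)
qed

text \<open>The kernel is supported strictly inside one half plane and in t > 0: the first fact
  admits it in the equation, the second allows the distribution to be replaced by \<open>W\<close>.
  Two x-derivatives give \<open>e ^ 2 = 1\<close>.\<close>

lemma mollified_wave:
  assumes e: "e \<in> {1, - 1}" and m: "m \<ge> 1" and x: "0 \<le> x" "x + 1 \<le> D" and t: "0 \<le> t" "t + 1 \<le> D"
  shows "mollified D (p e) m 0 2 x t = (c e)\<^sup>2 *\<^sub>R mollified D (p e) m 2 0 x t"
proof -
  have mm: "1 / (2 * m) > 0" using m by simp
  have T: "bump_tensor k e m x t i j \<in> test_functions (UNIV \<times> {0<..})" for k i j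
  proof (rule bump_tensor_test_function[OF m e])
    fix z :: "real \<times> real" assume "t + 1 / (2 * m) \<le> snd z"
    then have "snd z > 0" using mm t(1) by linarith
    then show "z \<in> UNIV \<times> {0<..}" by (simp add: mem_Times_iff)
  qed
  have T': "bump_tensor k e m x t i j \<in> test_functions UNIV" for k i j
    by (rule bump_tensor_test_function[OF m e]) simp
  have h: "bump_tensor 1 e m x t 0 0 \<in> test_functions ({..<0} \<times> UNIV) \<union> test_functions ({0<..} \<times> UNIV)"
  proof (cases "e = 1")
    case True
    have "bump_tensor 1 e m x t 0 0 \<in> test_functions ({0<..} \<times> UNIV)"
    proof (rule bump_tensor_test_function[OF m e])
      fix z :: "real \<times> real" assume "x + 1 / (2 * m) \<le> e * fst z"
      then have "0 < e * fst z" using mm x(1) by linarith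
      then show "z \<in> {0<..} \<times> UNIV" using True by (simp add: mem_Times_iff)
    qed
    then show ?thesis by (rule UnI2)
  next
    case False
    then have "e = -1" using e by simp
    have "bump_tensor 1 e m x t 0 0 \<in> test_functions ({..<0} \<times> UNIV)"
    proof (rule bump_tensor_test_function[OF m e])
      fix z :: "real \<times> real" assume "x + 1 / (2 * m) \<le> e * fst z"
      then have "0 < e * fst z" using mm x(1) by linarith
      then show "z \<in> {..<0} \<times> UNIV" using \<open>e = -1\<close> by (simp add: mem_Times_iff)
    qed
    then show ?thesis by (rule UnI1)
  qed
  have uW: "u (bump_tensor k e m x t i j) = (k * e ^ i) *\<^sub>R mollified D (p e) m i j x t" for k i j
    using u_W T[of k i j] function_distribution_bump_tensor[OF W_cont m e x t, of k i j]
    unfolding distributions_equal_on_def p_def[abs_def] by (simp only: Ball_def)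
  have add: "\<forall>\<theta>\<in>test_functions UNIV. \<forall>\<eta>\<in>test_functions UNIV. u (\<lambda>z. \<theta> z + \<eta> z) = u \<theta> + u \<eta>"
    using dist unfolding distribution_on_def by (rule conjunct1)
  have "0 = u (\<lambda>z. bump_tensor (A e) e m x t 0 2 z + bump_tensor (- B e) e m x t 2 0 z)"
    using equation[OF h] unfolding wave_operator_bump_tensor[OF m e x(1) t(1)] by simp
  also have "\<dots> = u (bump_tensor (A e) e m x t 0 2) + u (bump_tensor (- B e) e m x t 2 0)"
    by (rule add[rule_format, OF T' T'])
  also have "\<dots> = A e *\<^sub>R mollified D (p e) m 0 2 x t - B e *\<^sub>R mollified D (p e) m 2 0 x t"
    unfolding uW using e by auto
  finally have eq: "A e *\<^sub>R mollified D (p e) m 0 2 x t = B e *\<^sub>R mollified D (p e) m 2 0 x t" by simp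
  have "mollified D (p e) m 0 2 x t = (1 / A e) *\<^sub>R (A e *\<^sub>R mollified D (p e) m 0 2 x t)"
    using AB_pos(1)[of e] by simp
  also have "\<dots> = (c e)\<^sup>2 *\<^sub>R mollified D (p e) m 2 0 x t"
    unfolding eq c_sq by simp
  finally show ?thesis .
qed

lemma mollified_velocity:
  assumes e: "e \<in> {1, - 1}" and m: "m \<ge> 1" and x: "0 \<le> x" "x + 1 \<le> D" and t: "0 \<le> t" "t + 1 \<le> D"
  shows "mollified D (p e) m 0 1 x t = - mollified D (v e) m 0 0 x t"
proof -
  have mm: "1 / (2 * m) > 0" using m by simp
  have T: "bump_tensor k e m x t i j \<in> test_functions (UNIV \<times> {0<..})" for k i j
  proof (rule bump_tensor_test_function[OF m e])
    fix z :: "real \<times> real" assume "t + 1 / (2 * m) \<le> snd z"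
    then have "snd z > 0" using mm t(1) by linarith
    then show "z \<in> UNIV \<times> {0<..}" by (simp add: mem_Times_iff)
  qed
  have "- u (D_t (bump_tensor 1 e m x t 0 0)) = function_distribution V (bump_tensor 1 e m x t 0 0)"
    using u_V T[of 1 0 0] unfolding distributions_equal_on_def by (rule bspec)
  moreover have "u (bump_tensor 1 e m x t 0 1) = function_distribution W (bump_tensor 1 e m x t 0 1)"
    using u_W T[of 1 0 1] unfolding distributions_equal_on_def by (rule bspec)
  moreover have "D_t (bump_tensor 1 e m x t 0 0) = bump_tensor 1 e m x t 0 1"
    by (simp only: bump_tensor_deriv One_nat_def)
  ultimately have "- (1 * e ^ 0) *\<^sub>R mollified D (p e) m 0 1 x t = (1 * e ^ 0) *\<^sub>R mollified D (v e) m 0 0 x t"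
    unfolding function_distribution_bump_tensor[OF W_cont m e x t] function_distribution_bump_tensor[OF V_cont m e x t]
      p_def[abs_def] v_def[abs_def] by simp
  then show ?thesis by (simp add: minus_equation_iff)
qed

lemma pv_cont: "continuous2 ({0..} \<times> {0..}) (p e)" "continuous2 ({0..} \<times> {0..}) (v e)"
  unfolding p_def v_def
  by (rule continuous_on_compose2[OF W_cont], auto intro!: continuous_intros)
    (rule continuous_on_compose2[OF V_cont], auto intro!: continuous_intros)

lemma side_quadrant:
  assumes e: "e \<in> {1, - 1}" and L: "L > 0"
  shows "cauchy_quadrant (p e) (v e) (c e) (\<lambda>x. w0 (e * x)) (\<lambda>x. e *\<^sub>R w0' (e * x)) (\<lambda>x. w1 (e * x)) L"
proof unfold_locales
  show "c e > 0" by (rule c_pos)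
  show "continuous2 ({0..} \<times> {0..}) (p e)" "continuous2 ({0..} \<times> {0..}) (v e)" by (rule pv_cont)+
  show "mollified D (p e) m 0 2 x t = (c e)\<^sup>2 *\<^sub>R mollified D (p e) m 2 0 x t"
    if "m \<ge> 1" "0 \<le> x" "x + 1 \<le> D" "0 \<le> t" "t + 1 \<le> D" for D m x t
    by (rule mollified_wave[OF e that])
  show "mollified D (p e) m 0 1 x t = - mollified D (v e) m 0 0 x t"
    if "m \<ge> 1" "0 \<le> x" "x + 1 \<le> D" "0 \<le> t" "t + 1 \<le> D" for D m x t
    by (rule mollified_velocity[OF e that])
  show "((\<lambda>x. w0 (e * x)) has_vector_derivative e *\<^sub>R w0' (e * x)) (at x)" for x
  proof -
    have "((\<lambda>x. e * x) has_real_derivative e) (at x)" by (auto intro!: derivative_eq_intros)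
    then show ?thesis by (rule has_vector_derivative_chain_real[OF w0_deriv])
  qed
  show "continuous_on UNIV (\<lambda>x. e *\<^sub>R w0' (e * x))"
    by (intro continuous_intros continuous_on_UNIV_compose[OF w0'_cont])
  show "continuous_on UNIV (\<lambda>x. w1 (e * x))"
    by (intro continuous_intros continuous_on_UNIV_compose[OF w1_cont])
  show "p e x 0 = w0 (e * x)" "v e x 0 = w1 (e * x)" for x
    by (simp_all add: p_def v_def W_init V_init)
  show "L > 0" by (rule L)
qed

lemma interface: "p 1 0 t = p (- 1) 0 t"
  by (simp add: p_def)

text \<open>For almost every time the continuous extension h of the flux can be approached from
  either side, and the two limits express h(0) by \<open>U\<close> on the right and, with opposite
  sign, on the left. Integration in time discards the exceptional null set.\<close>

lemma flux_integral:
  assumes L: "L > 0" and t: "t \<ge> 0"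
  shows "B 1 *\<^sub>R cauchy_quadrant.Yx (p 1) (c 1) (\<lambda>x. w0 (1 * x)) (\<lambda>x. w1 (1 * x)) L 0 t
    + B (- 1) *\<^sub>R cauchy_quadrant.Yx (p (- 1)) (c (- 1)) (\<lambda>x. w0 (- 1 * x)) (\<lambda>x. w1 (- 1 * x)) L 0 t = 0"
proof -
  interpret r: cauchy_quadrant "p 1" "v 1" "c 1" "\<lambda>x. w0 (1 * x)" "\<lambda>x. 1 *\<^sub>R w0' (1 * x)" "\<lambda>x. w1 (1 * x)" L
    by (rule side_quadrant) (use L in auto)
  interpret l: cauchy_quadrant "p (- 1)" "v (- 1)" "c (- 1)" "\<lambda>x. w0 (- 1 * x)" "\<lambda>x. - 1 *\<^sub>R w0' (- 1 * x)" "\<lambda>x. w1 (- 1 * x)" L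
    by (rule side_quadrant) (use L in auto)
  have limit: "h 0 = e *\<^sub>R (B e *\<^sub>R U 0 \<sigma>)"
    if e: "e \<in> {1, - 1}" and \<sigma>: "\<sigma> \<ge> 0" and U: "continuous2 ({0..L} \<times> {0..}) U"
      and p_x: "\<And>x. x \<in> {0<..<L} \<Longrightarrow> ((\<lambda>x. p e x \<sigma>) has_vector_derivative U x \<sigma>) (at x)"
      and h: "continuous_on UNIV h" "\<forall>x. x \<noteq> 0 \<longrightarrow> (\<exists>d. ((\<lambda>y. W (y, \<sigma>)) has_vector_derivative d) (at x) \<and> h x = B x *\<^sub>R d)"
    for e \<sigma> U h
  proof -
    define D where "D = (\<lambda>x. h (e * x) - e *\<^sub>R (B e *\<^sub>R U x \<sigma>))"
    have D0: "D x = 0" if x: "x \<in> {0<..<L}" for x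
    proof -
      have ex: "e * x \<noteq> 0" using x e by auto
      have "\<exists>d. ((\<lambda>y. W (y, \<sigma>)) has_vector_derivative d) (at (e * x)) \<and> h (e * x) = B (e * x) *\<^sub>R d"
        by (rule h(2)[rule_format, OF ex])
      then obtain d where d: "((\<lambda>y. W (y, \<sigma>)) has_vector_derivative d) (at (e * x))" "h (e * x) = B (e * x) *\<^sub>R d"
        by (elim exE conjE)
      have "((\<lambda>x. e * x) has_real_derivative e) (at x)" by (auto intro!: derivative_eq_intros)
      from has_vector_derivative_chain_real[OF d(1) this]
      have "((\<lambda>x. p e x \<sigma>) has_vector_derivative e *\<^sub>R d) (at x)" by (simp add: p_def)
      from vector_derivative_unique_at[OF p_x[OF x] this] have "U x \<sigma> = e *\<^sub>R d" .
      \<comment> \<open>The reflected derivative is \<open>e\<close> times the original one and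
        \<open>e * e = 1\<close>, so h(e x) = e B(e) U(x) for interior x; continuity extends this to
        x = 0.\<close>
      moreover have "B (e * x) = B e" using on_side[OF e, of "e * x"] x e by auto
      ultimately show ?thesis using d(2) e by (auto simp: D_def)
    qed
    have "continuous_on {0..L} D"
      unfolding D_def
      by (intro continuous_intros continuous_on_UNIV_compose[OF h(1)] continuous2_slice_x[OF U]) (use \<sigma> in simp)
    then have "continuous_on (closure {0<..<L}) D" using L by (simp add: closure_greaterThanLessThan)
    from continuous_constant_on_closure[OF this D0, of 0] have "D 0 = 0"
      using L by (simp add: closure_greaterThanLessThan)
    then show ?thesis by (simp add: D_def)
  qed
  have ae: "AE \<sigma> in lborel. \<sigma> \<in> {0..t} \<longrightarrow> B 1 *\<^sub>R r.U 0 \<sigma> + B (- 1) *\<^sub>R l.U 0 \<sigma> = 0"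
    using flux
  proof eventually_elim
    case (elim \<sigma>)
    show ?case
    proof
      assume "\<sigma> \<in> {0..t}"
      then have \<sigma>: "\<sigma> \<ge> 0" by simp
      from elim[rule_format, OF \<sigma>] obtain h where h: "continuous_on UNIV h"
        "\<forall>x. x \<noteq> 0 \<longrightarrow> (\<exists>d. ((\<lambda>y. W (y, \<sigma>)) has_vector_derivative d) (at x) \<and> h x = B x *\<^sub>R d)"
        by (elim exE conjE)
      have 1: "h 0 = 1 *\<^sub>R (B 1 *\<^sub>R r.U 0 \<sigma>)"
        by (rule limit[OF _ \<sigma> r.U_cont r.p_x h]) (use \<sigma> in simp_all)
      have 2: "h 0 = (- 1) *\<^sub>R (B (- 1) *\<^sub>R l.U 0 \<sigma>)"
        by (rule limit[OF _ \<sigma> l.U_cont l.p_x h]) (use \<sigma> in simp_all)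
      have "B 1 *\<^sub>R r.U 0 \<sigma> = h 0" by (subst 1) simp
      moreover have "B (- 1) *\<^sub>R l.U 0 \<sigma> = - h 0" by (subst 2) simp
      ultimately show "B 1 *\<^sub>R r.U 0 \<sigma> + B (- 1) *\<^sub>R l.U 0 \<sigma> = 0" by simp
    qed
  qed
  have L0: "0 \<in> {0..L}" using L by simp
  have c: "continuous_on {0..t} (r.U 0)" "continuous_on {0..t} (l.U 0)"
    by (rule continuous_on_subset[OF continuous2_slice_t[OF r.U_cont L0]], force)
      (rule continuous_on_subset[OF continuous2_slice_t[OF l.U_cont L0]], force)
  have I: "((\<lambda>\<sigma>. B 1 *\<^sub>R r.U 0 \<sigma> + B (- 1) *\<^sub>R l.U 0 \<sigma>) has_integral B 1 *\<^sub>R r.Yx 0 t + B (- 1) *\<^sub>R l.Yx 0 t) {0..t}"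
    unfolding r.U_integral[OF L0 t, symmetric] l.U_integral[OF L0 t, symmetric]
    by (intro has_integral_add has_integral_cmul integrable_integral integrable_continuous_real c)
  have "((\<lambda>\<sigma>. 0) has_integral B 1 *\<^sub>R r.Yx 0 t + B (- 1) *\<^sub>R l.Yx 0 t) {0..t}"
    using I by (rule iffD1[OF has_integral_AE[OF ae]])
  from has_integral_unique[OF this has_integral_0] show ?thesis .
qed

end

section \<open>Duality for the regularised problem\<close>

lemma partial_derivatives:
  fixes f :: "real \<times> real \<Rightarrow> 'b::real_normed_vector"
  assumes "f differentiable (at (x, t))"
  shows "((\<lambda>x. f (x, t)) has_vector_derivative D_x f (x, t)) (at x)"
    and "((\<lambda>t. f (x, t)) has_vector_derivative D_t f (x, t)) (at t)"
proof -
  have d: "(f has_derivative frechet_derivative f (at (x, t))) (at (x, t))"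
    by (rule iffD1[OF frechet_derivative_works assms])
  have lin: "linear (frechet_derivative f (at (x, t)))"
    by (rule linear_frechet_derivative[OF assms])
  have "((\<lambda>x. (x, t)) has_derivative (\<lambda>h. (h, 0))) (at x)"
    by (auto intro!: derivative_eq_intros)
  from has_derivative_compose[OF this d]
  have "((\<lambda>x. f (x, t)) has_derivative (\<lambda>h. frechet_derivative f (at (x, t)) (h, 0))) (at x)" .
  moreover have "(\<lambda>h. frechet_derivative f (at (x, t)) (h, 0)) = (\<lambda>h. h *\<^sub>R frechet_derivative f (at (x, t)) (1, 0))"
  proof
    show "frechet_derivative f (at (x, t)) (h, 0) = h *\<^sub>R frechet_derivative f (at (x, t)) (1, 0)" for h
      using linear_cmul[OF lin, of h "(1, 0)"] by simp
  qed
  ultimately show "((\<lambda>x. f (x, t)) has_vector_derivative D_x f (x, t)) (at x)"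
    by (simp only: has_vector_derivative_def iter_deriv.simps)
  have "((\<lambda>t. (x, t)) has_derivative (\<lambda>h. (0, h))) (at t)"
    by (auto intro!: derivative_eq_intros)
  from has_derivative_compose[OF this d]
  have "((\<lambda>t. f (x, t)) has_derivative (\<lambda>h. frechet_derivative f (at (x, t)) (0, h))) (at t)" .
  moreover have "(\<lambda>h. frechet_derivative f (at (x, t)) (0, h)) = (\<lambda>h. h *\<^sub>R frechet_derivative f (at (x, t)) (0, 1))"
  proof
    show "frechet_derivative f (at (x, t)) (0, h) = h *\<^sub>R frechet_derivative f (at (x, t)) (0, 1)" for h
      using linear_cmul[OF lin, of h "(0, 1)"] by simp
  qed
  ultimately show "((\<lambda>t. f (x, t)) has_vector_derivative D_t f (x, t)) (at t)"
    by (simp only: has_vector_derivative_def iter_deriv.simps)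
qed

lemma smooth_wave_of_smooth_on:
  fixes f :: "real \<times> real \<Rightarrow> complex"
  assumes f: "smooth_on (UNIV \<times> {-T<..<T}) f" and a: "smooth_on UNIV a" and b: "smooth_on UNIV b"
    and n: "smooth_on (UNIV \<times> {-T<..<T}) (wave_operator a b f)"
  shows "smooth_wave T a b (\<lambda>x t. f (x, t)) (\<lambda>x t. D_t f (x, t)) (\<lambda>x t. D_x f (x, t)) (\<lambda>x t. D_t (D_t f) (x, t))
    (\<lambda>x t. D_x (D_t f) (x, t)) (\<lambda>x t. D_x (\<lambda>y. b (fst y) *\<^sub>R D_x f y) (x, t)) (\<lambda>x t. wave_operator a b f (x, t))"
proof -
  let ?U = "UNIV \<times> {-T<..<T} :: (real \<times> real) set"
  have Bx: "(1, 0) \<in> (Basis :: (real \<times> real) set)" and Bt: "(0, 1) \<in> (Basis :: (real \<times> real) set)"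
    by (auto simp: Basis_prod_def)
  have diff: "iter_deriv vs f differentiable (at z)" if "z \<in> ?U" "set vs \<subseteq> {(1, 0), (0, 1)}" for z vs
    by (rule smooth_on_iter_deriv[OF f _ that(1)]) (use that(2) Bx Bt in auto)
  note d0 = diff[where vs = "[]", simplified] and dt = diff[where vs = "[(0, 1)]", simplified]
    and dx = diff[where vs = "[(1, 0)]", simplified] and dtt = diff[where vs = "[(0, 1), (0, 1)]", simplified]
    and dxt = diff[where vs = "[(1, 0), (0, 1)]", simplified]
  have cont: "continuous_on ?U g" if "\<And>z. z \<in> ?U \<Longrightarrow> g differentiable (at z)" for g :: "real \<times> real \<Rightarrow> complex"
    by (rule continuous_at_imp_continuous_on, rule ballI, rule differentiable_imp_continuous_within, rule that)
  have c: "continuous2 ?U (\<lambda>x t. g (x, t))" if "continuous_on ?U g" for g :: "real \<times> real \<Rightarrow> complex"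
    using that by simp
  have U: "(x, t) \<in> ?U" if "t \<in> {-T<..<T}" for x t using that by simp
  have ca: "continuous_on UNIV a" and cb: "continuous_on UNIV b"
    by (rule smooth_on_imp_continuous_on[OF a], rule smooth_on_imp_continuous_on[OF b])
  \<comment> \<open>Continuity of the flux derivative comes from the definition of the operator: it
    is a difference of two functions already known to be continuous.\<close>
  have F_eq: "D_x (\<lambda>y. b (fst y) *\<^sub>R D_x f y) z = a (fst z) *\<^sub>R D_t (D_t f) z - wave_operator a b f z" for z
    by (simp only: wave_operator_def) simp
  have db: "b differentiable (at x)" for x
    using smooth_on_iter_deriv[OF b, of "[]"] by simp
  have flux: "(\<lambda>y. b (fst y) *\<^sub>R D_x f y) differentiable (at z)" if "z \<in> ?U" for z
  proof -
    have "(\<lambda>y. b (fst y)) differentiable (at z)"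
      by (rule differentiable_compose[OF db]) (auto intro!: bounded_linear_imp_differentiable bounded_linear_fst)
    then show ?thesis
      by (rule differentiable_scaleR) (use dx[OF that] in simp)
  qed
  show ?thesis
  proof
    have c0: "continuous_on ?U f" by (rule cont[of f], rule d0)
    have ct: "continuous_on ?U (D_t f)" by (rule cont[of "D_t f"]) (use dt in simp)
    have cx: "continuous_on ?U (D_x f)" by (rule cont[of "D_x f"]) (use dx in simp)
    have ctt: "continuous_on ?U (D_t (D_t f))" by (rule cont[of "D_t (D_t f)"]) (use dtt in simp)
    have cxt: "continuous_on ?U (D_x (D_t f))" by (rule cont[of "D_x (D_t f)"]) (use dxt in simp)
    have cn: "continuous_on ?U (wave_operator a b f)" by (rule smooth_on_imp_continuous_on[OF n])
    show "continuous2 ?U (\<lambda>x t. f (x, t))" by (rule c[of f, OF c0])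
    show "continuous2 ?U (\<lambda>x t. D_t f (x, t))" by (rule c[of "D_t f", OF ct])
    show "continuous2 ?U (\<lambda>x t. D_x f (x, t))" by (rule c[of "D_x f", OF cx])
    show "continuous2 ?U (\<lambda>x t. D_t (D_t f) (x, t))" by (rule c[of "D_t (D_t f)", OF ctt])
    show "continuous2 ?U (\<lambda>x t. D_x (D_t f) (x, t))" by (rule c[of "D_x (D_t f)", OF cxt])
    show "continuous2 ?U (\<lambda>x t. wave_operator a b f (x, t))" by (rule c[of "wave_operator a b f", OF cn])
    have "continuous_on ?U (\<lambda>z. a (fst z) *\<^sub>R D_t (D_t f) z - wave_operator a b f z)"
      by (rule continuous_on_diff[OF continuous_on_scaleR[OF continuous_on_UNIV_compose[OF ca continuous_on_fst[OF continuous_on_id]] ctt] cn])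
    from c[OF this]
    show "continuous2 ?U (\<lambda>x t. D_x (\<lambda>y. b (fst y) *\<^sub>R D_x f y) (x, t))" by (simp only: F_eq)
    show "continuous_on UNIV a" "continuous_on UNIV b" by (rule ca cb)+
    fix x t :: real assume t: "t \<in> {-T<..<T}"
    show "((\<lambda>t. f (x, t)) has_vector_derivative D_t f (x, t)) (at t)"
      by (rule partial_derivatives(2)[OF d0[OF U[OF t]]])
    show "((\<lambda>x. f (x, t)) has_vector_derivative D_x f (x, t)) (at x)"
      by (rule partial_derivatives(1)[OF d0[OF U[OF t]]])
    have dt': "D_t f differentiable (at (x, t))" if "t \<in> {-T<..<T}" for x t using dt[OF U[OF that]] by simp
    have dx': "D_x f differentiable (at (x, t))" if "t \<in> {-T<..<T}" for x t using dx[OF U[OF that]] by simp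
    show "((\<lambda>t. D_t f (x, t)) has_vector_derivative D_t (D_t f) (x, t)) (at t)"
      by (rule partial_derivatives(2)[OF dt'[OF t]])
    show "((\<lambda>x. D_t f (x, t)) has_vector_derivative D_x (D_t f) (x, t)) (at x)"
      by (rule partial_derivatives(1)[OF dt'[OF t]])
    have "(\<lambda>x t. D_t (D_x f) (x, t)) x t = (\<lambda>x t. D_x (D_t f) (x, t)) x t"
    proof (rule mixed_partials_eq[where f = "\<lambda>x t. f (x, t)" and fx = "\<lambda>x t. D_x f (x, t)" and ft = "\<lambda>x t. D_t f (x, t)"
          and T = T])
      show "continuous2 ?U (\<lambda>x t. D_t f (x, t))" by (rule c[of "D_t f", OF ct])
      show "continuous2 ?U (\<lambda>x t. D_x (D_t f) (x, t))" by (rule c[of "D_x (D_t f)", OF cxt])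
      show "t \<in> {-T<..<T}" by (rule t)
      fix x t assume t: "t \<in> {-T<..<T}"
      show "((\<lambda>x. f (x, t)) has_vector_derivative D_x f (x, t)) (at x)" by (rule partial_derivatives(1)[OF d0[OF U[OF t]]])
      show "((\<lambda>t. f (x, t)) has_vector_derivative D_t f (x, t)) (at t)" by (rule partial_derivatives(2)[OF d0[OF U[OF t]]])
      show "((\<lambda>t. D_x f (x, t)) has_vector_derivative D_t (D_x f) (x, t)) (at t)" by (rule partial_derivatives(2)[OF dx'[OF t]])
      show "((\<lambda>x. D_t f (x, t)) has_vector_derivative D_x (D_t f) (x, t)) (at x)" by (rule partial_derivatives(1)[OF dt'[OF t]])
    qed
    then have mp: "D_t (D_x f) (x, t) = D_x (D_t f) (x, t)" .
    have "((\<lambda>t. D_x f (x, t)) has_vector_derivative D_t (D_x f) (x, t)) (at t)"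
      by (rule partial_derivatives(2)[OF dx'[OF t]])
    then show "((\<lambda>t. D_x f (x, t)) has_vector_derivative D_x (D_t f) (x, t)) (at t)"
      unfolding mp .
    show "((\<lambda>x. b x *\<^sub>R D_x f (x, t)) has_vector_derivative D_x (\<lambda>y. b (fst y) *\<^sub>R D_x f y) (x, t)) (at x)"
      using partial_derivatives(1)[OF flux[OF U[OF t]]] by (simp only: fst_conv)
    show "a x *\<^sub>R D_t (D_t f) (x, t) - D_x (\<lambda>y. b (fst y) *\<^sub>R D_x f y) (x, t) = wave_operator a b f (x, t)"
      by (simp only: F_eq fst_conv) simp
  qed
qed



locale wave_pairing = smooth_wave + transmission_dual +
  fixes L s :: real
  assumes s: "0 < s" "s < T" and L_range: "range_at s \<le> L"
begin

text \<open>The discrepancy between the bilinear form with the dual coefficients and the one with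
  the coefficients of the regularised equation. \<open>e *\<^sub>R wx (e * x) t\<close> is the
  derivative of the reflected function.\<close>

definition "remainder e x t = ((B e - b (e * x)) *\<^sub>R (e *\<^sub>R wx (e * x) t)) * \<zeta>x e x (s - t)
  + ((A e - a (e * x)) *\<^sub>R wt (e * x) t) * \<zeta>t e x (s - t)"

definition "initial_pairing e = integral {0..L} (\<lambda>x. (A e *\<^sub>R \<zeta>t e x s) * w (e * x) 0)
  + integral {0..L} (\<lambda>x. (a (e * x) *\<^sub>R wt (e * x) 0) * \<zeta> e x s)"

lemma L_nonneg: "L \<ge> 0"
  using range_at_ge[of s] s X L_range by linarith

lemma side_cont:
  assumes "continuous2 (UNIV \<times> {-T<..<T}) q"
  shows "continuous2 ({0..L} \<times> {0..s}) (\<lambda>x t. q (e * x) t)"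
proof -
  have "continuous_on ({0..L} \<times> {0..s}) (\<lambda>z :: real \<times> real. (e * fst z, snd z))"
    by (intro continuous_intros)
  moreover have "(\<lambda>z. (e * fst z, snd z)) ` ({0..L} \<times> {0..s}) \<subseteq> UNIV \<times> {-T<..<T}"
    using s by auto
  ultimately have "continuous_on ({0..L} \<times> {0..s}) (\<lambda>z. (\<lambda>y. q (fst y) (snd y)) (e * fst z, snd z))"
    by (rule continuous_on_compose2[OF assms])
  then show ?thesis by (simp only: fst_conv snd_conv)
qed

lemma dual_cont:
  assumes "\<And>S. continuous2 S q"
  shows "continuous2 S (\<lambda>x t. q x (s - t))"
proof -
  have "continuous_on S (\<lambda>z :: real \<times> real. (fst z, s - snd z))"
    by (intro continuous_intros)
  then have "continuous_on S (\<lambda>z. (\<lambda>y. q (fst y) (snd y)) (fst z, s - snd z))"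
    by (rule continuous_on_UNIV_compose[OF assms])
  then show ?thesis by (simp only: fst_conv snd_conv)
qed

lemma coeff_cont: "continuous2 S (\<lambda>x t. a (e * x))" "continuous2 S (\<lambda>x t. b (e * x))"
  by (intro continuous_on_UNIV_compose[OF cont_a] continuous_on_UNIV_compose[OF cont_b] continuous_intros)+

lemma dual_conts:
  "continuous2 S (\<lambda>x t. \<zeta> e x (s - t))" "continuous2 S (\<lambda>x t. \<zeta>x e x (s - t))" "continuous2 S (\<lambda>x t. \<zeta>t e x (s - t))"
  "continuous2 S (\<lambda>x t. \<zeta>xx e x (s - t))" "continuous2 S (\<lambda>x t. \<zeta>tt e x (s - t))"
  by (rule dual_cont[of "\<zeta> e"], rule continuous2_dual, rule dual_cont[of "\<zeta>x e"], rule continuous2_dual,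
      rule dual_cont[of "\<zeta>t e"], rule continuous2_dual, rule dual_cont[of "\<zeta>xx e"], rule continuous2_dual,
      rule dual_cont[of "\<zeta>tt e"], rule continuous2_dual)

lemma side_conts:
  "continuous2 ({0..L} \<times> {0..s}) (\<lambda>x t. w (e * x) t)" "continuous2 ({0..L} \<times> {0..s}) (\<lambda>x t. wt (e * x) t)"
  "continuous2 ({0..L} \<times> {0..s}) (\<lambda>x t. wx (e * x) t)" "continuous2 ({0..L} \<times> {0..s}) (\<lambda>x t. wtt (e * x) t)"
  "continuous2 ({0..L} \<times> {0..s}) (\<lambda>x t. F (e * x) t)" "continuous2 ({0..L} \<times> {0..s}) (\<lambda>x t. n (e * x) t)"
  by (rule side_cont[of w], rule cont, rule side_cont[of wt], rule cont, rule side_cont[of wx], rule cont,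
      rule side_cont[of wtt], rule cont, rule side_cont[of F], rule cont, rule side_cont[of n], rule cont)

lemmas pairing_conts = side_conts coeff_cont dual_conts

lemma remainder_cont: "continuous2 ({0..L} \<times> {0..s}) (remainder e)"
  unfolding remainder_def by (intro continuous_intros pairing_conts)

lemma time: "t \<in> {0..s} \<Longrightarrow> t \<in> {-T<..<T}"
  using s by auto

lemma \<zeta>_time:
  "((\<lambda>t. \<zeta> e x (s - t)) has_vector_derivative - \<zeta>t e x (s - t)) (at t)"
  "((\<lambda>t. - (A e *\<^sub>R \<zeta>t e x (s - t))) has_vector_derivative A e *\<^sub>R \<zeta>tt e x (s - t)) (at t)"
proof -
  have rt: "((\<lambda>t. s - t) has_real_derivative - 1) (at t)" by (auto intro!: derivative_eq_intros)
  show "((\<lambda>t. \<zeta> e x (s - t)) has_vector_derivative - \<zeta>t e x (s - t)) (at t)"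
    using has_vector_derivative_chain_real[OF dual_t rt] by simp
  show "((\<lambda>t. - (A e *\<^sub>R \<zeta>t e x (s - t))) has_vector_derivative A e *\<^sub>R \<zeta>tt e x (s - t)) (at t)"
    using has_vector_derivative_minus[OF has_vector_derivative_scaleR_const[OF has_vector_derivative_chain_real[OF dual_tt rt], of "A e"]] by simp
qed

text \<open>Green's identity for the dual solution against the fields of \<open>w\<close>, and for
  \<open>w\<close> against the dual fields. The two left-hand sides now differ by
  \<open>remainder\<close>, because the fields carry different coefficients.\<close>

lemma side_pairing:
  assumes e: "e \<in> {1, - 1}"
  shows "integral {0..L} (\<lambda>x. G e x * w (e * x) s) = initial_pairing e
    + rect_integral L s (\<lambda>x t. n (e * x) t * \<zeta> e x (s - t)) + rect_integral L s (remainder e)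
    - integral {0..s} (\<lambda>t. (e *\<^sub>R b 0 *\<^sub>R wx 0 t) * \<zeta> e 0 (s - t))
    + integral {0..s} (\<lambda>t. (B e *\<^sub>R \<zeta>x e 0 (s - t)) * w 0 t)"
proof -
  let ?R = "{0..L} \<times> {0..s}"
  have ee: "e * e = 1" "e * (e * y) = y" for y using e by auto
  have s0: "s \<ge> 0" using s by simp
  have ed: "((\<lambda>x. e * x) has_real_derivative e) (at x)" for x by (auto intro!: derivative_eq_intros)
  have far: "\<zeta> e L \<tau> = 0" "\<zeta>x e L \<tau> = 0" if "\<tau> \<in> {0..s}" for \<tau>
    by (rule dual_support[OF e that L_range])+
  note ct = pairing_conts
  have 1: "rect_integral L s (\<lambda>x t. (e *\<^sub>R b (e * x) *\<^sub>R wx (e * x) t) * \<zeta>x e x (s - t) - (a (e * x) *\<^sub>R wt (e * x) t) * - \<zeta>t e x (s - t))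
    = rect_integral L s (\<lambda>x t. (a (e * x) *\<^sub>R wtt (e * x) t - F (e * x) t) * \<zeta> e x (s - t))
      - integral {0..L} (\<lambda>x. (a (e * x) *\<^sub>R wt (e * x) s) * \<zeta> e x (s - s) - (a (e * x) *\<^sub>R wt (e * x) 0) * \<zeta> e x (s - 0))
      + integral {0..s} (\<lambda>t. (e *\<^sub>R b (e * L) *\<^sub>R wx (e * L) t) * \<zeta> e L (s - t) - (e *\<^sub>R b (e * 0) *\<^sub>R wx (e * 0) t) * \<zeta> e 0 (s - t))"
  proof (rule green_identity[OF L_nonneg s0])
    show "((\<lambda>x. e *\<^sub>R b (e * x) *\<^sub>R wx (e * x) t) has_vector_derivative F (e * x) t) (at x)"
      if "x \<in> {0<..<L}" "t \<in> {0..s}" for x t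
      using has_vector_derivative_scaleR_const[OF has_vector_derivative_chain_real[OF flux_x[OF time[OF that(2)]] ed], of e] ee(1) by simp
    show "((\<lambda>t. a (e * x) *\<^sub>R wt (e * x) t) has_vector_derivative a (e * x) *\<^sub>R wtt (e * x) t) (at t)"
      if "x \<in> {0..L}" "t \<in> {0<..<s}" for x t
      by (rule has_vector_derivative_scaleR_const[OF wt_t]) (use that s in auto)
  qed (intro continuous_intros ct dual_x \<zeta>_time)+
  have 2: "rect_integral L s (\<lambda>x t. (B e *\<^sub>R \<zeta>x e x (s - t)) * (e *\<^sub>R wx (e * x) t) - (- (A e *\<^sub>R \<zeta>t e x (s - t))) * wt (e * x) t)
    = rect_integral L s (\<lambda>x t. (A e *\<^sub>R \<zeta>tt e x (s - t) - B e *\<^sub>R \<zeta>xx e x (s - t)) * w (e * x) t)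
      - integral {0..L} (\<lambda>x. (- (A e *\<^sub>R \<zeta>t e x (s - s))) * w (e * x) s - (- (A e *\<^sub>R \<zeta>t e x (s - 0))) * w (e * x) 0)
      + integral {0..s} (\<lambda>t. (B e *\<^sub>R \<zeta>x e L (s - t)) * w (e * L) t - (B e *\<^sub>R \<zeta>x e 0 (s - t)) * w (e * 0) t)"
  proof (rule green_identity[OF L_nonneg s0])
    show "((\<lambda>x. w (e * x) t) has_vector_derivative e *\<^sub>R wx (e * x) t) (at x)" if "x \<in> {0<..<L}" "t \<in> {0..s}" for x t
      by (rule has_vector_derivative_chain_real[OF w_x[OF time[OF that(2)]] ed])
    show "((\<lambda>t. w (e * x) t) has_vector_derivative wt (e * x) t) (at t)" if "x \<in> {0..L}" "t \<in> {0<..<s}" for x t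
      by (rule w_t) (use that s in auto)
  qed (intro continuous_intros ct has_vector_derivative_scaleR_const dual_xx \<zeta>_time)+
  let ?l = "\<lambda>x t. (e *\<^sub>R b (e * x) *\<^sub>R wx (e * x) t) * \<zeta>x e x (s - t) - (a (e * x) *\<^sub>R wt (e * x) t) * - \<zeta>t e x (s - t)"
  have lhs: "rect_integral L s (\<lambda>x t. (B e *\<^sub>R \<zeta>x e x (s - t)) * (e *\<^sub>R wx (e * x) t) - (- (A e *\<^sub>R \<zeta>t e x (s - t))) * wt (e * x) t)
      = rect_integral L s (remainder e) + rect_integral L s ?l"
  proof -
    have "rect_integral L s (\<lambda>x t. (B e *\<^sub>R \<zeta>x e x (s - t)) * (e *\<^sub>R wx (e * x) t) - (- (A e *\<^sub>R \<zeta>t e x (s - t))) * wt (e * x) t)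
      = rect_integral L s (\<lambda>x t. remainder e x t + ?l x t)"
      by (rule rect_integral_cong) (simp add: remainder_def scaleR_conv_of_real algebra_simps)
    also have "\<dots> = rect_integral L s (remainder e) + rect_integral L s ?l"
      by (rule rect_integral_add[OF remainder_cont]) (intro continuous_intros ct)
    finally show ?thesis .
  qed
  have a1: "rect_integral L s (\<lambda>x t. (a (e * x) *\<^sub>R wtt (e * x) t - F (e * x) t) * \<zeta> e x (s - t))
      = rect_integral L s (\<lambda>x t. n (e * x) t * \<zeta> e x (s - t))"
  proof (rule rect_integral_cong)
    fix x t assume "t \<in> {0..s}"
    from equation[OF time[OF this]]
    show "(a (e * x) *\<^sub>R wtt (e * x) t - F (e * x) t) * \<zeta> e x (s - t) = n (e * x) t * \<zeta> e x (s - t)"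
      by (simp only:)
  qed
  have a2: "integral {0..L} (\<lambda>x. (a (e * x) *\<^sub>R wt (e * x) s) * \<zeta> e x (s - s) - (a (e * x) *\<^sub>R wt (e * x) 0) * \<zeta> e x (s - 0))
      = - integral {0..L} (\<lambda>x. (a (e * x) *\<^sub>R wt (e * x) 0) * \<zeta> e x s)"
    by (simp add: dual_initial(1))
  have a3: "integral {0..s} (\<lambda>t. (e *\<^sub>R b (e * L) *\<^sub>R wx (e * L) t) * \<zeta> e L (s - t) - (e *\<^sub>R b (e * 0) *\<^sub>R wx (e * 0) t) * \<zeta> e 0 (s - t))
      = - integral {0..s} (\<lambda>t. (e *\<^sub>R b 0 *\<^sub>R wx 0 t) * \<zeta> e 0 (s - t))"
    unfolding Henstock_Kurzweil_Integration.integral_neg[symmetric]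
    by (rule integral_cong) (simp add: far)
  have b1: "rect_integral L s (\<lambda>x t. (A e *\<^sub>R \<zeta>tt e x (s - t) - B e *\<^sub>R \<zeta>xx e x (s - t)) * w (e * x) t) = 0"
    by (simp add: dual_equation rect_integral_def)
  have cx: "continuous_on {0..L} (\<lambda>x. q (e * x) t)" if "continuous2 (UNIV \<times> {-T<..<T}) q" "t \<in> {0..s}" for q :: "real \<Rightarrow> real \<Rightarrow> complex" and t
    by (rule continuous2_slice_x[OF side_cont[OF that(1)] that(2)])
  have b2: "integral {0..L} (\<lambda>x. (- (A e *\<^sub>R \<zeta>t e x (s - s))) * w (e * x) s - (- (A e *\<^sub>R \<zeta>t e x (s - 0))) * w (e * x) 0)
      = integral {0..L} (\<lambda>x. (A e *\<^sub>R \<zeta>t e x s) * w (e * x) 0) - integral {0..L} (\<lambda>x. G e x * w (e * x) s)"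
  proof -
    have i: "(\<lambda>x. (A e *\<^sub>R \<zeta>t e x s) * w (e * x) 0) integrable_on {0..L}" "(\<lambda>x. G e x * w (e * x) s) integrable_on {0..L}"
      by (rule integrable_continuous_real, intro continuous_intros cx cont continuous2_slice_x[OF continuous2_dual(3)[of "{0..L} \<times> UNIV"]]
          continuous_on_subset[OF G_cont]; use s in auto)+
    show ?thesis
      unfolding Henstock_Kurzweil_Integration.integral_diff[OF i, symmetric]
      by (rule integral_cong) (simp add: dual_initial(2))
  qed
  have b3: "integral {0..s} (\<lambda>t. (B e *\<^sub>R \<zeta>x e L (s - t)) * w (e * L) t - (B e *\<^sub>R \<zeta>x e 0 (s - t)) * w (e * 0) t)
      = - integral {0..s} (\<lambda>t. (B e *\<^sub>R \<zeta>x e 0 (s - t)) * w 0 t)"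
    unfolding Henstock_Kurzweil_Integration.integral_neg[symmetric]
    by (rule integral_cong) (simp add: far)
  show ?thesis
    using 1 2 lhs unfolding a1 a2 a3 b1 b2 b3 initial_pairing_def by algebra
qed

text \<open>As \<open>w\<close> is differentiable across the interface, both sides see the same
  value of \<open>w\<close> there and opposite fluxes. Together with the matching values and
  cancelling fluxes of the dual solution this removes all interface terms without any condition on
  \<open>w\<close>.\<close>

theorem duality:
  "(\<Sum>e\<in>{1, - 1}. integral {0..L} (\<lambda>x. G e x * w (e * x) s)) =
   (\<Sum>e\<in>{1, - 1}. initial_pairing e + rect_integral L s (\<lambda>x t. n (e * x) t * \<zeta> e x (s - t)) + rect_integral L s (remainder e))"
proof -
  have i: "integral {0..s} (\<lambda>t. (1 *\<^sub>R b 0 *\<^sub>R wx 0 t) * \<zeta> 1 0 (s - t)) = - integral {0..s} (\<lambda>t. (- 1 *\<^sub>R b 0 *\<^sub>R wx 0 t) * \<zeta> (- 1) 0 (s - t))"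
    unfolding Henstock_Kurzweil_Integration.integral_neg[symmetric]
  proof (rule integral_cong)
    fix t assume "t \<in> {0..s}"
    then have "\<zeta> 1 0 (s - t) = \<zeta> (- 1) 0 (s - t)" by (intro dual_continuous_at_interface) simp
    then show "(1 *\<^sub>R b 0 *\<^sub>R wx 0 t) * \<zeta> 1 0 (s - t) = - ((- 1 *\<^sub>R b 0 *\<^sub>R wx 0 t) * \<zeta> (- 1) 0 (s - t))" by simp
  qed
  have j: "integral {0..s} (\<lambda>t. (B 1 *\<^sub>R \<zeta>x 1 0 (s - t)) * w 0 t) = - integral {0..s} (\<lambda>t. (B (- 1) *\<^sub>R \<zeta>x (- 1) 0 (s - t)) * w 0 t)"
    unfolding Henstock_Kurzweil_Integration.integral_neg[symmetric]
  proof (rule integral_cong)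
    fix t assume "t \<in> {0..s}"
    then have "B 1 *\<^sub>R \<zeta>x 1 0 (s - t) + B (- 1) *\<^sub>R \<zeta>x (- 1) 0 (s - t) = 0" by (intro dual_flux_at_interface) simp
    then have "B 1 *\<^sub>R \<zeta>x 1 0 (s - t) = - (B (- 1) *\<^sub>R \<zeta>x (- 1) 0 (s - t))" by (simp add: eq_neg_iff_add_eq_0)
    then show "(B 1 *\<^sub>R \<zeta>x 1 0 (s - t)) * w 0 t = - ((B (- 1) *\<^sub>R \<zeta>x (- 1) 0 (s - t)) * w 0 t)" by simp
  qed
  have m: "(1 :: real) \<noteq> - 1" by simp
  have sum2: "(\<Sum>e\<in>{1, - 1}. q e) = q 1 + q (- 1)" for q :: "real \<Rightarrow> complex" by simp
  show ?thesis
    unfolding sum2 side_pairing[of 1, simplified insert_iff, OF disjI1[OF refl]]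
      side_pairing[of "- 1", simplified insert_iff, OF disjI2[OF disjI1[OF refl]]] i j
    by simp
qed

end

section \<open>Quantitative form of the duality\<close>

lemma side_integral_le:
  fixes q :: "real \<Rightarrow> real"
  assumes e: "e \<in> {1, - 1}" and L: "L \<ge> 0" and q: "continuous_on {-L..L} q" "\<And>x. q x \<ge> 0"
  shows "integral {0..L} (\<lambda>x. q (e * x)) \<le> integral {-L..L} q"
proof -
  have i: "q integrable_on {a..b}" if "{a..b} \<subseteq> {-L..L}" for a b
    by (rule integrable_continuous_real[OF continuous_on_subset[OF q(1) that]])
  have "integral {0..L} (\<lambda>x. q (e * x)) = integral (if e = 1 then {0..L} else {-L..0}) q"
    using e Henstock_Kurzweil_Integration.integral_reflect_real[of 0 "-L" q] by auto
  also have "\<dots> \<le> integral {-L..L} q"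
    by (rule integral_subset_le) (use L q(2) i in auto)
  finally show ?thesis .
qed

lemma integral_product_bound:
  fixes f g h :: "real \<Rightarrow> complex"
  assumes c: "continuous_on {a..b} f" "continuous_on {a..b} g" "continuous_on {a..b} h"
    and h: "\<And>x. x \<in> {a..b} \<Longrightarrow> norm (h x) \<le> C" and C: "C \<ge> 0"
  shows "norm (integral {a..b} (\<lambda>x. (f x * g x) * h x))
    \<le> C * (sqrt (integral {a..b} (\<lambda>x. (norm (f x))\<^sup>2)) * sqrt (integral {a..b} (\<lambda>x. (norm (g x))\<^sup>2)))"
proof -
  have "norm (integral {a..b} (\<lambda>x. (f x * g x) * h x)) \<le> integral {a..b} (\<lambda>x. C * (norm (f x) * norm (g x)))"
  proof (rule integral_norm_bound_integral)
    show "(\<lambda>x. (f x * g x) * h x) integrable_on {a..b}"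
      by (intro integrable_continuous_real continuous_intros c)
    show "(\<lambda>x. C * (norm (f x) * norm (g x))) integrable_on {a..b}"
      by (intro integrable_continuous_real continuous_intros c)
    show "norm ((f x * g x) * h x) \<le> C * (norm (f x) * norm (g x))" if "x \<in> {a..b}" for x
      using mult_right_mono[OF h[OF that], of "norm (f x) * norm (g x)"] by (simp add: norm_mult mult_ac)
  qed
  also have "\<dots> = C * integral {a..b} (\<lambda>x. norm (f x) * norm (g x))"
    by (rule integral_mult_right)
  also have "\<dots> \<le> C * (sqrt (integral {a..b} (\<lambda>x. (norm (f x))\<^sup>2)) * sqrt (integral {a..b} (\<lambda>x. (norm (g x))\<^sup>2)))"
    by (rule mult_left_mono[OF integral_Cauchy_Schwarz[OF c(1,2)] C])
  finally show ?thesis .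
qed

lemma integral_square_triangle:
  fixes f g :: "real \<Rightarrow> complex"
  assumes c: "continuous_on {a..b} f" "continuous_on {a..b} g"
  shows "integral {a..b} (\<lambda>x. (norm (f x))\<^sup>2) \<le> 2 * integral {a..b} (\<lambda>x. (norm (f x - g x))\<^sup>2) + 2 * integral {a..b} (\<lambda>x. (norm (g x))\<^sup>2)"
proof -
  have i: "(\<lambda>x. 2 * (norm (f x - g x))\<^sup>2) integrable_on {a..b}" "(\<lambda>x. 2 * (norm (g x))\<^sup>2) integrable_on {a..b}"
    by (intro integrable_continuous_real continuous_intros c)+
  have "integral {a..b} (\<lambda>x. (norm (f x))\<^sup>2) \<le> integral {a..b} (\<lambda>x. 2 * (norm (f x - g x))\<^sup>2 + 2 * (norm (g x))\<^sup>2)"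
  proof (rule integral_le)
    show "(norm (f x))\<^sup>2 \<le> 2 * (norm (f x - g x))\<^sup>2 + 2 * (norm (g x))\<^sup>2" for x
      using norm_add_square_le[of "f x - g x" "g x"] by simp
  qed (intro integrable_continuous_real continuous_intros c)+
  also have "\<dots> = 2 * integral {a..b} (\<lambda>x. (norm (f x - g x))\<^sup>2) + 2 * integral {a..b} (\<lambda>x. (norm (g x))\<^sup>2)"
    unfolding Henstock_Kurzweil_Integration.integral_add[OF i] by simp
  finally show ?thesis .
qed

context wave_pairing
begin

text \<open>The limit form of \<open>initial_pairing\<close>, with the limit coefficient and the
  unregularised data; it coincides with the side \<open>e\<close> summand in the pairing of the
  connected solution.\<close>

definition "target w0 w1 e = integral {0..L} (\<lambda>x. (A e *\<^sub>R w1 (e * x)) * \<zeta> e x s)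
  + integral {0..L} (\<lambda>x. (A e *\<^sub>R w0 (e * x)) * \<zeta>t e x s)"

text \<open>One summand for each source of error: initial displacement, coefficient against initial
  velocity, initial velocity, residual, and \<open>remainder\<close> over the time interval. Each
  contains an L2 factor that tends to 0. \<open>C\<close> bounds the dual solution and its first
  derivatives, \<open>E\<close> the squared L2 norms of the derivatives of \<open>w\<close>.\<close>

definition "error C E w0 w1 e = C * A e * (sqrt L * sqrt (integral {-L..L} (\<lambda>x. (norm (w x 0 - w0 x))\<^sup>2)))
  + C * (sqrt (integral {0..L} (\<lambda>x. (A e - a (e * x))\<^sup>2)) * sqrt E)
  + C * A e * (sqrt L * sqrt (integral {-L..L} (\<lambda>x. (norm (wt x 0 - w1 x))\<^sup>2)))
  + C * (sqrt L * (sqrt s * sqrt (integral {0..s} (\<lambda>t. integral {-L..L} (\<lambda>x. (norm (n x t))\<^sup>2)))))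
  + s * (C * (sqrt (integral {0..L} (\<lambda>x. (B e - b (e * x))\<^sup>2)) * sqrt E)
    + C * (sqrt (integral {0..L} (\<lambda>x. (A e - a (e * x))\<^sup>2)) * sqrt E))"

lemma line_cont:
  assumes "continuous2 (UNIV \<times> {-T<..<T}) q" "t \<in> {0..s}"
  shows "continuous_on S (\<lambda>x. q x t)" "continuous_on S (\<lambda>x. q (e * x) t)"
proof -
  have *: "continuous_on UNIV (\<lambda>x. q x t)"
    by (rule continuous2_slice_x[OF assms(1) time[OF assms(2)]])
  show "continuous_on S (\<lambda>x. q x t)" by (rule continuous_on_subset[OF *]) simp
  have "continuous_on S (\<lambda>x. e * x)" by (intro continuous_intros)
  from continuous_on_UNIV_compose[OF * this] show "continuous_on S (\<lambda>x. q (e * x) t)" .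
qed

lemma dual_line_cont:
  "continuous_on S (\<lambda>x. \<zeta> e x t)" "continuous_on S (\<lambda>x. \<zeta>x e x t)" "continuous_on S (\<lambda>x. \<zeta>t e x t)"
  by (rule continuous2_slice_x[OF continuous2_dual(1)[of "S \<times> UNIV"]], simp,
      rule continuous2_slice_x[OF continuous2_dual(2)[of "S \<times> UNIV"]], simp,
      rule continuous2_slice_x[OF continuous2_dual(3)[of "S \<times> UNIV"]], simp)

lemma side_L2_le:
  assumes "continuous_on UNIV q" and e: "e \<in> {1, - 1}"
  shows "sqrt (integral {0..L} (\<lambda>x. (norm (q (e * x)))\<^sup>2)) \<le> sqrt (integral {-L..L} (\<lambda>x. (norm (q x :: complex))\<^sup>2))"
proof (rule real_sqrt_le_mono, rule side_integral_le[OF e L_nonneg])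
  show "continuous_on {-L..L} (\<lambda>x. (norm (q x))\<^sup>2)"
    by (intro continuous_intros continuous_on_subset[OF assms(1)]) simp
qed simp

lemma side_error:
  assumes C: "C \<ge> 0" and dual_le: "\<And>x t. x \<in> {0..L} \<Longrightarrow> t \<in> {0..s} \<Longrightarrow> norm (\<zeta> e x t) \<le> C \<and> norm (\<zeta>x e x t) \<le> C \<and> norm (\<zeta>t e x t) \<le> C"
    and E: "\<And>t. t \<in> {0..s} \<Longrightarrow> integral {-L..L} (\<lambda>x. (norm (wt x t))\<^sup>2) \<le> E \<and> integral {-L..L} (\<lambda>x. (norm (wx x t))\<^sup>2) \<le> E"
    and w0: "continuous_on UNIV w0" and w1: "continuous_on UNIV w1" and e: "e \<in> {1, - 1}"
  shows "norm (initial_pairing e + rect_integral L s (\<lambda>x t. n (e * x) t * \<zeta> e x (s - t)) + rect_integral L s (remainder e)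
    - target w0 w1 e) \<le> error C E w0 w1 e"
proof -
  have s0: "0 \<in> {0..s}" "s \<in> {0..s}" using s by auto
  have t': "s - t \<in> {0..s}" if "t \<in> {0..s}" for t using that by auto
  have comp: "continuous_on S (\<lambda>x. q (e * x))" if "continuous_on UNIV q" for q :: "real \<Rightarrow> 'z::topological_space" and S
    by (rule continuous_on_UNIV_compose[OF that]) (intro continuous_intros)
  have L1: "sqrt (integral {0..L} (\<lambda>x. (norm (1 :: complex))\<^sup>2)) = sqrt L"
    using L_nonneg by simp
  have E0: "sqrt (integral {0..L} (\<lambda>x. (norm (wt (e * x) t))\<^sup>2)) \<le> sqrt E"
      "sqrt (integral {0..L} (\<lambda>x. (norm (e *\<^sub>R wx (e * x) t))\<^sup>2)) \<le> sqrt E" if "t \<in> {0..s}" for t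
  proof -
    show "sqrt (integral {0..L} (\<lambda>x. (norm (wt (e * x) t))\<^sup>2)) \<le> sqrt E"
      using side_L2_le[OF line_cont(1)[OF cont(2) that] e] E[OF that] by (meson order_trans real_sqrt_le_mono)
    have "norm (e *\<^sub>R wx (e * x) t) = norm (wx (e * x) t)" for x using e by auto
    then show "sqrt (integral {0..L} (\<lambda>x. (norm (e *\<^sub>R wx (e * x) t))\<^sup>2)) \<le> sqrt E"
      using side_L2_le[OF line_cont(1)[OF cont(3) that] e] E[OF that] by (simp only:) (meson order_trans real_sqrt_le_mono)
  qed
  note cs = line_cont[OF cont(1)] line_cont[OF cont(2)] line_cont[OF cont(3)] line_cont[OF cont(7)] dual_line_cont
    comp[OF cont_a] comp[OF cont_b] comp[OF w0] comp[OF w1]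
  define \<alpha> where "\<alpha> = sqrt (integral {0..L} (\<lambda>x. (A e - a (e * x))\<^sup>2))"
  define \<beta> where "\<beta> = sqrt (integral {0..L} (\<lambda>x. (B e - b (e * x))\<^sup>2))"
  have \<alpha>0: "\<alpha> \<ge> 0" and \<beta>0: "\<beta> \<ge> 0"
    by (auto simp: \<alpha>_def \<beta>_def intro!: integral_nonneg integrable_continuous_real continuous_intros cs)
  have \<alpha>': "sqrt (integral {0..L} (\<lambda>x. (norm (complex_of_real (A e - a (e * x))))\<^sup>2)) = \<alpha>"
    by (simp only: \<alpha>_def norm_of_real power2_abs)
  have \<beta>': "sqrt (integral {0..L} (\<lambda>x. (norm (complex_of_real (B e - b (e * x))))\<^sup>2)) = \<beta>"
    by (simp only: \<beta>_def norm_of_real power2_abs)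
  \<comment> \<open>The velocity terms are split by a w_t - A w1 = A (w_t - w1) - (A - a) w_t, which
    gives J3 - J2. The factor 1 in J1 and J3 is the second function in Cauchy-Schwarz and produces
    \<open>sqrt L\<close>.\<close>
  define J1 where "J1 = integral {0..L} (\<lambda>x. (1 * (w (e * x) 0 - w0 (e * x))) * (A e *\<^sub>R \<zeta>t e x s))"
  define J2 where "J2 = integral {0..L} (\<lambda>x. (complex_of_real (A e - a (e * x)) * wt (e * x) 0) * \<zeta> e x s)"
  define J3 where "J3 = integral {0..L} (\<lambda>x. (1 * (wt (e * x) 0 - w1 (e * x))) * (A e *\<^sub>R \<zeta> e x s))"
  have A0: "A e > 0" by (rule pos(1))
  have scaled: "norm (A e *\<^sub>R z) \<le> C * A e" if "norm z \<le> C" for z :: complex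
    using mult_left_mono[OF that, of "A e"] A0 by (simp add: mult.commute)
  have J1: "norm J1 \<le> C * A e * (sqrt L * sqrt (integral {-L..L} (\<lambda>x. (norm (w x 0 - w0 x))\<^sup>2)))"
  proof -
    have "norm J1 \<le> (C * A e) * (sqrt (integral {0..L} (\<lambda>x. (norm (1 :: complex))\<^sup>2)) * sqrt (integral {0..L} (\<lambda>x. (norm (w (e * x) 0 - w0 (e * x)))\<^sup>2)))"
      unfolding J1_def
      by (rule integral_product_bound) (use dual_le s0 scaled C A0 in \<open>auto intro!: continuous_intros cs\<close>)
    also have "\<dots> \<le> (C * A e) * (sqrt L * sqrt (integral {-L..L} (\<lambda>x. (norm (w x 0 - w0 x))\<^sup>2)))"
      unfolding L1
      by (intro mult_left_mono side_L2_le[of "\<lambda>x. w x 0 - w0 x"] continuous_intros cs w0 e) (use C A0 L_nonneg s0 in auto)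
    finally show ?thesis .
  qed
  have J3: "norm J3 \<le> C * A e * (sqrt L * sqrt (integral {-L..L} (\<lambda>x. (norm (wt x 0 - w1 x))\<^sup>2)))"
  proof -
    have "norm J3 \<le> (C * A e) * (sqrt (integral {0..L} (\<lambda>x. (norm (1 :: complex))\<^sup>2)) * sqrt (integral {0..L} (\<lambda>x. (norm (wt (e * x) 0 - w1 (e * x)))\<^sup>2)))"
      unfolding J3_def
      by (rule integral_product_bound) (use dual_le s0 scaled C A0 in \<open>auto intro!: continuous_intros cs\<close>)
    also have "\<dots> \<le> (C * A e) * (sqrt L * sqrt (integral {-L..L} (\<lambda>x. (norm (wt x 0 - w1 x))\<^sup>2)))"
      unfolding L1
      by (intro mult_left_mono side_L2_le[of "\<lambda>x. wt x 0 - w1 x"] continuous_intros cs w1 e) (use C A0 L_nonneg s0 in auto)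
    finally show ?thesis .
  qed
  have J2: "norm J2 \<le> C * (\<alpha> * sqrt E)"
  proof -
    have "norm J2 \<le> C * (\<alpha> * sqrt (integral {0..L} (\<lambda>x. (norm (wt (e * x) 0))\<^sup>2)))"
      unfolding J2_def \<alpha>'[symmetric]
      by (rule integral_product_bound) (use dual_le s0 C in \<open>auto intro!: continuous_intros cs\<close>)
    also have "\<dots> \<le> C * (\<alpha> * sqrt E)"
      by (intro mult_left_mono E0 s0 C \<alpha>0)
    finally show ?thesis .
  qed
  have init: "initial_pairing e - target w0 w1 e = J1 - J2 + J3"
  proof -
    have 1: "integral {0..L} (\<lambda>x. (A e *\<^sub>R \<zeta>t e x s) * w (e * x) 0) - integral {0..L} (\<lambda>x. (A e *\<^sub>R w0 (e * x)) * \<zeta>t e x s) = J1"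
    proof -
      have i: "(\<lambda>x. (A e *\<^sub>R \<zeta>t e x s) * w (e * x) 0) integrable_on {0..L}" "(\<lambda>x. (A e *\<^sub>R w0 (e * x)) * \<zeta>t e x s) integrable_on {0..L}"
        by (intro integrable_continuous_real continuous_intros cs s0)+
      show ?thesis
        unfolding Henstock_Kurzweil_Integration.integral_diff[OF i, symmetric] J1_def
        by (rule integral_cong) (simp add: scaleR_conv_of_real algebra_simps)
    qed
    have 2: "integral {0..L} (\<lambda>x. (a (e * x) *\<^sub>R wt (e * x) 0) * \<zeta> e x s) - integral {0..L} (\<lambda>x. (A e *\<^sub>R w1 (e * x)) * \<zeta> e x s) = J3 - J2"
    proof -
      have i: "(\<lambda>x. (a (e * x) *\<^sub>R wt (e * x) 0) * \<zeta> e x s) integrable_on {0..L}" "(\<lambda>x. (A e *\<^sub>R w1 (e * x)) * \<zeta> e x s) integrable_on {0..L}"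
        "(\<lambda>x. (1 * (wt (e * x) 0 - w1 (e * x))) * (A e *\<^sub>R \<zeta> e x s)) integrable_on {0..L}"
        "(\<lambda>x. (complex_of_real (A e - a (e * x)) * wt (e * x) 0) * \<zeta> e x s) integrable_on {0..L}"
        by (intro integrable_continuous_real continuous_intros cs s0)+
      show ?thesis
        unfolding J3_def J2_def Henstock_Kurzweil_Integration.integral_diff[OF i(1,2), symmetric] Henstock_Kurzweil_Integration.integral_diff[OF i(3,4), symmetric]
        by (rule integral_cong) (simp add: scaleR_conv_of_real algebra_simps)
    qed
    show ?thesis
      using 1 2 unfolding initial_pairing_def target_def by (simp add: algebra_simps)
  qed
  define N where "N = (\<lambda>t. integral {-L..L} (\<lambda>x. (norm (n x t))\<^sup>2))"
  have N_cont: "continuous_on {0..s} N"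
    unfolding N_def
    by (rule continuous2_integral_x, intro continuous_intros, rule continuous_on_subset[OF cont(7)]) (use s in auto)
  have N0: "N t \<ge> 0" if "t \<in> {0..s}" for t
    unfolding N_def by (intro integral_nonneg integrable_continuous_real continuous_intros cs that) simp
  \<comment> \<open>Cauchy-Schwarz in x for each t, and once more in t, since for the residual only
    the integral over space and time is small.\<close>
  have R1: "norm (rect_integral L s (\<lambda>x t. n (e * x) t * \<zeta> e x (s - t))) \<le> C * (sqrt L * (sqrt s * sqrt (integral {0..s} N)))"
  proof -
    have "norm (rect_integral L s (\<lambda>x t. n (e * x) t * \<zeta> e x (s - t))) \<le> integral {0..s} (\<lambda>t. C * (sqrt L * (norm (1::real) * norm (sqrt (N t)))))"
      unfolding rect_integral_def
    proof (rule integral_norm_bound_integral)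
      show "(\<lambda>t. integral {0..L} (\<lambda>x. n (e * x) t * \<zeta> e x (s - t))) integrable_on {0..s}"
        by (intro integrable_continuous_real continuous2_integral_x continuous_intros pairing_conts)
      show "(\<lambda>t. C * (sqrt L * (norm (1::real) * norm (sqrt (N t))))) integrable_on {0..s}"
        by (intro integrable_continuous_real continuous_intros N_cont)
      fix t assume t: "t \<in> {0..s}"
      have "norm (integral {0..L} (\<lambda>x. (1 * n (e * x) t) * \<zeta> e x (s - t)))
        \<le> C * (sqrt (integral {0..L} (\<lambda>x. (norm (1 :: complex))\<^sup>2)) * sqrt (integral {0..L} (\<lambda>x. (norm (n (e * x) t))\<^sup>2)))"
        by (rule integral_product_bound) (use dual_le t'[OF t] t C in \<open>auto intro!: continuous_intros cs\<close>)
      also have "\<dots> \<le> C * (sqrt L * sqrt (N t))"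
        unfolding L1 N_def by (intro mult_left_mono side_L2_le[of "\<lambda>x. n x t"] cs t e) (use C L_nonneg in auto)
      finally show "norm (integral {0..L} (\<lambda>x. n (e * x) t * \<zeta> e x (s - t))) \<le> C * (sqrt L * (norm (1::real) * norm (sqrt (N t))))"
        using N0[OF t] by simp
    qed
    also have "\<dots> = C * (sqrt L * integral {0..s} (\<lambda>t. norm (1::real) * norm (sqrt (N t))))"
      by (simp only: integral_mult_right)
    also have "\<dots> \<le> C * (sqrt L * (sqrt (integral {0..s} (\<lambda>t. (norm (1::real))\<^sup>2)) * sqrt (integral {0..s} (\<lambda>t. (norm (sqrt (N t)))\<^sup>2))))"
      by (intro mult_left_mono integral_Cauchy_Schwarz continuous_intros N_cont C) (use L_nonneg in simp)
    also have "integral {0..s} (\<lambda>t. (norm (sqrt (N t)))\<^sup>2) = integral {0..s} N"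
      by (rule integral_cong) (use N0 in simp)
    also have "integral {0..s} (\<lambda>t. (norm (1::real))\<^sup>2) = s" using s by simp
    finally show ?thesis .
  qed
  have R2: "norm (rect_integral L s (remainder e)) \<le> s * (C * (\<beta> * sqrt E) + C * (\<alpha> * sqrt E))"
  proof -
    have "norm (rect_integral L s (remainder e)) \<le> integral {0..s} (\<lambda>t. C * (\<beta> * sqrt E) + C * (\<alpha> * sqrt E))"
      unfolding rect_integral_def
    proof (rule integral_norm_bound_integral)
      show "(\<lambda>t. integral {0..L} (\<lambda>x. remainder e x t)) integrable_on {0..s}"
        by (intro integrable_continuous_real continuous2_integral_x remainder_cont)
      fix t assume t: "t \<in> {0..s}"
      define f where "f = (\<lambda>x. (complex_of_real (B e - b (e * x)) * (e *\<^sub>R wx (e * x) t)) * \<zeta>x e x (s - t))"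
      define g where "g = (\<lambda>x. (complex_of_real (A e - a (e * x)) * wt (e * x) t) * \<zeta>t e x (s - t))"
      have i: "f integrable_on {0..L}" "g integrable_on {0..L}"
        unfolding f_def g_def by (intro integrable_continuous_real continuous_intros cs t)+
      have "integral {0..L} (\<lambda>x. remainder e x t) = integral {0..L} (\<lambda>x. f x + g x)"
        by (rule integral_cong) (simp add: remainder_def f_def g_def scaleR_conv_of_real)
      also have "\<dots> = integral {0..L} f + integral {0..L} g"
        by (rule Henstock_Kurzweil_Integration.integral_add[OF i])
      finally have "norm (integral {0..L} (\<lambda>x. remainder e x t)) \<le> norm (integral {0..L} f) + norm (integral {0..L} g)"
        by (simp add: norm_triangle_ineq)
      moreover have "norm (integral {0..L} f) \<le> C * (\<beta> * sqrt E)"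
      proof -
        have "norm (integral {0..L} f) \<le> C * (\<beta> * sqrt (integral {0..L} (\<lambda>x. (norm (e *\<^sub>R wx (e * x) t))\<^sup>2)))"
          unfolding f_def \<beta>'[symmetric]
          by (rule integral_product_bound) (use dual_le t'[OF t] t C in \<open>auto intro!: continuous_intros cs\<close>)
        also have "\<dots> \<le> C * (\<beta> * sqrt E)" by (intro mult_left_mono E0 t C \<beta>0)
        finally show ?thesis .
      qed
      moreover have "norm (integral {0..L} g) \<le> C * (\<alpha> * sqrt E)"
      proof -
        have "norm (integral {0..L} g) \<le> C * (\<alpha> * sqrt (integral {0..L} (\<lambda>x. (norm (wt (e * x) t))\<^sup>2)))"
          unfolding g_def \<alpha>'[symmetric]
          by (rule integral_product_bound) (use dual_le t'[OF t] t C in \<open>auto intro!: continuous_intros cs\<close>)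
        also have "\<dots> \<le> C * (\<alpha> * sqrt E)" by (intro mult_left_mono E0 t C \<alpha>0)
        finally show ?thesis .
      qed
      ultimately show "norm (integral {0..L} (\<lambda>x. remainder e x t)) \<le> C * (\<beta> * sqrt E) + C * (\<alpha> * sqrt E)"
        by linarith
    qed (rule integrable_const_ivl)
    also have "\<dots> = s * (C * (\<beta> * sqrt E) + C * (\<alpha> * sqrt E))" using s by simp
    finally show ?thesis .
  qed
  have "initial_pairing e + rect_integral L s (\<lambda>x t. n (e * x) t * \<zeta> e x (s - t)) + rect_integral L s (remainder e)
    - target w0 w1 e = J1 - J2 + J3 + rect_integral L s (\<lambda>x t. n (e * x) t * \<zeta> e x (s - t)) + rect_integral L s (remainder e)"
    using init by (simp add: algebra_simps)
  moreover have "norm (z1 - z2 + z3 + z4 + z5) \<le> norm z1 + norm z2 + norm z3 + norm z4 + norm z5" for z1 z2 z3 z4 z5 :: complex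
    using norm_triangle_ineq[of "z1 - z2 + z3 + z4" z5] norm_triangle_ineq[of "z1 - z2 + z3" z4]
      norm_triangle_ineq[of "z1 - z2" z3] norm_triangle_ineq4[of z1 z2] by linarith
  ultimately have "norm (initial_pairing e + rect_integral L s (\<lambda>x t. n (e * x) t * \<zeta> e x (s - t)) + rect_integral L s (remainder e)
    - target w0 w1 e) \<le> norm J1 + norm J2 + norm J3 + norm (rect_integral L s (\<lambda>x t. n (e * x) t * \<zeta> e x (s - t))) + norm (rect_integral L s (remainder e))"
    by (simp only:)
  also have "\<dots> \<le> error C E w0 w1 e"
    unfolding error_def \<alpha>_def[symmetric] \<beta>_def[symmetric]
    using J1 J2 J3 R1[unfolded N_def] R2 by linarith
  finally show ?thesis .
qed

lemma duality_error:
  assumes C: "C \<ge> 0" and dual_le: "\<And>e x t. e \<in> {1, - 1} \<Longrightarrow> x \<in> {0..L} \<Longrightarrow> t \<in> {0..s} \<Longrightarrow> norm (\<zeta> e x t) \<le> C \<and> norm (\<zeta>x e x t) \<le> C \<and> norm (\<zeta>t e x t) \<le> C"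
    and E: "\<And>t. t \<in> {0..s} \<Longrightarrow> integral {-L..L} (\<lambda>x. (norm (wt x t))\<^sup>2) \<le> E \<and> integral {-L..L} (\<lambda>x. (norm (wx x t))\<^sup>2) \<le> E"
    and w0: "continuous_on UNIV w0" and w1: "continuous_on UNIV w1"
  shows "norm ((\<Sum>e\<in>{1, - 1}. integral {0..L} (\<lambda>x. G e x * w (e * x) s)) - (\<Sum>e\<in>{1, - 1}. target w0 w1 e))
    \<le> (\<Sum>e\<in>{1, - 1}. error C E w0 w1 e)"
  unfolding duality sum_subtractf[symmetric]
  by (rule sum_norm_le, rule side_error[OF C dual_le E w0 w1]; assumption)

end

section \<open>Uniform energy bounds and the limit of the pairing\<close>

locale wave_family =
  fixes T a_minus a_plus b_minus b_plus a0 a1 b0 b1 :: real and ar br :: "real \<Rightarrow> real \<Rightarrow> real"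
    and w wt wx wtt wxt F n :: "real \<Rightarrow> real \<Rightarrow> real \<Rightarrow> complex" and w0 w1 :: "real \<Rightarrow> complex"
  assumes bound_pos: "a0 > 0" "b0 > 0"
    and wave: "\<forall>\<^sub>F \<epsilon> in at_right 0. smooth_wave T (ar \<epsilon>) (br \<epsilon>) (w \<epsilon>) (wt \<epsilon>) (wx \<epsilon>) (wtt \<epsilon>) (wxt \<epsilon>) (F \<epsilon>) (n \<epsilon>)"
    and bounds: "\<forall>\<^sub>F \<epsilon> in at_right 0. \<forall>x. a0 \<le> ar \<epsilon> x \<and> ar \<epsilon> x \<le> a1 \<and> b0 \<le> br \<epsilon> x \<and> br \<epsilon> x \<le> b1"
    and a_lim: "\<And>e L. e \<in> {1, - 1} \<Longrightarrow> ((\<lambda>\<epsilon>. integral {0..L} (\<lambda>x. (two_phase a_minus a_plus e - ar \<epsilon> (e * x))\<^sup>2)) \<longlongrightarrow> 0) (at_right 0)"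
    and b_lim: "\<And>e L. e \<in> {1, - 1} \<Longrightarrow> ((\<lambda>\<epsilon>. integral {0..L} (\<lambda>x. (two_phase b_minus b_plus e - br \<epsilon> (e * x))\<^sup>2)) \<longlongrightarrow> 0) (at_right 0)"
    and w_lim: "\<And>L. ((\<lambda>\<epsilon>. integral {-L..L} (\<lambda>x. (norm (w \<epsilon> x 0 - w0 x))\<^sup>2)) \<longlongrightarrow> 0) (at_right 0)"
    and wt_lim: "\<And>L. ((\<lambda>\<epsilon>. integral {-L..L} (\<lambda>x. (norm (wt \<epsilon> x 0 - w1 x))\<^sup>2)) \<longlongrightarrow> 0) (at_right 0)"
    and wx_bound: "\<And>L. \<exists>C. \<forall>\<^sub>F \<epsilon> in at_right 0. integral {-L..L} (\<lambda>x. (norm (wx \<epsilon> x 0))\<^sup>2) \<le> C"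
    and n_lim: "\<And>L s. 0 < s \<Longrightarrow> s < T \<Longrightarrow>
      ((\<lambda>\<epsilon>. integral {0..s} (\<lambda>t. integral {-L..L} (\<lambda>x. (norm (n \<epsilon> x t))\<^sup>2))) \<longlongrightarrow> 0) (at_right 0)"
    and w0_cont: "continuous_on UNIV w0" and w1_cont': "continuous_on UNIV w1"
begin

lemma energy_bound:
  assumes s: "0 < s" "s < T" and X: "X \<ge> 0"
  shows "\<exists>E. \<forall>\<^sub>F \<epsilon> in at_right 0. \<forall>t\<in>{0..s}. integral {-X..X} (\<lambda>x. (norm (w \<epsilon> x t))\<^sup>2) \<le> E \<and>
    integral {-X..X} (\<lambda>x. (norm (wt \<epsilon> x t))\<^sup>2) \<le> E \<and> integral {-X..X} (\<lambda>x. (norm (wx \<epsilon> x t))\<^sup>2) \<le> E"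
proof -
  \<comment> \<open>b <= b1 = (b1 / a0) a0 <= M a: one cone speed for all small \<epsilon>, hence
    also one \<open>K\<close>.\<close>
  define M where "M = max 1 (b1 / a0)"
  define K where "K = M * s + sqrt (1 + X\<^sup>2) + 1"
  define Q where "Q = exp ((2 / a0 + 1) * s) * K\<^sup>2 * (max 1 (max a1 b1) / min 1 (min a0 b0))"
  have Q: "Q \<ge> 0" using bound_pos by (auto simp: Q_def intro!: mult_nonneg_nonneg divide_nonneg_nonneg)
  obtain C where C: "\<forall>\<^sub>F \<epsilon> in at_right 0. integral {-K..K} (\<lambda>x. (norm (wx \<epsilon> x 0))\<^sup>2) \<le> C"
    using wx_bound[of K] by (rule exE)
  define I0 where "I0 = integral {-K..K} (\<lambda>x. (norm (w0 x))\<^sup>2)"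
  define I1 where "I1 = integral {-K..K} (\<lambda>x. (norm (w1 x))\<^sup>2)"
  \<comment> \<open>Eventually the data are within distance 1 of their limits, so |f|^2 <= 2 |f -
    g|^2 + 2 |g|^2 bounds the first two energies by 2 + 2 I0 and 2 + 2 I1; \<open>C\<close> bounds
    the x-derivative and 1 the residual.\<close>
  define E where "E = Q * ((2 + 2 * I0) + (2 + 2 * I1) + C + 1)"
  have e1: "\<forall>\<^sub>F \<epsilon> in at_right 0. integral {-K..K} (\<lambda>x. (norm (w \<epsilon> x 0 - w0 x))\<^sup>2) < 1"
    by (rule order_tendstoD(2)[OF w_lim]) simp
  have e2: "\<forall>\<^sub>F \<epsilon> in at_right 0. integral {-K..K} (\<lambda>x. (norm (wt \<epsilon> x 0 - w1 x))\<^sup>2) < 1"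
    by (rule order_tendstoD(2)[OF wt_lim]) simp
  have e3: "\<forall>\<^sub>F \<epsilon> in at_right 0. integral {0..s} (\<lambda>t. integral {-K..K} (\<lambda>x. (norm (n \<epsilon> x t))\<^sup>2)) < 1"
    by (rule order_tendstoD(2)[OF n_lim[OF s]]) simp
  have "\<forall>\<^sub>F \<epsilon> in at_right 0. \<forall>t\<in>{0..s}. integral {-X..X} (\<lambda>x. (norm (w \<epsilon> x t))\<^sup>2) \<le> E \<and>
    integral {-X..X} (\<lambda>x. (norm (wt \<epsilon> x t))\<^sup>2) \<le> E \<and> integral {-X..X} (\<lambda>x. (norm (wx \<epsilon> x t))\<^sup>2) \<le> E"
    using wave bounds C e1 e2 e3
  proof eventually_elim
    case (elim \<epsilon>)
    interpret smooth_wave T "ar \<epsilon>" "br \<epsilon>" "w \<epsilon>" "wt \<epsilon>" "wx \<epsilon>" "wtt \<epsilon>" "wxt \<epsilon>" "F \<epsilon>" "n \<epsilon>" by (rule elim(1))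
    have bd: "a0 \<le> ar \<epsilon> x" "ar \<epsilon> x \<le> a1" "b0 \<le> br \<epsilon> x" "br \<epsilon> x \<le> b1" for x
      using elim(2) by simp_all
    have M: "M \<ge> 1" "br \<epsilon> x \<le> M * ar \<epsilon> x" for x
    proof -
      show "M \<ge> 1" by (simp add: M_def)
      have "b1 = (b1 / a0) * a0" using bound_pos by simp
      also have "\<dots> \<le> M * ar \<epsilon> x"
        by (rule mult_mono) (use bd[of x] bound_pos in \<open>auto simp: M_def\<close>)
      finally show "br \<epsilon> x \<le> M * ar \<epsilon> x" using bd(4)[of x] by linarith
    qed
    have line: "continuous_on S (\<lambda>x. q x t)" if "continuous2 (UNIV \<times> {-T<..<T}) q" "t \<in> {0..s}" for q :: "real \<Rightarrow> real \<Rightarrow> complex" and t S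
      by (rule continuous_on_subset[OF continuous2_slice_x[OF that(1)]]) (use that s in auto)
    note ls = line[OF cont(1)] line[OF cont(2)] line[OF cont(3)]
    have split: "integral {-K..K} (\<lambda>x. density x 0) = integral {-K..K} (\<lambda>x. (norm (w \<epsilon> x 0))\<^sup>2)
      + integral {-K..K} (\<lambda>x. (norm (wt \<epsilon> x 0))\<^sup>2) + integral {-K..K} (\<lambda>x. (norm (wx \<epsilon> x 0))\<^sup>2)"
    proof -
      have i: "(\<lambda>x. (norm (w \<epsilon> x 0))\<^sup>2) integrable_on {-K..K}" "(\<lambda>x. (norm (wt \<epsilon> x 0))\<^sup>2) integrable_on {-K..K}"
        "(\<lambda>x. (norm (wx \<epsilon> x 0))\<^sup>2) integrable_on {-K..K}"
        by (intro integrable_continuous_real continuous_intros ls; use s in simp)+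
      show ?thesis
        unfolding density_def Henstock_Kurzweil_Integration.integral_add[OF integrable_add[OF i(1,2)] i(3)]
          Henstock_Kurzweil_Integration.integral_add[OF i(1,2)] by (rule refl)
    qed
    have w_le: "integral {-K..K} (\<lambda>x. (norm (w \<epsilon> x 0))\<^sup>2) \<le> 2 * integral {-K..K} (\<lambda>x. (norm (w \<epsilon> x 0 - w0 x))\<^sup>2) + 2 * I0"
      unfolding I0_def
      by (rule integral_square_triangle[OF ls(1) continuous_on_subset[OF w0_cont]]) (use s in auto)
    have wt_le: "integral {-K..K} (\<lambda>x. (norm (wt \<epsilon> x 0))\<^sup>2) \<le> 2 * integral {-K..K} (\<lambda>x. (norm (wt \<epsilon> x 0 - w1 x))\<^sup>2) + 2 * I1"
      unfolding I1_def
      by (rule integral_square_triangle[OF ls(2) continuous_on_subset[OF w1_cont']]) (use s in auto)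
    show ?case
    proof
      fix t assume t: "t \<in> {0..s}"
      have "integral {-X..X} (\<lambda>x. density x t) \<le> Q * (integral {-K..K} (\<lambda>x. density x 0) + integral {0..s} (\<lambda>t. integral {-K..K} (\<lambda>x. (norm (n \<epsilon> x t))\<^sup>2)))"
        unfolding Q_def
        by (rule energy_estimate[OF bound_pos(1) bd(1,2) bound_pos(2) bd(3,4) M less_imp_le[OF s(1)] s(2) X K_def t])
      also have "\<dots> \<le> E"
        unfolding E_def
      proof (rule mult_left_mono[OF _ Q])
        show "integral {-K..K} (\<lambda>x. density x 0) + integral {0..s} (\<lambda>t. integral {-K..K} (\<lambda>x. (norm (n \<epsilon> x t))\<^sup>2)) \<le> (2 + 2 * I0) + (2 + 2 * I1) + C + 1"
          using split w_le wt_le elim(3-6) by linarith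
      qed
      finally have D: "integral {-X..X} (\<lambda>x. density x t) \<le> E" .
      have dc: "density x t = (norm (w \<epsilon> x t))\<^sup>2 + (norm (wt \<epsilon> x t))\<^sup>2 + (norm (wx \<epsilon> x t))\<^sup>2" for x by (rule density_def)
      have le: "integral {-X..X} (\<lambda>x. (norm (q x t))\<^sup>2) \<le> E"
        if q: "continuous_on {-X..X} (\<lambda>x. q x t)" "\<And>x. (norm (q x t))\<^sup>2 \<le> density x t" for q :: "real \<Rightarrow> real \<Rightarrow> complex"
      proof -
        have "integral {-X..X} (\<lambda>x. (norm (q x t))\<^sup>2) \<le> integral {-X..X} (\<lambda>x. density x t)"
        proof (rule integral_le)
          show "(\<lambda>x. (norm (q x t))\<^sup>2) integrable_on {-X..X}" by (intro integrable_continuous_real continuous_intros q)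
          show "(\<lambda>x. density x t) integrable_on {-X..X}"
            unfolding dc by (intro integrable_continuous_real continuous_intros ls t)
        qed (rule q(2))
        then show ?thesis using D by linarith
      qed
      show "integral {-X..X} (\<lambda>x. (norm (w \<epsilon> x t))\<^sup>2) \<le> E \<and>
        integral {-X..X} (\<lambda>x. (norm (wt \<epsilon> x t))\<^sup>2) \<le> E \<and> integral {-X..X} (\<lambda>x. (norm (wx \<epsilon> x t))\<^sup>2) \<le> E"
        by (intro conjI le ls t) (simp_all add: dc)
    qed
  qed
  then show ?thesis by (rule exI)
qed

abbreviation (input) "\<A> \<equiv> two_phase a_minus a_plus"
abbreviation (input) "\<B> \<equiv> two_phase b_minus b_plus"

text \<open>The dual solution does not depend on \<epsilon> and is bounded on the compact rectangle;
  with the uniform energy bound every summand of the error keeps a factor that tends to 0.\<close>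

lemma pairing_limit:
  assumes dual: "transmission_dual \<A> \<B> G G' X" and s: "0 < s" "s < T" and L: "transmission_dual.range_at \<A> \<B> X s \<le> L"
  shows "((\<lambda>\<epsilon>. \<Sum>e\<in>{1, - 1}. integral {0..L} (\<lambda>x. G e x * w \<epsilon> (e * x) s)) \<longlongrightarrow>
    (\<Sum>e\<in>{1, - 1}. integral {0..L} (\<lambda>x. (\<A> e *\<^sub>R w1 (e * x)) * transmission_dual.\<zeta> \<A> \<B> G e x s)
      + integral {0..L} (\<lambda>x. (\<A> e *\<^sub>R w0 (e * x)) * transmission_dual.\<zeta>t \<A> \<B> G e x s))) (at_right 0)"
proof -
  interpret d: transmission_dual \<A> \<B> G G' X by (rule dual)
  have L0: "L \<ge> 0" using d.range_at_ge[of s] s d.X L by linarith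
  have bdd: "\<exists>C. \<forall>z\<in>{0..L} \<times> {0..s}. norm (q (fst z) (snd z)) \<le> C" if "continuous2 ({0..L} \<times> {0..s}) q" for q :: "real \<Rightarrow> real \<Rightarrow> complex"
  proof -
    have "compact ((\<lambda>z. q (fst z) (snd z)) ` ({0..L} \<times> {0..s}))"
      by (intro compact_continuous_image that compact_Times) simp_all
    from compact_imp_bounded[OF this] show ?thesis unfolding bounded_iff by (simp only: ball_simps)
  qed
  have "\<exists>C. \<forall>z\<in>{0..L} \<times> {0..s}. norm (d.\<zeta> e (fst z) (snd z)) \<le> C" "\<exists>C. \<forall>z\<in>{0..L} \<times> {0..s}. norm (d.\<zeta>x e (fst z) (snd z)) \<le> C"
    "\<exists>C. \<forall>z\<in>{0..L} \<times> {0..s}. norm (d.\<zeta>t e (fst z) (snd z)) \<le> C" for e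
    by (rule bdd[of "d.\<zeta> e"], rule d.continuous2_dual, rule bdd[of "d.\<zeta>x e"], rule d.continuous2_dual, rule bdd[of "d.\<zeta>t e"], rule d.continuous2_dual)
  then have "\<forall>e. \<exists>C. \<forall>z\<in>{0..L} \<times> {0..s}. norm (d.\<zeta> e (fst z) (snd z)) \<le> C" "\<forall>e. \<exists>C. \<forall>z\<in>{0..L} \<times> {0..s}. norm (d.\<zeta>x e (fst z) (snd z)) \<le> C"
    "\<forall>e. \<exists>C. \<forall>z\<in>{0..L} \<times> {0..s}. norm (d.\<zeta>t e (fst z) (snd z)) \<le> C" by simp_all
  note this[THEN choice]
  then obtain C1 C2 C3 where C123: "\<forall>e. \<forall>z\<in>{0..L} \<times> {0..s}. norm (d.\<zeta> e (fst z) (snd z)) \<le> C1 e"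
    "\<forall>e. \<forall>z\<in>{0..L} \<times> {0..s}. norm (d.\<zeta>x e (fst z) (snd z)) \<le> C2 e" "\<forall>e. \<forall>z\<in>{0..L} \<times> {0..s}. norm (d.\<zeta>t e (fst z) (snd z)) \<le> C3 e"
    by (elim exE)
  \<comment> \<open>Summing absolute values over both sides gives one constant for both.\<close>
  define C where "C = (\<Sum>e\<in>{1, - 1}. \<bar>C1 e\<bar> + \<bar>C2 e\<bar> + \<bar>C3 e\<bar>)"
  have C0: "C \<ge> 0" unfolding C_def by (intro sum_nonneg) simp
  have C: "norm (d.\<zeta> e x t) \<le> C \<and> norm (d.\<zeta>x e x t) \<le> C \<and> norm (d.\<zeta>t e x t) \<le> C"
    if e: "e \<in> {1, - 1}" and x: "x \<in> {0..L}" and t: "t \<in> {0..s}" for e x t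
  proof -
    have "\<bar>C1 e\<bar> + \<bar>C2 e\<bar> + \<bar>C3 e\<bar> \<le> C" using e by (auto simp: C_def)
    moreover have "norm (d.\<zeta> e x t) \<le> C1 e" using bspec[OF spec[OF C123(1), of e], of "(x, t)"] x t by simp
    moreover have "norm (d.\<zeta>x e x t) \<le> C2 e" using bspec[OF spec[OF C123(2), of e], of "(x, t)"] x t by simp
    moreover have "norm (d.\<zeta>t e x t) \<le> C3 e" using bspec[OF spec[OF C123(3), of e], of "(x, t)"] x t by simp
    ultimately show ?thesis by linarith
  qed
  obtain E where E: "\<forall>\<^sub>F \<epsilon> in at_right 0. \<forall>t\<in>{0..s}. integral {-L..L} (\<lambda>x. (norm (w \<epsilon> x t))\<^sup>2) \<le> E \<and>
    integral {-L..L} (\<lambda>x. (norm (wt \<epsilon> x t))\<^sup>2) \<le> E \<and> integral {-L..L} (\<lambda>x. (norm (wx \<epsilon> x t))\<^sup>2) \<le> E"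
    using energy_bound[OF s L0] by (rule exE)
  define err where "err = (\<lambda>\<epsilon>. \<Sum>e\<in>{1, - 1}. C * \<A> e * (sqrt L * sqrt (integral {-L..L} (\<lambda>x. (norm (w \<epsilon> x 0 - w0 x))\<^sup>2)))
    + C * (sqrt (integral {0..L} (\<lambda>x. (\<A> e - ar \<epsilon> (e * x))\<^sup>2)) * sqrt E)
    + C * \<A> e * (sqrt L * sqrt (integral {-L..L} (\<lambda>x. (norm (wt \<epsilon> x 0 - w1 x))\<^sup>2)))
    + C * (sqrt L * (sqrt s * sqrt (integral {0..s} (\<lambda>t. integral {-L..L} (\<lambda>x. (norm (n \<epsilon> x t))\<^sup>2)))))
    + s * (C * (sqrt (integral {0..L} (\<lambda>x. (\<B> e - br \<epsilon> (e * x))\<^sup>2)) * sqrt E)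
      + C * (sqrt (integral {0..L} (\<lambda>x. (\<A> e - ar \<epsilon> (e * x))\<^sup>2)) * sqrt E)))"
  have "(err \<longlongrightarrow> (\<Sum>e\<in>{1, - 1::real}. C * \<A> e * (sqrt L * sqrt 0) + C * (sqrt 0 * sqrt E) + C * \<A> e * (sqrt L * sqrt 0)
      + C * (sqrt L * (sqrt s * sqrt 0)) + s * (C * (sqrt 0 * sqrt E) + C * (sqrt 0 * sqrt E)))) (at_right 0)"
    unfolding err_def by (intro tendsto_sum tendsto_intros w_lim wt_lim a_lim b_lim n_lim s)
  then have err0: "(err \<longlongrightarrow> 0) (at_right 0)" by simp
  show ?thesis
  proof (rule LIM_zero_cancel, rule Lim_null_comparison[OF _ err0])
    show "\<forall>\<^sub>F \<epsilon> in at_right 0. norm ((\<Sum>e\<in>{1, - 1}. integral {0..L} (\<lambda>x. G e x * w \<epsilon> (e * x) s))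
      - (\<Sum>e\<in>{1, - 1}. integral {0..L} (\<lambda>x. (\<A> e *\<^sub>R w1 (e * x)) * d.\<zeta> e x s)
      + integral {0..L} (\<lambda>x. (\<A> e *\<^sub>R w0 (e * x)) * d.\<zeta>t e x s))) \<le> err \<epsilon>"
      using wave E
    proof eventually_elim
      case (elim \<epsilon>)
      interpret wp: wave_pairing T "ar \<epsilon>" "br \<epsilon>" "w \<epsilon>" "wt \<epsilon>" "wx \<epsilon>" "wtt \<epsilon>" "wxt \<epsilon>" "F \<epsilon>" "n \<epsilon>" \<A> \<B> G G' X L s
        by (rule wave_pairing.intro[OF elim(1) dual]) (unfold_locales, use s L in auto)
      have "norm ((\<Sum>e\<in>{1, - 1}. integral {0..L} (\<lambda>x. G e x * w \<epsilon> (e * x) s)) - (\<Sum>e\<in>{1, - 1}. wp.target w0 w1 e))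
        \<le> (\<Sum>e\<in>{1, - 1}. wp.error C E w0 w1 e)"
        by (rule wp.duality_error[OF C0 C _ w0_cont w1_cont']) (use elim(2) in auto)
      then show ?case
        unfolding wp.target_def wp.error_def err_def .
    qed
  qed
qed

end

section \<open>Weak convergence\<close>

text \<open>For functions that are merely bounded close to the interface and small further away: the
  squared coefficient error and the squared complement of the cutoff.\<close>

lemma integral_le_split:
  fixes f :: "real \<Rightarrow> real"
  assumes f: "continuous_on {0..L} f" and r: "0 \<le> r" "r \<le> L"
    and M: "\<And>x. x \<in> {0..r} \<Longrightarrow> f x \<le> M" and m: "\<And>x. x \<in> {r..L} \<Longrightarrow> f x \<le> m" "m \<ge> 0"
  shows "integral {0..L} f \<le> M * r + m * L"
proof -
  have i: "f integrable_on {a..b}" if "{a..b} \<subseteq> {0..L}" for a b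
    by (rule integrable_continuous_real[OF continuous_on_subset[OF f that]])
  have "integral {0..r} f \<le> integral {0..r} (\<lambda>x. M)"
    by (rule integral_le) (use r M in \<open>auto intro!: i\<close>)
  moreover have "integral {r..L} f \<le> integral {r..L} (\<lambda>x. m)"
    by (rule integral_le) (use r m in \<open>auto intro!: i\<close>)
  moreover have "integral {0..r} f + integral {r..L} f = integral {0..L} f"
    by (rule Henstock_Kurzweil_Integration.integral_combine) (use r i in auto)
  moreover have "integral {0..r} (\<lambda>x. M) = M * r" "integral {r..L} (\<lambda>x. m) = m * (L - r)" using r by simp_all
  moreover have "m * (L - r) \<le> m * L" using r m(2) by (intro mult_left_mono) auto
  ultimately show ?thesis by linarith
qed

lemma integral_sides:
  fixes q :: "real \<Rightarrow> complex"
  assumes q: "continuous_on {-L..L} q" and L: "L \<ge> 0"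
  shows "integral {-L..L} q = (\<Sum>e\<in>{1, - 1}. integral {0..L} (\<lambda>x. q (e * x)))"
proof -
  have "integral {-L..0} q + integral {0..L} q = integral {-L..L} q"
    by (rule Henstock_Kurzweil_Integration.integral_combine) (use L q integrable_continuous_real in auto)
  moreover have "integral {0..L} (\<lambda>x. q (- x)) = integral {-L..0} q"
    using Henstock_Kurzweil_Integration.integral_reflect_real[of 0 "-L" q] by simp
  ultimately show ?thesis by (simp add: add.commute)
qed

lemma function_distribution_box:
  fixes q \<theta> :: "'a::euclidean_space \<Rightarrow> complex"
  assumes q: "continuous_on (cbox a b) q" and \<theta>: "continuous_on UNIV \<theta>"
    and zero: "\<And>z. z \<notin> cbox a b \<Longrightarrow> \<theta> z = 0"
  shows "function_distribution q \<theta> = integral (cbox a b) (\<lambda>z. \<theta> z * q z)"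
proof -
  let ?C = "cbox a b"
  define g where "g = (\<lambda>z. \<theta> z * q z)"
  have cont: "continuous_on ?C g"
    unfolding g_def by (intro continuous_intros q continuous_on_subset[OF \<theta>]) simp
  have gi: "q z * \<theta> z = indicator ?C z *\<^sub>R g z" for z using zero[of z] by (auto simp: indicator_def g_def)
  have si: "set_integrable lborel ?C g"
    unfolding set_integrable_def by (rule borel_integrable_compact[OF compact_cbox cont])
  have "function_distribution q \<theta> = (LINT z:?C|lborel. g z)"
    unfolding function_distribution_def set_lebesgue_integral_def gi by (rule refl)
  also have "\<dots> = integral ?C g"
    by (rule set_borel_integral_eq_integral(2)[OF si])
  finally show ?thesis by (simp only: g_def)
qed

lemma function_distribution_iterated:
  fixes q \<theta> :: "real \<times> real \<Rightarrow> complex"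
  assumes q: "continuous_on (cbox (-L, t0) (L, t1)) q" and \<theta>: "continuous_on UNIV \<theta>"
    and zero: "\<And>z. z \<notin> cbox (-L, t0) (L, t1) \<Longrightarrow> \<theta> z = 0"
  shows "function_distribution q \<theta> = integral {t0..t1} (\<lambda>t. integral {-L..L} (\<lambda>x. \<theta> (x, t) * q (x, t)))"
proof -
  define g where "g = (\<lambda>z. \<theta> z * q z)"
  have cont: "continuous_on (cbox (-L, t0) (L, t1)) g"
    unfolding g_def by (intro continuous_intros q continuous_on_subset[OF \<theta>]) simp
  have "function_distribution q \<theta> = integral (cbox (-L, t0) (L, t1)) g"
    unfolding g_def by (rule function_distribution_box[OF q \<theta> zero])
  also have "\<dots> = integral (cbox (-L) L) (\<lambda>x. integral (cbox t0 t1) (\<lambda>t. g (x, t)))"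
    by (rule integral_prod_continuous[OF cont])
  also have "\<dots> = integral (cbox t0 t1) (\<lambda>t. integral (cbox (-L) L) (\<lambda>x. g (x, t)))"
    by (rule integral_swap_continuous) (use cont in simp)
  finally show ?thesis by (simp add: g_def)
qed

lemma test_function_box:
  fixes T :: real and \<theta> :: "real \<times> real \<Rightarrow> complex"
  assumes T: "T > 0" and \<theta>: "\<theta> \<in> test_functions (UNIV \<times> {0<..<T})"
  obtains X t0 t1 where "X > 0" "0 < t0" "t1 < T" "\<And>x s. \<theta> (x, s) \<noteq> 0 \<Longrightarrow> \<bar>x\<bar> < X \<and> t0 \<le> s \<and> s \<le> t1"
proof -
  have cs: "compact (supp \<theta>)" and sub: "supp \<theta> \<subseteq> UNIV \<times> {0<..<T}"
    using \<theta> by (simp_all add: test_functions_def)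
  \<comment> \<open>The additional point makes the compact set nonempty, so that the extrema exist
    even for the zero function.\<close>
  define K where "K = insert (0, T / 2) (supp \<theta>)"
  have K: "compact K" "K \<noteq> {}" "K \<subseteq> UNIV \<times> {0<..<T}" using cs sub T by (auto simp: K_def)
  obtain z0 where z0: "z0 \<in> K" "\<forall>z\<in>K. snd z0 \<le> snd z"
    using continuous_attains_inf[OF K(1,2), of snd] continuous_on_snd[OF continuous_on_id] by blast
  obtain z1 where z1: "z1 \<in> K" "\<forall>z\<in>K. snd z \<le> snd z1"
    using continuous_attains_sup[OF K(1,2), of snd] continuous_on_snd[OF continuous_on_id] by blast
  obtain z2 where z2: "z2 \<in> K" "\<forall>z\<in>K. \<bar>fst z\<bar> \<le> \<bar>fst z2\<bar>"
    using continuous_attains_sup[OF K(1,2), of "\<lambda>z. \<bar>fst z\<bar>"] continuous_on_rabs[OF continuous_on_fst[OF continuous_on_id]] by blast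
  show thesis
  proof (rule that[of "\<bar>fst z2\<bar> + 1" "snd z0" "snd z1"])
    show "0 < snd z0" "snd z1 < T" using z0(1) z1(1) K(3) by auto
    fix x s assume "\<theta> (x, s) \<noteq> 0"
    then have "(x, s) \<in> supp \<theta>" using not_in_supp[of "(x, s)" \<theta>] by auto
    then have "(x, s) \<in> K" by (simp add: K_def)
    then have "\<bar>fst (x, s)\<bar> \<le> \<bar>fst z2\<bar>" "snd z0 \<le> snd (x, s)" "snd (x, s) \<le> snd z1" using z0(2) z1(2) z2(2) by blast+
    then show "\<bar>x\<bar> < \<bar>fst z2\<bar> + 1 \<and> snd z0 \<le> s \<and> s \<le> snd z1" by simp
  qed simp
qed

section \<open>From the pairing to slices and to test functions\<close>

locale wave_limit = wave_family + connected_wave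
begin

lemma W_slice: "s \<ge> 0 \<Longrightarrow> continuous_on S (\<lambda>x. W (x, s))"
  by (rule continuous_on_compose2[OF W_cont]) (auto intro!: continuous_intros)

text \<open>The limit of the regularised pairing and the pairing of the connected solution are the
  same expression in the initial data. The strict inequality s < S is there because
  \<open>pairing\<close> arises by differentiating at an interior terminal time.\<close>

lemma side_limit:
  assumes dual: "transmission_dual A B G G' X" and s: "0 < s" "s < T" "s < S"
    and L: "X + (c 1 + c (- 1)) * S \<le> L"
  shows "((\<lambda>\<epsilon>. \<Sum>e\<in>{1, - 1}. integral {0..L} (\<lambda>x. G e x * w \<epsilon> (e * x) s)) \<longlongrightarrow>
    (\<Sum>e\<in>{1, - 1}. integral {0..L} (\<lambda>x. G e x * W (e * x, s)))) (at_right 0)"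
proof -
  interpret d: transmission_dual A B G G' X by (rule dual)
  have sp: "d.speed e = c e" for e by (simp only: d.speed_def c_def)
  have cc: "c 1 + c (- 1) > 0" using c_pos[of 1] c_pos[of "- 1"] by linarith
  then have "(c 1 + c (- 1)) * S > 0" using s by simp
  then have L0: "L > 0" using L d.X by linarith
  interpret ts: transmission_solution A B G G' X p v "\<lambda>e x. w0 (e * x)" "\<lambda>e x. e *\<^sub>R w0' (e * x)" "\<lambda>e x. w1 (e * x)" L S
  proof (rule transmission_solution.intro[OF dual], rule transmission_solution_axioms.intro)
    show "cauchy_quadrant (p e) (v e) (d.speed e) (\<lambda>x. w0 (e * x)) (\<lambda>x. e *\<^sub>R w0' (e * x)) (\<lambda>x. w1 (e * x)) L" if "e \<in> {1, - 1}" for e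
      unfolding sp by (rule side_quadrant[OF that L0])
    show "0 \<le> S" using s by simp
    show "d.range_at S \<le> L" unfolding d.range_at_def sp by (rule L)
    show "p 1 0 t = p (- 1) 0 t" for t by (rule interface)
    show "B 1 *\<^sub>R cauchy_quadrant.Yx (p 1) (d.speed 1) (\<lambda>x. w0 (1 * x)) (\<lambda>x. w1 (1 * x)) L 0 t
       + B (- 1) *\<^sub>R cauchy_quadrant.Yx (p (- 1)) (d.speed (- 1)) (\<lambda>x. w0 (- 1 * x)) (\<lambda>x. w1 (- 1 * x)) L 0 t = 0" if "t \<ge> 0" for t
      unfolding sp by (rule flux_integral[OF L0 that])
  qed
  have "(c 1 + c (- 1)) * s \<le> (c 1 + c (- 1)) * S" using cc s by (intro mult_left_mono) auto
  then have "d.range_at s \<le> L" unfolding d.range_at_def sp using L by linarith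
  from pairing_limit[OF dual s(1,2) this] ts.pairing[of s] s
  show ?thesis by (simp only: p_def greaterThanLessThan_iff conj_absorb simp_thms)
qed

text \<open>A general slice need not vanish at the interface. It is multiplied by a cutoff on each
  side, and the error is at most the L2 norm of 1 - cutoff times the L2 norm of the difference of
  the solutions, which the energy estimate bounds uniformly.\<close>

lemma slice_limit:
  assumes g: "\<And>x. (g has_vector_derivative g' x) (at x)" and g': "continuous_on UNIV g'"
    and X: "X > 0" "\<And>x. \<bar>x\<bar> \<ge> X \<Longrightarrow> g x = 0"
    and s: "0 < s" "s < T" "s < S" and L: "X + (c 1 + c (- 1)) * S \<le> L"
  shows "((\<lambda>\<epsilon>. integral {-L..L} (\<lambda>x. g x * w \<epsilon> x s)) \<longlongrightarrow> integral {-L..L} (\<lambda>x. g x * W (x, s))) (at_right 0)"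
proof (rule tendstoI)
  fix \<eta> :: real assume \<eta>: "\<eta> > 0"
  have "(c 1 + c (- 1)) * S > 0" using c_pos[of 1] c_pos[of "- 1"] s by simp
  then have L0: "L > 0" using L X by linarith
  have g_cont: "continuous_on U g" for U by (rule has_vector_derivative_imp_continuous_on[OF g])
  obtain Cg where Cg: "\<forall>x\<in>{-L..L}. norm (g x) \<le> Cg"
  proof -
    have "compact (g ` {-L..L})" by (intro compact_continuous_image g_cont) simp
    from compact_imp_bounded[OF this] show ?thesis using that unfolding bounded_iff by auto
  qed
  have "norm (g 0) \<le> Cg" by (rule bspec[OF Cg]) (use L0 in simp)
  then have Cg0: "Cg \<ge> 0" using norm_ge_zero[of "g 0"] by linarith
  obtain E where E: "\<forall>\<^sub>F \<epsilon> in at_right 0. \<forall>t\<in>{0..s}. integral {-L..L} (\<lambda>x. (norm (w \<epsilon> x t))\<^sup>2) \<le> E \<and>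
    integral {-L..L} (\<lambda>x. (norm (wt \<epsilon> x t))\<^sup>2) \<le> E \<and> integral {-L..L} (\<lambda>x. (norm (wx \<epsilon> x t))\<^sup>2) \<le> E"
    using energy_bound[OF s(1,2) less_imp_le[OF L0]] by (rule exE)
  define IW where "IW = integral {-L..L} (\<lambda>x. (norm (W (x, s)))\<^sup>2)"
  define E' where "E' = \<bar>2 * E + 2 * IW\<bar>"
  \<comment> \<open>\<rho> is going to bound the L2 norm of 1 - cutoff on one side. The second entry
    keeps the error of both sides together below \<eta>/2, the first keeps \<rho>^2 within the
    length L.\<close>
  define \<rho> where "\<rho> = min (sqrt L) (\<eta> / (4 * (Cg + 1) * (sqrt E' + 1)))"
  have E'0: "sqrt E' \<ge> 0" by (simp add: E'_def)
  have \<rho>: "\<rho> > 0" "\<rho>\<^sup>2 \<le> L" "2 * (Cg * (\<rho> * sqrt E')) \<le> \<eta> / 2"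
  proof -
    have "Cg + 1 > 0" "sqrt E' + 1 > 0" using Cg0 E'0 by linarith+
    then have den: "4 * (Cg + 1) * (sqrt E' + 1) > 0" by (intro mult_pos_pos) simp_all
    show \<rho>0: "\<rho> > 0" using \<eta> den L0 by (simp add: \<rho>_def)
    have "\<rho>\<^sup>2 \<le> (sqrt L)\<^sup>2" by (rule power_mono) (use \<rho>0 in \<open>auto simp: \<rho>_def\<close>)
    then show "\<rho>\<^sup>2 \<le> L" using L0 by simp
    have "\<rho> \<le> \<eta> / (4 * (Cg + 1) * (sqrt E' + 1))" by (simp add: \<rho>_def)
    then have 1: "\<rho> * (4 * (Cg + 1) * (sqrt E' + 1)) \<le> \<eta>" using den by (simp add: pos_le_divide_eq)
    have "Cg * sqrt E' \<le> (Cg + 1) * (sqrt E' + 1)"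
      by (rule mult_mono) (use Cg0 E'0 in linarith)+
    then have "4 * (Cg * sqrt E') \<le> 4 * ((Cg + 1) * (sqrt E' + 1))" by (rule mult_left_mono) simp
    then have "\<rho> * (4 * (Cg * sqrt E')) \<le> \<rho> * (4 * (Cg + 1) * (sqrt E' + 1))"
      unfolding mult.assoc using \<rho>0 by (intro mult_left_mono) auto
    with 1 show "2 * (Cg * (\<rho> * sqrt E')) \<le> \<eta> / 2" by (simp add: mult_ac)
  qed
  \<comment> \<open>1 - cutoff is at most 1 and lives on [0, 2\<delta>], so its L2 norm is at most
    sqrt(2\<delta>) = \<rho>.\<close>
  define \<delta> where "\<delta> = \<rho>\<^sup>2 / 2"
  have \<delta>: "\<delta> > 0" "2 * \<delta> \<le> L" "sqrt (2 * \<delta>) = \<rho>" using \<rho>(1,2) by (simp_all add: \<delta>_def)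
  define cutoff where "cutoff = (\<lambda>x. smooth_step 0 ((x - \<delta>) / \<delta>))"
  define cutoff' where "cutoff' = (\<lambda>x. smooth_step (Suc 0) ((x - \<delta>) / \<delta>) * (1 / \<delta>))"
  have cutoff_deriv: "(cutoff has_real_derivative cutoff' x) (at x)" for x
  proof -
    have "((\<lambda>x. (x - \<delta>) / \<delta>) has_real_derivative 1 / \<delta>) (at x)"
      using \<delta>(1) by (auto intro!: derivative_eq_intros)
    from DERIV_chain2[OF deriv_seqD[OF smooth_step_deriv_seq] this] show ?thesis unfolding cutoff_def cutoff'_def .
  qed
  have cutoff_cont: "continuous_on U cutoff" for U
    by (rule DERIV_continuous_on) (rule DERIV_subset[OF cutoff_deriv], simp)
  have step_cont: "continuous_on UNIV (smooth_step (Suc 0))"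
    by (rule DERIV_continuous_on) (rule deriv_seqD[OF smooth_step_deriv_seq])
  have cutoff'_cont: "continuous_on U cutoff'" for U
    unfolding cutoff'_def by (intro continuous_intros continuous_on_UNIV_compose[OF step_cont]) (use \<delta> in simp)
  have cutoff0: "cutoff x = 0" if "x \<le> 0" for x
    unfolding cutoff_def by (rule smooth_step_0(1)) (use that \<delta> in \<open>simp add: divide_nonpos_pos\<close>)
  have cutoff1: "cutoff x = 1" if "x \<ge> 2 * \<delta>" for x
    unfolding cutoff_def by (rule smooth_step_0(2)) (use that \<delta> in \<open>simp add: pos_le_divide_eq\<close>)
  have cutoff01: "0 \<le> cutoff x" "cutoff x \<le> 1" for x unfolding cutoff_def by (rule smooth_step_0)+
  \<comment> \<open>The dual locale speaks of all real labels. A sign defined for each of them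
    agrees with \<open>e\<close> on the two actual sides and has modulus 1, which keeps the support
    condition valid throughout.\<close>
  define \<kappa> :: "real \<Rightarrow> real" where "\<kappa> e = (if e < 0 then - 1 else 1)" for e
  have \<kappa>: "\<bar>\<kappa> e\<bar> = 1" "e \<in> {1, - 1} \<Longrightarrow> \<kappa> e = e" for e by (auto simp: \<kappa>_def)
  define G where "G e x = cutoff x *\<^sub>R g (\<kappa> e * x)" for e x
  define G' where "G' e x = cutoff x *\<^sub>R (\<kappa> e *\<^sub>R g' (\<kappa> e * x)) + cutoff' x *\<^sub>R g (\<kappa> e * x)" for e x
  have dual: "transmission_dual A B G G' X"
  proof
    show "A e > 0" "B e > 0" for e by (rule AB_pos)+
    show "(G e has_vector_derivative G' e x) (at x)" for e x
    proof -
      have "((\<lambda>x. \<kappa> e * x) has_real_derivative \<kappa> e) (at x)" by (auto intro!: derivative_eq_intros)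
      from has_vector_derivative_scaleR[OF cutoff_deriv has_vector_derivative_chain_real[OF g this]]
      show ?thesis unfolding G_def[abs_def] G'_def .
    qed
    show "continuous_on UNIV (G' e)" for e
      unfolding G'_def[abs_def]
      by (intro continuous_intros cutoff_cont cutoff'_cont continuous_on_UNIV_compose[OF g'] continuous_on_UNIV_compose[OF g_cont])
    show "G e x = 0" if "x \<le> 0 \<or> x \<ge> X" for e x
      using that
    proof
      assume "x \<ge> X"
      then have "\<bar>\<kappa> e * x\<bar> \<ge> X" using \<kappa>(1)[of e] by (simp add: abs_mult)
      then show ?thesis using X(2) by (simp add: G_def)
    qed (simp add: G_def cutoff0)
    show "X \<ge> 0" using X by simp
  qed
  have lim: "\<forall>\<^sub>F \<epsilon> in at_right 0. dist (\<Sum>e\<in>{1, - 1}. integral {0..L} (\<lambda>x. G e x * w \<epsilon> (e * x) s))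
    (\<Sum>e\<in>{1, - 1}. integral {0..L} (\<lambda>x. G e x * W (e * x, s))) < \<eta> / 2"
    by (rule tendstoD[OF side_limit[OF dual s L]]) (use \<eta> in simp)
  show "\<forall>\<^sub>F \<epsilon> in at_right 0. dist (integral {-L..L} (\<lambda>x. g x * w \<epsilon> x s)) (integral {-L..L} (\<lambda>x. g x * W (x, s))) < \<eta>"
    using lim E wave
  proof eventually_elim
    case (elim \<epsilon>)
    interpret sw: smooth_wave T "ar \<epsilon>" "br \<epsilon>" "w \<epsilon>" "wt \<epsilon>" "wx \<epsilon>" "wtt \<epsilon>" "wxt \<epsilon>" "F \<epsilon>" "n \<epsilon>" by (rule elim(3))
    have wc: "continuous_on U (\<lambda>x. w \<epsilon> x s)" for U
      by (rule continuous_on_subset[OF continuous2_slice_x[OF sw.cont(1)]]) (use s in auto)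
    have Wc: "continuous_on U (\<lambda>x. W (x, s))" for U by (rule W_slice) (use s in simp)
    define D where "D = (\<lambda>x. w \<epsilon> x s - W (x, s))"
    have Dc: "continuous_on U D" for U unfolding D_def by (intro continuous_intros wc Wc)
    have comp: "continuous_on U (\<lambda>x. q (e * x))" if "continuous_on UNIV q" for q :: "real \<Rightarrow> complex" and U and e :: real
      by (rule continuous_on_UNIV_compose[OF that]) (intro continuous_intros)
    have D_le: "integral {-L..L} (\<lambda>x. (norm (D x))\<^sup>2) \<le> E'"
    proof -
      have "integral {-L..L} (\<lambda>x. (norm (D x))\<^sup>2) \<le> 2 * integral {-L..L} (\<lambda>x. (norm (D x - (- W (x, s))))\<^sup>2) + 2 * integral {-L..L} (\<lambda>x. (norm (- W (x, s)))\<^sup>2)"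
        by (intro integral_square_triangle Dc continuous_intros Wc)
      also have "\<dots> = 2 * integral {-L..L} (\<lambda>x. (norm (w \<epsilon> x s))\<^sup>2) + 2 * IW"
        by (simp add: D_def IW_def)
      also have "\<dots> \<le> 2 * E + 2 * IW" using bspec[OF elim(2), of s] s by simp
      finally show ?thesis by (simp add: E'_def)
    qed
    have i: "f integrable_on {0..L}" if "continuous_on {0..L} f" for f :: "real \<Rightarrow> complex"
      by (rule integrable_continuous_real[OF that])
    \<comment> \<open>The part removed by the cutoff. It is estimated as a whole, with the
      difference of the two solutions as the L2 factor.\<close>
    define J where "J e = integral {0..L} (\<lambda>x. (complex_of_real (1 - cutoff x) * D (e * x)) * g (e * x))" for e
    have J_le: "norm (J e) \<le> Cg * (\<rho> * sqrt E')" if e: "e \<in> {1, - 1}" for e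
    proof -
      have "norm (J e) \<le> Cg * (sqrt (integral {0..L} (\<lambda>x. (norm (complex_of_real (1 - cutoff x)))\<^sup>2)) * sqrt (integral {0..L} (\<lambda>x. (norm (D (e * x)))\<^sup>2)))"
        unfolding J_def
        by (rule integral_product_bound) (use e Cg Cg0 in \<open>auto intro!: continuous_intros cutoff_cont comp Dc g_cont\<close>)
      also have "\<dots> \<le> Cg * (\<rho> * sqrt E')"
      proof (intro mult_left_mono mult_mono)
        have "integral {0..L} (\<lambda>x. (norm (complex_of_real (1 - cutoff x)))\<^sup>2) \<le> 1 * (2 * \<delta>) + 0 * L"
        proof (rule integral_le_split)
          show "continuous_on {0..L} (\<lambda>x. (norm (complex_of_real (1 - cutoff x)))\<^sup>2)" by (intro continuous_intros cutoff_cont)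
          show "(norm (complex_of_real (1 - cutoff x)))\<^sup>2 \<le> 1" for x
            unfolding norm_of_real power2_abs using cutoff01[of x] by (simp add: power_le_one)
          show "(norm (complex_of_real (1 - cutoff x)))\<^sup>2 \<le> 0" if "x \<in> {2 * \<delta>..L}" for x using cutoff1[of x] that by simp
        qed (use \<delta> in auto)
        then have "sqrt (integral {0..L} (\<lambda>x. (norm (complex_of_real (1 - cutoff x)))\<^sup>2)) \<le> sqrt (2 * \<delta>)"
          by (intro real_sqrt_le_mono) simp
        then show "sqrt (integral {0..L} (\<lambda>x. (norm (complex_of_real (1 - cutoff x)))\<^sup>2)) \<le> \<rho>" unfolding \<delta>(3) .
        have "integral {0..L} (\<lambda>x. (norm (D (e * x)))\<^sup>2) \<le> integral {-L..L} (\<lambda>x. (norm (D x))\<^sup>2)"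
          by (rule side_integral_le[OF e]) (use L0 in \<open>auto intro!: continuous_intros Dc\<close>)
        then show "sqrt (integral {0..L} (\<lambda>x. (norm (D (e * x)))\<^sup>2)) \<le> sqrt E'"
          using D_le by (intro real_sqrt_le_mono) linarith
        show "0 \<le> sqrt (integral {0..L} (\<lambda>x. (norm (D (e * x)))\<^sup>2))"
          by (intro real_sqrt_ge_zero integral_nonneg integrable_continuous_real continuous_intros comp Dc) simp
      qed (use \<rho> Cg0 in auto)
      finally show ?thesis .
    qed
    have split: "integral {0..L} (\<lambda>x. g (e * x) * w \<epsilon> (e * x) s) - integral {0..L} (\<lambda>x. g (e * x) * W (e * x, s))
      = (integral {0..L} (\<lambda>x. G e x * w \<epsilon> (e * x) s) - integral {0..L} (\<lambda>x. G e x * W (e * x, s))) + J e"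
      if e: "e \<in> {1, - 1}" for e
    proof -
      have Gc: "continuous_on {0..L} (G e)" unfolding G_def[abs_def] by (intro continuous_intros cutoff_cont comp g_cont)
      note cs = continuous_intros Gc comp[OF g_cont] comp[OF wc] comp[OF Wc] comp[OF Dc] cutoff_cont
      have i1: "(\<lambda>x. g (e * x) * w \<epsilon> (e * x) s) integrable_on {0..L}" by (rule i) (intro cs)
      have i2: "(\<lambda>x. g (e * x) * W (e * x, s)) integrable_on {0..L}" by (rule i) (intro cs)
      have i3: "(\<lambda>x. G e x * w \<epsilon> (e * x) s) integrable_on {0..L}" by (rule i) (intro cs)
      have i4: "(\<lambda>x. G e x * W (e * x, s)) integrable_on {0..L}" by (rule i) (intro cs)
      have i5: "(\<lambda>x. (complex_of_real (1 - cutoff x) * D (e * x)) * g (e * x)) integrable_on {0..L}" by (rule i) (intro cs)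
      show ?thesis
        unfolding J_def Henstock_Kurzweil_Integration.integral_diff[OF i1 i2, symmetric] Henstock_Kurzweil_Integration.integral_diff[OF i3 i4, symmetric]
          Henstock_Kurzweil_Integration.integral_add[OF integrable_diff[OF i3 i4] i5, symmetric]
        by (rule integral_cong) (simp add: G_def D_def \<kappa>(2)[OF e] scaleR_conv_of_real algebra_simps)
    qed
    have gw: "continuous_on {-L..L} (\<lambda>x. g x * w \<epsilon> x s)" "continuous_on {-L..L} (\<lambda>x. g x * W (x, s))"
      by (intro continuous_intros g_cont wc Wc)+
    have "integral {-L..L} (\<lambda>x. g x * w \<epsilon> x s) - integral {-L..L} (\<lambda>x. g x * W (x, s))
      = (\<Sum>e\<in>{1, - 1}. (integral {0..L} (\<lambda>x. G e x * w \<epsilon> (e * x) s) - integral {0..L} (\<lambda>x. G e x * W (e * x, s))) + J e)"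
      unfolding integral_sides[OF gw(1) less_imp_le[OF L0]] integral_sides[OF gw(2) less_imp_le[OF L0]] sum_subtractf[symmetric]
      by (rule sum.cong[OF refl split])
    also have "\<dots> = ((\<Sum>e\<in>{1, - 1}. integral {0..L} (\<lambda>x. G e x * w \<epsilon> (e * x) s)) - (\<Sum>e\<in>{1, - 1}. integral {0..L} (\<lambda>x. G e x * W (e * x, s)))) + (\<Sum>e\<in>{1, - 1}. J e)"
      by (simp only: sum.distrib sum_subtractf)
    finally have "dist (integral {-L..L} (\<lambda>x. g x * w \<epsilon> x s)) (integral {-L..L} (\<lambda>x. g x * W (x, s)))
      \<le> dist (\<Sum>e\<in>{1, - 1}. integral {0..L} (\<lambda>x. G e x * w \<epsilon> (e * x) s)) (\<Sum>e\<in>{1, - 1}. integral {0..L} (\<lambda>x. G e x * W (e * x, s))) + norm (\<Sum>e\<in>{1, - 1::real}. J e)"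
      unfolding dist_norm by (simp only: norm_triangle_ineq)
    moreover have "norm (\<Sum>e\<in>{1, - 1::real}. J e) \<le> (\<Sum>e\<in>{1, - 1::real}. Cg * (\<rho> * sqrt E'))"
      by (rule sum_norm_le[OF J_le])
    moreover have "(\<Sum>e\<in>{1, - 1::real}. Cg * (\<rho> * sqrt E')) = 2 * (Cg * (\<rho> * sqrt E'))" by simp
    ultimately show ?case using elim(1) \<rho>(3) by linarith
  qed
qed

text \<open>The slices converge pointwise in s, and the energy bound supplies a majorant that is
  constant in s; dominated convergence does the rest.\<close>

lemma time_integrated_limit:
  assumes \<theta>: "continuous_on UNIV \<theta>" and \<theta>_x: "\<And>x s. ((\<lambda>x. \<theta> (x, s)) has_vector_derivative \<theta>x (x, s)) (at x)" and \<theta>x: "continuous_on UNIV \<theta>x"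
    and X: "X > 0" "\<And>x s. \<bar>x\<bar> \<ge> X \<Longrightarrow> \<theta> (x, s) = 0" and t: "0 < t0" "t1 < T" and L: "X + (c 1 + c (- 1)) * T \<le> L" and L0: "L \<ge> 0"
  shows "((\<lambda>\<epsilon>. integral {t0..t1} (\<lambda>s. integral {-L..L} (\<lambda>x. \<theta> (x, s) * w \<epsilon> x s))) \<longlongrightarrow>
    integral {t0..t1} (\<lambda>s. integral {-L..L} (\<lambda>x. \<theta> (x, s) * W (x, s)))) (at_right 0)"
proof (cases "t0 \<le> t1")
  case True
  then have t1: "0 < t1" using t by simp
  obtain E where E: "\<forall>\<^sub>F \<epsilon> in at_right 0. \<forall>t\<in>{0..t1}. integral {-L..L} (\<lambda>x. (norm (w \<epsilon> x t))\<^sup>2) \<le> E \<and>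
    integral {-L..L} (\<lambda>x. (norm (wt \<epsilon> x t))\<^sup>2) \<le> E \<and> integral {-L..L} (\<lambda>x. (norm (wx \<epsilon> x t))\<^sup>2) \<le> E"
    using energy_bound[OF t1 t(2) L0] by (rule exE)
  obtain C where C: "\<forall>z\<in>cbox (-L, t0) (L, t1). norm (\<theta> z) \<le> C"
  proof -
    have "compact (\<theta> ` cbox (-L, t0) (L, t1))" by (intro compact_continuous_image continuous_on_subset[OF \<theta>]) auto
    from compact_imp_bounded[OF this] show ?thesis using that unfolding bounded_iff by auto
  qed
  have "norm (\<theta> (0, t0)) \<le> C" by (rule bspec[OF C]) (use True L0 in \<open>simp add: cbox_Pair_eq\<close>)
  then have C0: "C \<ge> 0" using norm_ge_zero[of "\<theta> (0, t0)"] by linarith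
  have \<theta>_line: "continuous_on S (\<lambda>x. \<theta> (x, s))" for S s
    by (rule continuous_on_UNIV_compose[OF \<theta>]) (intro continuous_intros)
  \<comment> \<open>What dominated convergence asks of a single \<epsilon>: integrability of the
    slice integrals and the common bound.\<close>
  define good where "good \<epsilon> \<longleftrightarrow> (\<lambda>s. integral {-L..L} (\<lambda>x. \<theta> (x, s) * w \<epsilon> x s)) integrable_on {t0..t1} \<and>
      (\<forall>s\<in>{t0..t1}. norm (integral {-L..L} (\<lambda>x. \<theta> (x, s) * w \<epsilon> x s)) \<le> C * (sqrt (2 * L) * sqrt E))" for \<epsilon>
  have good: "\<forall>\<^sub>F \<epsilon> in at_right 0. good \<epsilon>"
    using E wave
  proof eventually_elim
    case (elim \<epsilon>)
    interpret sw: smooth_wave T "ar \<epsilon>" "br \<epsilon>" "w \<epsilon>" "wt \<epsilon>" "wx \<epsilon>" "wtt \<epsilon>" "wxt \<epsilon>" "F \<epsilon>" "n \<epsilon>" by (rule elim(2))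
    show ?case
      unfolding good_def
    proof (intro conjI ballI)
      have "continuous2 ({-L..L} \<times> {t0..t1}) (\<lambda>x s. \<theta> (x, s) * w \<epsilon> x s)"
      proof -
        have 1: "continuous2 ({-L..L} \<times> {t0..t1}) (w \<epsilon>)" by (rule continuous_on_subset[OF sw.cont(1)]) (use t in auto)
        have 2: "continuous2 ({-L..L} \<times> {t0..t1}) (\<lambda>x s. \<theta> (x, s))"
          using continuous_on_subset[OF \<theta>, of "{-L..L} \<times> {t0..t1}"] by simp
        show ?thesis by (rule continuous_on_mult[OF 2 1])
      qed
      from continuous2_integral_x[OF this]
      show "(\<lambda>s. integral {-L..L} (\<lambda>x. \<theta> (x, s) * w \<epsilon> x s)) integrable_on {t0..t1}"
        by (rule integrable_continuous_real)
      fix s assume s: "s \<in> {t0..t1}"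
      have wc: "continuous_on U (\<lambda>x. w \<epsilon> x s)" for U
        by (rule continuous_on_subset[OF continuous2_slice_x[OF sw.cont(1)]]) (use s t in auto)
      have "norm (integral {-L..L} (\<lambda>x. (1 * w \<epsilon> x s) * \<theta> (x, s)))
        \<le> C * (sqrt (integral {-L..L} (\<lambda>x. (norm (1 :: complex))\<^sup>2)) * sqrt (integral {-L..L} (\<lambda>x. (norm (w \<epsilon> x s))\<^sup>2)))"
        by (rule integral_product_bound) (use C C0 s wc \<theta>_line in \<open>auto simp: cbox_Pair_eq\<close>)
      also have "\<dots> \<le> C * (sqrt (2 * L) * sqrt E)"
        using bspec[OF elim(1), of s] s t L0 by (intro mult_left_mono mult_mono real_sqrt_le_mono) (auto simp: C0 intro!: integral_nonneg integrable_continuous_real continuous_intros wc)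
      finally show "norm (integral {-L..L} (\<lambda>x. \<theta> (x, s) * w \<epsilon> x s)) \<le> C * (sqrt (2 * L) * sqrt E)"
        by (simp add: mult.commute)
    qed
  qed
  have slice: "((\<lambda>\<epsilon>. integral {-L..L} (\<lambda>x. \<theta> (x, s) * w \<epsilon> x s)) \<longlongrightarrow> integral {-L..L} (\<lambda>x. \<theta> (x, s) * W (x, s))) (at_right 0)"
    if s: "s \<in> {t0..t1}" for s
  proof (rule slice_limit[OF \<theta>_x _ X(1) X(2) _ _ _ L])
    show "continuous_on UNIV (\<lambda>x. \<theta>x (x, s))"
      by (rule continuous_on_UNIV_compose[OF \<theta>x]) (intro continuous_intros)
  qed (use s t in auto)
  \<comment> \<open>Dominated convergence concerns sequences, so the limit is tested along an
    arbitrary positive null sequence. \<open>good\<close> holds only eventually, hence the shift by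
    \<open>N\<close>.\<close>
  show ?thesis
    unfolding tendsto_at_iff_sequentially comp_def
  proof (intro allI impI)
    fix \<sigma> :: "nat \<Rightarrow> real" assume \<sigma>: "\<forall>i. \<sigma> i \<in> {0<..} - {0}" "\<sigma> \<longlonglongrightarrow> 0"
    have f\<sigma>: "filterlim \<sigma> (at_right 0) sequentially"
    proof -
      have pos: "\<sigma> i > 0" for i using \<sigma>(1) by simp
      then have "\<sigma> i \<noteq> 0" for i by (metis less_irrefl)
      then show ?thesis unfolding filterlim_at using pos \<sigma>(2) by simp
    qed
    have "\<forall>\<^sub>F k in sequentially. good (\<sigma> k)"
      using filterlim_iff[THEN iffD1, OF f\<sigma>, rule_format, OF good] .
    then obtain N where N: "\<And>k. k \<ge> N \<Longrightarrow> good (\<sigma> k)" unfolding eventually_sequentially by auto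
    have "(\<lambda>k. integral {t0..t1} (\<lambda>s. integral {-L..L} (\<lambda>x. \<theta> (x, s) * w (\<sigma> (k + N)) x s))) \<longlonglongrightarrow>
      integral {t0..t1} (\<lambda>s. integral {-L..L} (\<lambda>x. \<theta> (x, s) * W (x, s)))"
    proof (rule dominated_convergence(2))
      show "(\<lambda>s. integral {-L..L} (\<lambda>x. \<theta> (x, s) * w (\<sigma> (k + N)) x s)) integrable_on {t0..t1}" for k
        using N[of "k + N"] unfolding good_def by simp
      show "(\<lambda>s. C * (sqrt (2 * L) * sqrt E)) integrable_on {t0..t1}" by (rule integrable_const_ivl)
      show "norm (integral {-L..L} (\<lambda>x. \<theta> (x, s) * w (\<sigma> (k + N)) x s)) \<le> C * (sqrt (2 * L) * sqrt E)" if "s \<in> {t0..t1}" for k s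
        using N[of "k + N"] that unfolding good_def by simp
      show "(\<lambda>k. integral {-L..L} (\<lambda>x. \<theta> (x, s) * w (\<sigma> (k + N)) x s)) \<longlonglongrightarrow> integral {-L..L} (\<lambda>x. \<theta> (x, s) * W (x, s))" if "s \<in> {t0..t1}" for s
        by (rule LIMSEQ_ignore_initial_segment[OF filterlim_compose[OF slice[OF that] f\<sigma>]])
    qed
    then show "(\<lambda>k. integral {t0..t1} (\<lambda>s. integral {-L..L} (\<lambda>x. \<theta> (x, s) * w (\<sigma> k) x s))) \<longlonglongrightarrow>
      integral {t0..t1} (\<lambda>s. integral {-L..L} (\<lambda>x. \<theta> (x, s) * W (x, s)))"
      by (rule LIMSEQ_offset)
  qed
qed simp

theorem weak_limit:
  assumes T: "T > 0" and \<theta>: "\<theta> \<in> test_functions (UNIV \<times> {0<..<T})"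
  shows "((\<lambda>\<epsilon>. function_distribution (\<lambda>z. w \<epsilon> (fst z) (snd z)) \<theta>) \<longlongrightarrow> u \<theta>) (at_right 0)"
proof -
  have sm: "smooth_on UNIV \<theta>" and cs: "compact (supp \<theta>)" and sub: "supp \<theta> \<subseteq> UNIV \<times> {0<..<T}"
    using \<theta> by (simp_all add: test_functions_def)
  obtain X t0 t1 where X: "X > 0" and t: "0 < t0" "t1 < T" and in_box: "\<And>x s. \<theta> (x, s) \<noteq> 0 \<Longrightarrow> \<bar>x\<bar> < X \<and> t0 \<le> s \<and> s \<le> t1"
    using test_function_box[OF T \<theta>] by metis
  \<comment> \<open>Large enough for the dual waves of every terminal time below T to stay inside
    [-L,L].\<close>
  define L where "L = X + (c 1 + c (- 1)) * T"
  have "(c 1 + c (- 1)) * T > 0" using c_pos[of 1] c_pos[of "- 1"] T by simp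
  then have LX: "L \<ge> X" "X > 0" "L \<ge> 0" using X by (auto simp: L_def)
  have zero: "\<theta> z = 0" if "z \<notin> cbox (-L, t0) (L, t1)" for z
  proof (rule ccontr)
    assume "\<theta> z \<noteq> 0"
    then have "\<bar>fst z\<bar> < X \<and> t0 \<le> snd z \<and> snd z \<le> t1" using in_box[of "fst z" "snd z"] by simp
    with that LX show False by (cases z) (auto simp: cbox_Pair_eq)
  qed
  have \<theta>c: "continuous_on UNIV \<theta>" by (rule smooth_on_imp_continuous_on[OF sm])
  have Bx: "(1, 0) \<in> (Basis :: (real \<times> real) set)" by (auto simp: Basis_prod_def)
  have "iter_deriv [(1, 0)] \<theta> differentiable (at z)" for z
    by (rule smooth_on_iter_deriv[OF sm]) (use Bx in auto)
  then have \<theta>x: "continuous_on UNIV (D_x \<theta>)"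
    by (intro continuous_at_imp_continuous_on ballI differentiable_imp_continuous_within)
  have d\<theta>: "\<theta> differentiable (at z)" for z using smooth_on_iter_deriv[OF sm, of "[]"] by simp
  have lim: "((\<lambda>\<epsilon>. integral {t0..t1} (\<lambda>s. integral {-L..L} (\<lambda>x. \<theta> (x, s) * w \<epsilon> x s))) \<longlongrightarrow>
    integral {t0..t1} (\<lambda>s. integral {-L..L} (\<lambda>x. \<theta> (x, s) * W (x, s)))) (at_right 0)"
  proof (rule time_integrated_limit[OF \<theta>c partial_derivatives(1)[OF d\<theta>] \<theta>x LX(2) _ t _ LX(3)])
    show "\<theta> (x, s) = 0" if "\<bar>x\<bar> \<ge> X" for x s
      using in_box[of x s] that by auto
    show "X + (c 1 + c (- 1)) * T \<le> L" by (simp add: L_def)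
  qed
  have box: "cbox (-L, t0) (L, t1) \<subseteq> UNIV \<times> {0..}" "cbox (-L, t0) (L, t1) \<subseteq> UNIV \<times> {-T<..<T}"
    using t by (auto simp: cbox_Pair_eq)
  have "supp \<theta> \<subseteq> UNIV \<times> {0<..}" using sub by auto
  then have "\<theta> \<in> test_functions (UNIV \<times> {0<..})" using sm cs by (simp add: test_functions_def)
  then have "u \<theta> = function_distribution W \<theta>"
    using u_W unfolding distributions_equal_on_def by (rule bspec[rotated])
  also have "\<dots> = integral {t0..t1} (\<lambda>s. integral {-L..L} (\<lambda>x. \<theta> (x, s) * W (x, s)))"
    by (rule function_distribution_iterated[OF continuous_on_subset[OF W_cont box(1)] \<theta>c zero])
  finally have u: "u \<theta> = integral {t0..t1} (\<lambda>s. integral {-L..L} (\<lambda>x. \<theta> (x, s) * W (x, s)))" .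
  have "\<forall>\<^sub>F \<epsilon> in at_right 0. integral {t0..t1} (\<lambda>s. integral {-L..L} (\<lambda>x. \<theta> (x, s) * w \<epsilon> x s))
      = function_distribution (\<lambda>z. w \<epsilon> (fst z) (snd z)) \<theta>"
    using wave
  proof eventually_elim
    case (elim \<epsilon>)
    then have "continuous2 (UNIV \<times> {-T<..<T}) (w \<epsilon>)" by (rule smooth_wave.cont)
    from function_distribution_iterated[OF continuous_on_subset[OF this box(2)] \<theta>c zero]
    show ?case by simp
  qed
  from Lim_transform_eventually[OF lim this] show ?thesis unfolding u .
qed

end

text \<open>Nothing converges at the jump itself, but a bounded integrand on a short interval costs
  little, and beyond it the convergence is uniform.\<close>

lemma (in delta_net) representative_L2_limit:
  assumes c: "c > 0" and d: "d > 0"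
    and ar: "ar \<in> generalised_class W_infty sup_seminorms (\<lambda>\<epsilon>. convolution (two_phase c d) (\<phi> \<epsilon>))"
    and e: "e \<in> {1, - 1}"
  shows "((\<lambda>\<epsilon>. integral {0..L} (\<lambda>x. (two_phase c d e - ar \<epsilon> (e * x))\<^sup>2)) \<longlongrightarrow> 0) (at_right 0)"
proof (cases "L > 0")
  case True
  show ?thesis
  proof (rule tendstoI)
    fix \<eta> :: real assume \<eta>: "\<eta> > 0"
    \<comment> \<open>The limit value is at most \<open>max c d\<close> and the representative at
      most \<open>2 * max c d\<close>, both positive. With \<rho> and \<eta>' as below, the interval
      next to the jump and the rest contribute \<eta>/4 each.\<close>
    define M where "M = (3 * max c d)\<^sup>2"
    have M: "M > 0" using c by (auto simp: M_def)
    define \<rho> where "\<rho> = min L (\<eta> / (4 * M))"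
    define \<eta>' where "\<eta>' = sqrt (\<eta> / (4 * L))"
    have \<rho>: "\<rho> > 0" "\<rho> \<le> L" using True \<eta> M by (auto simp: \<rho>_def)
    have "\<rho> \<le> \<eta> / (4 * M)" by (simp add: \<rho>_def)
    then have M\<rho>: "M * \<rho> \<le> \<eta> / 4" using M by (simp add: field_simps)
    have \<eta>': "\<eta>' > 0" using \<eta> True by (simp add: \<eta>'_def)
    have "\<eta>'\<^sup>2 = \<eta> / (4 * L)" using \<eta> True by (simp add: \<eta>'_def)
    then have \<eta>L: "\<eta>'\<^sup>2 * L = \<eta> / 4" using True by simp
    show "\<forall>\<^sub>F \<epsilon> in at_right 0. dist (integral {0..L} (\<lambda>x. (two_phase c d e - ar \<epsilon> (e * x))\<^sup>2)) 0 < \<eta>"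
      using eventually_in_unit representative_bounds[OF c d ar] representative_limit[OF c d ar \<rho>(1) \<eta>']
    proof eventually_elim
      case (elim \<epsilon>)
      have ac: "continuous_on UNIV (ar \<epsilon>)"
        by (rule smooth_on_imp_continuous_on[OF representative_smooth[OF c d ar elim(1)]])
      have fc: "continuous_on {0..L} (\<lambda>x. (two_phase c d e - ar \<epsilon> (e * x))\<^sup>2)"
        by (intro continuous_intros continuous_on_UNIV_compose[OF ac])
      have "integral {0..L} (\<lambda>x. (two_phase c d e - ar \<epsilon> (e * x))\<^sup>2) \<le> M * \<rho> + \<eta>'\<^sup>2 * L"
      proof (rule integral_le_split[OF fc])
        show "(two_phase c d e - ar \<epsilon> (e * x))\<^sup>2 \<le> M" for x
        proof -
          have "min c d / 2 \<le> ar \<epsilon> (e * x)" "ar \<epsilon> (e * x) \<le> 2 * max c d" using elim(2) by blast+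
          moreover have "0 < two_phase c d e" "two_phase c d e \<le> max c d" using c d by (auto simp: two_phase_def)
          ultimately have "\<bar>two_phase c d e - ar \<epsilon> (e * x)\<bar> \<le> 3 * max c d" using c d by linarith
          then show ?thesis unfolding M_def by (rule abs_le_square_iff[THEN iffD1, OF order_trans]) simp
        qed
        show "(two_phase c d e - ar \<epsilon> (e * x))\<^sup>2 \<le> \<eta>'\<^sup>2" if x: "x \<in> {\<rho>..L}" for x
        proof -
          have "\<bar>e * x\<bar> \<ge> \<rho>" using e x \<rho> by auto
          then have "\<bar>ar \<epsilon> (e * x) - two_phase c d (e * x)\<bar> < \<eta>'" using elim(3) by blast
          moreover have "two_phase c d (e * x) = two_phase c d e" using e x \<rho> by (auto simp: two_phase_def)
          ultimately have "\<bar>two_phase c d e - ar \<epsilon> (e * x)\<bar> \<le> \<bar>\<eta>'\<bar>" by linarith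
          then show ?thesis by (rule abs_le_square_iff[THEN iffD1])
        qed
      qed (use \<rho> in auto)
      moreover have "integral {0..L} (\<lambda>x. (two_phase c d e - ar \<epsilon> (e * x))\<^sup>2) \<ge> 0"
        by (rule integral_nonneg[OF integrable_continuous_real[OF fc]]) simp
      ultimately show ?case using M\<rho> \<eta>L \<eta> by (simp add: dist_real_def)
    qed
  qed
next
  case False
  then have "integral {0..L} f = 0" for f :: "real \<Rightarrow> real"
    by (cases "L = 0") auto
  then show ?thesis by simp
qed

section \<open>Consequences of negligibility\<close>

lemma negligible_box_integral:
  fixes D :: "real \<Rightarrow> 'a::euclidean_space \<Rightarrow> complex"
  assumes D: "D \<in> negligible_nets (H_infty U) (sobolev_seminorms U)" and sub: "cbox a b \<subseteq> U"
  shows "\<exists>C>0. \<forall>\<^sub>F \<epsilon> in at_right 0. continuous_on U (D \<epsilon>) \<and> integral (cbox a b) (\<lambda>z. (norm (D \<epsilon> z))\<^sup>2) \<le> C * \<epsilon>\<^sup>2"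
proof -
  obtain C where C: "C > 0" "\<forall>\<^sub>F \<epsilon> in at_right 0. (LINT z:U|lborel. (norm (iter_deriv [] (D \<epsilon>) z))\<^sup>2) \<le> C * \<epsilon>\<^sup>2"
    using negligible_seminorm[OF D, of "[]"] by auto
  have "\<forall>\<^sub>F \<epsilon> in at_right 0. continuous_on U (D \<epsilon>) \<and> integral (cbox a b) (\<lambda>z. (norm (D \<epsilon> z))\<^sup>2) \<le> C * \<epsilon>\<^sup>2"
    using C(2) eventually_in_unit
  proof eventually_elim
    case (elim \<epsilon>)
    have H: "D \<epsilon> \<in> H_infty U" by (rule negligible_netsD(1)[OF D elim(2)])
    have "set_integrable lborel U (\<lambda>z. (norm (D \<epsilon> z))\<^sup>2)" using H_inftyD(2)[OF H, of "[]"] by simp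
    from integral_le_set_integral[OF this sub]
    have "integral (cbox a b) (\<lambda>z. (norm (D \<epsilon> z))\<^sup>2) \<le> (LINT z:U|lborel. (norm (D \<epsilon> z))\<^sup>2)" by simp
    also have "\<dots> \<le> C * \<epsilon>\<^sup>2" using elim(1) by simp
    finally show ?case using smooth_on_imp_continuous_on[OF H_inftyD(1)[OF H]] by blast
  qed
  then show ?thesis using C(1) by blast
qed

lemma quadratic_null:
  "(\<forall>\<^sub>F \<epsilon> in at_right (0::real). 0 \<le> f \<epsilon> \<and> f \<epsilon> \<le> C * \<epsilon>\<^sup>2) \<Longrightarrow> (f \<longlongrightarrow> (0::real)) (at_right 0)"
proof (rule tendsto_sandwich[of "\<lambda>_. 0" f _ "\<lambda>\<epsilon>. C * \<epsilon>\<^sup>2"])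
  have "((\<lambda>\<epsilon>. C * \<epsilon>\<^sup>2) \<longlongrightarrow> C * 0\<^sup>2) (at_right (0::real))" by (intro tendsto_intros)
  then show "((\<lambda>\<epsilon>. C * \<epsilon>\<^sup>2) \<longlongrightarrow> 0) (at_right (0::real))" by simp
qed (auto elim: eventually_mono)

lemma negligible_rectangle_limit:
  fixes D :: "real \<Rightarrow> real \<times> real \<Rightarrow> complex"
  assumes D: "D \<in> negligible_nets (H_infty (UNIV \<times> {-T<..<T})) (sobolev_seminorms (UNIV \<times> {-T<..<T}))"
    and s: "0 < s" "s < T"
  shows "((\<lambda>\<epsilon>. integral {0..s} (\<lambda>t. integral {-L..L} (\<lambda>x. (norm (D \<epsilon> (x, t)))\<^sup>2))) \<longlongrightarrow> 0) (at_right 0)"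
proof -
  have sub: "cbox (-L, 0) (L, s) \<subseteq> UNIV \<times> {-T<..<T}" using s by (auto simp: cbox_Pair_eq)
  obtain C where "\<forall>\<^sub>F \<epsilon> in at_right 0. continuous_on (UNIV \<times> {-T<..<T}) (D \<epsilon>) \<and> integral (cbox (-L, 0) (L, s)) (\<lambda>z. (norm (D \<epsilon> z))\<^sup>2) \<le> C * \<epsilon>\<^sup>2"
    using negligible_box_integral[OF D sub] by blast
  then have "\<forall>\<^sub>F \<epsilon> in at_right 0. 0 \<le> integral {0..s} (\<lambda>t. integral {-L..L} (\<lambda>x. (norm (D \<epsilon> (x, t)))\<^sup>2)) \<and>
      integral {0..s} (\<lambda>t. integral {-L..L} (\<lambda>x. (norm (D \<epsilon> (x, t)))\<^sup>2)) \<le> C * \<epsilon>\<^sup>2"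
  proof eventually_elim
    case (elim \<epsilon>)
    have c: "continuous_on (cbox (-L, 0) (L, s)) (\<lambda>z. (norm (D \<epsilon> z))\<^sup>2)"
      by (intro continuous_intros continuous_on_subset[OF conjunct1[OF elim] sub])
    have "integral (cbox (-L, 0) (L, s)) (\<lambda>z. (norm (D \<epsilon> z))\<^sup>2) = integral (cbox (-L) L) (\<lambda>x. integral (cbox 0 s) (\<lambda>t. (norm (D \<epsilon> (x, t)))\<^sup>2))"
      by (rule integral_prod_continuous[OF c])
    also have "\<dots> = integral (cbox 0 s) (\<lambda>t. integral (cbox (-L) L) (\<lambda>x. (norm (D \<epsilon> (x, t)))\<^sup>2))"
      by (rule integral_swap_continuous) (use c in \<open>simp add: case_prod_unfold\<close>)
    finally have eq: "integral {0..s} (\<lambda>t. integral {-L..L} (\<lambda>x. (norm (D \<epsilon> (x, t)))\<^sup>2)) = integral (cbox (-L, 0) (L, s)) (\<lambda>z. (norm (D \<epsilon> z))\<^sup>2)"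
      by simp
    have "integral (cbox (-L, 0) (L, s)) (\<lambda>z. (norm (D \<epsilon> z))\<^sup>2) \<ge> 0"
      by (rule integral_nonneg[OF integrable_continuous[OF c]]) simp
    then show ?case unfolding eq using elim by blast
  qed
  then show ?thesis by (rule quadratic_null)
qed

text \<open>Equivalent nets have the same weak limit; this carries the convergence from the
  representative that solves the equation to all others.\<close>

lemma negligible_difference_pairing:
  fixes f g :: "real \<Rightarrow> real \<times> real \<Rightarrow> complex"
  assumes D: "(\<lambda>\<epsilon>. f \<epsilon> - g \<epsilon>) \<in> negligible_nets (H_infty (UNIV \<times> {-T<..<T})) (sobolev_seminorms (UNIV \<times> {-T<..<T}))"
    and f: "f \<in> moderate_nets (H_infty (UNIV \<times> {-T<..<T})) (sobolev_seminorms (UNIV \<times> {-T<..<T}))"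
    and g: "g \<in> moderate_nets (H_infty (UNIV \<times> {-T<..<T})) (sobolev_seminorms (UNIV \<times> {-T<..<T}))"
    and T: "T > 0" and \<theta>: "\<theta> \<in> test_functions (UNIV \<times> {0<..<T})"
  shows "((\<lambda>\<epsilon>. function_distribution (f \<epsilon>) \<theta> - function_distribution (g \<epsilon>) \<theta>) \<longlongrightarrow> 0) (at_right 0)"
proof -
  let ?U = "UNIV \<times> {-T<..<T} :: (real \<times> real) set"
  obtain X t0 t1 where X: "X > 0" and t: "0 < t0" "t1 < T" and in_box: "\<And>x s. \<theta> (x, s) \<noteq> 0 \<Longrightarrow> \<bar>x\<bar> < X \<and> t0 \<le> s \<and> s \<le> t1"
    using test_function_box[OF T \<theta>] by metis
  let ?C = "cbox (-X, t0) (X, t1)"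
  have zero: "\<theta> z = 0" if "z \<notin> ?C" for z
  proof (rule ccontr)
    assume "\<theta> z \<noteq> 0"
    then have "\<bar>fst z\<bar> < X \<and> t0 \<le> snd z \<and> snd z \<le> t1" using in_box[of "fst z" "snd z"] by simp
    with that show False by (cases z) (auto simp: cbox_Pair_eq)
  qed
  have sub: "?C \<subseteq> ?U" using t by (auto simp: cbox_Pair_eq)
  have \<theta>c: "continuous_on S \<theta>" for S
    using \<theta> continuous_on_subset[OF smooth_on_imp_continuous_on, of UNIV \<theta> S] by (simp add: test_functions_def)
  define P where "P = integral ?C (\<lambda>z. (norm (\<theta> z))\<^sup>2)"
  obtain C where C: "C > 0" "\<forall>\<^sub>F \<epsilon> in at_right 0. continuous_on ?U (f \<epsilon> - g \<epsilon>) \<and> integral ?C (\<lambda>z. (norm ((f \<epsilon> - g \<epsilon>) z))\<^sup>2) \<le> C * \<epsilon>\<^sup>2"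
    using negligible_box_integral[OF D sub] by blast
  have "\<forall>\<^sub>F \<epsilon> in at_right 0. norm (function_distribution (f \<epsilon>) \<theta> - function_distribution (g \<epsilon>) \<theta>) \<le> (P + C) * \<epsilon>"
    using C(2) eventually_in_unit
  proof eventually_elim
    case (elim \<epsilon>)
    have \<epsilon>: "\<epsilon> > 0" using elim(2) by simp
    have fc: "continuous_on ?C (f \<epsilon>)" and gc: "continuous_on ?C (g \<epsilon>)"
      by (rule continuous_on_subset[OF smooth_on_imp_continuous_on[OF H_inftyD(1)[OF moderate_netsD(1)[OF f elim(2)]]] sub],
          rule continuous_on_subset[OF smooth_on_imp_continuous_on[OF H_inftyD(1)[OF moderate_netsD(1)[OF g elim(2)]]] sub])
    have Dc: "continuous_on ?C (f \<epsilon> - g \<epsilon>)" by (rule continuous_on_subset[OF conjunct1[OF elim(1)] sub])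
    have i: "(\<lambda>z. \<theta> z * f \<epsilon> z) integrable_on ?C" "(\<lambda>z. \<theta> z * g \<epsilon> z) integrable_on ?C"
      "(\<lambda>z. \<epsilon> * (norm (\<theta> z))\<^sup>2) integrable_on ?C" "(\<lambda>z. (1 / \<epsilon>) * (norm ((f \<epsilon> - g \<epsilon>) z))\<^sup>2) integrable_on ?C"
      by (intro integrable_continuous continuous_intros \<theta>c fc gc Dc)+
    have fd: "function_distribution (f \<epsilon>) \<theta> = integral ?C (\<lambda>z. \<theta> z * f \<epsilon> z)"
      "function_distribution (g \<epsilon>) \<theta> = integral ?C (\<lambda>z. \<theta> z * g \<epsilon> z)"
      by (rule function_distribution_box[OF fc \<theta>c zero], assumption, rule function_distribution_box[OF gc \<theta>c zero], assumption)
    have "norm (function_distribution (f \<epsilon>) \<theta> - function_distribution (g \<epsilon>) \<theta>) = norm (integral ?C (\<lambda>z. \<theta> z * f \<epsilon> z - \<theta> z * g \<epsilon> z))"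
      unfolding Henstock_Kurzweil_Integration.integral_diff[OF i(1,2)] by (simp only: fd)
    also have "\<dots> \<le> integral ?C (\<lambda>z. \<epsilon> * (norm (\<theta> z))\<^sup>2 + (1 / \<epsilon>) * (norm ((f \<epsilon> - g \<epsilon>) z))\<^sup>2)"
    proof (rule integral_norm_bound_integral[OF integrable_diff[OF i(1,2)] integrable_add[OF i(3,4)]])
      fix z
      \<comment> \<open>The weight \<epsilon> balances the two terms: the squared difference
        integrates to O(\<epsilon>^2), so after division by \<epsilon> both terms are
        O(\<epsilon>).\<close>
      have *: "x * y \<le> \<epsilon> * x\<^sup>2 + (1 / \<epsilon>) * y\<^sup>2" for x y :: real
      proof -
        have "0 \<le> (\<epsilon> * x - y)\<^sup>2 + (\<epsilon> * x)\<^sup>2 + y\<^sup>2" by simp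
        then have "\<epsilon> * (x * y) \<le> \<epsilon> * (\<epsilon> * x\<^sup>2 + (1 / \<epsilon>) * y\<^sup>2)"
          using \<epsilon> by (simp add: power2_eq_square algebra_simps)
        then show ?thesis using \<epsilon> by (simp only: mult_le_cancel_left_pos)
      qed
      have "norm (\<theta> z * f \<epsilon> z - \<theta> z * g \<epsilon> z) = norm (\<theta> z) * norm ((f \<epsilon> - g \<epsilon>) z)"
        by (simp add: norm_mult[symmetric] right_diff_distrib)
      then show "norm (\<theta> z * f \<epsilon> z - \<theta> z * g \<epsilon> z) \<le> \<epsilon> * (norm (\<theta> z))\<^sup>2 + (1 / \<epsilon>) * (norm ((f \<epsilon> - g \<epsilon>) z))\<^sup>2"
        using * by (simp only:)
    qed
    also have "\<dots> = \<epsilon> * P + (1 / \<epsilon>) * integral ?C (\<lambda>z. (norm ((f \<epsilon> - g \<epsilon>) z))\<^sup>2)"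
      unfolding Henstock_Kurzweil_Integration.integral_add[OF i(3,4)] P_def by (simp only: integral_mult_right)
    also have "\<dots> \<le> \<epsilon> * P + (1 / \<epsilon>) * (C * \<epsilon>\<^sup>2)"
      by (intro add_left_mono mult_left_mono conjunct2[OF elim(1)]) (use \<epsilon> in simp)
    also have "\<dots> = (P + C) * \<epsilon>" using \<epsilon> by (simp add: power2_eq_square field_simps)
    finally show ?case .
  qed
  moreover have "((\<lambda>\<epsilon>. (P + C) * \<epsilon>) \<longlongrightarrow> 0) (at_right 0)"
    by (rule tendsto_mult_right_zero) (rule tendsto_ident_at)
  ultimately show ?thesis by (rule Lim_null_comparison)
qed

theorem proposition5p8:
  fixes T a_minus a_plus b_minus b_plus :: real
    and \<phi> :: "real \<Rightarrow> real \<Rightarrow> real"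
    and \<psi> :: "real \<Rightarrow> real \<Rightarrow> complex"
    and a b :: "(real \<Rightarrow> real \<Rightarrow> real) set"
    and wbar0 wbar1 :: "real \<Rightarrow> complex"
    and w0 w1 :: "(real \<Rightarrow> real \<Rightarrow> complex) set"
    and w :: "(real \<Rightarrow> real \<times> real \<Rightarrow> complex) set"
    and wbar :: "(real \<times> real \<Rightarrow> complex) \<Rightarrow> complex"
  assumes "T > 0"
    and "a_minus > 0" "a_plus > 0" "b_minus > 0" "b_plus > 0"
    and "\<forall>\<epsilon>\<in>{0<..1}. smooth_on UNIV (\<phi> \<epsilon>) \<and> (\<forall>x. \<phi> \<epsilon> x \<ge> 0)"
    and "compactly_supported_net \<phi>"
    and "log_slow_scale_regular \<phi>"
    and "converges_weakly_on UNIV (\<lambda>\<epsilon> x. complex_of_real (\<phi> \<epsilon> x)) dirac"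
    and "a = generalised_class W_infty sup_seminorms
               (\<lambda>\<epsilon>. convolution (two_phase a_minus a_plus) (\<phi> \<epsilon>))"
    and "b = generalised_class W_infty sup_seminorms
               (\<lambda>\<epsilon>. convolution (two_phase b_minus b_plus) (\<phi> \<epsilon>))"
    and "wbar0 C1_differentiable_on UNIV" "compact (supp wbar0)"
    and "continuous_on UNIV wbar1" "compact (supp wbar1)"
    and "moderate_mollifier \<psi>"
    and "w0 = G22_class UNIV (\<lambda>\<epsilon>. convolution wbar0 (\<psi> \<epsilon>))"
    and "w1 = G22_class UNIV (\<lambda>\<epsilon>. convolution wbar1 (\<psi> \<epsilon>))"
    and "generalised_wave_solution T a b w0 w1 w"
    and "connected_solution (two_phase a_minus a_plus) (two_phase b_minus b_plus) wbar0 wbar1 wbar"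
  shows "associated_on (UNIV \<times> {0<..<T}) w wbar"
proof -
  let ?U = "UNIV \<times> {-T<..<T} :: (real \<times> real) set"
  let ?H = "H_infty ?U" and ?P = "sobolev_seminorms ?U"
  note hyps = assms
  interpret delta_net \<phi> by standard (rule hyps(6), rule hyps(7), rule hyps(9))
  obtain ar br wr where ar: "ar \<in> a" and br: "br \<in> b" and wr: "wr \<in> w"
    and neg: "(\<lambda>\<epsilon>. wave_operator (ar \<epsilon>) (br \<epsilon>) (wr \<epsilon>)) \<in> negligible_nets ?H ?P"
    and i0: "G22_class UNIV (\<lambda>\<epsilon> x. wr \<epsilon> (x, 0)) = w0" and i1: "G22_class UNIV (\<lambda>\<epsilon> x. D_t (wr \<epsilon>) (x, 0)) = w1"
    and wG: "w \<in> G22 ?U"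
    using hyps(19) unfolding generalised_wave_solution_def by (elim conjE bexE)
  have ar': "ar \<in> generalised_class W_infty sup_seminorms (\<lambda>\<epsilon>. convolution (two_phase a_minus a_plus) (\<phi> \<epsilon>))"
    using ar unfolding hyps(10) .
  have br': "br \<in> generalised_class W_infty sup_seminorms (\<lambda>\<epsilon>. convolution (two_phase b_minus b_plus) (\<phi> \<epsilon>))"
    using br unfolding hyps(11) .
  \<comment> \<open>A net generating the class. The representative \<open>wr\<close>, for which the
    equation holds, and an arbitrary \<open>f\<close> are both compared with it, so neither symmetry
    nor transitivity of the relation has to be proved.\<close>
  obtain u0 where "w = generalised_rel ?H ?P `` {u0}"
    using wG unfolding generalised_functions_def by (rule quotientE)
  then have w_iff: "f \<in> w \<longleftrightarrow> u0 \<in> moderate_nets ?H ?P \<and> f \<in> moderate_nets ?H ?P \<and> (\<lambda>\<epsilon>. u0 \<epsilon> - f \<epsilon>) \<in> negligible_nets ?H ?P" for f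
    by (simp only: generalised_class_def[symmetric] generalised_class_iff)
  obtain w0' where w0': "\<forall>x\<in>UNIV. (wbar0 has_vector_derivative w0' x) (at x)" "continuous_on UNIV w0'"
    using hyps(12) unfolding C1_differentiable_on_def by (elim exE conjE)
  have w0c: "continuous_on UNIV wbar0"
    by (rule has_vector_derivative_imp_continuous_on) (use w0' in auto)
  have dist: "distribution_on UNIV wbar"
    and eqn: "\<forall>\<theta>\<in>test_functions ({..<0} \<times> UNIV) \<union> test_functions ({0<..} \<times> UNIV).
      wbar (wave_operator (two_phase a_minus a_plus) (two_phase b_minus b_plus) \<theta>) = 0"
    by (rule conjunct1[OF hyps(20)[unfolded connected_solution_def]],
        rule conjunct1[OF conjunct2[OF hyps(20)[unfolded connected_solution_def]]])
  obtain W V where WV: "continuous_on (UNIV \<times> {0..}) W"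
    "distributions_equal_on (UNIV \<times> {0<..}) wbar (function_distribution W)" "\<forall>x. W (x, 0) = wbar0 x"
    "continuous_on (UNIV \<times> {0..}) V" "distributions_equal_on (UNIV \<times> {0<..}) (\<lambda>\<theta>. - wbar (D_t \<theta>)) (function_distribution V)"
    "\<forall>x. V (x, 0) = wbar1 x"
    "AE t in lborel. t \<ge> 0 \<longrightarrow> (\<exists>h. continuous_on UNIV h \<and> (\<forall>x. x \<noteq> 0 \<longrightarrow>
        (\<exists>d. ((\<lambda>y. W (y, t)) has_vector_derivative d) (at x) \<and> h x = two_phase b_minus b_plus x *\<^sub>R d)))"
    using hyps(20) unfolding connected_solution_def by (elim conjE exE)
  have wr_H: "wr \<epsilon> \<in> ?H" if "\<epsilon> \<in> {0<..1}" for \<epsilon>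
    by (rule moderate_netsD(1)[OF _ that]) (use wr w_iff in blast)
  have e0: "G22_class UNIV (\<lambda>\<epsilon> x. wr \<epsilon> (x, 0)) = G22_class UNIV (\<lambda>\<epsilon>. convolution wbar0 (\<psi> \<epsilon>))"
    unfolding i0 by (rule hyps(17))
  have e1: "G22_class UNIV (\<lambda>\<epsilon> x. D_t (wr \<epsilon>) (x, 0)) = G22_class UNIV (\<lambda>\<epsilon>. convolution wbar1 (\<psi> \<epsilon>))"
    unfolding i1 by (rule hyps(18))
  note d0 = initial_data[OF w0c hyps(13) hyps(16) e0] and d1 = initial_data[OF hyps(14) hyps(15) hyps(16) e1]
  define w' where "w' \<epsilon> x t = wr \<epsilon> (x, t)" for \<epsilon> x t
  interpret wave_limit T a_minus a_plus b_minus b_plus "min a_minus a_plus / 2" "2 * max a_minus a_plus" "min b_minus b_plus / 2" "2 * max b_minus b_plus"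
    ar br w' "\<lambda>\<epsilon> x t. D_t (wr \<epsilon>) (x, t)" "\<lambda>\<epsilon> x t. D_x (wr \<epsilon>) (x, t)" "\<lambda>\<epsilon> x t. D_t (D_t (wr \<epsilon>)) (x, t)" "\<lambda>\<epsilon> x t. D_x (D_t (wr \<epsilon>)) (x, t)"
    "\<lambda>\<epsilon> x t. D_x (\<lambda>y. br \<epsilon> (fst y) *\<^sub>R D_x (wr \<epsilon>) y) (x, t)" "\<lambda>\<epsilon> x t. wave_operator (ar \<epsilon>) (br \<epsilon>) (wr \<epsilon>) (x, t)"
    wbar0 wbar1 w0' wbar W V
  proof (rule wave_limit.intro)
    show "wave_family T a_minus a_plus b_minus b_plus (min a_minus a_plus / 2) (2 * max a_minus a_plus) (min b_minus b_plus / 2) (2 * max b_minus b_plus)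
      ar br w' (\<lambda>\<epsilon> x t. D_t (wr \<epsilon>) (x, t)) (\<lambda>\<epsilon> x t. D_x (wr \<epsilon>) (x, t)) (\<lambda>\<epsilon> x t. D_t (D_t (wr \<epsilon>)) (x, t)) (\<lambda>\<epsilon> x t. D_x (D_t (wr \<epsilon>)) (x, t))
      (\<lambda>\<epsilon> x t. D_x (\<lambda>y. br \<epsilon> (fst y) *\<^sub>R D_x (wr \<epsilon>) y) (x, t)) (\<lambda>\<epsilon> x t. wave_operator (ar \<epsilon>) (br \<epsilon>) (wr \<epsilon>) (x, t)) wbar0 wbar1"
    proof
      show "0 < min a_minus a_plus / 2" "0 < min b_minus b_plus / 2" using hyps(2-5) by simp_all
      show "\<forall>\<^sub>F \<epsilon> in at_right 0. smooth_wave T (ar \<epsilon>) (br \<epsilon>) (w' \<epsilon>) (\<lambda>x t. D_t (wr \<epsilon>) (x, t)) (\<lambda>x t. D_x (wr \<epsilon>) (x, t)) (\<lambda>x t. D_t (D_t (wr \<epsilon>)) (x, t))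
        (\<lambda>x t. D_x (D_t (wr \<epsilon>)) (x, t)) (\<lambda>x t. D_x (\<lambda>y. br \<epsilon> (fst y) *\<^sub>R D_x (wr \<epsilon>) y) (x, t)) (\<lambda>x t. wave_operator (ar \<epsilon>) (br \<epsilon>) (wr \<epsilon>) (x, t))"
        using eventually_in_unit
      proof eventually_elim
        case (elim \<epsilon>)
        show ?case
          unfolding w'_def[abs_def]
          by (rule smooth_wave_of_smooth_on[OF H_inftyD(1)[OF wr_H[OF elim]] representative_smooth[OF hyps(2,3) ar' elim]
              representative_smooth[OF hyps(4,5) br' elim] H_inftyD(1)[OF negligible_netsD(1)[OF neg elim]]])
      qed
      show "\<forall>\<^sub>F \<epsilon> in at_right 0. \<forall>x. min a_minus a_plus / 2 \<le> ar \<epsilon> x \<and> ar \<epsilon> x \<le> 2 * max a_minus a_plus \<and>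
          min b_minus b_plus / 2 \<le> br \<epsilon> x \<and> br \<epsilon> x \<le> 2 * max b_minus b_plus"
        using representative_bounds[OF hyps(2,3) ar'] representative_bounds[OF hyps(4,5) br']
        by eventually_elim simp
      show "((\<lambda>\<epsilon>. integral {0..L} (\<lambda>x. (two_phase a_minus a_plus e - ar \<epsilon> (e * x))\<^sup>2)) \<longlongrightarrow> 0) (at_right 0)" if "e \<in> {1, - 1}" for e L
        by (rule representative_L2_limit[OF hyps(2,3) ar' that])
      show "((\<lambda>\<epsilon>. integral {0..L} (\<lambda>x. (two_phase b_minus b_plus e - br \<epsilon> (e * x))\<^sup>2)) \<longlongrightarrow> 0) (at_right 0)" if "e \<in> {1, - 1}" for e L
        by (rule representative_L2_limit[OF hyps(4,5) br' that])
      show "((\<lambda>\<epsilon>. integral {-L..L} (\<lambda>x. (norm (w' \<epsilon> x 0 - wbar0 x))\<^sup>2)) \<longlongrightarrow> 0) (at_right 0)" for L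
        unfolding w'_def by (rule d0(2))
      show "((\<lambda>\<epsilon>. integral {-L..L} (\<lambda>x. (norm (D_t (wr \<epsilon>) (x, 0) - wbar1 x))\<^sup>2)) \<longlongrightarrow> 0) (at_right 0)" for L
        by (rule d1(2))
      show "\<exists>C. \<forall>\<^sub>F \<epsilon> in at_right 0. integral {-L..L} (\<lambda>x. (norm (D_x (wr \<epsilon>) (x, 0)))\<^sup>2) \<le> C" for L
      proof -
        \<comment> \<open>The x-derivative at time 0 is the derivative of the initial slice, so the
          bound comes from the C1 part of \<open>initial_data\<close>.\<close>
        obtain C where C: "\<forall>\<^sub>F \<epsilon> in at_right 0. integral {-L..L} (\<lambda>x. (norm (iter_deriv [1] (\<lambda>x. wr \<epsilon> (x, 0)) x))\<^sup>2) \<le> C"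
          using d0(3)[OF hyps(12), of L] by (rule exE)
        have "\<forall>\<^sub>F \<epsilon> in at_right 0. integral {-L..L} (\<lambda>x. (norm (D_x (wr \<epsilon>) (x, 0)))\<^sup>2) \<le> C"
          using C eventually_in_unit
        proof eventually_elim
          case (elim \<epsilon>)
          have "iter_deriv [1] (\<lambda>x. wr \<epsilon> (x, 0)) x = D_x (wr \<epsilon>) (x, 0)" for x
          proof -
            have "wr \<epsilon> differentiable (at (x, 0))"
              using smooth_on_iter_deriv[OF H_inftyD(1)[OF wr_H[OF elim(2)]], of "[]" "(x, 0)"] hyps(1) by simp
            from frechet_derivative_real[OF partial_derivatives(1)[OF this], of 1] show ?thesis by simp
          qed
          with elim(1) show ?case by (simp only:)
        qed
        then show ?thesis by (rule exI)
      qed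
      show "((\<lambda>\<epsilon>. integral {0..s} (\<lambda>t. integral {-L..L} (\<lambda>x. (norm (wave_operator (ar \<epsilon>) (br \<epsilon>) (wr \<epsilon>) (x, t)))\<^sup>2))) \<longlongrightarrow> 0) (at_right 0)"
        if "0 < s" "s < T" for L s
        by (rule negligible_rectangle_limit[OF neg that])
      show "continuous_on UNIV wbar0" "continuous_on UNIV wbar1" by (rule w0c, rule hyps(14))
    qed
    show "connected_wave a_minus a_plus b_minus b_plus wbar0 w0' wbar1 wbar W V"
    proof
      show "a_minus > 0" "a_plus > 0" "b_minus > 0" "b_plus > 0" by (rule hyps)+
      show "distribution_on UNIV wbar" by (rule dist)
      show "wbar (wave_operator (two_phase a_minus a_plus) (two_phase b_minus b_plus) \<theta>) = 0"
        if "\<theta> \<in> test_functions ({..<0} \<times> UNIV) \<union> test_functions ({0<..} \<times> UNIV)" for \<theta>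
        by (rule bspec[OF eqn that])
      show "continuous_on (UNIV \<times> {0..}) W" "distributions_equal_on (UNIV \<times> {0<..}) wbar (function_distribution W)"
        "continuous_on (UNIV \<times> {0..}) V" "distributions_equal_on (UNIV \<times> {0<..}) (\<lambda>\<theta>. - wbar (D_t \<theta>)) (function_distribution V)"
        by (rule WV)+
      show "W (x, 0) = wbar0 x" "V (x, 0) = wbar1 x" for x by (rule spec[OF WV(3)], rule spec[OF WV(6)])
      show "AE t in lborel. t \<ge> 0 \<longrightarrow> (\<exists>h. continuous_on UNIV h \<and> (\<forall>x. x \<noteq> 0 \<longrightarrow>
        (\<exists>d. ((\<lambda>y. W (y, t)) has_vector_derivative d) (at x) \<and> h x = two_phase b_minus b_plus x *\<^sub>R d)))"
        by (rule WV(7))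
      show "(wbar0 has_vector_derivative w0' x) (at x)" for x by (rule bspec[OF w0'(1) UNIV_I])
      show "continuous_on UNIV w0'" "continuous_on UNIV wbar1" by (rule w0'(2), rule hyps(14))
    qed
  qed
  show ?thesis
    unfolding associated_on_def converges_weakly_on_def
  proof (intro ballI)
    fix f and \<theta> :: "real \<times> real \<Rightarrow> complex"
    assume f: "f \<in> w" and \<theta>: "\<theta> \<in> test_functions (UNIV \<times> {0<..<T})"
    have \<theta>': "\<theta> \<in> test_functions (UNIV \<times> {0<..<T})" using \<theta> by simp
    note W = wr[unfolded w_iff] and Fm = f[unfolded w_iff]
    have 1: "((\<lambda>\<epsilon>. function_distribution (u0 \<epsilon>) \<theta> - function_distribution (wr \<epsilon>) \<theta>) \<longlongrightarrow> 0) (at_right 0)"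
      by (rule negligible_difference_pairing[OF _ _ _ hyps(1) \<theta>']) (use W in blast)+
    have 2: "((\<lambda>\<epsilon>. function_distribution (u0 \<epsilon>) \<theta> - function_distribution (f \<epsilon>) \<theta>) \<longlongrightarrow> 0) (at_right 0)"
      by (rule negligible_difference_pairing[OF _ _ _ hyps(1) \<theta>']) (use Fm in blast)+
    have 3: "((\<lambda>\<epsilon>. function_distribution (wr \<epsilon>) \<theta>) \<longlongrightarrow> wbar \<theta>) (at_right 0)"
      using weak_limit[OF hyps(1) \<theta>'] by (simp add: w'_def)
    \<comment> \<open>f = wr + (u0 - wr) - (u0 - f) at the level of pairings.\<close>
    from tendsto_diff[OF tendsto_add[OF 3 1] 2]
    show "((\<lambda>\<epsilon>. function_distribution (f \<epsilon>) \<theta>) \<longlongrightarrow> wbar \<theta>) (at_right 0)" by simp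
  qed
qed

end
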